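(* Let $1\le\tau<2$. Assume that $\bar a\in L^\infty(D)$ is such that $\operatorname{ess\,inf}\bar a>0$, and that there exist a sequence $\rho=(\rho_j)_{j\ge1}$ of positive numbers and a sequence $\bar\rho=(\bar\rho_j)_{j\ge1}$ of numbers strictly larger than $1$ such that $$\left\|\frac{\sum_{j\ge1}\bar\rho_j\rho_j|\psi_j|}{\bar a}\right\|_{L^\infty(D)}=\theta<1,$$ and that $(\bar\rho_j^{-1})_{j\ge1}\in\ell^{\bar q}(\mathbb N)$ where $\frac12+\frac1{\bar q}=\frac1\tau$. Assume in addition that $f\in H^{-1}(D)\cap L^\tau(D)$, and that $\bar a$ and all functions $\psi_j$ belong to $W^{1,\infty}(D)$ with $$\Big\|\sum_{j\ge1}\rho_j|\nabla\psi_j|\Big\|_{L^\infty(D)}<\infty .$$ Then $$\sum_{\nu\in\mathcal F}\big(\rho^\nu\|t_\nu\|_{B^\tau}\big)^\tau<\infty,\qquad\rho^\nu:=\prod_{j\ge1}\rho_j^{\nu_j}.$$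
   Context: $D\subset\mathbb R^m$ is a bounded Lipschitz domain, $V=H^1_0(D)$ with norm $\|v\|_V=\|\nabla v\|_{L^2(D)}$, and $V'=H^{-1}(D)$. Affine parametrization: given functions $\bar a,\psi_1,\psi_2,\dots\in L^\infty(D)$, put $a(y)=\bar a+\sum_{j\ge1}y_j\psi_j$ for parameter sequences $y=(y_j)_{j\ge1}$. For fixed $f\in V'$ (independent of $y$), $u(y)\in V$ is the unique solution of $\int_Da(y)\nabla u(y)\cdot\nabla v=\langle f,v\rangle_{V',V}$ for all $v\in V$ (weak form of $-\mathrm{div}(a\nabla u)=f$ with zero Dirichlet data), for those $y$ for which $a(y)$ is bounded above and bounded below by a positive constant. $\mathcal F$ is the set of finitely supported sequences $\nu=(\nu_j)_{j\ge1}$ of non-negative integers, $\nu!=\prod_{j\ge1}\nu_j!$, and the Taylor coefficients are $t_\nu=\frac1{\nu!}\partial^\nu u(y)|_{y=0}\in V$, where $\partial^\nu$ is the partial derivative with respect to the finitely many parameters $y_j$ with $\nu_j\ne0$ (the others being kept at $0$). For $1\le\tau\le2$, $B^\tau=\{v\in V:\Delta v\in L^\tau(D)\}$ with norm $\|v\|_{B^\tau}=\|v\|_V+\|\Delta v\|_{L^\tau(D)}$. $|\nabla\psi|$ is the Euclidean norm of the gradient. *)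

theory Defs
  imports "HOL-Probability.Essential_Supremum"
begin

text \<open>
  Functions on \<open>D\<close> are total functions whose values outside \<open>D\<close> play no role; functions that agree
  almost everywhere on \<open>D\<close> are not identified.  Hence the norms below are seminorms on
  representatives, and objects that are unique only up to null sets (weak gradient, weak divergence,
  solution, derivatives with respect to parameters) are chosen with \<open>SOME\<close>.
\<close>

subsection \<open>Bounded Lipschitz domains\<close>

text \<open>
  Near every boundary point, \<open>D\<close> is the strict epigraph, in some unit direction \<open>e\<close>, of a Lipschitz
  function \<open>\<gamma>\<close> on the hyperplane orthogonal to \<open>e\<close>; \<open>x - (x \<bullet> e) *\<^sub>R e\<close> is the projection of \<open>x\<close> to it.
\<close>

definition bounded_Lipschitz_domain :: "'a::euclidean_space set \<Rightarrow> bool" where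
  "bounded_Lipschitz_domain D \<longleftrightarrow>
     open D \<and> connected D \<and> D \<noteq> {} \<and> bounded D \<and>
     (\<forall>p\<in>frontier D. \<exists>r>0. \<exists>e. norm e = 1 \<and>
        (\<exists>(\<gamma> :: 'a \<Rightarrow> real) L. L-lipschitz_on {z. z \<bullet> e = 0} \<gamma> \<and>
           D \<inter> ball p r = {x \<in> ball p r. x \<bullet> e > \<gamma> (x - (x \<bullet> e) *\<^sub>R e)}))"

subsection \<open>Lebesgue spaces\<close>

definition Lp_norm :: "'a::euclidean_space set \<Rightarrow> real \<Rightarrow> ('a \<Rightarrow> 'b::real_normed_vector) \<Rightarrow> real" where
  "Lp_norm D p f = (LINT x|lebesgue_on D. norm (f x) powr p) powr (1 / p)"

definition Lp_space :: "'a::euclidean_space set \<Rightarrow> real \<Rightarrow> ('a \<Rightarrow> 'b::real_normed_vector) set" where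
  "Lp_space D p = {f. f \<in> borel_measurable (lebesgue_on D) \<and>
                      integrable (lebesgue_on D) (\<lambda>x. norm (f x) powr p)}"

text \<open>The argument is extended-real-valued so that infinite series of functions are allowed.\<close>

definition Linf_norm :: "'a::euclidean_space set \<Rightarrow> ('a \<Rightarrow> ereal) \<Rightarrow> ereal" where
  "Linf_norm D g = esssup (lebesgue_on D) (\<lambda>x. \<bar>g x\<bar>)"

definition Linf_space :: "'a::euclidean_space set \<Rightarrow> ('a \<Rightarrow> 'b::real_normed_vector) set" where
  "Linf_space D = {f. f \<in> borel_measurable (lebesgue_on D) \<and>
                      Linf_norm D (\<lambda>x. ereal (norm (f x))) < \<infinity>}"

definition ess_inf :: "'a::euclidean_space set \<Rightarrow> ('a \<Rightarrow> real) \<Rightarrow> ereal" where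
  "ess_inf D f = - esssup (lebesgue_on D) (\<lambda>x. ereal (- f x))"

definition loc_integrable :: "'a::euclidean_space set \<Rightarrow> ('a \<Rightarrow> 'b::euclidean_space) \<Rightarrow> bool" where
  "loc_integrable D f \<longleftrightarrow> (\<forall>K. compact K \<and> K \<subseteq> D \<longrightarrow> integrable (lebesgue_on K) f)"

subsection \<open>Test functions and weak derivatives\<close>

fun C_k :: "nat \<Rightarrow> ('a::euclidean_space \<Rightarrow> real) \<Rightarrow> bool" where
  "C_k 0 f \<longleftrightarrow> continuous_on UNIV f"
| "C_k (Suc k) f \<longleftrightarrow> (\<exists>G. (\<forall>x. GDERIV f x :> G x) \<and> (\<forall>e\<in>Basis. C_k k (\<lambda>x. G x \<bullet> e)))"

definition test_functions :: "'a::euclidean_space set \<Rightarrow> ('a \<Rightarrow> real) set" where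
  "test_functions D = {\<phi>. (\<forall>k. C_k k \<phi>) \<and> compact (closure {x. \<phi> x \<noteq> 0}) \<and>
                          closure {x. \<phi> x \<noteq> 0} \<subseteq> D}"

definition grad :: "('a::euclidean_space \<Rightarrow> real) \<Rightarrow> 'a \<Rightarrow> 'a" where
  "grad f x = (THE g. GDERIV f x :> g)"

definition is_weak_grad :: "'a::euclidean_space set \<Rightarrow> ('a \<Rightarrow> real) \<Rightarrow> ('a \<Rightarrow> 'a) \<Rightarrow> bool" where
  "is_weak_grad D f G \<longleftrightarrow> loc_integrable D f \<and> loc_integrable D G \<and>
     (\<forall>\<phi>\<in>test_functions D.
        (LINT x|lebesgue_on D. f x *\<^sub>R grad \<phi> x) = - (LINT x|lebesgue_on D. \<phi> x *\<^sub>R G x))"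

definition weak_grad :: "'a::euclidean_space set \<Rightarrow> ('a \<Rightarrow> real) \<Rightarrow> 'a \<Rightarrow> 'a" where
  "weak_grad D f = (SOME G. is_weak_grad D f G)"

definition is_weak_div :: "'a::euclidean_space set \<Rightarrow> ('a \<Rightarrow> 'a) \<Rightarrow> ('a \<Rightarrow> real) \<Rightarrow> bool" where
  "is_weak_div D G g \<longleftrightarrow> loc_integrable D G \<and> loc_integrable D g \<and>
     (\<forall>\<phi>\<in>test_functions D.
        (LINT x|lebesgue_on D. G x \<bullet> grad \<phi> x) = - (LINT x|lebesgue_on D. g x * \<phi> x))"

definition is_weak_laplacian :: "'a::euclidean_space set \<Rightarrow> ('a \<Rightarrow> real) \<Rightarrow> ('a \<Rightarrow> real) \<Rightarrow> bool" where
  "is_weak_laplacian D v g \<longleftrightarrow> (\<exists>G. is_weak_grad D v G \<and> is_weak_div D G g)"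

definition weak_laplacian :: "'a::euclidean_space set \<Rightarrow> ('a \<Rightarrow> real) \<Rightarrow> 'a \<Rightarrow> real" where
  "weak_laplacian D v = (SOME g. is_weak_laplacian D v g)"

subsection \<open>Sobolev spaces\<close>

definition W1inf_space :: "'a::euclidean_space set \<Rightarrow> ('a \<Rightarrow> real) set" where
  "W1inf_space D = {f \<in> Linf_space D. \<exists>G. is_weak_grad D f G \<and> G \<in> Linf_space D}"

definition H1_space :: "'a::euclidean_space set \<Rightarrow> ('a \<Rightarrow> real) set" where
  "H1_space D = {v \<in> Lp_space D 2. \<exists>G. is_weak_grad D v G \<and> G \<in> Lp_space D 2}"

definition H1_norm :: "'a::euclidean_space set \<Rightarrow> ('a \<Rightarrow> real) \<Rightarrow> real" where
  "H1_norm D v = sqrt ((Lp_norm D 2 v)\<^sup>2 + (Lp_norm D 2 (weak_grad D v))\<^sup>2)"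

text \<open>\<open>V = H\<^sup>1\<^sub>0(D)\<close>: the closure of the test functions in the \<open>H\<^sup>1\<close> norm.\<close>

definition V_space :: "'a::euclidean_space set \<Rightarrow> ('a \<Rightarrow> real) set" where
  "V_space D = {v \<in> H1_space D. \<forall>\<epsilon>>0. \<exists>\<phi>\<in>test_functions D. H1_norm D (\<lambda>x. v x - \<phi> x) < \<epsilon>}"

definition V_norm :: "'a::euclidean_space set \<Rightarrow> ('a \<Rightarrow> real) \<Rightarrow> real" where
  "V_norm D v = Lp_norm D 2 (weak_grad D v)"

text \<open>
  \<open>V' = H\<^sup>-\<^sup>1(D)\<close>: bounded linear functionals on \<open>V\<close>.  Boundedness with respect to the seminorm
  makes them insensitive to the choice of representatives.
\<close>

definition V_dual :: "'a::euclidean_space set \<Rightarrow> (('a \<Rightarrow> real) \<Rightarrow> real) set" where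
  "V_dual D = {F. (\<forall>v\<in>V_space D. \<forall>w\<in>V_space D. F (\<lambda>x. v x + w x) = F v + F w) \<and>
                  (\<forall>v\<in>V_space D. \<forall>c. F (\<lambda>x. c * v x) = c * F v) \<and>
                  (\<exists>C. \<forall>v\<in>V_space D. \<bar>F v\<bar> \<le> C * V_norm D v)}"

text \<open>Membership of a functional in \<open>L\<^sup>p(D)\<close> is understood in the sense of distributions.\<close>

definition functional_in_Lp :: "'a::euclidean_space set \<Rightarrow> real \<Rightarrow> (('a \<Rightarrow> real) \<Rightarrow> real) \<Rightarrow> bool" where
  "functional_in_Lp D p F \<longleftrightarrow>
     (\<exists>g \<in> Lp_space D p. \<forall>\<phi>\<in>test_functions D. F \<phi> = (LINT x|lebesgue_on D. g x * \<phi> x))"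

definition B_space :: "'a::euclidean_space set \<Rightarrow> real \<Rightarrow> ('a \<Rightarrow> real) set" where
  "B_space D \<tau> = {v \<in> V_space D. \<exists>g. is_weak_laplacian D v g \<and> g \<in> Lp_space D \<tau>}"

definition B_norm :: "'a::euclidean_space set \<Rightarrow> real \<Rightarrow> ('a \<Rightarrow> real) \<Rightarrow> real" where
  "B_norm D \<tau> v = V_norm D v + Lp_norm D \<tau> (weak_laplacian D v)"

subsection \<open>The parametric elliptic problem\<close>

text \<open>
  Sequences \<open>(y\<^sub>j)\<^sub>j\<^sub>\<ge>\<^sub>1\<close> are indexed by \<open>nat\<close>, starting from 0.  The Taylor coefficients at 0 only
  involve finitely supported \<open>y\<close>, for which the series below is a finite sum.
\<close>

definition affine_coeff :: "('a \<Rightarrow> real) \<Rightarrow> (nat \<Rightarrow> 'a \<Rightarrow> real) \<Rightarrow> (nat \<Rightarrow> real) \<Rightarrow> 'a \<Rightarrow> real" where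
  "affine_coeff abar \<psi> y x = abar x + (\<Sum>j. y j * \<psi> j x)"

definition is_weak_solution ::
    "'a::euclidean_space set \<Rightarrow> ('a \<Rightarrow> real) \<Rightarrow> (('a \<Rightarrow> real) \<Rightarrow> real) \<Rightarrow> ('a \<Rightarrow> real) \<Rightarrow> bool" where
  "is_weak_solution D a f u \<longleftrightarrow> u \<in> V_space D \<and>
     (\<forall>v\<in>V_space D. (LINT x|lebesgue_on D. a x * (weak_grad D u x \<bullet> weak_grad D v x)) = f v)"

text \<open>
  Meaningful only for those \<open>y\<close> for which the coefficient is bounded above and bounded below by a
  positive constant; then the solution exists and is unique up to null sets.
\<close>

definition param_solution ::
    "'a::euclidean_space set \<Rightarrow> ('a \<Rightarrow> real) \<Rightarrow> (nat \<Rightarrow> 'a \<Rightarrow> real) \<Rightarrow> (('a \<Rightarrow> real) \<Rightarrow> real) \<Rightarrow>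
     (nat \<Rightarrow> real) \<Rightarrow> 'a \<Rightarrow> real" where
  "param_solution D abar \<psi> f y = (SOME u. is_weak_solution D (affine_coeff abar \<psi> y) f u)"

subsection \<open>Taylor coefficients\<close>

definition has_V_partial_derivative ::
    "'a::euclidean_space set \<Rightarrow> nat \<Rightarrow> ((nat \<Rightarrow> real) \<Rightarrow> 'a \<Rightarrow> real) \<Rightarrow> (nat \<Rightarrow> real) \<Rightarrow>
     ('a \<Rightarrow> real) \<Rightarrow> bool" where
  "has_V_partial_derivative D j F y w \<longleftrightarrow> w \<in> V_space D \<and>
     ((\<lambda>h. V_norm D (\<lambda>x. (F (y(j := y j + h)) x - F y x) / h - w x)) \<longlongrightarrow> 0) (at 0)"

definition V_partial ::
    "'a::euclidean_space set \<Rightarrow> nat \<Rightarrow> ((nat \<Rightarrow> real) \<Rightarrow> 'a \<Rightarrow> real) \<Rightarrow>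
     (nat \<Rightarrow> real) \<Rightarrow> 'a \<Rightarrow> real" where
  "V_partial D j F y = (SOME w. has_V_partial_derivative D j F y w)"

definition multiindices :: "(nat \<Rightarrow> nat) set" where
  "multiindices = {\<nu>. finite {j. \<nu> j \<noteq> 0}}"

text \<open>\<open>\<partial>\<^sup>\<nu>\<close>, the derivatives with respect to the largest index being taken first.\<close>

definition V_mixed_partial ::
    "'a::euclidean_space set \<Rightarrow> (nat \<Rightarrow> nat) \<Rightarrow> ((nat \<Rightarrow> real) \<Rightarrow> 'a \<Rightarrow> real) \<Rightarrow>
     (nat \<Rightarrow> real) \<Rightarrow> 'a \<Rightarrow> real" where
  "V_mixed_partial D \<nu> F =
     foldr (\<lambda>j. V_partial D j ^^ \<nu> j) (sorted_list_of_set {j. \<nu> j \<noteq> 0}) F"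

definition multi_fact :: "(nat \<Rightarrow> nat) \<Rightarrow> real" where
  "multi_fact \<nu> = (\<Prod>j | \<nu> j \<noteq> 0. fact (\<nu> j))"

definition multi_power :: "(nat \<Rightarrow> real) \<Rightarrow> (nat \<Rightarrow> nat) \<Rightarrow> real" where
  "multi_power \<rho> \<nu> = (\<Prod>j | \<nu> j \<noteq> 0. \<rho> j ^ \<nu> j)"

definition taylor_coeff ::
    "'a::euclidean_space set \<Rightarrow> ('a \<Rightarrow> real) \<Rightarrow> (nat \<Rightarrow> 'a \<Rightarrow> real) \<Rightarrow> (('a \<Rightarrow> real) \<Rightarrow> real) \<Rightarrow>
     (nat \<Rightarrow> nat) \<Rightarrow> 'a \<Rightarrow> real" where
  "taylor_coeff D abar \<psi> f \<nu> x =
     V_mixed_partial D \<nu> (param_solution D abar \<psi> f) (\<lambda>_. 0) x / multi_fact \<nu>"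

end

theory Submission
  imports Defs
begin

text \<open>
  With the weights \<open>\<rho>bar\<^sub>j \<rho>\<^sub>j\<close>, testing the recursion
  \<open>\<integral> abar \<nabla>t\<^sub>\<nu> \<bullet> \<nabla>v = - \<Sum>\<^sub>j \<integral> \<psi>\<^sub>j \<nabla>t\<^sub>\<nu>\<^sub>-\<^sub>e\<^sub>j \<bullet> \<nabla>v\<close> with \<open>v = t\<^sub>\<nu>\<close> and absorbing half of the
  right-hand side gives \<open>\<ell>\<^sup>2\<close> summability of \<open>\<rho>bar\<^sup>\<nu> \<rho>\<^sup>\<nu> \<parallel>t\<^sub>\<nu>\<parallel>\<^sub>V\<close>, hence \<open>\<ell>\<^sup>\<tau>\<close> summability of
  \<open>\<rho>\<^sup>\<nu> \<parallel>t\<^sub>\<nu>\<parallel>\<^sub>V\<close> by Young's inequality.  The Laplacians satisfy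
  \<open>abar \<Delta>t\<^sub>\<nu> = - \<nabla>abar \<bullet> \<nabla>t\<^sub>\<nu> - \<Sum>\<^sub>j (\<psi>\<^sub>j \<Delta>t\<^sub>\<nu>\<^sub>-\<^sub>e\<^sub>j + \<nabla>\<psi>\<^sub>j \<bullet> \<nabla>t\<^sub>\<nu>\<^sub>-\<^sub>e\<^sub>j)\<close> for \<open>\<nu> \<noteq> 0\<close>.
  Since \<open>\<Sum>\<^sub>j \<rho>\<^sub>j \<bar>\<psi>\<^sub>j\<bar> \<le> \<theta> abar\<close>, Jensen's inequality with these weights bounds, pointwise,
  \<open>(\<rho>\<^sup>\<nu> \<bar>\<Delta>t\<^sub>\<nu>\<bar>)\<^sup>\<tau>\<close> by \<open>\<Sum>\<^sub>j w\<^sub>j (\<rho>\<^sup>\<nu>\<^sup>-\<^sup>e\<^sup>j \<bar>\<Delta>t\<^sub>\<nu>\<^sub>-\<^sub>e\<^sub>j\<bar>)\<^sup>\<tau>\<close>, where \<open>\<Sum>\<^sub>j w\<^sub>j \<le> \<theta>\<close>, plus gradient terms that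
  are already summable.  Summing over a finite box of multi-indices, the first part is absorbed.
\<close>

subsection \<open>Smooth functions\<close>

text \<open>Before any estimate, the Laplacian of a Taylor coefficient is only a distribution.
  Expanding the divergence of \<open>\<psi> j\<close> times a gradient requires a product rule
  between a factor with bounded weak gradient and a field that is merely locally integrable together
  with its divergence. It is obtained by concentrating a double integral on the diagonal, and it
  also yields the weak gradient of 1/abar, which is needed to solve for the Laplacian. A second
  obstacle is that solutions and derivatives are arbitrary choices, fixed only up to vanishing V
  seminorm; the recursion therefore sees the Taylor coefficients only through energy forms, which
  ignore the choice. Absorbing a sum into itself is legitimate only for a finite sum, and the
  recursion must not leave the index set: hence boxes, which are finite and closed under lowering an
  index. The surplus of \<open>\<rho>bar\<close> over 1 is spent on the passage from l^2 to l^\<tau>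
  for the gradients. For the Laplacians, which are only in L^\<tau>, Jensen's inequality leaves the
  factor 1 in front of the weights, so that their total mass \<open>\<theta>\<close> < 1 suffices to
  absorb.\<close>

lemma GDERIV_unique:
  assumes "GDERIV f x :> a" "GDERIV f x :> b"
  shows "a = b"
proof -
  have "(\<lambda>h. inner h a) = (\<lambda>h. inner h b)"
    using assms has_derivative_unique unfolding gderiv_def by blast
  then have "inner (a - b) a = inner (a - b) b" by metis
  then have "inner (a - b) (a - b) = 0" by (simp add: inner_diff_right)
  then show ?thesis by simp
qed

lemma grad_eqI: "GDERIV f x :> a \<Longrightarrow> grad f x = a"
  unfolding grad_def using GDERIV_unique by blast

lemma GDERIV_imp_continuous_on:
  assumes "\<And>x. GDERIV f x :> G x"
  shows "continuous_on UNIV f"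
  using assms unfolding gderiv_def
  by (metis has_derivative_continuous continuous_at_imp_continuous_on)

lemma C_k_continuous: "C_k k f \<Longrightarrow> continuous_on UNIV f"
  by (cases k) (use GDERIV_imp_continuous_on in auto)

lemma C_k_SucD: "C_k (Suc k) f \<Longrightarrow> C_k k f"
proof (induction k arbitrary: f)
  case 0
  then show ?case using C_k_continuous C_k.simps(1) by blast
next
  case (Suc k)
  then show ?case by (metis C_k.simps(2))
qed

lemma C_k_const: "C_k k (\<lambda>x. c)"
proof (induction k arbitrary: c)
  case (Suc k)
  show ?case unfolding C_k.simps
    by (rule exI[of _ "\<lambda>x. 0"]) (use Suc GDERIV_const in auto)
qed auto

lemma C_k_inner: "C_k k (\<lambda>x. x \<bullet> e)"
proof (cases k)
  case (Suc n)
  have "GDERIV (\<lambda>x. x \<bullet> e) x :> e" for x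
    unfolding gderiv_def by (auto intro!: derivative_eq_intros)
  then show ?thesis unfolding Suc C_k.simps
    by (intro exI[of _ "\<lambda>x. e"]) (auto simp: C_k_const)
qed (auto intro!: continuous_intros)

lemma C_k_add: "C_k k f \<Longrightarrow> C_k k g \<Longrightarrow> C_k k (\<lambda>x. f x + g x)"
proof (induction k arbitrary: f g)
  case 0
  then show ?case by (auto intro!: continuous_intros)
next
  case (Suc k)
  obtain F G where F: "\<And>x. GDERIV f x :> F x" "\<And>e. e\<in>Basis \<Longrightarrow> C_k k (\<lambda>x. F x \<bullet> e)"
    and G: "\<And>x. GDERIV g x :> G x" "\<And>e. e\<in>Basis \<Longrightarrow> C_k k (\<lambda>x. G x \<bullet> e)"
    using Suc.prems unfolding C_k.simps by metis
  show ?case unfolding C_k.simps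
    by (rule exI[of _ "\<lambda>x. F x + G x"])
       (use F G Suc.IH in \<open>auto intro!: GDERIV_add simp: inner_add_left\<close>)
qed

lemma C_k_mult: "C_k k f \<Longrightarrow> C_k k g \<Longrightarrow> C_k k (\<lambda>x. f x * g x)"
proof (induction k arbitrary: f g)
  case 0
  then show ?case by (auto intro!: continuous_intros)
next
  case (Suc k)
  obtain F G where F: "\<And>x. GDERIV f x :> F x" "\<And>e. e\<in>Basis \<Longrightarrow> C_k k (\<lambda>x. F x \<bullet> e)"
    and G: "\<And>x. GDERIV g x :> G x" "\<And>e. e\<in>Basis \<Longrightarrow> C_k k (\<lambda>x. G x \<bullet> e)"
    using Suc.prems unfolding C_k.simps by metis
  have fg: "C_k k f" "C_k k g" using Suc.prems C_k_SucD by blast+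
  show ?case unfolding C_k.simps
    by (rule exI[of _ "\<lambda>x. f x *\<^sub>R G x + g x *\<^sub>R F x"])
       (use F G Suc.IH fg in \<open>auto intro!: GDERIV_mult C_k_add simp: inner_add_left\<close>)
qed

lemma C_k_sum: "finite I \<Longrightarrow> (\<And>i. i \<in> I \<Longrightarrow> C_k k (f i)) \<Longrightarrow> C_k k (\<lambda>x. \<Sum>i\<in>I. f i x)"
  by (induction I rule: finite_induct) (auto simp: C_k_const C_k_add)

lemma GDERIV_shift:
  assumes "GDERIV f (x - y) :> g"
  shows "GDERIV (\<lambda>x. f (x - y)) x :> g"
proof -
  have d: "((\<lambda>x. x - y) has_derivative (\<lambda>h. h)) (at x)"
    by (auto intro!: derivative_eq_intros)
  show ?thesis
    using has_derivative_compose[OF d, of f "\<lambda>h. h \<bullet> g"] assms unfolding gderiv_def by simp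
qed

lemma GDERIV_reflect:
  assumes "GDERIV f (y - x) :> g"
  shows "GDERIV (\<lambda>x. f (y - x)) x :> - g"
proof -
  have d: "((\<lambda>x. y - x) has_derivative (\<lambda>h. - h)) (at x)"
    by (auto intro!: derivative_eq_intros)
  show ?thesis
    using has_derivative_compose[OF d, of f "\<lambda>h. h \<bullet> g"] assms unfolding gderiv_def by simp
qed

lemma C_k_shift: "C_k k f \<Longrightarrow> C_k k (\<lambda>x. f (x - y))"
proof (induction k arbitrary: f)
  case 0
  then show ?case by (auto intro!: continuous_intros continuous_on_compose2[of UNIV f])
next
  case (Suc k)
  obtain F where F: "\<And>x. GDERIV f x :> F x" "\<And>e. e\<in>Basis \<Longrightarrow> C_k k (\<lambda>x. F x \<bullet> e)"
    using Suc.prems by auto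
  show ?case unfolding C_k.simps
    by (intro exI[of _ "\<lambda>x. F (x - y)"]) (use F Suc.IH GDERIV_shift in blast)
qed

lemma C_k_reflect: "C_k k f \<Longrightarrow> C_k k (\<lambda>x. f (y - x))"
proof (induction k arbitrary: f)
  case 0
  then show ?case by (auto intro!: continuous_intros continuous_on_compose2[of UNIV f])
next
  case (Suc k)
  obtain F where F: "\<And>x. GDERIV f x :> F x" "\<And>e. e\<in>Basis \<Longrightarrow> C_k k (\<lambda>x. F x \<bullet> e)"
    using Suc.prems by auto
  have "C_k k (\<lambda>x. (- 1) * (F (y - x) \<bullet> e))" if "e \<in> Basis" for e
    by (rule C_k_mult[OF C_k_const]) (use F Suc.IH that in blast)
  then show ?case unfolding C_k.simps
    by (intro exI[of _ "\<lambda>x. - F (y - x)"]) (use F(1) in \<open>auto intro: GDERIV_reflect\<close>)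
qed

text \<open>The family is closed under differentiation: \<open>\<beta>\<^sub>n' = \<beta>\<^sub>n\<^sub>+\<^sub>2 - n \<beta>\<^sub>n\<^sub>+\<^sub>1\<close>.\<close>

definition bump1 :: "nat \<Rightarrow> real \<Rightarrow> real" where
  "bump1 n t = (if t > 0 then exp (- inverse t) * inverse t ^ n else 0)"

lemma bump1_DERIV: "DERIV (bump1 n) t :> bump1 (n + 2) t - real n * bump1 (n + 1) t"
proof (cases t "0::real" rule: linorder_cases)
  case less
  have "DERIV (\<lambda>t. 0) t :> 0" by simp
  moreover have "\<forall>\<^sub>F s in nhds t. bump1 n s = 0"
    using eventually_nhds_in_open[of "{..<0}" t] less
    by (auto simp: bump1_def elim!: eventually_mono)
  ultimately have "DERIV (bump1 n) t :> 0"
    by (subst DERIV_cong_ev[OF refl _ refl]) auto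
  then show ?thesis using less by (simp add: bump1_def)
next
  case equal
  have "((\<lambda>x. exp (- x) * x ^ Suc n) \<longlongrightarrow> (0::real)) at_top"
    using tendsto_power_div_exp_0[of "Suc n"] by (simp add: exp_minus field_simps)
  \<comment> \<open>Substituting x = 1/s turns the decay of \<open>exp (- x) * x ^ Suc n\<close> at
    infinity into the one-sided derivative 0 at the point where the two branches are glued.\<close>
  then have lim: "((\<lambda>s. exp (- inverse s) * inverse s ^ Suc n) \<longlongrightarrow> (0::real)) (at_right 0)"
    by (subst at_right_to_top) (simp add: filterlim_filtermap)
  have "((\<lambda>s. bump1 n s / s) \<longlongrightarrow> 0) (at_right 0)"
    by (rule Lim_transform_eventually[OF lim])
       (auto simp: bump1_def eventually_at field_simps intro!: exI[of _ 1])
  moreover have "((\<lambda>s. bump1 n s / s) \<longlongrightarrow> 0) (at_left 0)"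
    by (rule Lim_transform_eventually[OF tendsto_const])
       (auto simp: bump1_def eventually_at intro!: exI[of _ 1])
  ultimately have "((\<lambda>s. bump1 n s / s) \<longlongrightarrow> 0) (at 0)"
    by (simp add: filterlim_split_at)
  then have "DERIV (bump1 n) 0 :> 0"
    unfolding DERIV_def by (simp add: bump1_def)
  then show ?thesis using equal by (simp add: bump1_def)
next
  case greater
  have di: "DERIV inverse t :> - (inverse t)\<^sup>2"
    using DERIV_inverse[of t] greater by (simp add: numeral_2_eq_2)
  have "DERIV (\<lambda>s. exp (- inverse s)) t :> exp (- inverse t) * (inverse t)\<^sup>2"
    using DERIV_chain2[OF DERIV_exp DERIV_minus[OF di]] by simp
  \<comment> \<open>The power rule produces the truncated exponent \<open>n - 1\<close>, so n = 0
    has to be treated apart.\<close>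
  from DERIV_mult[OF this DERIV_power[OF di, of n]]
  have "DERIV (\<lambda>s. exp (- inverse s) * inverse s ^ n) t :> bump1 (n + 2) t - real n * bump1 (n + 1) t"
    by (rule DERIV_cong)
       (cases n; use greater in \<open>simp add: bump1_def power2_eq_square algebra_simps\<close>)
  moreover have "\<forall>\<^sub>F s in nhds t. bump1 n s = exp (- inverse s) * inverse s ^ n"
    using eventually_nhds_in_open[of "{0<..}" t] greater
    by (auto simp: bump1_def elim!: eventually_mono)
  ultimately show ?thesis
    by (subst DERIV_cong_ev[OF refl _ refl]) auto
qed

text \<open>The induction on \<open>k\<close> must hold for all \<open>n\<close> at once, because
  each differentiation raises the index of \<open>bump1\<close>.\<close>

lemma C_k_bump1:
  assumes "\<And>k. C_k k p"
  shows "C_k k (\<lambda>x. bump1 n (p x))"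
proof (induction k arbitrary: n)
  case 0
  have "continuous_on UNIV (bump1 n)"
    by (rule DERIV_continuous_on[where D="\<lambda>t. bump1 (n + 2) t - real n * bump1 (n + 1) t"])
       (use bump1_DERIV in auto)
  then show ?case using C_k_continuous[OF assms] by (auto intro: continuous_on_compose2)
next
  case (Suc k)
  obtain P where P: "\<And>x. GDERIV p x :> P x" "\<And>e. e\<in>Basis \<Longrightarrow> C_k k (\<lambda>x. P x \<bullet> e)"
    using assms[of "Suc k"] by auto
  have g: "GDERIV (\<lambda>x. bump1 n (p x)) x :> (bump1 (n+2) (p x) + (- real n) * bump1 (n+1) (p x)) *\<^sub>R P x" for x
    using GDERIV_DERIV_compose[OF P(1) bump1_DERIV] by simp
  show ?case unfolding C_k.simps
    apply (rule exI[of _ "\<lambda>x. (bump1 (n+2) (p x) + (- real n) * bump1 (n+1) (p x)) *\<^sub>R P x"])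
    apply (intro conjI allI g ballI)
    apply (simp only: inner_scaleR_left)
    apply (intro C_k_mult C_k_add C_k_const Suc P(2))
    apply assumption
    done
qed

text \<open>The mollifier kernel. It is built on the polynomial
  \<open>r\<^sup>2 - x \<bullet> x\<close>, which is smooth at 0, unlike the norm. It is not
  normalised; its mass is carried along instead.\<close>

definition ball_bump :: "real \<Rightarrow> 'a::euclidean_space \<Rightarrow> real" where
  "ball_bump r x = bump1 0 (r\<^sup>2 - x \<bullet> x)"

lemma ball_bump_pos_iff: "r > 0 \<Longrightarrow> ball_bump r x > 0 \<longleftrightarrow> norm x < r"
proof -
  assume "r > 0"
  have "ball_bump r x > 0 \<longleftrightarrow> (norm x)\<^sup>2 < r\<^sup>2"
    by (auto simp: ball_bump_def bump1_def power2_norm_eq_inner)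
  also have "\<dots> \<longleftrightarrow> norm x < r" using \<open>r > 0\<close> by (meson less_imp_le norm_ge_zero power_strict_mono power2_less_imp_less zero_less_numeral)
  finally show ?thesis .
qed

lemma ball_bump_nonneg: "ball_bump r x \<ge> 0"
  by (auto simp: ball_bump_def bump1_def)

lemma C_k_ball_bump: "C_k k (ball_bump r :: 'a::euclidean_space \<Rightarrow> real)"
proof -
  have "C_k k (\<lambda>x. (r\<^sup>2 + (-1) * (\<Sum>e\<in>Basis. (x \<bullet> e) * (x \<bullet> e))) :: real)" for k and x :: 'a
    by (intro C_k_add C_k_const C_k_mult C_k_sum C_k_inner) auto
  then have "C_k k (\<lambda>x::'a. r\<^sup>2 - x \<bullet> x)" for k
    by (subst euclidean_inner) simp
  from C_k_bump1[OF this, of k 0] show ?thesis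
    by (simp add: ball_bump_def[abs_def])
qed

subsection \<open>Test functions\<close>

lemma test_functionsD:
  assumes "\<phi> \<in> test_functions D"
  shows "C_k k \<phi>" "compact (closure {x. \<phi> x \<noteq> 0})" "closure {x. \<phi> x \<noteq> 0} \<subseteq> D"
    "continuous_on UNIV \<phi>"
  using assms C_k_continuous unfolding test_functions_def by blast+

lemma test_functionsI:
  assumes "\<And>k. C_k k \<phi>" "compact K" "K \<subseteq> D" "\<And>x. x \<notin> K \<Longrightarrow> \<phi> x = 0"
  shows "\<phi> \<in> test_functions D"
proof -
  have sub: "closure {x. \<phi> x \<noteq> 0} \<subseteq> K"
    using assms by (intro closure_minimal) (auto dest: compact_imp_closed)
  then have "compact (closure {x. \<phi> x \<noteq> 0})"
    using assms(2) by (metis closed_closure compact_Int_closed inf.absorb2)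
  then show ?thesis unfolding test_functions_def using assms sub by blast
qed

lemma test_functions_eq_0: "x \<notin> closure {x. \<phi> x \<noteq> 0} \<Longrightarrow> \<phi> x = 0"
  using closure_subset[of "{x. \<phi> x \<noteq> 0}"] by blast

lemma test_functions_supp:
  assumes "\<phi> \<in> test_functions D"
  obtains K where "compact K" "K \<subseteq> D" "\<And>x. x \<notin> K \<Longrightarrow> \<phi> x = 0"
  using that[OF test_functionsD(2,3)[OF assms]] test_functions_eq_0[of _ \<phi>] by blast

lemma test_functions_mult:
  assumes "\<phi> \<in> test_functions D" "\<And>k. C_k k g"
  shows "(\<lambda>x. g x * \<phi> x) \<in> test_functions D"
  by (rule test_functionsI[of _ "closure {x. \<phi> x \<noteq> 0}"])
    (use test_functionsD[OF assms(1)] assms(2) in \<open>auto intro!: C_k_mult dest: test_functions_eq_0\<close>)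

lemma test_functions_add:
  assumes "\<phi> \<in> test_functions D" "\<psi> \<in> test_functions D"
  shows "(\<lambda>x. \<phi> x + \<psi> x) \<in> test_functions D"
proof -
  obtain K where K: "compact K" "K \<subseteq> D" "\<And>x. x \<notin> K \<Longrightarrow> \<phi> x = 0"
    using test_functions_supp[OF assms(1)] by blast
  obtain L where L: "compact L" "L \<subseteq> D" "\<And>x. x \<notin> L \<Longrightarrow> \<psi> x = 0"
    using test_functions_supp[OF assms(2)] by blast
  show ?thesis
    by (rule test_functionsI[of _ "K \<union> L"])
      (use K L test_functionsD(1)[OF assms(1)] test_functionsD(1)[OF assms(2)] in \<open>auto intro!: C_k_add\<close>)
qed

lemma test_functions_scale: "\<phi> \<in> test_functions D \<Longrightarrow> (\<lambda>x. c * \<phi> x) \<in> test_functions D"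
  by (rule test_functions_mult) (auto simp: C_k_const)

lemma test_functions_GDERIV:
  assumes "\<phi> \<in> test_functions D"
  shows "GDERIV \<phi> x :> grad \<phi> x"
  using test_functionsD(1)[OF assms, of "Suc 0"] grad_eqI by (metis C_k.simps(2))

lemma test_functions_grad_C_k:
  assumes "\<phi> \<in> test_functions D" "e \<in> Basis"
  shows "C_k k (\<lambda>x. grad \<phi> x \<bullet> e)"
proof -
  obtain G where G: "\<And>x. GDERIV \<phi> x :> G x" "\<And>e. e\<in>Basis \<Longrightarrow> C_k k (\<lambda>x. G x \<bullet> e)"
    using test_functionsD(1)[OF assms(1), of "Suc k"] by auto
  have "grad \<phi> = G" using grad_eqI[OF G(1)] by auto
  then show ?thesis using G assms by auto
qed

lemma test_functions_grad_continuous: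
  assumes "\<phi> \<in> test_functions D"
  shows "continuous_on UNIV (grad \<phi>)"
  using test_functions_grad_C_k[OF assms, of _ 0]
  by (subst continuous_on_componentwise) auto

lemma grad_outside:
  assumes "\<phi> \<in> test_functions D" "closed K" "\<And>x. x \<notin> K \<Longrightarrow> \<phi> x = 0" "x \<notin> K"
  shows "grad \<phi> x = 0"
proof -
  have "(\<phi> has_derivative (\<lambda>h. 0)) (at x)"
    by (rule has_derivative_transform_within_open[of "\<lambda>_. 0" _ _ _ "- K"])
       (use assms in auto)
  then have "GDERIV \<phi> x :> 0" unfolding gderiv_def by simp
  then show ?thesis by (rule grad_eqI)
qed

lemma continuous_compact_support_bounded:
  fixes f :: "'a::euclidean_space \<Rightarrow> 'b::real_normed_vector"
  assumes "continuous_on UNIV f" "compact K" "\<And>x. x \<notin> K \<Longrightarrow> f x = 0"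
  obtains C where "\<And>x. norm (f x) \<le> C" "C \<ge> 0"
proof -
  have "bounded (f ` K)"
    using compact_imp_bounded[OF compact_continuous_image[OF continuous_on_subset[OF assms(1)] assms(2)]] by simp
  then obtain C where C: "\<And>x. x \<in> K \<Longrightarrow> norm (f x) \<le> C" "C > 0"
    unfolding bounded_pos by auto
  have "norm (f x) \<le> C" for x using C assms(3)[of x] by (cases "x \<in> K") auto
  then show ?thesis using that[of C] C by simp
qed

lemma grad_mult:
  assumes "\<phi> \<in> test_functions D" "GDERIV g x :> G"
  shows "grad (\<lambda>x. g x * \<phi> x) x = g x *\<^sub>R grad \<phi> x + \<phi> x *\<^sub>R G"
  by (rule grad_eqI) (rule GDERIV_mult[OF assms(2) test_functions_GDERIV[OF assms(1)]])

lemma grad_add: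
  assumes "\<phi> \<in> test_functions D" "\<psi> \<in> test_functions D"
  shows "grad (\<lambda>x. \<phi> x + \<psi> x) x = grad \<phi> x + grad \<psi> x"
  by (rule grad_eqI) (intro GDERIV_add test_functions_GDERIV assms test_functions_GDERIV[OF assms(2)] test_functions_GDERIV[OF assms(1)])

lemma grad_scale:
  assumes "\<phi> \<in> test_functions D"
  shows "grad (\<lambda>x. c * \<phi> x) x = c *\<^sub>R grad \<phi> x"
  using grad_mult[OF assms GDERIV_const, of "c" x] by simp

lemma ball_bump_outside: "r > 0 \<Longrightarrow> norm x \<ge> r \<Longrightarrow> ball_bump r x = 0"
  using ball_bump_pos_iff[of r x] ball_bump_nonneg[of r x] by linarith

lemma ball_bump_test:
  assumes "r > 0" shows "ball_bump r \<in> test_functions UNIV"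
  by (rule test_functionsI[of _ "cball 0 r"])
     (use assms in \<open>auto intro!: C_k_ball_bump ball_bump_outside\<close>)

lemma ball_bump_shift_test:
  assumes "r > 0" "cball y r \<subseteq> D"
  shows "(\<lambda>x. ball_bump r (x - y)) \<in> test_functions D"
  by (rule test_functionsI[of _ "cball y r"])
     (use assms in \<open>auto intro!: C_k_shift C_k_ball_bump ball_bump_outside simp: dist_norm norm_minus_commute\<close>)

lemma grad_shift:
  assumes "\<phi> \<in> test_functions D"
  shows "grad (\<lambda>x. \<phi> (x - y)) x = grad \<phi> (x - y)"
  by (intro grad_eqI GDERIV_shift test_functions_GDERIV[OF assms])

subsection \<open>Continuity of translations in \<open>L\<^sup>1\<close>\<close>

lemma lborel_integral_translate:
  fixes f :: "'a::euclidean_space \<Rightarrow> 'b::{banach, second_countable_topology}"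
  assumes "f \<in> borel_measurable borel"
  shows "(LINT x|lborel. f (x + h)) = (LINT x|lborel. f x)"
proof -
  have "(LINT x|lborel. f x) = (LINT x|distr lborel borel ((+) h). f x)"
    by (simp only: lborel_distr_plus)
  also have "\<dots> = (LINT x|lborel. f (h + x))"
    using assms by (intro integral_distr) auto
  finally show ?thesis by (simp add: add.commute)
qed

lemma lborel_integrable_translate:
  fixes f :: "'a::euclidean_space \<Rightarrow> 'b::{banach, second_countable_topology}"
  assumes "integrable lborel f"
  shows "integrable lborel (\<lambda>x. f (x + h))"
proof -
  have "integrable (distr lborel borel ((+) h)) f"
    using assms by (simp only: lborel_distr_plus)
  then have "integrable lborel (\<lambda>x. f (h + x))"
    by (rule integrable_distr[rotated]) auto
  then show ?thesis by (simp add: add.commute)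
qed

lemma lborel_integral_reflect:
  fixes f :: "'a::euclidean_space \<Rightarrow> 'b::{banach, second_countable_topology}"
  assumes "f \<in> borel_measurable borel"
  shows "(LINT y|lborel. f (x - y)) = (LINT z|lborel. f z)"
proof -
  have "(lborel :: 'a measure) = density (distr lborel borel (\<lambda>y. x + (- 1) *\<^sub>R y)) (\<lambda>_. ennreal (\<bar>- 1\<bar> ^ DIM('a)))"
    by (rule lborel_affine) simp
  then have *: "lborel = distr lborel borel (\<lambda>y::'a. x - y)"
    by (simp add: density_1)
  have "(LINT z|lborel. f z) = (LINT z|distr lborel borel (\<lambda>y. x - y). f z)"
    using * by simp
  also have "\<dots> = (LINT y|lborel. f (x - y))"
    using assms by (intro integral_distr) auto
  finally show ?thesis by simp
qed

lemma inner_compact_lborel: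
  fixes S :: "'a::euclidean_space set"
  assumes S: "S \<in> sets borel" "emeasure lborel S < \<infinity>" and "e > 0"
  obtains K where "compact K" "K \<subseteq> S" "measure lborel (S - K) < e"
proof -
  obtain T where T: "closed T" "T \<subseteq> S" "S - T \<in> lmeasurable" "emeasure lebesgue (S - T) < ennreal e"
    using sets_lebesgue_inner_closed[of S e] S \<open>e > 0\<close> by auto
  have Tb: "T \<in> sets borel" using T by auto
  \<comment> \<open>A closed inner approximation, truncated by balls to become compact; continuity
    from above makes the truncation harmless.\<close>
  define A where "A n = S - (T \<inter> cball 0 (real n))" for n
  have lim: "(\<lambda>n. measure lborel (A n)) \<longlonglongrightarrow> measure lborel (\<Inter>n. A n)"
  proof (rule Lim_measure_decseq)
    show "range A \<subseteq> sets lborel" using S Tb by (auto simp: A_def)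
    show "decseq A" unfolding A_def decseq_def by force
    fix i
    have "emeasure lborel (A i) \<le> emeasure lborel S"
      by (rule emeasure_mono) (use S in \<open>auto simp: A_def\<close>)
    then show "emeasure lborel (A i) \<noteq> \<infinity>" using S by auto
  qed
  have "(\<Inter>n. A n) = S - T"
    using T(2) real_arch_simple by (auto simp: A_def)
  moreover have "measure lborel (S - T) < e"
  proof -
    have "emeasure lborel (S - T) < ennreal e"
      using T(4) S Tb by (simp add: emeasure_completion)
    then show ?thesis using \<open>e > 0\<close>
      by (metis emeasure_eq_ennreal_measure ennreal_less_iff measure_nonneg order_less_imp_not_eq2 top.not_eq_extremum top.extremum_strict)
  qed
  ultimately have "eventually (\<lambda>n. measure lborel (A n) < e) sequentially"
    using lim by (simp add: order_tendstoD(2))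
  then obtain n where n: "measure lborel (A n) < e" by (auto simp: eventually_sequentially)
  show thesis
    by (rule that[of "T \<inter> cball 0 (real n)"]) (use T n in \<open>auto simp: A_def closed_Int_compact\<close>)
qed

lemma outer_open_lborel:
  fixes S :: "'a::euclidean_space set"
  assumes S: "S \<in> sets borel" "emeasure lborel S < \<infinity>" and "e > 0"
  obtains U where "open U" "S \<subseteq> U" "emeasure lborel U < \<infinity>" "measure lborel (U - S) < e"
proof -
  obtain U where U: "open U" "S \<subseteq> U" "emeasure lborel (U - S) < ennreal e"
    using outer_regular_lborel[OF S(1) \<open>e > 0\<close>] by blast
  have "emeasure lborel U \<le> emeasure lborel S + emeasure lborel (U - S)"
    using U S by (metis Diff_partition Un_Diff_cancel borel_open emeasure_subadditive sets.Diff sets_lborel)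
  also have "\<dots> < \<infinity>" using U(3) S(2) by (simp add: less_top[symmetric]) (metis ennreal_add_eq_top order_less_imp_not_eq2 top.extremum_strict)
  finally have "emeasure lborel U < \<infinity>" .
  moreover have "measure lborel (U - S) < e"
    using U(3) \<open>e > 0\<close>
    by (metis emeasure_eq_ennreal_measure ennreal_less_iff measure_nonneg order_less_imp_not_eq2 top.not_eq_extremum top.extremum_strict)
  ultimately show thesis using that U by blast
qed

text \<open>Squeeze \<open>S\<close> between a compact \<open>K\<close> and an open
  \<open>U\<close>. A shift shorter than the distance from \<open>K\<close> to the complement of
  \<open>U\<close> moves \<open>K\<close> only inside \<open>U\<close>, so the change of the
  indicator is at most the sum of two nonnegative differences, each with integral measure of
  \<open>U\<close> minus measure of \<open>K\<close>.\<close>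

lemma indicator_translation_continuous:
  fixes S :: "'a::euclidean_space set"
  assumes S: "S \<in> sets borel" "emeasure lborel S < \<infinity>" and "e > 0"
  shows "\<exists>d>0. \<forall>h. norm h < d \<longrightarrow> (LINT x|lborel. \<bar>indicator S (x + h) - indicator S x :: real\<bar>) < e"
proof -
  obtain K where K: "compact K" "K \<subseteq> S" "measure lborel (S - K) < e / 4"
    using inner_compact_lborel[OF S, of "e/4"] \<open>e > 0\<close> by auto
  obtain U where U: "open U" "S \<subseteq> U" "emeasure lborel U < \<infinity>" "measure lborel (U - S) < e / 4"
    using outer_open_lborel[OF S, of "e/4"] \<open>e > 0\<close> by auto
  have borel[measurable]: "K \<in> sets borel" "U \<in> sets borel" "S \<in> sets borel" using K U S by (auto simp: borel_compact)
  have finK: "emeasure lborel K < \<infinity>"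
    using emeasure_mono[of K S lborel] K S by (auto simp: less_top[symmetric] top_unique)
  have sep: "\<exists>d>0. \<forall>x\<in>K. \<forall>y\<in>-U. d \<le> dist x y"
    using K U by (intro separate_compact_closed) auto
  then obtain d where d: "d > 0" "\<And>x y. x \<in> K \<Longrightarrow> y \<notin> U \<Longrightarrow> d \<le> dist x y" by auto
  have iK: "integrable lborel (indicator K :: 'a \<Rightarrow> real)" and iU: "integrable lborel (indicator U :: 'a \<Rightarrow> real)"
    and iS: "integrable lborel (indicator S :: 'a \<Rightarrow> real)"
    using finK U S by auto
  note iKh = lborel_integrable_translate[OF iK] and iUh = lborel_integrable_translate[OF iU]
    and iSh = lborel_integrable_translate[OF iS]
  have "measure lborel U - measure lborel K = measure lborel (U - S) + measure lborel (S - K)"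
  proof -
    have "measure lborel (U - S) = measure lborel U - measure lborel S"
      using U S by (intro measure_Diff) auto
    moreover have "measure lborel (S - K) = measure lborel S - measure lborel K"
      using K S by (intro measure_Diff) auto
    ultimately show ?thesis by simp
  qed
  then have UK: "measure lborel U - measure lborel K < e / 2" using K U by simp
  have "(LINT x|lborel. \<bar>indicator S (x + h) - indicator S x :: real\<bar>) < e" if h: "norm h < d" for h
  proof -
    have pt: "\<bar>indicator S (x + h) - indicator S x :: real\<bar> \<le>
      (indicator U x - indicator K (x + h)) + (indicator U (x + h) - indicator K x)" for x
    proof -
      have "x + h \<in> K \<Longrightarrow> x \<in> U" "x \<in> K \<Longrightarrow> x + h \<in> U"
        using d(2)[of "x + h" x] d(2)[of x "x + h"] h by (force simp: dist_norm)+
      then show ?thesis using K(2) U(2) by (auto simp: indicator_def)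
    qed
    have "(LINT x|lborel. \<bar>indicator S (x + h) - indicator S x :: real\<bar>) \<le>
       (LINT x|lborel. (indicator U x - indicator K (x + h)) + (indicator U (x + h) - indicator K x :: real))"
      by (intro integral_mono pt integrable_abs Bochner_Integration.integrable_diff Bochner_Integration.integrable_add
           iU iK iS iKh iUh iSh)
    also have "\<dots> = (measure lborel U - measure lborel K) + (measure lborel U - measure lborel K)"
      using iU iK iKh iUh lborel_integral_translate[of "indicator K :: 'a \<Rightarrow> real" h]
        lborel_integral_translate[of "indicator U :: 'a \<Rightarrow> real" h]
      by (simp del: indicator_le_1)
    finally show ?thesis using UK by simp
  qed
  then show ?thesis using d(1) by blast
qed

text \<open>Induction over the construction of integrable functions: indicators are the regularity
  argument above, and the limit case is a three-epsilon argument in which translation invariance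
  makes the two outer errors equal.\<close>

lemma L1_translation_continuous:
  fixes A :: "'a::euclidean_space \<Rightarrow> 'b::{banach, second_countable_topology}"
  assumes "integrable lborel A" "e > 0"
  shows "\<exists>d>0. \<forall>h. norm h < d \<longrightarrow> (LINT x|lborel. norm (A (x + h) - A x)) < e"
  using assms
proof (induction A arbitrary: e rule: integrable_induct)
  case (base S c)
  obtain d where d: "d > 0" "\<And>h. norm h < d \<Longrightarrow> (LINT x|lborel. \<bar>indicator S (x + h) - indicator S x :: real\<bar>) < e / (norm c + 1)"
    using indicator_translation_continuous[of S "e / (norm c + 1)"] base
    by (auto simp: add_nonneg_pos)
  show ?case
  proof (intro exI[of _ d] conjI d(1) allI impI)
    fix h :: 'a assume h: "norm h < d"
    have "(LINT x|lborel. norm (indicator S (x + h) *\<^sub>R c - indicator S x *\<^sub>R c)) =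
      (LINT x|lborel. \<bar>indicator S (x + h) - indicator S x :: real\<bar>) * norm c"
      by (simp add: scaleR_diff_left[symmetric])
    also have "\<dots> \<le> e / (norm c + 1) * norm c"
      using d(2)[OF h] by (intro mult_right_mono) auto
    also have "\<dots> < e"
      using \<open>e > 0\<close> norm_ge_zero[of c]
      by (subst times_divide_eq_left, subst pos_divide_less_eq) (linarith, simp add: algebra_simps)
    finally show "(LINT x|lborel. norm (indicator S (x + h) *\<^sub>R c - indicator S x *\<^sub>R c)) < e" .
  qed
next
  case (add f g)
  obtain d1 where d1: "d1 > 0" "\<And>h. norm h < d1 \<Longrightarrow> (LINT x|lborel. norm (f (x + h) - f x)) < e / 2"
    using add.IH(1)[of "e/2"] add.prems by auto
  obtain d2 where d2: "d2 > 0" "\<And>h. norm h < d2 \<Longrightarrow> (LINT x|lborel. norm (g (x + h) - g x)) < e / 2"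
    using add.IH(2)[of "e/2"] add.prems by auto
  show ?case
  proof (intro exI[of _ "min d1 d2"] conjI allI impI)
    fix h :: 'a assume h: "norm h < min d1 d2"
    note fi = lborel_integrable_translate[OF add.hyps(1), of h] and gi = lborel_integrable_translate[OF add.hyps(2), of h]
    have "(LINT x|lborel. norm (f (x + h) + g (x + h) - (f x + g x))) \<le>
      (LINT x|lborel. norm (f (x + h) - f x) + norm (g (x + h) - g x))"
      using norm_triangle_ineq[of "f (x + h) - f x" "g (x + h) - g x" for x]
      by (intro integral_mono integrable_norm Bochner_Integration.integrable_diff Bochner_Integration.integrable_add
           fi gi add.hyps) (simp add: algebra_simps)
    also have "\<dots> = (LINT x|lborel. norm (f (x + h) - f x)) + (LINT x|lborel. norm (g (x + h) - g x))"
      by (intro Bochner_Integration.integral_add integrable_norm Bochner_Integration.integrable_diff fi gi add.hyps)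
    also have "\<dots> < e" using d1(2)[of h] d2(2)[of h] h by simp
    finally show "(LINT x|lborel. norm (f (x + h) + g (x + h) - (f x + g x))) < e" .
  qed (use d1 d2 in auto)
next
  case (lim f s)
  \<comment> \<open>The approximants satisfy \<open>norm (s i x) \<le> 2 * norm (f x)\<close>,
    whence the dominating function \<open>3 * norm (f x)\<close>.\<close>
  have "(\<lambda>i. LINT x|lborel. norm (s i x - f x)) \<longlonglongrightarrow> (LINT x|lborel. norm (f x - f x))"
  proof (rule integral_dominated_convergence[where w="\<lambda>x. 3 * norm (f x)"])
    show "AE x in lborel. (\<lambda>i. norm (s i x - f x)) \<longlonglongrightarrow> norm (f x - f x)"
      by (rule AE_I2, rule tendsto_norm[OF tendsto_diff[OF lim.hyps(2) tendsto_const]]) simp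
    show "AE x in lborel. norm (norm (s i x - f x)) \<le> 3 * norm (f x)" for i
    proof (rule AE_I2)
      fix x :: 'a
      have "norm (s i x - f x) \<le> norm (s i x) + norm (f x)" by (rule norm_triangle_ineq4)
      then show "norm (norm (s i x - f x)) \<le> 3 * norm (f x)" using lim.hyps(3)[of x i] by simp
    qed
  qed (use lim.hyps in auto)
  then have "(\<lambda>i. LINT x|lborel. norm (s i x - f x)) \<longlonglongrightarrow> 0" by simp
  then have "eventually (\<lambda>i. (LINT x|lborel. norm (s i x - f x)) < e / 3) sequentially"
    using lim.prems by (intro order_tendstoD(2)) auto
  then obtain i where i: "(LINT x|lborel. norm (s i x - f x)) < e / 3" by (auto simp: eventually_sequentially)
  obtain d where d: "d > 0" "\<And>h. norm h < d \<Longrightarrow> (LINT x|lborel. norm (s i (x + h) - s i x)) < e / 3"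
    using lim.IH[of "e/3" i] lim.prems by auto
  show ?case
  proof (intro exI[of _ d] conjI d(1) allI impI)
    fix h :: 'a assume h: "norm h < d"
    note fi = lborel_integrable_translate[OF lim.hyps(4), of h] and si = lborel_integrable_translate[OF lim.hyps(1)[of i], of h]
    have pt: "norm (f (x + h) - f x) \<le> norm (s i (x + h) - f (x + h)) + norm (s i (x + h) - s i x) + norm (s i x - f x)" for x
      by norm
    have m: "(\<lambda>x. norm (s i x - f x)) \<in> borel_measurable borel"
      using borel_measurable_integrable[OF lim.hyps(1)[of i]] borel_measurable_integrable[OF lim.hyps(4)] by simp
    have "(LINT x|lborel. norm (f (x + h) - f x)) \<le>
      (LINT x|lborel. norm (s i (x + h) - f (x + h)) + norm (s i (x + h) - s i x) + norm (s i x - f x))"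
      by (intro integral_mono pt integrable_norm Bochner_Integration.integrable_diff Bochner_Integration.integrable_add
           fi si lim.hyps)
    also have "\<dots> = (LINT x|lborel. norm (s i (x + h) - f (x + h))) + (LINT x|lborel. norm (s i (x + h) - s i x)) + (LINT x|lborel. norm (s i x - f x))"
      using fi si lim.hyps by simp
    also have "(LINT x|lborel. norm (s i (x + h) - f (x + h))) = (LINT x|lborel. norm (s i x - f x))"
      by (rule lborel_integral_translate[OF m])
    also have "(LINT x|lborel. norm (s i x - f x)) + (LINT x|lborel. norm (s i (x + h) - s i x)) + (LINT x|lborel. norm (s i x - f x)) < e"
      using i d(2)[OF h] by simp
    finally show "(LINT x|lborel. norm (f (x + h) - f x)) < e" .
  qed
qed

subsection \<open>Concentration on the diagonal\<close>

abbreviation bump_mass :: "'a::euclidean_space itself \<Rightarrow> real \<Rightarrow> real" where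
  "bump_mass _ r \<equiv> (LINT z|lborel. ball_bump r (z::'a))"

lemma continuous_compact_support_integrable:
  fixes f :: "'a::euclidean_space \<Rightarrow> 'b::{banach, second_countable_topology}"
  assumes "continuous_on UNIV f" "compact K" "\<And>x. x \<notin> K \<Longrightarrow> f x = 0"
  shows "integrable lborel f"
proof -
  have "integrable lborel (\<lambda>x. indicator K x *\<^sub>R f x)"
    using borel_integrable_compact[OF assms(2) continuous_on_subset[OF assms(1)]] by simp
  moreover have "(\<lambda>x. indicator K x *\<^sub>R f x) = f"
    using assms(3) by (auto simp: indicator_def)
  ultimately show ?thesis by simp
qed

lemma integrable_ball_bump: "r > 0 \<Longrightarrow> integrable lborel (ball_bump r)"
  by (rule continuous_compact_support_integrable[of _ "cball 0 r"])
     (auto simp: ball_bump_outside C_k_continuous[OF C_k_ball_bump])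

lemma borel_measurable_ball_bump [measurable]: "ball_bump r \<in> borel_measurable borel"
  using C_k_continuous[OF C_k_ball_bump] by (rule borel_measurable_continuous_onI)

lemma bump_mass_pos:
  assumes "r > 0" shows "bump_mass TYPE('a::euclidean_space) r > 0"
proof -
  have "bump_mass TYPE('a) r \<noteq> 0"
  proof
    assume "bump_mass TYPE('a) r = 0"
    then have "AE x::'a in lborel. ball_bump r x = 0"
      using integral_nonneg_eq_0_iff_AE[OF integrable_ball_bump[OF assms]] ball_bump_nonneg by auto
    then have "AE x::'a in lborel. x \<notin> ball 0 r"
    proof eventually_elim
      case (elim x)
      then show ?case using ball_bump_pos_iff[OF assms, of x] by auto
    qed
    then have "ball (0::'a) r \<in> null_sets lborel"
      by (subst (asm) AE_iff_null_sets[symmetric]) auto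
    then show False using assms
      by (metis open_ball ball_eq_empty negligible_iff_null_sets null_sets_completionI open_not_negligible not_less)
  qed
  moreover have "bump_mass TYPE('a) r \<ge> 0" by (simp add: ball_bump_nonneg)
  ultimately show ?thesis by linarith
qed

lemma lborel_pair_integrable_mult:
  fixes f g :: "'a::euclidean_space \<Rightarrow> real"
  assumes f: "integrable lborel f" and g: "integrable lborel g"
  shows "integrable (lborel \<Otimes>\<^sub>M lborel) (\<lambda>(x, y). f x * g y)"
proof (rule lborel_pair.Fubini_integrable)
  have [measurable]: "f \<in> borel_measurable borel" "g \<in> borel_measurable borel" using f g by auto
  show "(\<lambda>(x, y). f x * g y) \<in> borel_measurable (lborel \<Otimes>\<^sub>M lborel)" by measurable
  show "integrable lborel (\<lambda>x. LINT y|lborel. norm (case (x, y) of (x, y) \<Rightarrow> f x * g y))"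
    using f by (simp add: abs_mult)
  show "AE x in lborel. integrable lborel (\<lambda>y. case (x, y) of (x, y) \<Rightarrow> f x * g y)"
    using g by auto
qed

text \<open>With z = x - y and Fubini, the double integral becomes the average, over the kernel, of
  the pairing of \<open>A (x + z)\<close> with \<open>B x\<close>. Since \<open>B\<close> is
  bounded, this pairing is continuous at z = 0 by continuity of translations in L^1. No smoothness
  of \<open>A\<close> or \<open>B\<close> enters.\<close>

lemma diag_concentration:
  fixes A B :: "'a::euclidean_space \<Rightarrow> 'b::euclidean_space"
  assumes A: "integrable lborel A" and B: "B \<in> borel_measurable borel" and M: "\<And>x. norm (B x) \<le> M"
    and "e > 0"
  shows "\<exists>d>0. \<forall>r. 0 < r \<and> r < d \<longrightarrow>
     \<bar>(LINT x|lborel. LINT y|lborel. (A x \<bullet> B y) * ball_bump r (x - y)) -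
        bump_mass TYPE('a) r * (LINT x|lborel. A x \<bullet> B x)\<bar> \<le> e * bump_mass TYPE('a) r"
proof -
  have M0: "M \<ge> 0" using M[of 0] norm_ge_zero[of "B 0"] by linarith
  note [measurable] = B
  have [measurable]: "A \<in> borel_measurable borel" using A by auto
  \<comment> \<open>The pairing with \<open>B\<close> costs a factor \<open>M\<close>; the 1 in
    \<open>M + 1\<close> guards against \<open>M = 0\<close>.\<close>
  obtain d where d: "d > 0" "\<And>h. norm h < d \<Longrightarrow> (LINT x|lborel. norm (A (x + h) - A x)) < e / (M + 1)"
    using L1_translation_continuous[OF A, of "e / (M+1)"] M0 \<open>e > 0\<close> by auto
  have AB: "integrable lborel (\<lambda>x. A' x \<bullet> B x)" if "integrable lborel A'" for A' :: "'a \<Rightarrow> 'b"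
  proof (rule Bochner_Integration.integrable_bound[of _ "\<lambda>x. M * norm (A' x)"])
    show "AE x in lborel. norm (A' x \<bullet> B x) \<le> norm (M * norm (A' x))"
    proof (rule AE_I2)
      fix x
      have "\<bar>A' x \<bullet> B x\<bar> \<le> norm (A' x) * norm (B x)" by (rule Cauchy_Schwarz_ineq2)
      also have "\<dots> \<le> M * norm (A' x)"
        using M[of x] by (simp add: mult.commute[of M] mult_left_mono)
      finally show "norm (A' x \<bullet> B x) \<le> norm (M * norm (A' x))" using M0 by simp
    qed
  qed (use that in auto)
  have "\<bar>(LINT x|lborel. LINT y|lborel. (A x \<bullet> B y) * ball_bump r (x - y)) -
        bump_mass TYPE('a) r * (LINT x|lborel. A x \<bullet> B x)\<bar> \<le> e * bump_mass TYPE('a) r"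
    if r: "0 < r" "r < d" for r
  proof -
    note ib = integrable_ball_bump[OF r(1), where 'a='a]
    have "(LINT x|lborel. LINT y|lborel. (A x \<bullet> B y) * ball_bump r (x - y)) =
       (LINT x|lborel. LINT z|lborel. (A x \<bullet> B (x - z)) * ball_bump r z)"
    proof (rule Bochner_Integration.integral_cong[OF refl])
      fix x
      show "(LINT y|lborel. (A x \<bullet> B y) * ball_bump r (x - y)) = (LINT z|lborel. (A x \<bullet> B (x - z)) * ball_bump r z)"
        using lborel_integral_reflect[of "\<lambda>z. (A x \<bullet> B (x - z)) * ball_bump r z" x] by simp
    qed
    also have "\<dots> = (LINT z|lborel. LINT x|lborel. (A x \<bullet> B (x - z)) * ball_bump r z)"
    proof (rule lborel_pair.Fubini_integral[symmetric])
      have dom: "integrable (lborel \<Otimes>\<^sub>M lborel) (\<lambda>(x, z::'a). (M * norm (A x)) * ball_bump r z)"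
        using lborel_pair_integrable_mult[OF integrable_mult_right[OF integrable_norm[OF A], of M] ib] .
      show "integrable (lborel \<Otimes>\<^sub>M lborel) (\<lambda>(x, z). (A x \<bullet> B (x - z)) * ball_bump r z)"
      proof (rule Bochner_Integration.integrable_bound[OF dom])
        show "AE p in lborel \<Otimes>\<^sub>M lborel. norm (case p of (x, z) \<Rightarrow> (A x \<bullet> B (x - z)) * ball_bump r z)
            \<le> norm (case p of (x, z) \<Rightarrow> (M * norm (A x)) * ball_bump r z)"
        proof (rule AE_I2, clarify)
          fix x z :: 'a
          have "\<bar>A x \<bullet> B (x - z)\<bar> \<le> norm (A x) * norm (B (x - z))" by (rule Cauchy_Schwarz_ineq2)
          also have "\<dots> \<le> M * norm (A x)"
            using M[of "x - z"] by (simp add: mult.commute[of M] mult_left_mono)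
          finally show "norm ((A x \<bullet> B (x - z)) * ball_bump r z) \<le> norm ((M * norm (A x)) * ball_bump r z)"
            using M0 by (simp add: abs_mult mult_right_mono)
        qed
      qed measurable
    qed
    also have "\<dots> = (LINT z|lborel. (LINT x|lborel. A (x + z) \<bullet> B x) * ball_bump r z)"
    proof (rule Bochner_Integration.integral_cong[OF refl])
      fix z
      show "(LINT x|lborel. (A x \<bullet> B (x - z)) * ball_bump r z) = (LINT x|lborel. A (x + z) \<bullet> B x) * ball_bump r z"
        using lborel_integral_translate[of "\<lambda>x. A x \<bullet> B (x - z)" z] by simp
    qed
    finally have eq: "(LINT x|lborel. LINT y|lborel. (A x \<bullet> B y) * ball_bump r (x - y)) =
       (LINT z|lborel. (LINT x|lborel. A (x + z) \<bullet> B x) * ball_bump r z)" .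
    have bd: "\<bar>(LINT x|lborel. A (x + z) \<bullet> B x) * ball_bump r z - (LINT x|lborel. A x \<bullet> B x) * ball_bump r z\<bar>
         \<le> e * ball_bump r z" for z
    proof (cases "norm z < r")
      case True
      note iAz = lborel_integrable_translate[OF A, of z]
      have "(LINT x|lborel. A (x + z) \<bullet> B x) - (LINT x|lborel. A x \<bullet> B x) = (LINT x|lborel. (A (x + z) - A x) \<bullet> B x)"
        by (subst Bochner_Integration.integral_diff[symmetric])
           (use AB[OF A] AB[OF iAz] in \<open>auto simp: inner_diff_left\<close>)
      also have "\<bar>\<dots>\<bar> \<le> (LINT x|lborel. M * norm (A (x + z) - A x))"
      proof (rule integral_abs_bound_integral)
        fix x
        have "\<bar>(A (x + z) - A x) \<bullet> B x\<bar> \<le> norm (A (x + z) - A x) * norm (B x)" by (rule Cauchy_Schwarz_ineq2)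
        also have "\<dots> \<le> M * norm (A (x + z) - A x)"
          using M[of x] by (simp add: mult.commute[of M] mult_left_mono)
        finally show "\<bar>(A (x + z) - A x) \<bullet> B x\<bar> \<le> M * norm (A (x + z) - A x)" .
      qed (use A iAz AB[of "\<lambda>x. A (x + z) - A x"] in auto)
      also have "\<dots> = M * (LINT x|lborel. norm (A (x + z) - A x))" by simp
      also have "\<dots> \<le> M * (e / (M + 1))"
        using d(2)[of z] True r M0 by (intro mult_left_mono) auto
      also have "\<dots> \<le> e"
        using M0 \<open>e > 0\<close> by (simp add: field_simps)
      finally show ?thesis
        using ball_bump_nonneg[of r z] by (simp add: left_diff_distrib[symmetric] abs_mult mult_right_mono)
    next
      case False
      then show ?thesis using ball_bump_outside[OF r(1), of z] by simp
    qed
    have i1: "integrable lborel (\<lambda>z. (LINT x|lborel. A (x + z) \<bullet> B x) * ball_bump r z)"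
    proof (rule Bochner_Integration.integrable_bound[of _ "\<lambda>z. (\<bar>LINT x|lborel. A x \<bullet> B x\<bar> + e) * ball_bump r z"])
      show "AE z in lborel. norm ((LINT x|lborel. A (x + z) \<bullet> B x) * ball_bump r z)
          \<le> norm ((\<bar>LINT x|lborel. A x \<bullet> B x\<bar> + e) * ball_bump r z)"
      proof (rule AE_I2)
        fix z :: 'a
        have "\<bar>(LINT x|lborel. A x \<bullet> B x) * ball_bump r z\<bar> = \<bar>LINT x|lborel. A x \<bullet> B x\<bar> * ball_bump r z"
          using ball_bump_nonneg[of r z] by (simp add: abs_mult)
        then show "norm ((LINT x|lborel. A (x + z) \<bullet> B x) * ball_bump r z)
          \<le> norm ((\<bar>LINT x|lborel. A x \<bullet> B x\<bar> + e) * ball_bump r z)"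
          using bd[of z] ball_bump_nonneg[of r z] \<open>e > 0\<close> unfolding real_norm_def
          by (subst (2) abs_mult) (simp add: distrib_right)
      qed
      show "(\<lambda>z. (LINT x|lborel. A (x + z) \<bullet> B x) * ball_bump r z) \<in> borel_measurable lborel"
        by measurable
    qed (use ib in simp)
    have i2: "integrable lborel (\<lambda>z. (LINT x|lborel. A x \<bullet> B x) * ball_bump r (z::'a))" using ib by simp
    have "(LINT z|lborel. (LINT x|lborel. A (x + z) \<bullet> B x) * ball_bump r z) - bump_mass TYPE('a) r * (LINT x|lborel. A x \<bullet> B x)
      = (LINT z|lborel. (LINT x|lborel. A (x + z) \<bullet> B x) * ball_bump r z - (LINT x|lborel. A x \<bullet> B x) * ball_bump r z)"
      using i1 i2 by simp
    also have "\<bar>\<dots>\<bar> \<le> (LINT z|lborel. e * ball_bump r (z::'a))"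
      by (rule integral_abs_bound_integral) (use i1 i2 ib bd in auto)
    also have "\<dots> = e * bump_mass TYPE('a) r" by simp
    finally show ?thesis unfolding eq .
  qed
  then show ?thesis using d(1) by blast
qed

text \<open>This turns identities between smeared pairings into identities between pairings. Both
  double integrals are asymptotically the bump mass times the diagonal integral, so after division
  by the mass they can agree for all small \<open>r\<close> only if the diagonal integrals agree.
  The two value types are independent because a pairing of vector fields gets compared with one of
  scalars.\<close>

lemma diag_eqI:
  fixes A B :: "'a::euclidean_space \<Rightarrow> 'b::euclidean_space" and A' B' :: "'a \<Rightarrow> 'c::euclidean_space"
  assumes A: "integrable lborel A" "B \<in> borel_measurable borel" "\<And>x. norm (B x) \<le> M"
    and A': "integrable lborel A'" "B' \<in> borel_measurable borel" "\<And>x. norm (B' x) \<le> M'"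
    and "r0 > 0"
    and eq: "\<And>r. 0 < r \<Longrightarrow> r < r0 \<Longrightarrow> (LINT x|lborel. LINT y|lborel. (A x \<bullet> B y) * ball_bump r (x - y)) =
      (LINT x|lborel. LINT y|lborel. (A' x \<bullet> B' y) * ball_bump r (x - y))"
  shows "(LINT x|lborel. A x \<bullet> B x) = (LINT x|lborel. A' x \<bullet> B' x)"
proof (rule ccontr)
  let ?I = "LINT x|lborel. A x \<bullet> B x" and ?I' = "LINT x|lborel. A' x \<bullet> B' x"
  assume "?I \<noteq> ?I'"
  define e where "e = \<bar>?I - ?I'\<bar> / 3"
  have e: "e > 0" using \<open>?I \<noteq> ?I'\<close> by (simp add: e_def)
  obtain d where d: "d > 0" "\<And>r. 0 < r \<and> r < d \<Longrightarrow>
     \<bar>(LINT x|lborel. LINT y|lborel. (A x \<bullet> B y) * ball_bump r (x - y)) -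
        bump_mass TYPE('a) r * ?I\<bar> \<le> e * bump_mass TYPE('a) r"
    using diag_concentration[OF A e] by blast
  obtain d' where d': "d' > 0" "\<And>r. 0 < r \<and> r < d' \<Longrightarrow>
     \<bar>(LINT x|lborel. LINT y|lborel. (A' x \<bullet> B' y) * ball_bump r (x - y)) -
        bump_mass TYPE('a) r * ?I'\<bar> \<le> e * bump_mass TYPE('a) r"
    using diag_concentration[OF A' e] by blast
  define r where "r = min r0 (min d d') / 2"
  have r: "0 < r" "r < r0" "r < d" "r < d'" using \<open>r0 > 0\<close> d d' by (auto simp: r_def)
  let ?m = "bump_mass TYPE('a) r"
  have m: "?m > 0" by (rule bump_mass_pos[OF r(1)])
  have "\<bar>?m * ?I - ?m * ?I'\<bar> \<le> 2 * e * ?m"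
    using d(2)[of r] d'(2)[of r] r eq[OF r(1,2)] by auto
  moreover have "\<bar>?m * ?I - ?m * ?I'\<bar> = ?m * \<bar>?I - ?I'\<bar>"
    unfolding right_diff_distrib[symmetric] abs_mult using m by linarith
  moreover have "2 * e * ?m = ?m * (2 * e)" by (rule mult.commute)
  ultimately have "?m * \<bar>?I - ?I'\<bar> \<le> ?m * (2 * e)" by linarith
  then have "\<bar>?I - ?I'\<bar> \<le> 2 * e" using m mult_le_cancel_left_pos by blast
  then show False using e by (simp add: e_def)
qed

subsection \<open>Borel representatives\<close>

text \<open>Norms and weak identities live on the completed measure, whereas Fubini and translations
  are applied on \<open>lborel\<close>; this replaces a representative by a Borel one,
  componentwise.\<close>

lemma ex_borel_version:
  fixes f :: "'a::euclidean_space \<Rightarrow> 'b::euclidean_space"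
  assumes "f \<in> borel_measurable lebesgue"
  obtains g where "g \<in> borel_measurable borel" "AE x in lborel. f x = g x"
proof -
  have "\<exists>g\<in>borel_measurable lborel. AE x in lborel. f x \<bullet> b = g x" for b
    by (rule completion_ex_borel_measurable_real) (use assms in measurable)
  then have "\<forall>b. \<exists>g. g \<in> borel_measurable borel \<and> (AE x in lborel. f x \<bullet> b = g x)"
    by auto
  from choice[OF this] obtain g where
    g: "\<And>b. g b \<in> borel_measurable borel" "\<And>b. AE x in lborel. f x \<bullet> b = g b x" by auto
  have "AE x in lborel. \<forall>b\<in>Basis. f x \<bullet> b = g b x"
    by (rule AE_finite_allI) (use g in auto)
  then have "AE x in lborel. f x = (\<Sum>b\<in>Basis. g b x *\<^sub>R b)"
  proof eventually_elim
    case (elim x)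
    have "f x = (\<Sum>b\<in>Basis. (f x \<bullet> b) *\<^sub>R b)" by (simp add: euclidean_representation)
    also have "\<dots> = (\<Sum>b\<in>Basis. g b x *\<^sub>R b)" by (rule sum.cong) (use elim in auto)
    finally show ?case .
  qed
  moreover have "(\<lambda>x. \<Sum>b\<in>Basis. g b x *\<^sub>R b) \<in> borel_measurable borel"
    using g(1) by measurable
  ultimately show thesis using that by blast
qed

text \<open>The bridge between the two measures: extend by zero from \<open>D\<close>, then pass to
  a Borel version. Weak identities enter the double integrals through it.\<close>

lemma integral_lebesgue_on_eq_lborel:
  fixes h h' :: "'a::euclidean_space \<Rightarrow> 'b::euclidean_space"
  assumes D: "D \<in> sets lebesgue" and h': "h' \<in> borel_measurable borel"
    and ae: "AE x in lborel. indicator D x *\<^sub>R h x = h' x"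
  shows "(LINT x|lebesgue_on D. h x) = (LINT x|lborel. h' x)"
    and "integrable (lebesgue_on D) h \<longleftrightarrow> integrable lborel h'"
proof -
  have ae': "AE x in lebesgue. h' x = indicator D x *\<^sub>R h x"
    using AE_completion[OF ae] by eventually_elim simp
  have m: "h' \<in> borel_measurable lebesgue" using h' by (simp add: measurable_completion)
  have m2: "(\<lambda>x. indicator D x *\<^sub>R h x) \<in> borel_measurable lebesgue"
    by (rule borel_measurable_AE[OF m ae'])
  have "(LINT x|lebesgue_on D. h x) = (LINT x|lebesgue. indicator D x *\<^sub>R h x)"
    using D by (simp add: integral_restrict_space)
  also have "\<dots> = (LINT x|lebesgue. h' x)"
    by (rule integral_cong_AE[OF m2 m]) (use ae' in eventually_elim, simp)
  also have "\<dots> = (LINT x|lborel. h' x)" using h' by (simp add: integral_completion)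
  finally show "(LINT x|lebesgue_on D. h x) = (LINT x|lborel. h' x)" .
  have "integrable (lebesgue_on D) h \<longleftrightarrow> integrable lebesgue (\<lambda>x. indicator D x *\<^sub>R h x)"
    using D by (simp add: integrable_restrict_space)
  also have "\<dots> \<longleftrightarrow> integrable lebesgue h'"
    by (rule integrable_cong_AE[OF m2 m]) (use ae' in eventually_elim, simp)
  also have "\<dots> \<longleftrightarrow> integrable lborel h'" using h' by (simp add: integrable_completion)
  finally show "integrable (lebesgue_on D) h \<longleftrightarrow> integrable lborel h'" .
qed

lemma AE_lebesgue_on_iff:
  "D \<in> sets lebesgue \<Longrightarrow> (AE x in lebesgue_on D. P x) \<longleftrightarrow> (AE x in lborel. x \<in> D \<longrightarrow> P x)"
  by (simp add: AE_restrict_space_iff AE_completion_iff)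

lemma compact_in_lebesgue: "compact K \<Longrightarrow> K \<in> sets lebesgue"
  by (simp add: borel_compact)

lemma open_in_lebesgue: "open D \<Longrightarrow> D \<in> sets lebesgue"
  by simp

lemma loc_integrableD:
  assumes "loc_integrable D f" "compact K" "K \<subseteq> D"
  shows "integrable lebesgue (\<lambda>x. indicator K x *\<^sub>R f x)"
proof -
  have "integrable (lebesgue_on K) f" using assms unfolding loc_integrable_def by blast
  then show ?thesis using compact_in_lebesgue[OF assms(2)] by (simp add: integrable_restrict_space)
qed

lemma ex_local_borel_version:
  fixes f :: "'a::euclidean_space \<Rightarrow> 'b::euclidean_space"
  assumes "loc_integrable D f" "compact K" "K \<subseteq> D"
  obtains g where "integrable lborel g" "AE x in lborel. indicator K x *\<^sub>R f x = g x"
    "g \<in> borel_measurable borel"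
proof -
  have i: "integrable (lebesgue_on K) f" using assms unfolding loc_integrable_def by blast
  have "(\<lambda>x. indicator K x *\<^sub>R f x) \<in> borel_measurable lebesgue"
    using loc_integrableD[OF assms] by (rule borel_measurable_integrable)
  then obtain g where g: "g \<in> borel_measurable borel" "AE x in lborel. indicator K x *\<^sub>R f x = g x"
    by (rule ex_borel_version)
  have "integrable lborel g"
    using integral_lebesgue_on_eq_lborel(2)[OF compact_in_lebesgue[OF assms(2)] g] i by blast
  then show thesis using that g by blast
qed

lemma integrable_lebesgue_on_subset_support:
  fixes f :: "'a::euclidean_space \<Rightarrow> 'b::euclidean_space"
  assumes "D \<in> sets lebesgue" "K \<in> sets lebesgue" "K \<subseteq> D" "\<And>x. x \<in> D \<Longrightarrow> x \<notin> K \<Longrightarrow> f x = 0"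
  shows "integrable (lebesgue_on D) f \<longleftrightarrow> integrable (lebesgue_on K) f"
    "(LINT x|lebesgue_on D. f x) = (LINT x|lebesgue_on K. f x)"
proof -
  have "(\<lambda>x. indicator D x *\<^sub>R f x) = (\<lambda>x. indicator K x *\<^sub>R f x)"
    using assms(3,4) by (auto simp: indicator_def fun_eq_iff)
  then show "integrable (lebesgue_on D) f \<longleftrightarrow> integrable (lebesgue_on K) f"
    "(LINT x|lebesgue_on D. f x) = (LINT x|lebesgue_on K. f x)"
    using assms(1,2) by (simp_all add: integrable_restrict_space integral_restrict_space)
qed

lemma continuous_imp_borel_measurable_lebesgue_on:
  fixes \<phi> :: "'a::euclidean_space \<Rightarrow> 'b::euclidean_space"
  assumes "continuous_on UNIV \<phi>"
  shows "\<phi> \<in> borel_measurable (lebesgue_on D)"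
proof -
  have "\<phi> \<in> borel_measurable borel" using assms by (rule borel_measurable_continuous_onI)
  then have "\<phi> \<in> borel_measurable lebesgue" by (simp add: measurable_completion)
  then show ?thesis by (rule measurable_restrict_space1)
qed

lemma loc_integrable_bilinear:
  fixes f :: "'a::euclidean_space \<Rightarrow> 'b::euclidean_space" and \<phi> :: "'a \<Rightarrow> 'c::euclidean_space"
    and B :: "'b \<Rightarrow> 'c \<Rightarrow> 'd::euclidean_space"
  assumes f: "loc_integrable D f" and D: "open D" and \<phi>: "continuous_on UNIV \<phi>"
    and K: "compact K" "K \<subseteq> D" "\<And>x. x \<notin> K \<Longrightarrow> \<phi> x = 0"
    and B: "bounded_bilinear B"
  shows "integrable (lebesgue_on D) (\<lambda>x. B (f x) (\<phi> x))"
proof -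
  obtain C where C: "\<And>x. norm (\<phi> x) \<le> C" "C \<ge> 0"
    using continuous_compact_support_bounded[OF \<phi> K(1,3)] by blast
  obtain N where N: "\<And>a b. norm (B a b) \<le> norm a * norm b * N" "N \<ge> 0"
    using bounded_bilinear.nonneg_bounded[OF B] by blast
  have i: "integrable (lebesgue_on K) f" using f K unfolding loc_integrable_def by blast
  have "integrable (lebesgue_on K) (\<lambda>x. B (f x) (\<phi> x))"
  proof (rule Bochner_Integration.integrable_bound[of _ "\<lambda>x. norm (f x) * C * N"])
    show "integrable (lebesgue_on K) (\<lambda>x. norm (f x) * C * N)" using i by auto
    show "(\<lambda>x. B (f x) (\<phi> x)) \<in> borel_measurable (lebesgue_on K)"
      by (rule borel_measurable_bilinear[OF _ borel_measurable_integrable[OF i] continuous_imp_borel_measurable_lebesgue_on[OF \<phi>] compact_in_lebesgue[OF K(1)]])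
         (use B in \<open>simp add: bilinear_conv_bounded_bilinear\<close>)
    show "AE x in lebesgue_on K. norm (B (f x) (\<phi> x)) \<le> norm (norm (f x) * C * N)"
    proof (rule AE_I2)
      fix x
      have "norm (B (f x) (\<phi> x)) \<le> norm (f x) * norm (\<phi> x) * N" by (rule N)
      also have "\<dots> \<le> norm (f x) * C * N" using C N by (intro mult_right_mono mult_left_mono) auto
      finally show "norm (B (f x) (\<phi> x)) \<le> norm (norm (f x) * C * N)" using C N by simp
    qed
  qed
  moreover have "B (f x) (\<phi> x) = 0" if "x \<notin> K" for x
    using K(3)[OF that] bounded_bilinear.zero_right[OF B] by simp
  ultimately show ?thesis
    using integrable_lebesgue_on_subset_support(1)[OF open_in_lebesgue[OF D] compact_in_lebesgue[OF K(1)] K(2), of "\<lambda>x. B (f x) (\<phi> x)"] by blast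
qed

text \<open>\<open>L\<close> is \<open>K\<close> thickened by half its distance to the complement of
  \<open>D\<close>. A bump of width at most \<open>r\<close> centred in \<open>K\<close> is then a
  test function on \<open>D\<close>, and its support lies in \<open>L\<close>, where one integrable
  representative is fixed.\<close>

lemma compact_neighbourhood:
  fixes D :: "'a::euclidean_space set"
  assumes "compact K" "open D" "K \<subseteq> D"
  obtains r L where "r > 0" "compact L" "K \<subseteq> L" "L \<subseteq> D" "\<And>y. y \<in> K \<Longrightarrow> cball y r \<subseteq> L"
proof -
  have "\<exists>d>0. \<forall>x\<in>K. \<forall>y\<in>-D. d \<le> dist x y"
    using assms by (intro separate_compact_closed) auto
  then obtain d where d: "d > 0" "\<And>x y. x \<in> K \<Longrightarrow> y \<notin> D \<Longrightarrow> d \<le> dist x y" by auto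
  define L where "L = {x + y | x y. x \<in> K \<and> y \<in> cball 0 (d/2)}"
  show thesis
  proof (rule that[of "d/2" L])
    show "compact L" unfolding L_def by (rule compact_sums) (use assms in auto)
    show "K \<subseteq> L"
    proof
      fix x assume "x \<in> K"
      then have "x = x + 0 \<and> x \<in> K \<and> 0 \<in> cball 0 (d/2)" using d by auto
      then show "x \<in> L" unfolding L_def by blast
    qed
    show "L \<subseteq> D"
    proof
      fix z assume "z \<in> L"
      then obtain x y where xy: "z = x + y" "x \<in> K" "norm y \<le> d / 2" unfolding L_def by auto
      then have "dist x z < d" using d(1) by (simp add: dist_norm)
      then show "z \<in> D" using d(2)[of x z] xy(2) by (meson not_le)
    qed
    fix y assume y: "y \<in> K"
    show "cball y (d/2) \<subseteq> L"
    proof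
      fix z assume "z \<in> cball y (d/2)"
      then have "z = y + (z - y) \<and> y \<in> K \<and> z - y \<in> cball 0 (d/2)"
        using y by (simp add: dist_norm norm_minus_commute)
      then show "z \<in> L" unfolding L_def by blast
    qed
  qed (use d in auto)
qed

lemma Fubini_dominated:
  fixes f :: "'a::euclidean_space \<Rightarrow> 'a \<Rightarrow> real"
  assumes f: "case_prod f \<in> borel_measurable (borel \<Otimes>\<^sub>M borel)"
    and A: "integrable lborel A" and B: "integrable lborel B"
    and le: "\<And>x y. \<bar>f x y\<bar> \<le> A x * B y"
  shows "(LINT x|lborel. LINT y|lborel. f x y) = (LINT y|lborel. LINT x|lborel. f x y)"
proof (rule lborel_pair.Fubini_integral[symmetric])
  show "integrable (lborel \<Otimes>\<^sub>M lborel) (case_prod f)"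
  proof (rule Bochner_Integration.integrable_bound[OF lborel_pair_integrable_mult[OF A B]])
    show "case_prod f \<in> borel_measurable (lborel \<Otimes>\<^sub>M lborel)"
      using f by (simp cong: measurable_cong_sets)
    show "AE p in lborel \<Otimes>\<^sub>M lborel. norm (case_prod f p) \<le> norm (case p of (x, y) \<Rightarrow> A x * B y)"
      by (rule AE_I2) (use le order.trans[OF le abs_ge_self] in auto)
  qed
qed

lemma ball_bump_bounded:
  assumes "r > 0"
  obtains C where "\<And>z. norm (ball_bump r (z::'a::euclidean_space)) \<le> C" "C \<ge> 0"
  using continuous_compact_support_bounded[OF C_k_continuous[OF C_k_ball_bump] compact_cball[of 0 r], of r thesis]
    ball_bump_outside[OF assms] by force

lemma bounded_support_integrable:
  fixes B :: "'a::euclidean_space \<Rightarrow> 'b::euclidean_space"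
  assumes "B \<in> borel_measurable borel" "\<And>x. norm (B x) \<le> M" "compact K" "\<And>x. x \<notin> K \<Longrightarrow> B x = 0"
  shows "integrable lborel B"
proof (rule integrableI_bounded_set[where A=K and B=M])
  show "emeasure lborel K < \<infinity>" using assms(3) by (rule emeasure_compact_finite)
qed (use assms borel_compact in auto)

subsection \<open>The fundamental lemma of the calculus of variations\<close>

text \<open>On a compact \<open>K\<close>, pair \<open>h\<close> with the bounded function
  \<open>sgn h\<close> cut off to \<open>K\<close>. The smeared pairing vanishes because for each
  \<open>y\<close> in \<open>K\<close> the shifted bump is a test function, and
  \<open>diag_eqI\<close> against the zero pair makes the integral of the absolute value of
  \<open>h\<close> over \<open>K\<close> vanish.\<close>

lemma fundamental_lemma:
  fixes h :: "'a::euclidean_space \<Rightarrow> real"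
  assumes D: "open D" and h: "loc_integrable D h"
    and 0: "\<And>\<phi>. \<phi> \<in> test_functions D \<Longrightarrow> (LINT x|lebesgue_on D. h x * \<phi> x) = 0"
  shows "AE x in lebesgue_on D. h x = 0"
proof -
  have K0: "AE x in lborel. x \<in> K \<longrightarrow> h x = 0" if K: "compact K" "K \<subseteq> D" for K
  proof -
    obtain r0 L where L: "r0 > 0" "compact L" "K \<subseteq> L" "L \<subseteq> D" "\<And>y. y \<in> K \<Longrightarrow> cball y r0 \<subseteq> L"
      using compact_neighbourhood[OF K(1) D K(2)] by blast
    obtain A where A: "integrable lborel A" "AE x in lborel. indicator L x *\<^sub>R h x = A x" "A \<in> borel_measurable borel"
      using ex_local_borel_version[OF h L(2,4)] by blast
    define B where "B x = indicator K x * sgn (A x)" for x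
    have [measurable]: "K \<in> sets borel" using K by (simp add: borel_compact)
    have B: "B \<in> borel_measurable borel" unfolding B_def[abs_def] using A(3) by measurable
    have zero: "(LINT x|lborel. A x * ball_bump r (x - y)) * B y = 0" if r: "0 < r" "r < r0" for r y
    proof (cases "y \<in> K")
      case True
      have cb: "cball y r \<subseteq> L" using L(5)[OF True] r by (auto simp: subset_eq)
      have "(LINT x|lborel. A x * ball_bump r (x - y)) = (LINT x|lebesgue_on D. h x * ball_bump r (x - y))"
      proof (rule integral_lebesgue_on_eq_lborel(1)[symmetric])
        show "AE x in lborel. indicator D x *\<^sub>R (h x * ball_bump r (x - y)) = A x * ball_bump r (x - y)"
          using A(2)
        proof eventually_elim
          case (elim x)
          show ?case
          proof (cases "x \<in> L")
            case True
            then show ?thesis using elim L(4) by (auto simp: indicator_def split: if_splits)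
          next
            case False
            then have "ball_bump r (x - y) = 0"
              using cb ball_bump_outside[OF r(1), of "x - y"] by (force simp: subset_eq dist_norm norm_minus_commute)
            then show ?thesis by simp
          qed
        qed
      qed (use D A(3) in auto)
      also have "\<dots> = 0" by (rule 0, rule ball_bump_shift_test) (use r cb L in auto)
      finally show ?thesis by simp
    qed (simp add: B_def)
    have "(LINT x|lborel. A x \<bullet> B x) = (LINT x|lborel. (\<lambda>_::'a. 0::real) x \<bullet> (\<lambda>_::'a. 0) x)"
    proof (rule diag_eqI[where A=A and B=B and A'="\<lambda>_. 0::real" and B'="\<lambda>_. 0" and M=1 and M'=0 and ?r0.0=r0])
      show B1: "norm (B x) \<le> 1" for x
        by (auto simp: B_def indicator_def abs_sgn_eq)
      have iB: "integrable lborel B"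
        by (rule bounded_support_integrable[OF B B1 K(1)]) (simp add: B_def)
      fix r :: real assume r: "0 < r" "r < r0"
      obtain C where C: "\<And>z. norm (ball_bump r (z::'a)) \<le> C" "C \<ge> 0"
        using ball_bump_bounded[OF r(1)] by blast
      have "(LINT x|lborel. LINT y|lborel. A x \<bullet> B y * ball_bump r (x - y)) =
        (LINT y|lborel. LINT x|lborel. A x \<bullet> B y * ball_bump r (x - y))"
      proof (rule Fubini_dominated)
        show "(\<lambda>(x, y). A x \<bullet> B y * ball_bump r (x - y)) \<in> borel_measurable (borel \<Otimes>\<^sub>M borel)"
          using A(3) B by measurable
        show "integrable lborel (\<lambda>x. \<bar>A x\<bar> * C)" "integrable lborel (\<lambda>x. \<bar>B x\<bar>)" using A(1) iB by auto
        show "\<bar>A x \<bullet> B y * ball_bump r (x - y)\<bar> \<le> (\<bar>A x\<bar> * C) * \<bar>B y\<bar>" for x y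
          using mult_left_mono[OF C(1)[of "x - y"], of "\<bar>A x\<bar> * \<bar>B y\<bar>"] by (simp add: abs_mult mult_ac)
      qed
      also have "\<dots> = (LINT y|lborel. (LINT x|lborel. A x * ball_bump r (x - y)) * B y)"
        by (intro Bochner_Integration.integral_cong refl) (subst integral_mult_left_zero[symmetric], simp add: mult_ac)
      also have "\<dots> = 0" by (simp only: zero[OF r] Bochner_Integration.integral_zero)
      finally show "(LINT x|lborel. LINT y|lborel. A x \<bullet> B y * ball_bump r (x - y)) =
         (LINT x|lborel. LINT y|lborel. (\<lambda>_::'a. 0::real) x \<bullet> (\<lambda>_::'a. 0) y * ball_bump r (x - y))" by simp
    qed (use A B L(1) in auto)
    then have "(LINT x|lborel. A x * B x) = 0" by simp
    moreover have "A x * B x = indicator K x * \<bar>A x\<bar>" for x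
      by (simp add: B_def abs_sgn mult.left_commute)
    ultimately have "(LINT x|lborel. indicator K x * \<bar>A x\<bar>) = 0" by simp
    moreover have "integrable lborel (\<lambda>x. indicator K x * \<bar>A x\<bar>)"
      by (rule Bochner_Integration.integrable_bound[OF A(1)]) (use A(3) in \<open>auto simp: indicator_def\<close>)
    ultimately have "AE x in lborel. indicator K x * \<bar>A x\<bar> = 0"
      by (subst (asm) integral_nonneg_eq_0_iff_AE) auto
    with A(2) show ?thesis
    proof eventually_elim
      case (elim x)
      then show ?case using L(3) by (auto simp: indicator_def split: if_splits)
    qed
  qed
  \<comment> \<open>A countable compact exhaustion combines the exceptional null sets into
    one.\<close>
  obtain C :: "nat \<Rightarrow> 'a set" where C: "\<And>n. compact (C n)" "\<And>n. C n \<subseteq> D" "\<Union>(range C) = D"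
    by (rule open_Union_compact_subsets[OF D]) blast
  have "AE x in lborel. \<forall>n. x \<in> C n \<longrightarrow> h x = (0::real)"
    unfolding AE_all_countable using K0[OF C(1,2)] by blast
  then have "AE x in lborel. x \<in> D \<longrightarrow> h x = 0"
    by eventually_elim (use C(3) in blast)
  then show ?thesis using D by (simp add: AE_lebesgue_on_iff)
qed

subsection \<open>Integration by parts and the Poincare inequality for test functions\<close>

lemma test_functions_integrable: "\<phi> \<in> test_functions D \<Longrightarrow> integrable lborel \<phi>"
  by (rule test_functions_supp) (auto intro: continuous_compact_support_integrable test_functionsD(4))

lemma test_functions_grad_integrable:
  assumes "\<phi> \<in> test_functions D" shows "integrable lborel (grad \<phi>)"
proof -
  obtain K where K: "compact K" "K \<subseteq> D" "\<And>x. x \<notin> K \<Longrightarrow> \<phi> x = 0"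
    using test_functions_supp[OF assms(1)] by blast
  show ?thesis
    by (rule continuous_compact_support_integrable[OF test_functions_grad_continuous[OF assms] K(1)])
       (rule grad_outside[OF assms compact_imp_closed[OF K(1)] K(3)])
qed

lemma test_functions_grad_bounded:
  assumes "\<phi> \<in> test_functions D"
  obtains C where "\<And>x. norm (grad \<phi> x) \<le> C" "C \<ge> 0"
proof -
  obtain K where K: "compact K" "K \<subseteq> D" "\<And>x. x \<notin> K \<Longrightarrow> \<phi> x = 0"
    using test_functions_supp[OF assms(1)] by blast
  show ?thesis
    by (rule continuous_compact_support_bounded[OF test_functions_grad_continuous[OF assms] K(1) grad_outside[OF assms compact_imp_closed[OF K(1)] K(3)]])
       (use that in blast)+
qed

lemma test_functions_bounded:
  assumes "\<phi> \<in> test_functions D"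
  obtains C where "\<And>x. norm (\<phi> x) \<le> C" "C \<ge> 0"
proof -
  obtain K where K: "compact K" "K \<subseteq> D" "\<And>x. x \<notin> K \<Longrightarrow> \<phi> x = 0"
    using test_functions_supp[OF assms(1)] by blast
  show ?thesis
    by (rule continuous_compact_support_bounded[OF test_functionsD(4)[OF assms] K(1) K(3)])
       (use that in blast)+
qed

text \<open>By translation invariance, the difference quotients of a test function have integral zero.\<close>

lemma integral_grad_eq_0:
  fixes \<phi> :: "'a::euclidean_space \<Rightarrow> real"
  assumes "\<phi> \<in> test_functions D"
  shows "(LINT x|lborel. grad \<phi> x) = 0"
proof -
  have comp: "(LINT x|lborel. grad \<phi> x \<bullet> e) = 0" if e: "e \<in> Basis" for e
  proof -
    obtain K where K: "compact K" "K \<subseteq> D" "\<And>x. x \<notin> K \<Longrightarrow> \<phi> x = 0"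
      using test_functions_supp[OF assms(1)] by blast
    obtain C where C: "\<And>x. norm (grad \<phi> x) \<le> C" "C \<ge> 0" using test_functions_grad_bounded[OF assms] by blast
    \<comment> \<open>The unit enlargement of \<open>K\<close> contains the supports of all the
      difference quotients, as the steps \<open>h n\<close> are at most 1. With the mean value bound
      \<open>C\<close> on the quotients this gives an integrable majorant.\<close>
    define L where "L = {x + y | x y. x \<in> K \<and> y \<in> cball 0 (1::real)}"
    have L: "compact L" unfolding L_def by (rule compact_sums) (use K in auto)
    define h where "h n = inverse (real (Suc n))" for n
    have h: "h n > 0" "h n \<le> 1" for n by (auto simp: h_def inverse_le_1_iff)
    have h0: "h \<longlonglongrightarrow> 0" unfolding h_def[abs_def] by (rule LIMSEQ_inverse_real_of_nat)
    have i\<phi>: "integrable lborel \<phi>" by (rule test_functions_integrable[OF assms])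
    have m: "\<phi> \<in> borel_measurable borel" using i\<phi> by auto
    define q where "q n x = (\<phi> (x + h n *\<^sub>R e) - \<phi> x) / h n" for n x
    have "(LINT x|lborel. q n x) = 0" for n
      unfolding q_def using lborel_integrable_translate[OF i\<phi>, of "h n *\<^sub>R e"] i\<phi>
      by (simp add: lborel_integral_translate[OF m])
    moreover have "(\<lambda>n. LINT x|lborel. q n x) \<longlonglongrightarrow> (LINT x|lborel. grad \<phi> x \<bullet> e)"
    proof (rule integral_dominated_convergence[where w="\<lambda>x. C * indicator L x"])
      show "(\<lambda>x. grad \<phi> x \<bullet> e) \<in> borel_measurable lborel"
        using test_functions_grad_integrable[OF assms] by auto
      show "q n \<in> borel_measurable lborel" for n unfolding q_def[abs_def] using m by measurable
      have "emeasure lborel L < \<infinity>" by (rule emeasure_compact_finite[OF L])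
      then show "integrable lborel (\<lambda>x. C * indicator L x)"
        using L by (auto simp: borel_compact)
      show "AE x in lborel. (\<lambda>n. q n x) \<longlonglongrightarrow> grad \<phi> x \<bullet> e"
      proof (rule AE_I2)
        fix x
        have d: "((\<lambda>t. x + t *\<^sub>R e) has_derivative (\<lambda>t. t *\<^sub>R e)) (at 0)"
          by (auto intro!: derivative_eq_intros)
        have "((\<lambda>t. \<phi> (x + t *\<^sub>R e)) has_derivative (\<lambda>t. (t *\<^sub>R e) \<bullet> grad \<phi> x)) (at 0)"
          using has_derivative_compose[OF d, of \<phi> "\<lambda>k. k \<bullet> grad \<phi> x"] test_functions_GDERIV[OF assms, of x]
          unfolding gderiv_def by simp
        then have "DERIV (\<lambda>t. \<phi> (x + t *\<^sub>R e)) 0 :> (grad \<phi> x \<bullet> e)"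
          by (rule has_derivative_imp_has_field_derivative) (simp add: inner_commute)
        then have "((\<lambda>t. (\<phi> (x + t *\<^sub>R e) - \<phi> x) / t) \<longlongrightarrow> grad \<phi> x \<bullet> e) (at 0)"
          unfolding DERIV_def by simp
        moreover have "filterlim h (at 0) sequentially"
          using h0 h(1) by (auto simp: filterlim_at less_imp_neq[symmetric] intro!: always_eventually)
        ultimately show "(\<lambda>n. q n x) \<longlonglongrightarrow> grad \<phi> x \<bullet> e"
          unfolding q_def by (rule filterlim_compose)
      qed
      show "AE x in lborel. norm (q n x) \<le> C * indicator L x" for n
      proof (rule AE_I2)
        fix x
        show "norm (q n x) \<le> C * indicator L x"
        proof (cases "x \<in> L")
          case True
          have "norm (\<phi> (x + h n *\<^sub>R e) - \<phi> x) \<le> C * norm ((x + h n *\<^sub>R e) - x)"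
          proof (rule differentiable_bound[of UNIV \<phi> "\<lambda>x k. k \<bullet> grad \<phi> x"])
            show "(\<phi> has_derivative (\<lambda>k. k \<bullet> grad \<phi> y)) (at y within UNIV)" for y
              using test_functions_GDERIV[OF assms] unfolding gderiv_def by simp
            show "onorm (\<lambda>k. k \<bullet> grad \<phi> y) \<le> C" for y
            proof (rule onorm_bound)
              show "norm (k \<bullet> grad \<phi> y) \<le> C * norm k" for k
                using Cauchy_Schwarz_ineq2[of k "grad \<phi> y"] mult_left_mono[OF C(1)[of y], of "norm k"]
                by (simp add: mult.commute)
            qed (rule C)
          qed auto
          then show ?thesis using True h[of n] e unfolding q_def by (simp add: field_simps)
        next
          case False
          have "x = x + 0" by simp
          then have "x \<notin> K" using False unfolding L_def by force
          moreover have "x + h n *\<^sub>R e \<notin> K"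
          proof
            assume "x + h n *\<^sub>R e \<in> K"
            moreover have "x = (x + h n *\<^sub>R e) + (- h n *\<^sub>R e)" "- h n *\<^sub>R e \<in> cball 0 1"
              using h[of n] e by auto
            ultimately have "x \<in> L" unfolding L_def by blast
            then show False using False by simp
          qed
          ultimately show ?thesis using K(3) C False unfolding q_def by simp
        qed
      qed
    qed
    ultimately show ?thesis by (simp add: LIMSEQ_const_iff)
  qed
  show ?thesis
  proof (rule euclidean_eqI)
    fix e :: 'a assume "e \<in> Basis"
    then show "(LINT x|lborel. grad \<phi> x) \<bullet> e = 0 \<bullet> e"
      using comp test_functions_grad_integrable[OF assms] by simp
  qed
qed

lemma integral_lborel_eq_lebesgue_on:
  fixes f :: "'a::euclidean_space \<Rightarrow> 'b::euclidean_space"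
  assumes "open D" "f \<in> borel_measurable borel" "\<And>x. x \<notin> D \<Longrightarrow> f x = 0"
  shows "(LINT x|lebesgue_on D. f x) = (LINT x|lborel. f x)"
    and "integrable (lebesgue_on D) f \<longleftrightarrow> integrable lborel f"
  by (rule integral_lebesgue_on_eq_lborel[OF open_in_lebesgue[OF assms(1)] assms(2)]; 
      rule AE_I2; use assms(3) in \<open>auto simp: indicator_def\<close>)+

lemma test_functions_outside:
  assumes "\<phi> \<in> test_functions D" "x \<notin> D" shows "\<phi> x = 0" "grad \<phi> x = 0"
proof -
  obtain K where K: "compact K" "K \<subseteq> D" "\<And>x. x \<notin> K \<Longrightarrow> \<phi> x = 0"
    using test_functions_supp[OF assms(1)] by blast
  show "\<phi> x = 0" using K assms(2) by blast
  show "grad \<phi> x = 0"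
    by (rule grad_outside[OF assms(1) compact_imp_closed[OF K(1)] K(3)]) (use K assms in auto)
qed

lemma continuous_imp_loc_integrable:
  fixes f :: "'a::euclidean_space \<Rightarrow> 'b::euclidean_space"
  assumes "continuous_on UNIV f"
  shows "loc_integrable D f"
  unfolding loc_integrable_def
proof (intro allI impI)
  fix K assume K: "compact K \<and> K \<subseteq> D"
  have m: "(\<lambda>x. indicator K x *\<^sub>R f x) \<in> borel_measurable borel"
    using borel_measurable_continuous_onI[OF assms] borel_compact[of K] K
    by (intro borel_measurable_scaleR borel_measurable_indicator) auto
  have "integrable lborel (\<lambda>x. indicator K x *\<^sub>R f x)"
    using borel_integrable_compact[of K f] continuous_on_subset[OF assms] K by auto
  then show "integrable (lebesgue_on K) f"
    using integral_lebesgue_on_eq_lborel(2)[OF compact_in_lebesgue m, of K f] K by simp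
qed

text \<open>Integration by parts is the vanishing of the integral of the gradient of the product of
  two test functions. It identifies the chosen weak gradient of a test function with the classical
  one, up to null sets.\<close>

lemma test_functions_weak_grad:
  assumes "open D" "\<phi> \<in> test_functions D"
  shows "is_weak_grad D \<phi> (grad \<phi>)"
  unfolding is_weak_grad_def
proof (intro conjI ballI continuous_imp_loc_integrable test_functionsD(4)[OF assms(2)] test_functions_grad_continuous[OF assms(2)])
  fix \<psi> assume \<psi>: "\<psi> \<in> test_functions D"
  note c = test_functionsD(4)[OF assms(2)] test_functions_grad_continuous[OF assms(2)]
     test_functionsD(4)[OF \<psi>] test_functions_grad_continuous[OF \<psi>]
  obtain K where K: "compact K" "K \<subseteq> D" "\<And>x. x \<notin> K \<Longrightarrow> \<psi> x = 0"
    using test_functions_supp[OF \<psi>] by blast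
  have 1: "integrable lborel (\<lambda>x. \<phi> x *\<^sub>R grad \<psi> x)"
    by (rule continuous_compact_support_integrable[OF _ K(1)])
      (use c K grad_outside[OF \<psi> compact_imp_closed[OF K(1)] K(3)] in \<open>auto intro!: continuous_intros\<close>)
  have 2: "integrable lborel (\<lambda>x. \<psi> x *\<^sub>R grad \<phi> x)"
    by (rule continuous_compact_support_integrable[OF _ K(1)])
      (use c K in \<open>auto intro!: continuous_intros\<close>)
  have "(\<lambda>x. \<phi> x * \<psi> x) \<in> test_functions D"
    by (rule test_functions_mult[OF \<psi> test_functionsD(1)[OF assms(2)]])
  from integral_grad_eq_0[OF this]
  have "(LINT x|lborel. \<phi> x *\<^sub>R grad \<psi> x + \<psi> x *\<^sub>R grad \<phi> x) = 0"
    using grad_mult[OF \<psi> test_functions_GDERIV[OF assms(2)]] by simp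
  then have "(LINT x|lborel. \<phi> x *\<^sub>R grad \<psi> x) = - (LINT x|lborel. \<psi> x *\<^sub>R grad \<phi> x)"
    using 1 2 by (simp add: eq_neg_iff_add_eq_0)
  moreover have "(LINT x|lebesgue_on D. \<phi> x *\<^sub>R grad \<psi> x) = (LINT x|lborel. \<phi> x *\<^sub>R grad \<psi> x)"
    by (rule integral_lborel_eq_lebesgue_on[OF assms(1)])
       (use 1 test_functions_outside[OF \<psi>] in auto)
  moreover have "(LINT x|lebesgue_on D. \<psi> x *\<^sub>R grad \<phi> x) = (LINT x|lborel. \<psi> x *\<^sub>R grad \<phi> x)"
    by (rule integral_lborel_eq_lebesgue_on[OF assms(1)])
       (use 2 test_functions_outside[OF \<psi>] in auto)
  ultimately show "(LINT x|lebesgue_on D. \<phi> x *\<^sub>R grad \<psi> x) = - (LINT x|lebesgue_on D. \<psi> x *\<^sub>R grad \<phi> x)"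
    by simp
qed

text \<open>Integrate \<open>\<partial>\<^sub>e ((x \<bullet> e) \<phi>\<^sup>2) = \<phi>\<^sup>2 + 2 (x \<bullet> e) \<phi> \<partial>\<^sub>e \<phi>\<close>.\<close>

lemma Poincare_test_functions:
  fixes \<phi> :: "'a::euclidean_space \<Rightarrow> real"
  assumes \<phi>: "\<phi> \<in> test_functions D" and R: "\<And>x. x \<in> D \<Longrightarrow> norm x \<le> R"
  shows "(LINT x|lborel. (\<phi> x)\<^sup>2) \<le> 4 * R\<^sup>2 * (LINT x|lborel. (norm (grad \<phi> x))\<^sup>2)"
proof -
  obtain e :: 'a where e: "e \<in> Basis" using nonempty_Basis by blast
  obtain K where K: "compact K" "K \<subseteq> D" "\<And>x. x \<notin> K \<Longrightarrow> \<phi> x = 0"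
    using test_functions_supp[OF \<phi>] by blast
  note c = test_functionsD(4)[OF \<phi>] test_functions_grad_continuous[OF \<phi>]
  note out = grad_outside[OF \<phi> compact_imp_closed[OF K(1)] K(3)]
  define p where "p x = ((x \<bullet> e) * \<phi> x) * \<phi> x" for x
  have p: "p \<in> test_functions D"
    unfolding p_def[abs_def]
    by (intro test_functions_mult[OF \<phi>] C_k_mult C_k_inner test_functionsD(1)[OF \<phi>])
  have gp: "grad p x \<bullet> e = (\<phi> x)\<^sup>2 + 2 * (x \<bullet> e) * \<phi> x * (grad \<phi> x \<bullet> e)" for x
  proof -
    have ge: "GDERIV (\<lambda>x. x \<bullet> e) x :> e"
      unfolding gderiv_def by (auto intro!: derivative_eq_intros)
    show ?thesis
      unfolding p_def[abs_def] grad_mult[OF \<phi> GDERIV_mult[OF ge test_functions_GDERIV[OF \<phi>]]]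
      using e by (simp add: inner_add_left algebra_simps power2_eq_square)
  qed
  have i1: "integrable lborel (\<lambda>x. (\<phi> x)\<^sup>2)"
    by (rule continuous_compact_support_integrable[OF _ K(1)]) (use c K in \<open>auto intro!: continuous_intros\<close>)
  have i2: "integrable lborel (\<lambda>x. 2 * (x \<bullet> e) * \<phi> x * (grad \<phi> x \<bullet> e))"
    by (rule continuous_compact_support_integrable[OF _ K(1)]) (use c K in \<open>auto intro!: continuous_intros\<close>)
  have i3: "integrable lborel (\<lambda>x. (norm (grad \<phi> x))\<^sup>2)"
    by (rule continuous_compact_support_integrable[OF _ K(1)]) (use c out in \<open>auto intro!: continuous_intros\<close>)
  have "(LINT x|lborel. grad p x \<bullet> e) = 0"
    using integral_grad_eq_0[OF p] test_functions_grad_integrable[OF p] by simp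
  then have "(LINT x|lborel. (\<phi> x)\<^sup>2) = - (LINT x|lborel. 2 * (x \<bullet> e) * \<phi> x * (grad \<phi> x \<bullet> e))"
    unfolding gp using i1 i2 by simp
  also have "\<dots> = (LINT x|lborel. - (2 * (x \<bullet> e) * \<phi> x * (grad \<phi> x \<bullet> e)))" by simp
  also have "\<dots> \<le> (LINT x|lborel. (\<phi> x)\<^sup>2 / 2 + 2 * R\<^sup>2 * (norm (grad \<phi> x))\<^sup>2)"
  proof (rule integral_mono)
    fix x
    show "- (2 * (x \<bullet> e) * \<phi> x * (grad \<phi> x \<bullet> e)) \<le> (\<phi> x)\<^sup>2 / 2 + 2 * R\<^sup>2 * (norm (grad \<phi> x))\<^sup>2"
    proof (cases "x \<in> D")
      case True
      have xe: "\<bar>x \<bullet> e\<bar> \<le> R" using Basis_le_norm[OF e, of x] R[OF True] by linarith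
      have "\<bar>(x \<bullet> e) * (grad \<phi> x \<bullet> e)\<bar> \<le> R * norm (grad \<phi> x)"
        unfolding abs_mult by (intro mult_mono xe Basis_le_norm[OF e]) (use xe in auto)
      then have "((x \<bullet> e) * (grad \<phi> x \<bullet> e))\<^sup>2 \<le> (R * norm (grad \<phi> x))\<^sup>2"
        by (metis abs_ge_zero power2_abs power_mono)
      \<comment> \<open>Half of this square is Young's inequality with the weights that leave
        \<open>(\<phi> x)\<^sup>2 / 2\<close>. Absorbing it on the left doubles the constant
        \<open>2 * R\<^sup>2\<close> to \<open>4 * R\<^sup>2\<close>.\<close>
      moreover have "0 \<le> (\<phi> x + 2 * ((x \<bullet> e) * (grad \<phi> x \<bullet> e)))\<^sup>2" by simp
      ultimately show ?thesis by (simp add: power2_sum power_mult_distrib algebra_simps)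
    next
      case False
      then show ?thesis using test_functions_outside[OF \<phi>] by simp
    qed
  qed (use i1 i2 i3 in auto)
  also have "\<dots> = (LINT x|lborel. (\<phi> x)\<^sup>2) / 2 + 2 * R\<^sup>2 * (LINT x|lborel. (norm (grad \<phi> x))\<^sup>2)"
    using i1 i3 by simp
  finally show ?thesis by simp
qed

subsection \<open>Calculus of weak derivatives\<close>

text \<open>\<open>diag_concentration\<close> asks for a bound at every point, so the Borel version
  is reset to 0 wherever it violates the bound.\<close>

lemma ex_local_borel_version_bounded:
  fixes f :: "'a::euclidean_space \<Rightarrow> 'b::euclidean_space"
  assumes f: "loc_integrable D f" and K: "compact K" "K \<subseteq> D" and D: "open D"
    and M: "AE x in lebesgue_on D. norm (f x) \<le> M" and "M \<ge> 0"
  obtains g where "AE x in lborel. indicator K x *\<^sub>R f x = g x"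
    "g \<in> borel_measurable borel" "\<And>x. norm (g x) \<le> M"
proof -
  obtain g where g: "AE x in lborel. indicator K x *\<^sub>R f x = g x" "g \<in> borel_measurable borel"
    using ex_local_borel_version[OF f K] by blast
  define g' where "g' x = (if norm (g x) \<le> M then g x else 0)" for x
  have "AE x in lborel. x \<in> D \<longrightarrow> norm (f x) \<le> M" using M D by (simp add: AE_lebesgue_on_iff)
  with g(1) have "AE x in lborel. indicator K x *\<^sub>R f x = g' x"
  proof eventually_elim
    case (elim x)
    then show ?case using K(2) \<open>M \<ge> 0\<close> by (cases "x \<in> K") (auto simp: g'_def)
  qed
  moreover have "g' \<in> borel_measurable borel" unfolding g'_def[abs_def] using g(2) by measurable
  moreover have "norm (g' x) \<le> M" for x using \<open>M \<ge> 0\<close> by (simp add: g'_def)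
  ultimately show thesis using that by blast
qed

lemma AE_lebesgue_on_mono:
  assumes "D \<in> sets lebesgue" "K \<in> sets lebesgue" "K \<subseteq> D" "AE x in lebesgue_on D. P x"
  shows "AE x in lebesgue_on K. P x"
  using assms by (auto simp: AE_lebesgue_on_iff elim: eventually_mono)

lemma loc_integrable_bounded_bilinear:
  fixes f :: "'a::euclidean_space \<Rightarrow> 'b::euclidean_space" and g :: "'a \<Rightarrow> 'c::euclidean_space"
    and B :: "'b \<Rightarrow> 'c \<Rightarrow> 'd::euclidean_space"
  assumes f: "loc_integrable D f" and g: "loc_integrable D g" and D: "open D"
    and M: "AE x in lebesgue_on D. norm (f x) \<le> M" and B: "bounded_bilinear B"
  shows "loc_integrable D (\<lambda>x. B (f x) (g x))"
  unfolding loc_integrable_def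
proof (intro allI impI)
  fix K assume K: "compact K \<and> K \<subseteq> D"
  have i: "integrable (lebesgue_on K) f" "integrable (lebesgue_on K) g" using f g K unfolding loc_integrable_def by blast+
  obtain N where N: "\<And>a b. norm (B a b) \<le> norm a * norm b * N" "N \<ge> 0"
    using bounded_bilinear.nonneg_bounded[OF B] by blast
  have Kl: "K \<in> sets lebesgue" using K compact_in_lebesgue by blast
  show "integrable (lebesgue_on K) (\<lambda>x. B (f x) (g x))"
  proof (rule Bochner_Integration.integrable_bound[of _ "\<lambda>x. M * norm (g x) * N"])
    show "integrable (lebesgue_on K) (\<lambda>x. M * norm (g x) * N)" using i by auto
    show "(\<lambda>x. B (f x) (g x)) \<in> borel_measurable (lebesgue_on K)"
      by (rule borel_measurable_bilinear[OF _ borel_measurable_integrable[OF i(1)] borel_measurable_integrable[OF i(2)] Kl])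
         (use B in \<open>simp add: bilinear_conv_bounded_bilinear\<close>)
    show "AE x in lebesgue_on K. norm (B (f x) (g x)) \<le> norm (M * norm (g x) * N)"
      using AE_lebesgue_on_mono[OF open_in_lebesgue[OF D] Kl conjunct2[OF K] M]
    proof eventually_elim
      case (elim x)
      have "norm (B (f x) (g x)) \<le> norm (f x) * norm (g x) * N" by (rule N)
      also have "\<dots> \<le> M * norm (g x) * N" using elim N by (intro mult_right_mono) auto
      finally show ?case by simp
    qed
  qed
qed

lemma loc_integrable_add:
  "loc_integrable D f \<Longrightarrow> loc_integrable D g \<Longrightarrow> loc_integrable D (\<lambda>x. f x + g x)"
  unfolding loc_integrable_def by auto

lemma loc_integrable_scaleR:
  "loc_integrable D f \<Longrightarrow> loc_integrable D (\<lambda>x. (c::real) *\<^sub>R f x)"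
  unfolding loc_integrable_def by auto

lemma loc_integrable_inner:
  "loc_integrable D f \<Longrightarrow> loc_integrable D (\<lambda>x. f x \<bullet> e)"
  unfolding loc_integrable_def by auto

lemma weak_integrable_test:
  fixes f :: "'a::euclidean_space \<Rightarrow> 'b::euclidean_space" and B :: "'b \<Rightarrow> real \<Rightarrow> 'd::euclidean_space"
  assumes "loc_integrable D f" "open D" "\<phi> \<in> test_functions D" "bounded_bilinear B"
  shows "integrable (lebesgue_on D) (\<lambda>x. B (f x) (\<phi> x))"
proof -
  obtain K where K: "compact K" "K \<subseteq> D" "\<And>x. x \<notin> K \<Longrightarrow> \<phi> x = 0"
    using test_functions_supp[OF assms(3)] by blast
  show ?thesis by (rule loc_integrable_bilinear[OF assms(1,2) test_functionsD(4)[OF assms(3)] K assms(4)])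
qed

lemma weak_integrable_grad:
  fixes f :: "'a::euclidean_space \<Rightarrow> 'b::euclidean_space" and B :: "'b \<Rightarrow> 'a \<Rightarrow> 'd::euclidean_space"
  assumes "loc_integrable D f" "open D" "\<phi> \<in> test_functions D" "bounded_bilinear B"
  shows "integrable (lebesgue_on D) (\<lambda>x. B (f x) (grad \<phi> x))"
proof -
  obtain K where K: "compact K" "K \<subseteq> D" "\<And>x. x \<notin> K \<Longrightarrow> \<phi> x = 0"
    using test_functions_supp[OF assms(3)] by blast
  show ?thesis by (rule loc_integrable_bilinear[OF assms(1,2) test_functions_grad_continuous[OF assms(3)] K(1,2) _ assms(4)])
    (rule grad_outside[OF assms(3) compact_imp_closed[OF K(1)] K(3)])
qed

lemma bounded_bilinear_scaleR_flip: "bounded_bilinear (\<lambda>(v::'a::real_normed_vector) c. c *\<^sub>R v)"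
  by (rule bounded_bilinear.flip[OF bounded_bilinear_scaleR])

lemmas weak_integrable_test_scaleR = weak_integrable_test[OF _ _ _ bounded_bilinear_scaleR_flip]
lemmas weak_integrable_test_mult = weak_integrable_test[OF _ _ _ bounded_bilinear_mult]
lemmas weak_integrable_grad_scaleR = weak_integrable_grad[OF _ _ _ bounded_bilinear_scaleR]
lemmas weak_integrable_grad_inner = weak_integrable_grad[OF _ _ _ bounded_bilinear_inner]

lemma is_weak_grad_add:
  assumes D: "open D" and "is_weak_grad D f F" "is_weak_grad D g G"
  shows "is_weak_grad D (\<lambda>x. f x + g x) (\<lambda>x. F x + G x)"
  using assms weak_integrable_test_scaleR[of D F _] weak_integrable_test_scaleR[of D G _]
    weak_integrable_grad_scaleR[of D f _] weak_integrable_grad_scaleR[of D g _]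
  unfolding is_weak_grad_def
  by (auto simp: scaleR_add_left scaleR_add_right loc_integrable_add)

lemma is_weak_grad_scale:
  assumes D: "open D" and "is_weak_grad D f F"
  shows "is_weak_grad D (\<lambda>x. c * f x) (\<lambda>x. c *\<^sub>R F x)"
proof -
  have "(LINT x|lebesgue_on D. (c * f x) *\<^sub>R grad \<phi> x) = - (LINT x|lebesgue_on D. \<phi> x *\<^sub>R (c *\<^sub>R F x))"
    if "\<phi> \<in> test_functions D" for \<phi>
  proof -
    have "(LINT x|lebesgue_on D. (c * f x) *\<^sub>R grad \<phi> x) = c *\<^sub>R (LINT x|lebesgue_on D. f x *\<^sub>R grad \<phi> x)"
      by (simp flip: scaleR_scaleR)
    also have "\<dots> = - (c *\<^sub>R (LINT x|lebesgue_on D. \<phi> x *\<^sub>R F x))"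
      using assms(2) that unfolding is_weak_grad_def by auto
    also have "\<dots> = - (LINT x|lebesgue_on D. c *\<^sub>R (\<phi> x *\<^sub>R F x))"
      using weak_integrable_test_scaleR[OF _ D that, of F] assms(2) unfolding is_weak_grad_def
      by (subst integral_scaleR_right) auto
    also have "(\<lambda>x. c *\<^sub>R (\<phi> x *\<^sub>R F x)) = (\<lambda>x. \<phi> x *\<^sub>R (c *\<^sub>R F x))" by (auto simp: mult.commute)
    finally show ?thesis .
  qed
  then show ?thesis
    using assms loc_integrable_scaleR[of D f c] loc_integrable_scaleR[of D F c]
    unfolding is_weak_grad_def by auto
qed

section \<open>Uniqueness of weak gradients and divergences\<close>

lemma fundamental_lemma_unique:
  fixes h k :: "'a::euclidean_space \<Rightarrow> real"
  assumes D: "open D" and h: "loc_integrable D h" and k: "loc_integrable D k"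
    and eq: "\<And>\<phi>. \<phi> \<in> test_functions D \<Longrightarrow> (LINT x|lebesgue_on D. h x * \<phi> x) = (LINT x|lebesgue_on D. k x * \<phi> x)"
  shows "AE x in lebesgue_on D. h x = k x"
proof -
  have "AE x in lebesgue_on D. h x + (-1) *\<^sub>R k x = 0"
  proof (rule fundamental_lemma[OF D loc_integrable_add[OF h loc_integrable_scaleR[OF k]]])
    fix \<phi> assume "\<phi> \<in> test_functions D"
    then show "(LINT x|lebesgue_on D. (h x + (-1) *\<^sub>R k x) * \<phi> x) = 0"
      using eq[of \<phi>] weak_integrable_test_mult[OF h D] weak_integrable_test_mult[OF k D]
      by (simp add: left_diff_distrib)
  qed
  then show ?thesis by eventually_elim simp
qed

lemma is_weak_grad_unique:
  assumes D: "open D" and F: "is_weak_grad D f F" and G: "is_weak_grad D f G"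
  shows "AE x in lebesgue_on D. F x = G x"
proof -
  have comp: "AE x in lebesgue_on D. F x \<bullet> e = G x \<bullet> e" for e
  proof (rule fundamental_lemma_unique[OF D])
    show l: "loc_integrable D (\<lambda>x. F x \<bullet> e)" "loc_integrable D (\<lambda>x. G x \<bullet> e)"
      using F G unfolding is_weak_grad_def by (auto intro: loc_integrable_inner)
    fix \<phi> assume \<phi>: "\<phi> \<in> test_functions D"
    have iF: "integrable (lebesgue_on D) (\<lambda>x. \<phi> x *\<^sub>R F x)" and iG: "integrable (lebesgue_on D) (\<lambda>x. \<phi> x *\<^sub>R G x)"
      using weak_integrable_test_scaleR[OF _ D \<phi>] F G unfolding is_weak_grad_def by auto
    have "(LINT x|lebesgue_on D. \<phi> x *\<^sub>R F x) = (LINT x|lebesgue_on D. \<phi> x *\<^sub>R G x)"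
      using F G \<phi> unfolding is_weak_grad_def by simp
    then have "(LINT x|lebesgue_on D. (\<phi> x *\<^sub>R F x) \<bullet> e) = (LINT x|lebesgue_on D. (\<phi> x *\<^sub>R G x) \<bullet> e)"
      using iF iG by (simp del: inner_scaleR_left)
    then show "(LINT x|lebesgue_on D. F x \<bullet> e * \<phi> x) = (LINT x|lebesgue_on D. G x \<bullet> e * \<phi> x)"
      by (simp add: mult.commute)
  qed
  have "AE x in lebesgue_on D. \<forall>e\<in>Basis. F x \<bullet> e = G x \<bullet> e"
    by (rule AE_finite_allI) (use comp in auto)
  then show ?thesis by eventually_elim (auto intro: euclidean_eqI)
qed

lemma weak_grad_is_weak_grad: "is_weak_grad D f G \<Longrightarrow> is_weak_grad D f (weak_grad D f)"
  unfolding weak_grad_def by (rule someI[of "is_weak_grad D f"])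

lemma weak_grad_AE_eq:
  "open D \<Longrightarrow> is_weak_grad D f G \<Longrightarrow> AE x in lebesgue_on D. weak_grad D f x = G x"
  using is_weak_grad_unique weak_grad_is_weak_grad by blast

lemma is_weak_div_unique:
  assumes D: "open D" and "is_weak_div D G g" "is_weak_div D G' g'"
    and ae: "AE x in lebesgue_on D. G x = G' x"
  shows "AE x in lebesgue_on D. g x = g' x"
proof (rule fundamental_lemma_unique[OF D])
  show l: "loc_integrable D g" "loc_integrable D g'" using assms unfolding is_weak_div_def by auto
  fix \<phi> assume \<phi>: "\<phi> \<in> test_functions D"
  have "(LINT x|lebesgue_on D. G x \<bullet> grad \<phi> x) = (LINT x|lebesgue_on D. G' x \<bullet> grad \<phi> x)"
  proof (rule integral_cong_AE)
    show "(\<lambda>x. G x \<bullet> grad \<phi> x) \<in> borel_measurable (lebesgue_on D)" "(\<lambda>x. G' x \<bullet> grad \<phi> x) \<in> borel_measurable (lebesgue_on D)"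
      using assms weak_integrable_grad_inner[OF _ D \<phi>, of G] weak_integrable_grad_inner[OF _ D \<phi>, of G']
      unfolding is_weak_div_def by auto
    show "AE x in lebesgue_on D. G x \<bullet> grad \<phi> x = G' x \<bullet> grad \<phi> x"
      using ae by eventually_elim simp
  qed
  then show "(LINT x|lebesgue_on D. g x * \<phi> x) = (LINT x|lebesgue_on D. g' x * \<phi> x)"
    using assms \<phi> unfolding is_weak_div_def by auto
qed

text \<open>
  With \<open>\<zeta> = \<eta> \<phi>\<close>, both sides of the product rule are read off, as the bump width \<open>r\<close> tends to 0,
  from the double integral of \<open>\<zeta>(y) G(x) \<bullet> (\<nabla>b\<^sub>r)(x - y)\<close>: integrated in \<open>x\<close> first it involves the
  weak divergence of \<open>G\<close>, integrated in \<open>y\<close> first the weak gradient of \<open>\<eta>\<close>.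
\<close>

lemma is_weak_div_scale:
  fixes G :: "'a::euclidean_space \<Rightarrow> 'a"
  assumes D: "open D" and div: "is_weak_div D G g" and gr: "is_weak_grad D \<eta> H"
    and M\<eta>: "AE x in lebesgue_on D. norm (\<eta> x) \<le> M\<eta>" and MH: "AE x in lebesgue_on D. norm (H x) \<le> MH"
  shows "is_weak_div D (\<lambda>x. \<eta> x *\<^sub>R G x) (\<lambda>x. \<eta> x * g x + H x \<bullet> G x)"
proof -
  have lG: "loc_integrable D G" and lg: "loc_integrable D g" using div unfolding is_weak_div_def by auto
  have l\<eta>: "loc_integrable D \<eta>" and lH: "loc_integrable D H" using gr unfolding is_weak_grad_def by auto
  have l1: "loc_integrable D (\<lambda>x. \<eta> x *\<^sub>R G x)"
    by (rule loc_integrable_bounded_bilinear[OF l\<eta> lG D M\<eta> bounded_bilinear_scaleR])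
  have l2: "loc_integrable D (\<lambda>x. \<eta> x * g x)"
    by (rule loc_integrable_bounded_bilinear[OF l\<eta> lg D M\<eta> bounded_bilinear_mult])
  have l3: "loc_integrable D (\<lambda>x. H x \<bullet> G x)"
    by (rule loc_integrable_bounded_bilinear[OF lH lG D MH bounded_bilinear_inner])
  show ?thesis unfolding is_weak_div_def
  proof (intro conjI ballI l1 loc_integrable_add[OF l2 l3])
    fix \<phi> assume \<phi>: "\<phi> \<in> test_functions D"
    obtain K where K: "compact K" "K \<subseteq> D" "\<And>x. x \<notin> K \<Longrightarrow> \<phi> x = 0"
      using test_functions_supp[OF \<phi>] by blast
    note gK = grad_outside[OF \<phi> compact_imp_closed[OF K(1)] K(3)]
    obtain r0 L where L: "r0 > 0" "compact L" "K \<subseteq> L" "L \<subseteq> D" "\<And>y. y \<in> K \<Longrightarrow> cball y r0 \<subseteq> L"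
      using compact_neighbourhood[OF K(1) D K(2)] by blast
    obtain A where A: "integrable lborel A" "AE x in lborel. indicator L x *\<^sub>R G x = A x" "A \<in> borel_measurable borel"
      using ex_local_borel_version[OF lG L(2,4)] by blast
    obtain a where a: "integrable lborel a" "AE x in lborel. indicator L x *\<^sub>R g x = a x" "a \<in> borel_measurable borel"
      using ex_local_borel_version[OF lg L(2,4)] by blast
    have M\<eta>': "AE x in lebesgue_on D. norm (\<eta> x) \<le> \<bar>M\<eta>\<bar>" "\<bar>M\<eta>\<bar> \<ge> 0" using M\<eta> by (auto elim: eventually_mono)
    have MH': "AE x in lebesgue_on D. norm (H x) \<le> \<bar>MH\<bar>" "\<bar>MH\<bar> \<ge> 0" using MH by (auto elim: eventually_mono)
    obtain w where w: "AE x in lborel. indicator L x *\<^sub>R \<eta> x = w x" "w \<in> borel_measurable borel" "\<And>x. norm (w x) \<le> \<bar>M\<eta>\<bar>"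
      using ex_local_borel_version_bounded[OF l\<eta> L(2,4) D M\<eta>'] by blast
    obtain W where W: "AE x in lborel. indicator L x *\<^sub>R H x = W x" "W \<in> borel_measurable borel" "\<And>x. norm (W x) \<le> \<bar>MH\<bar>"
      using ex_local_borel_version_bounded[OF lH L(2,4) D MH'] by blast
    have [measurable]: "\<phi> \<in> borel_measurable borel" "grad \<phi> \<in> borel_measurable borel"
      using test_functionsD(4)[OF \<phi>] test_functions_grad_continuous[OF \<phi>] by (auto intro: borel_measurable_continuous_onI)
    note [measurable] = A(3) a(3) w(2) W(2)
    obtain C1 where C1: "\<And>x. norm (\<phi> x) \<le> C1" "C1 \<ge> 0" using test_functions_bounded[OF \<phi>] by blast
    obtain C2 where C2: "\<And>x. norm (grad \<phi> x) \<le> C2" "C2 \<ge> 0" using test_functions_grad_bounded[OF \<phi>] by blast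
    \<comment> \<open>\<open>\<zeta>\<close> represents \<open>\<eta> \<phi>\<close> and
      \<open>Z\<close> its weak gradient, in Borel versions that vanish outside
      \<open>K\<close>.\<close>
    define \<zeta> where "\<zeta> y = w y * \<phi> y" for y
    define Z where "Z y = \<phi> y *\<^sub>R W y + w y *\<^sub>R grad \<phi> y" for y
    have \<zeta>m[measurable]: "\<zeta> \<in> borel_measurable borel" unfolding \<zeta>_def[abs_def] by measurable
    have Zm[measurable]: "Z \<in> borel_measurable borel" unfolding Z_def[abs_def] by measurable
    have \<zeta>b: "norm (- \<zeta> y) \<le> \<bar>M\<eta>\<bar> * C1" "norm (\<zeta> y) \<le> \<bar>M\<eta>\<bar> * C1" for y
      unfolding \<zeta>_def norm_minus_cancel norm_mult by (intro mult_mono w C1; simp)+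
    have Zb: "norm (Z y) \<le> C1 * \<bar>MH\<bar> + \<bar>M\<eta>\<bar> * C2" for y
    proof -
      have "norm (\<phi> y *\<^sub>R W y) \<le> C1 * \<bar>MH\<bar>" "norm (w y *\<^sub>R grad \<phi> y) \<le> \<bar>M\<eta>\<bar> * C2"
        unfolding norm_scaleR using w(3) W(3) C1 C2 by (auto intro!: mult_mono simp flip: real_norm_def)
      then show ?thesis unfolding Z_def by (rule norm_add_rule_thm)
    qed
    have \<zeta>K: "\<zeta> y = 0" "Z y = 0" if "y \<notin> K" for y using that K(3) gK unfolding \<zeta>_def Z_def by auto
    have \<zeta>i: "integrable lborel \<zeta>" by (rule bounded_support_integrable[OF \<zeta>m \<zeta>b(2) K(1) \<zeta>K(1)])
    have Zi: "integrable lborel Z" by (rule bounded_support_integrable[OF Zm Zb K(1) \<zeta>K(2)])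

    \<comment> \<open>This is the definition of the weak divergence of \<open>G\<close>, with the
      nonsmooth \<open>\<zeta>\<close> in the role of the test function.\<close>
    have main: "(LINT x|lborel. A x \<bullet> Z x) = (LINT x|lborel. a x \<bullet> (- \<zeta> x))"
    proof (rule diag_eqI[OF A(1) Zm Zb a(1) _ \<zeta>b(1) L(1)])
      fix r :: real assume r: "0 < r" "r < r0"
      let ?b = "ball_bump r :: 'a \<Rightarrow> real"
      note bt = ball_bump_test[OF r(1), where 'a='a]
      obtain Cb where Cb: "\<And>z. norm (?b z) \<le> Cb" "Cb \<ge> 0" using ball_bump_bounded[OF r(1)] by blast
      obtain Cg where Cg: "\<And>z. norm (grad ?b z) \<le> Cg" "Cg \<ge> 0" using test_functions_grad_bounded[OF bt] by blast
      have gm[measurable]: "grad ?b \<in> borel_measurable borel"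
        using test_functions_grad_continuous[OF bt] by (rule borel_measurable_continuous_onI)
      have b0: "ball_bump r (x - y) = 0" "grad ?b (x - y) = 0" if "y \<in> K" "x \<notin> L" for x y
      proof -
        have nxy: "norm (x - y) > r0" using L(5)[OF that(1)] that(2) by (force simp: subset_eq dist_norm norm_minus_commute)
        then show "ball_bump r (x - y) = 0" using r by (intro ball_bump_outside) auto
        show "grad ?b (x - y) = 0"
          by (rule grad_outside[OF bt closed_cball[of 0 r]]) (use nxy r in \<open>auto intro: ball_bump_outside\<close>)
      qed
      \<comment> \<open>For fixed \<open>y\<close> in \<open>K\<close>, the weak divergence of
        \<open>G\<close> is tested with the bump centred at \<open>y\<close>. The factor
        \<open>\<zeta> y\<close> removes the other \<open>y\<close>, for which the bump may leave
        \<open>D\<close>.\<close>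
      have i: "\<zeta> y * (LINT x|lborel. A x \<bullet> grad ?b (x - y)) = - \<zeta> y * (LINT x|lborel. a x * ?b (x - y))" for y
      proof (cases "y \<in> K")
        case True
        have t: "(\<lambda>x. ?b (x - y)) \<in> test_functions D"
          by (rule ball_bump_shift_test[OF r(1)]) (use L(4,5) True r in \<open>force simp: subset_eq\<close>)
        have e1: "(LINT x|lebesgue_on D. G x \<bullet> grad (\<lambda>x. ?b (x - y)) x) = (LINT x|lborel. A x \<bullet> grad ?b (x - y))"
        proof (rule integral_lebesgue_on_eq_lborel(1)[OF open_in_lebesgue[OF D]])
          show "AE x in lborel. indicator D x *\<^sub>R (G x \<bullet> grad (\<lambda>x. ?b (x - y)) x) = A x \<bullet> grad ?b (x - y)"
            using A(2)
          proof eventually_elim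
            case (elim x)
            then show ?case using b0(2)[OF True, of x] L(4) unfolding grad_shift[OF bt]
              by (cases "x \<in> L") (auto simp: subset_eq)
          qed
        qed measurable
        have e2: "(LINT x|lebesgue_on D. g x * ?b (x - y)) = (LINT x|lborel. a x * ?b (x - y))"
        proof (rule integral_lebesgue_on_eq_lborel(1)[OF open_in_lebesgue[OF D]])
          show "AE x in lborel. indicator D x *\<^sub>R (g x * ?b (x - y)) = a x * ?b (x - y)"
            using a(2)
          proof eventually_elim
            case (elim x)
            then show ?case using b0(1)[OF True, of x] L(4) by (cases "x \<in> L") (auto simp: subset_eq)
          qed
        qed measurable
        show ?thesis using div t unfolding is_weak_div_def e1[symmetric] e2[symmetric] by auto
      qed (simp add: \<zeta>K)
      \<comment> \<open>For fixed \<open>x\<close>, the weak gradient of \<open>\<eta>\<close> is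
        tested with the reflected bump times \<open>\<phi>\<close>; the factor \<open>\<phi>\<close>
        keeps the support inside \<open>D\<close> for every \<open>x\<close>. The reflection gives
        the minus sign that moves the derivative from the bump onto \<open>\<zeta>\<close>.\<close>
      have ii: "(LINT y|lborel. \<zeta> y *\<^sub>R grad ?b (x - y)) = (LINT y|lborel. ?b (x - y) *\<^sub>R Z y)" for x
      proof -
        have t: "(\<lambda>y. ?b (x - y) * \<phi> y) \<in> test_functions D"
          by (rule test_functions_mult[OF \<phi>]) (intro C_k_reflect C_k_ball_bump)
        have gt: "grad (\<lambda>y. ?b (x - y) * \<phi> y) y = ?b (x - y) *\<^sub>R grad \<phi> y - \<phi> y *\<^sub>R grad ?b (x - y)" for y
          using grad_mult[OF \<phi> GDERIV_reflect[OF test_functions_GDERIV[OF bt]]] by simp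
        have e1: "(LINT y|lebesgue_on D. \<eta> y *\<^sub>R grad (\<lambda>y. ?b (x - y) * \<phi> y) y) =
          (LINT y|lborel. w y *\<^sub>R (?b (x - y) *\<^sub>R grad \<phi> y - \<phi> y *\<^sub>R grad ?b (x - y)))"
        proof (rule integral_lebesgue_on_eq_lborel(1)[OF open_in_lebesgue[OF D]])
          show "AE y in lborel. indicator D y *\<^sub>R (\<eta> y *\<^sub>R grad (\<lambda>y. ?b (x - y) * \<phi> y) y) =
             w y *\<^sub>R (?b (x - y) *\<^sub>R grad \<phi> y - \<phi> y *\<^sub>R grad ?b (x - y))"
            using w(1)
          proof eventually_elim
            case (elim y)
            show ?case
            proof (cases "y \<in> L")
              case True then show ?thesis using elim L(4) unfolding gt by (auto simp: subset_eq)
            next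
              case False
              then have "y \<notin> K" using L(3) by blast
              then show ?thesis unfolding gt using K(3) gK by simp
            qed
          qed
        qed measurable
        have e2: "(LINT y|lebesgue_on D. (?b (x - y) * \<phi> y) *\<^sub>R H y) = (LINT y|lborel. (?b (x - y) * \<phi> y) *\<^sub>R W y)"
        proof (rule integral_lebesgue_on_eq_lborel(1)[OF open_in_lebesgue[OF D]])
          show "AE y in lborel. indicator D y *\<^sub>R ((?b (x - y) * \<phi> y) *\<^sub>R H y) = (?b (x - y) * \<phi> y) *\<^sub>R W y"
            using W(1)
          proof eventually_elim
            case (elim y)
            show ?case
            proof (cases "y \<in> L")
              case True then show ?thesis using elim L(4) by (auto simp: subset_eq)
            next
              case False
              then have "y \<notin> K" using L(3) by blast
              then show ?thesis using K(3) by simp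
            qed
          qed
        qed measurable
        have s1: "integrable lborel (\<lambda>y. \<zeta> y *\<^sub>R grad ?b (x - y))"
          by (rule bounded_support_integrable[where M="(\<bar>M\<eta>\<bar> * C1) * Cg", OF _ _ K(1)])
             (use \<zeta>K \<zeta>b Cg C1 in \<open>auto simp flip: real_norm_def intro!: mult_mono\<close>)
        have s2: "integrable lborel (\<lambda>y. (?b (x - y) * \<phi> y) *\<^sub>R W y)"
          by (rule bounded_support_integrable[where M="(Cb * C1) * \<bar>MH\<bar>", OF _ _ K(1)])
             (use K(3) Cb C1 W(3) in \<open>auto simp: norm_mult simp flip: real_norm_def intro!: mult_mono\<close>)
        have s3: "integrable lborel (\<lambda>y. (w y * ?b (x - y)) *\<^sub>R grad \<phi> y)"
          by (rule bounded_support_integrable[where M="(\<bar>M\<eta>\<bar> * Cb) * C2", OF _ _ K(1)])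
             (use gK Cb C2 w(3) in \<open>auto simp: norm_mult simp flip: real_norm_def intro!: mult_mono\<close>)
        have "(LINT y|lborel. (w y * ?b (x - y)) *\<^sub>R grad \<phi> y - \<zeta> y *\<^sub>R grad ?b (x - y)) =
           (LINT y|lborel. w y *\<^sub>R (?b (x - y) *\<^sub>R grad \<phi> y - \<phi> y *\<^sub>R grad ?b (x - y)))"
          by (simp add: \<zeta>_def scaleR_diff_right)
        also have "\<dots> = - (LINT y|lborel. (?b (x - y) * \<phi> y) *\<^sub>R W y)"
          using gr t unfolding is_weak_grad_def e1[symmetric] e2[symmetric] by blast
        finally have "(LINT y|lborel. \<zeta> y *\<^sub>R grad ?b (x - y)) =
          (LINT y|lborel. (?b (x - y) * \<phi> y) *\<^sub>R W y) + (LINT y|lborel. (w y * ?b (x - y)) *\<^sub>R grad \<phi> y)"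
          using s1 s3 by (simp add: algebra_simps)
        also have "\<dots> = (LINT y|lborel. (?b (x - y) * \<phi> y) *\<^sub>R W y + (w y * ?b (x - y)) *\<^sub>R grad \<phi> y)"
          using s2 s3 by simp
        also have "\<dots> = (LINT y|lborel. ?b (x - y) *\<^sub>R Z y)"
          by (simp add: Z_def scaleR_add_right mult.commute)
        finally show ?thesis .
      qed
      have iZ: "integrable lborel (\<lambda>y. ?b (x - y) *\<^sub>R Z y)" for x
        by (rule bounded_support_integrable[where M="Cb * (C1 * \<bar>MH\<bar> + \<bar>M\<eta>\<bar> * C2)", OF _ _ K(1)])
           (use \<zeta>K Cb Zb in \<open>auto simp flip: real_norm_def intro!: mult_mono\<close>)
      have i\<zeta>: "integrable lborel (\<lambda>y. \<zeta> y *\<^sub>R grad ?b (x - y))" for x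
        by (rule bounded_support_integrable[where M="(\<bar>M\<eta>\<bar> * C1) * Cg", OF _ _ K(1)])
           (use \<zeta>K \<zeta>b Cg C1 in \<open>auto simp flip: real_norm_def intro!: mult_mono\<close>)
      have "(LINT x|lborel. LINT y|lborel. A x \<bullet> Z y * ?b (x - y)) =
        (LINT x|lborel. A x \<bullet> (LINT y|lborel. ?b (x - y) *\<^sub>R Z y))"
        by (intro Bochner_Integration.integral_cong refl)
           (subst integral_inner_right[symmetric], use iZ in \<open>auto simp: mult.commute\<close>)
      also have "\<dots> = (LINT x|lborel. A x \<bullet> (LINT y|lborel. \<zeta> y *\<^sub>R grad ?b (x - y)))"
        by (simp only: ii)
      also have "\<dots> = (LINT x|lborel. LINT y|lborel. \<zeta> y * (A x \<bullet> grad ?b (x - y)))"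
        by (intro Bochner_Integration.integral_cong refl)
           (subst integral_inner_right[symmetric], use i\<zeta> in auto)
      also have "\<dots> = (LINT y|lborel. LINT x|lborel. \<zeta> y * (A x \<bullet> grad ?b (x - y)))"
      proof (rule Fubini_dominated)
        show "(\<lambda>(x, y). \<zeta> y * (A x \<bullet> grad ?b (x - y))) \<in> borel_measurable (borel \<Otimes>\<^sub>M borel)" by measurable
        show "integrable lborel (\<lambda>x. norm (A x) * Cg)" "integrable lborel (\<lambda>y. \<bar>\<zeta> y\<bar>)" using A(1) \<zeta>i by auto
        show "\<bar>\<zeta> y * (A x \<bullet> grad ?b (x - y))\<bar> \<le> (norm (A x) * Cg) * \<bar>\<zeta> y\<bar>" for x y
        proof -
          have "\<bar>A x \<bullet> grad ?b (x - y)\<bar> \<le> norm (A x) * norm (grad ?b (x - y))" by (rule Cauchy_Schwarz_ineq2)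
          also have "\<dots> \<le> norm (A x) * Cg" by (intro mult_left_mono Cg) auto
          finally show ?thesis by (simp add: abs_mult mult.commute mult_left_mono)
        qed
      qed
      also have "\<dots> = (LINT y|lborel. \<zeta> y * (LINT x|lborel. A x \<bullet> grad ?b (x - y)))" by simp
      also have "\<dots> = (LINT y|lborel. - \<zeta> y * (LINT x|lborel. a x * ?b (x - y)))" by (simp only: i)
      also have "\<dots> = (LINT y|lborel. LINT x|lborel. a x \<bullet> (- \<zeta> y) * ?b (x - y))"
        by (intro Bochner_Integration.integral_cong refl)
           (subst integral_mult_right_zero[symmetric], simp add: mult_ac)
      also have "\<dots> = (LINT x|lborel. LINT y|lborel. a x \<bullet> (- \<zeta> y) * ?b (x - y))"
      proof (rule Fubini_dominated[symmetric])
        show "(\<lambda>(x, y). a x \<bullet> (- \<zeta> y) * ?b (x - y)) \<in> borel_measurable (borel \<Otimes>\<^sub>M borel)" by measurable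
        show "integrable lborel (\<lambda>x. \<bar>a x\<bar> * Cb)" "integrable lborel (\<lambda>y. \<bar>\<zeta> y\<bar>)" using a(1) \<zeta>i by auto
        show "\<bar>a x \<bullet> (- \<zeta> y) * ?b (x - y)\<bar> \<le> (\<bar>a x\<bar> * Cb) * \<bar>\<zeta> y\<bar>" for x y
          using mult_left_mono[OF Cb(1)[of "x - y"], of "\<bar>a x\<bar> * \<bar>\<zeta> y\<bar>"] by (simp add: abs_mult mult_ac)
      qed
      finally show "(LINT x|lborel. LINT y|lborel. A x \<bullet> Z y * ?b (x - y)) =
        (LINT x|lborel. LINT y|lborel. a x \<bullet> (- \<zeta> y) * ?b (x - y))" .
    qed measurable

    have j1: "integrable lborel (\<lambda>x. w x * (A x \<bullet> grad \<phi> x))"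
    proof (rule Bochner_Integration.integrable_bound[of _ "\<lambda>x. (\<bar>M\<eta>\<bar> * C2) * norm (A x)"])
      show "AE x in lborel. norm (w x * (A x \<bullet> grad \<phi> x)) \<le> norm ((\<bar>M\<eta>\<bar> * C2) * norm (A x))"
      proof (rule AE_I2)
        fix x
        have "\<bar>A x \<bullet> grad \<phi> x\<bar> \<le> norm (A x) * norm (grad \<phi> x)" by (rule Cauchy_Schwarz_ineq2)
        also have "\<dots> \<le> norm (A x) * C2" by (intro mult_left_mono C2) auto
        finally have "\<bar>w x\<bar> * \<bar>A x \<bullet> grad \<phi> x\<bar> \<le> \<bar>M\<eta>\<bar> * (norm (A x) * C2)"
          using w(3)[of x] by (intro mult_mono) auto
        then show "norm (w x * (A x \<bullet> grad \<phi> x)) \<le> norm ((\<bar>M\<eta>\<bar> * C2) * norm (A x))"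
          using C2 by (simp add: abs_mult mult_ac)
      qed
    qed (use A in auto)
    have j2: "integrable lborel (\<lambda>x. \<phi> x * (W x \<bullet> A x))"
    proof (rule Bochner_Integration.integrable_bound[of _ "\<lambda>x. (C1 * \<bar>MH\<bar>) * norm (A x)"])
      show "AE x in lborel. norm (\<phi> x * (W x \<bullet> A x)) \<le> norm ((C1 * \<bar>MH\<bar>) * norm (A x))"
      proof (rule AE_I2)
        fix x
        have "\<bar>W x \<bullet> A x\<bar> \<le> norm (W x) * norm (A x)" by (rule Cauchy_Schwarz_ineq2)
        also have "\<dots> \<le> \<bar>MH\<bar> * norm (A x)" by (intro mult_right_mono W(3)) auto
        finally have "\<bar>\<phi> x\<bar> * \<bar>W x \<bullet> A x\<bar> \<le> C1 * (\<bar>MH\<bar> * norm (A x))"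
          using C1(1)[of x] C1(2) by (intro mult_mono) auto
        then show "norm (\<phi> x * (W x \<bullet> A x)) \<le> norm ((C1 * \<bar>MH\<bar>) * norm (A x))"
          using C1 by (simp add: abs_mult mult_ac)
      qed
    qed (use A in auto)
    have j3: "integrable lborel (\<lambda>x. \<zeta> x * a x)"
    proof (rule Bochner_Integration.integrable_bound[of _ "\<lambda>x. (\<bar>M\<eta>\<bar> * C1) * a x"])
      show "AE x in lborel. norm (\<zeta> x * a x) \<le> norm ((\<bar>M\<eta>\<bar> * C1) * a x)"
        using mult_right_mono[OF \<zeta>b(2), of "\<bar>a x\<bar>" x for x] C1 by (intro AE_I2) (simp add: abs_mult)
    qed (use a in auto)
    have "(LINT x|lebesgue_on D. (\<eta> x *\<^sub>R G x) \<bullet> grad \<phi> x) = (LINT x|lborel. w x * (A x \<bullet> grad \<phi> x))"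
    proof (rule integral_lebesgue_on_eq_lborel(1)[OF open_in_lebesgue[OF D]])
      show "AE x in lborel. indicator D x *\<^sub>R ((\<eta> x *\<^sub>R G x) \<bullet> grad \<phi> x) = w x * (A x \<bullet> grad \<phi> x)"
        using A(2) w(1)
      proof eventually_elim
        case (elim x)
        then show ?case using gK[of x] L(3,4) by (cases "x \<in> L") (auto simp: subset_eq)
      qed
    qed measurable
    moreover have "(LINT x|lebesgue_on D. (\<eta> x * g x + H x \<bullet> G x) * \<phi> x) = (LINT x|lborel. \<zeta> x * a x + \<phi> x * (W x \<bullet> A x))"
    proof (rule integral_lebesgue_on_eq_lborel(1)[OF open_in_lebesgue[OF D]])
      show "AE x in lborel. indicator D x *\<^sub>R ((\<eta> x * g x + H x \<bullet> G x) * \<phi> x) = \<zeta> x * a x + \<phi> x * (W x \<bullet> A x)"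
        using A(2) w(1) a(2) W(1)
      proof eventually_elim
        case (elim x)
        show ?case
        proof (cases "x \<in> L")
          case True
          then have "x \<in> D" using L(4) by blast
          then show ?thesis using elim True by (simp add: \<zeta>_def algebra_simps)
        next
          case False
          then have "\<phi> x = 0" using K(3) L(3) by blast
          then show ?thesis by (simp add: \<zeta>_def)
        qed
      qed
    qed measurable
    moreover have "(LINT x|lborel. A x \<bullet> Z x) = (LINT x|lborel. \<phi> x * (W x \<bullet> A x)) + (LINT x|lborel. w x * (A x \<bullet> grad \<phi> x))"
      using j1 j2 by (simp add: Z_def inner_add_right inner_commute)
    moreover have "(LINT x|lborel. a x \<bullet> (- \<zeta> x)) = - (LINT x|lborel. \<zeta> x * a x)"
      by (simp add: mult.commute)
    ultimately show "(LINT x|lebesgue_on D. (\<eta> x *\<^sub>R G x) \<bullet> grad \<phi> x) = - (LINT x|lebesgue_on D. (\<eta> x * g x + H x \<bullet> G x) * \<phi> x)"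
      using main j2 j3 by simp
  qed
qed

text \<open>Weak gradients become weak divergences of the fields \<open>f x *\<^sub>R e\<close>, so
  that one product rule serves for both.\<close>

lemma is_weak_div_componentI:
  assumes "open D" "is_weak_grad D f F"
  shows "is_weak_div D (\<lambda>x. f x *\<^sub>R e) (\<lambda>x. F x \<bullet> e)"
  unfolding is_weak_div_def
proof (intro conjI ballI)
  have l: "loc_integrable D f" "loc_integrable D F" using assms unfolding is_weak_grad_def by auto
  show "loc_integrable D (\<lambda>x. F x \<bullet> e)" by (rule loc_integrable_inner[OF l(2)])
  show "loc_integrable D (\<lambda>x. f x *\<^sub>R e)" using l(1) unfolding loc_integrable_def by auto
  fix \<phi> assume \<phi>: "\<phi> \<in> test_functions D"
  have "(LINT x|lebesgue_on D. (f x *\<^sub>R grad \<phi> x) \<bullet> e) = (LINT x|lebesgue_on D. f x *\<^sub>R grad \<phi> x) \<bullet> e"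
    using weak_integrable_grad_scaleR[OF l(1) assms(1) \<phi>] by (rule integral_inner_left)
  also have "\<dots> = - ((LINT x|lebesgue_on D. \<phi> x *\<^sub>R F x) \<bullet> e)"
    using assms(2) \<phi> unfolding is_weak_grad_def by simp
  also have "\<dots> = - (LINT x|lebesgue_on D. (\<phi> x *\<^sub>R F x) \<bullet> e)"
    using weak_integrable_test_scaleR[OF l(2) assms(1) \<phi>] by (subst integral_inner_left) auto
  finally show "(LINT x|lebesgue_on D. (f x *\<^sub>R e) \<bullet> grad \<phi> x) = - (LINT x|lebesgue_on D. F x \<bullet> e * \<phi> x)"
    by (simp add: inner_commute mult.commute)
qed

lemma is_weak_gradI_component:
  fixes F :: "'a::euclidean_space \<Rightarrow> 'a"
  assumes D: "open D" and l: "loc_integrable D f" "loc_integrable D F"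
    and div: "\<And>e. e \<in> Basis \<Longrightarrow> is_weak_div D (\<lambda>x. f x *\<^sub>R e) (\<lambda>x. F x \<bullet> e)"
  shows "is_weak_grad D f F"
  unfolding is_weak_grad_def
proof (intro conjI ballI l)
  fix \<phi> assume \<phi>: "\<phi> \<in> test_functions D"
  show "(LINT x|lebesgue_on D. f x *\<^sub>R grad \<phi> x) = - (LINT x|lebesgue_on D. \<phi> x *\<^sub>R F x)"
  proof (rule euclidean_eqI)
    fix e :: 'a assume e: "e \<in> Basis"
    have "(LINT x|lebesgue_on D. f x *\<^sub>R grad \<phi> x) \<bullet> e = (LINT x|lebesgue_on D. (f x *\<^sub>R grad \<phi> x) \<bullet> e)"
      using weak_integrable_grad_scaleR[OF l(1) D \<phi>] by (subst integral_inner_left) auto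
    also have "\<dots> = (LINT x|lebesgue_on D. (f x *\<^sub>R e) \<bullet> grad \<phi> x)"
      by (simp add: inner_commute)
    also have "\<dots> = - (LINT x|lebesgue_on D. F x \<bullet> e * \<phi> x)"
      using div[OF e] \<phi> unfolding is_weak_div_def by blast
    also have "\<dots> = - (LINT x|lebesgue_on D. (\<phi> x *\<^sub>R F x) \<bullet> e)" by (simp add: mult.commute)
    also have "\<dots> = - ((LINT x|lebesgue_on D. \<phi> x *\<^sub>R F x) \<bullet> e)"
      using weak_integrable_test_scaleR[OF l(2) D \<phi>] by (subst integral_inner_left) auto
    finally show "(LINT x|lebesgue_on D. f x *\<^sub>R grad \<phi> x) \<bullet> e = - (LINT x|lebesgue_on D. \<phi> x *\<^sub>R F x) \<bullet> e"
      by simp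
  qed
qed

text \<open>The divergence rule applied to each field \<open>f x *\<^sub>R e\<close>. Only the
  factor \<open>\<eta>\<close> and its gradient have to be bounded.\<close>

lemma is_weak_grad_mult:
  assumes D: "open D" and f: "is_weak_grad D f F" and gr: "is_weak_grad D \<eta> H"
    and M\<eta>: "AE x in lebesgue_on D. norm (\<eta> x) \<le> M\<eta>" and MH: "AE x in lebesgue_on D. norm (H x) \<le> MH"
  shows "is_weak_grad D (\<lambda>x. \<eta> x * f x) (\<lambda>x. \<eta> x *\<^sub>R F x + f x *\<^sub>R H x)"
proof (rule is_weak_gradI_component[OF D])
  have l: "loc_integrable D f" "loc_integrable D F" "loc_integrable D \<eta>" "loc_integrable D H"
    using f gr unfolding is_weak_grad_def by auto
  show "loc_integrable D (\<lambda>x. \<eta> x * f x)"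
    by (rule loc_integrable_bounded_bilinear[OF l(3,1) D M\<eta> bounded_bilinear_mult])
  show "loc_integrable D (\<lambda>x. \<eta> x *\<^sub>R F x + f x *\<^sub>R H x)"
    by (intro loc_integrable_add
        loc_integrable_bounded_bilinear[OF l(3,2) D M\<eta> bounded_bilinear_scaleR]
        loc_integrable_bounded_bilinear[OF l(4,1) D MH bounded_bilinear_scaleR_flip])
  fix e :: 'a
  have "is_weak_div D (\<lambda>x. \<eta> x *\<^sub>R (f x *\<^sub>R e)) (\<lambda>x. \<eta> x * (F x \<bullet> e) + H x \<bullet> (f x *\<^sub>R e))"
    by (rule is_weak_div_scale[OF D is_weak_div_componentI[OF D f] gr M\<eta> MH])
  then show "is_weak_div D (\<lambda>x. (\<eta> x * f x) *\<^sub>R e) (\<lambda>x. (\<eta> x *\<^sub>R F x + f x *\<^sub>R H x) \<bullet> e)"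
    by (simp add: inner_add_left)
qed

text \<open>Dominated convergence: against a fixed continuous function of compact support, a uniform
  bound on the \<open>f n\<close> is an integrable majorant.\<close>

lemma LINT_test_limit:
  fixes f :: "nat \<Rightarrow> 'a::euclidean_space \<Rightarrow> 'b::euclidean_space" and \<phi> :: "'a \<Rightarrow> 'c::euclidean_space"
    and B :: "'b \<Rightarrow> 'c \<Rightarrow> 'd::euclidean_space"
  assumes D: "open D" and B: "bounded_bilinear B" and \<phi>: "continuous_on UNIV \<phi>"
    and K: "compact K" "K \<subseteq> D" "\<And>x. x \<notin> K \<Longrightarrow> \<phi> x = 0"
    and f: "\<And>n. loc_integrable D (f n)" and g: "loc_integrable D g"
    and lim: "AE x in lebesgue_on D. (\<lambda>n. f n x) \<longlonglongrightarrow> g x"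
    and M: "\<And>n. AE x in lebesgue_on D. norm (f n x) \<le> M"
  shows "(\<lambda>n. LINT x|lebesgue_on D. B (f n x) (\<phi> x)) \<longlonglongrightarrow> (LINT x|lebesgue_on D. B (g x) (\<phi> x))"
proof -
  obtain N where N: "\<And>a b. norm (B a b) \<le> norm a * norm b * N" "N \<ge> 0"
    using bounded_bilinear.nonneg_bounded[OF B] by blast
  show ?thesis
  proof (rule integral_dominated_convergence)
  show "(\<lambda>x. B (g x) (\<phi> x)) \<in> borel_measurable (lebesgue_on D)"
    by (rule borel_measurable_integrable[OF loc_integrable_bilinear[OF g D \<phi> K B]])
  show "(\<lambda>x. B (f n x) (\<phi> x)) \<in> borel_measurable (lebesgue_on D)" for n
    by (rule borel_measurable_integrable[OF loc_integrable_bilinear[OF f D \<phi> K B]])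
  have i\<phi>: "integrable lborel \<phi>" by (rule continuous_compact_support_integrable[OF \<phi> K(1,3)])
  have "integrable (lebesgue_on D) \<phi>"
    using integral_lborel_eq_lebesgue_on(2)[OF D, of \<phi>] i\<phi> K(2,3) by auto
  then show "integrable (lebesgue_on D) (\<lambda>x. M * norm (\<phi> x) * N)" by auto
  show "AE x in lebesgue_on D. (\<lambda>n. B (f n x) (\<phi> x)) \<longlonglongrightarrow> B (g x) (\<phi> x)"
    using lim by eventually_elim (auto intro: bounded_bilinear.tendsto[OF B])
  show "AE x in lebesgue_on D. norm (B (f n x) (\<phi> x)) \<le> M * norm (\<phi> x) * N" for n
    using M[of n]
  proof eventually_elim
    case (elim x)
    have "norm (B (f n x) (\<phi> x)) \<le> norm (f n x) * norm (\<phi> x) * N" by (rule N)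
    also have "\<dots> \<le> M * norm (\<phi> x) * N" using elim N by (intro mult_right_mono) auto
    finally show ?case .
  qed
  qed
qed

lemma is_weak_grad_limit:
  assumes D: "open D" and gr: "\<And>n. is_weak_grad D (f n) (F n)"
    and l: "loc_integrable D g" "loc_integrable D G"
    and lim: "AE x in lebesgue_on D. (\<lambda>n. f n x) \<longlonglongrightarrow> g x" "AE x in lebesgue_on D. (\<lambda>n. F n x) \<longlonglongrightarrow> G x"
    and M: "\<And>n. AE x in lebesgue_on D. norm (f n x) \<le> M" "\<And>n. AE x in lebesgue_on D. norm (F n x) \<le> M"
  shows "is_weak_grad D g G"
  unfolding is_weak_grad_def
proof (intro conjI ballI l)
  have lf: "loc_integrable D (f n)" "loc_integrable D (F n)" for n using gr unfolding is_weak_grad_def by auto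
  fix \<phi> assume \<phi>: "\<phi> \<in> test_functions D"
  obtain K where K: "compact K" "K \<subseteq> D" "\<And>x. x \<notin> K \<Longrightarrow> \<phi> x = 0"
    using test_functions_supp[OF \<phi>] by blast
  note gK = grad_outside[OF \<phi> compact_imp_closed[OF K(1)] K(3)]
  have "(\<lambda>n. LINT x|lebesgue_on D. f n x *\<^sub>R grad \<phi> x) \<longlonglongrightarrow> (LINT x|lebesgue_on D. g x *\<^sub>R grad \<phi> x)"
    by (rule LINT_test_limit[OF D bounded_bilinear_scaleR test_functions_grad_continuous[OF \<phi>] K(1,2) gK lf(1) l(1) lim(1) M(1)])
  moreover have "(\<lambda>n. - (LINT x|lebesgue_on D. \<phi> x *\<^sub>R F n x)) \<longlonglongrightarrow> - (LINT x|lebesgue_on D. \<phi> x *\<^sub>R G x)"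
    by (rule tendsto_minus[OF LINT_test_limit[OF D bounded_bilinear_scaleR_flip test_functionsD(4)[OF \<phi>] K lf(2) l(2) lim(2) M(2)]])
  ultimately show "(LINT x|lebesgue_on D. g x *\<^sub>R grad \<phi> x) = - (LINT x|lebesgue_on D. \<phi> x *\<^sub>R G x)"
    using gr \<phi> unfolding is_weak_grad_def by (simp add: LIMSEQ_unique)
qed

text \<open>
  The chain rule for \<open>1/a\<close> follows from the product rule through the Neumann series
  \<open>1/a = M\<^sup>-\<^sup>1 \<Sum>\<^sub>n (1 - a/M)\<^sup>n\<close>, where \<open>0 \<le> 1 - a/M \<le> 1 - c/M < 1\<close>.
\<close>

lemma is_weak_grad_inverse:
  fixes a :: "'a::euclidean_space \<Rightarrow> real"
  assumes D: "open D" and gr: "is_weak_grad D a G"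
    and c: "c > 0" and ca: "AE x in lebesgue_on D. c \<le> a x" and M: "AE x in lebesgue_on D. a x \<le> M" "c \<le> M"
    and MG: "AE x in lebesgue_on D. norm (G x) \<le> N"
  shows "is_weak_grad D (\<lambda>x. inverse (a x)) (\<lambda>x. - ((inverse (a x))\<^sup>2 *\<^sub>R G x))"
proof -
  define s where "s x = 1 - a x / M" for x
  define q where "q = 1 - c / M"
  have M0: "M > 0" using c M by simp
  have q: "0 \<le> q" "q < 1" using c M M0 by (auto simp: q_def)
  have sq: "AE x in lebesgue_on D. 0 \<le> s x \<and> s x \<le> q"
    using ca M(1)
  proof eventually_elim
    case (elim x)
    then show ?case using M0 by (auto simp: s_def q_def divide_right_mono)
  qed
  have pos: "AE x in lebesgue_on D. a x > 0" using ca by eventually_elim (use c in auto)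
  have la: "loc_integrable D a" "loc_integrable D G" using gr unfolding is_weak_grad_def by auto
  have one: "is_weak_grad D (\<lambda>x. k) (\<lambda>x. 0)" for k :: real
    unfolding is_weak_grad_def
  proof (intro conjI ballI)
    show "loc_integrable D (\<lambda>x. k)" "loc_integrable D (\<lambda>x. 0::'a)"
      by (auto intro!: continuous_imp_loc_integrable continuous_intros)
    fix \<phi> assume \<phi>: "\<phi> \<in> test_functions D"
    have "(LINT x|lebesgue_on D. grad \<phi> x) = (LINT x|lborel. grad \<phi> x)"
      by (rule integral_lborel_eq_lebesgue_on(1)[OF D])
         (use test_functions_grad_integrable[OF \<phi>] test_functions_outside[OF \<phi>] in auto)
    then show "(LINT x|lebesgue_on D. k *\<^sub>R grad \<phi> x) = - (LINT x|lebesgue_on D. \<phi> x *\<^sub>R 0)"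
      using integral_grad_eq_0[OF \<phi>] by simp
  qed
  define S where "S x = (- (1 / M)) *\<^sub>R G x" for x
  have grs: "is_weak_grad D s S"
    using is_weak_grad_add[OF D one[of 1] is_weak_grad_scale[OF D gr, of "- (1/M)"]]
    by (simp add: s_def[abs_def] S_def[abs_def])
  have N0: "norm (S x) \<le> \<bar>N\<bar> / M" if "norm (G x) \<le> N" for x
    using that M0 by (simp add: S_def divide_right_mono)
  have MS: "AE x in lebesgue_on D. norm (S x) \<le> \<bar>N\<bar> / M" using MG by eventually_elim (rule N0)
  have s1: "AE x in lebesgue_on D. norm (s x) \<le> 1" using sq by eventually_elim (use q in auto)
  \<comment> \<open>In each step the bounded \<open>s\<close>, with bounded gradient, is the
    multiplier and the power is the other factor, so no bounds on the gradients of powers have to be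
    carried through the induction.\<close>
  have pw: "is_weak_grad D (\<lambda>x. s x ^ n) (\<lambda>x. (real n * s x ^ (n - 1)) *\<^sub>R S x)" for n
  proof (induction n)
    case 0
    then show ?case using one[of 1] by simp
  next
    case (Suc n)
    have "is_weak_grad D (\<lambda>x. s x * s x ^ n) (\<lambda>x. s x *\<^sub>R ((real n * s x ^ (n - 1)) *\<^sub>R S x) + (s x ^ n) *\<^sub>R S x)"
      by (rule is_weak_grad_mult[OF D Suc grs s1 MS])
    moreover have "s x *\<^sub>R ((real n * s x ^ (n - 1)) *\<^sub>R S x) + (s x ^ n) *\<^sub>R S x = (real (Suc n) * s x ^ (Suc n - 1)) *\<^sub>R S x" for x
    proof -
      have "s x * (real n * s x ^ (n - 1)) + s x ^ n = real (Suc n) * s x ^ (Suc n - 1)"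
        by (cases n) (auto simp: algebra_simps)
      then show ?thesis by (simp only: scaleR_scaleR scaleR_add_left[symmetric])
    qed
    ultimately show ?case by simp
  qed
  define f where "f n x = (\<Sum>k<n. s x ^ k)" for n x
  define F where "F n x = (\<Sum>k<n. real k * s x ^ (k - 1)) *\<^sub>R S x" for n x
  have grf: "is_weak_grad D (f n) (F n)" for n
  proof (induction n)
    case 0
    then show ?case using one[of 0] by (simp add: f_def[abs_def] F_def[abs_def])
  next
    case (Suc n)
    from is_weak_grad_add[OF D this pw[of n]] show ?case
      by (simp add: f_def[abs_def] F_def[abs_def] scaleR_add_left)
  qed
  have sm: "summable (\<lambda>k. real k * q ^ (k - 1))"
    using termdiff_converges[of q 1 "\<lambda>_. 1"] q by (subst summable_Suc_iff[symmetric]) (auto simp: diffs_def intro: summable_geometric)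
  have sm0: "summable (\<lambda>k. q ^ k)" using q by (intro summable_geometric) auto
  \<comment> \<open>One constant for the partial sums and for their gradients, since the limit lemma
    takes a single bound.\<close>
  define C where "C = (\<Sum>k. q ^ k) + (\<Sum>k. real k * q ^ (k - 1)) * (\<bar>N\<bar> / M)"
  have C: "(\<Sum>k. q ^ k) \<le> C" "(\<Sum>k. real k * q ^ (k - 1)) * (\<bar>N\<bar> / M) \<le> C"
    unfolding C_def using suminf_nonneg[OF sm0] suminf_nonneg[OF sm] q M0 by auto
  have bf: "AE x in lebesgue_on D. norm (f n x) \<le> C" for n
    using sq
  proof eventually_elim
    case (elim x)
    have "norm (f n x) \<le> (\<Sum>k<n. q ^ k)"
      unfolding f_def by (rule sum_norm_le) (use elim in \<open>auto intro: power_mono\<close>)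
    also have "\<dots> \<le> (\<Sum>k. q ^ k)" by (rule sum_le_suminf[OF sm0]) (use q in auto)
    finally show ?case using C(1) by simp
  qed
  have bF: "AE x in lebesgue_on D. norm (F n x) \<le> C" for n
    using sq MS
  proof eventually_elim
    case (elim x)
    have "norm (\<Sum>k<n. real k * s x ^ (k - 1)) \<le> (\<Sum>k<n. real k * q ^ (k - 1))"
      by (rule sum_norm_le) (use elim in \<open>auto intro!: mult_left_mono power_mono simp: abs_mult\<close>)
    also have "\<dots> \<le> (\<Sum>k. real k * q ^ (k - 1))" by (rule sum_le_suminf[OF sm]) (use q in auto)
    finally have "norm (F n x) \<le> (\<Sum>k. real k * q ^ (k - 1)) * (\<bar>N\<bar> / M)"
      unfolding F_def norm_scaleR using elim(2) by (intro mult_mono) (use suminf_nonneg[OF sm] q in auto)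
    then show ?case using C(2) by simp
  qed
  have limf: "AE x in lebesgue_on D. (\<lambda>n. f n x) \<longlonglongrightarrow> M * inverse (a x)"
    using sq pos
  proof eventually_elim
    case (elim x)
    have "(\<lambda>k. s x ^ k) sums (1 / (1 - s x))" by (rule geometric_sums) (use elim q in auto)
    then show ?case using elim M0 unfolding sums_def f_def by (simp add: s_def field_simps)
  qed
  have limF: "AE x in lebesgue_on D. (\<lambda>n. F n x) \<longlonglongrightarrow> (M * inverse (a x))\<^sup>2 *\<^sub>R S x"
    using sq pos
  proof eventually_elim
    case (elim x)
    have sx: "norm (s x) < 1" using elim q by auto
    have "(\<lambda>k. real (Suc k) * s x ^ k) sums (1 / (1 - s x)\<^sup>2)" by (rule geometric_deriv_sums[OF sx])
    then have "(\<lambda>k. real k * s x ^ (k - 1)) sums (1 / (1 - s x)\<^sup>2)"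
      using sums_Suc_iff[of "\<lambda>k. real k * s x ^ (k - 1)" "1 / (1 - s x)\<^sup>2"] by simp
    moreover have "1 / (1 - s x)\<^sup>2 = (M * inverse (a x))\<^sup>2"
      using elim M0 by (simp add: s_def field_simps)
    ultimately show ?case unfolding sums_def F_def by (auto intro!: tendsto_intros)
  qed
  have l1: "loc_integrable D (\<lambda>x. inverse (a x))"
    unfolding loc_integrable_def
  proof (intro allI impI)
    fix K assume K: "compact K \<and> K \<subseteq> D"
    have Kl: "K \<in> sets lebesgue" using K compact_in_lebesgue by blast
    have i: "integrable (lebesgue_on K) a" using la(1) K unfolding loc_integrable_def by blast
    have i1: "integrable (lebesgue_on K) (\<lambda>x. 1::real)"
      using continuous_imp_loc_integrable[of "\<lambda>x::'a. 1::real" D] K unfolding loc_integrable_def by auto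
    show "integrable (lebesgue_on K) (\<lambda>x. inverse (a x))"
    proof (rule Bochner_Integration.integrable_bound[OF integrable_mult_right[OF i1, of "inverse c"]])
      show "(\<lambda>x. inverse (a x)) \<in> borel_measurable (lebesgue_on K)" using borel_measurable_integrable[OF i] by measurable
      show "AE x in lebesgue_on K. norm (inverse (a x)) \<le> norm (inverse c * 1)"
        using AE_lebesgue_on_mono[OF open_in_lebesgue[OF D] Kl conjunct2[OF K] ca]
        by eventually_elim (use c in \<open>auto intro: le_imp_inverse_le\<close>)
    qed
  qed
  have ib: "AE x in lebesgue_on D. norm (M * inverse (a x)) \<le> M * inverse c"
    using ca by eventually_elim (use c M0 in \<open>auto intro: le_imp_inverse_le simp: abs_mult\<close>)
  have lS: "loc_integrable D S" using grs unfolding is_weak_grad_def by auto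
  have l1': "loc_integrable D (\<lambda>x. M * inverse (a x))" using loc_integrable_scaleR[OF l1, of M] by simp
  have l2: "loc_integrable D (\<lambda>x. (M * inverse (a x))\<^sup>2 *\<^sub>R S x)"
    using loc_integrable_bounded_bilinear[OF l1' loc_integrable_bounded_bilinear[OF l1' lS D ib bounded_bilinear_scaleR] D ib bounded_bilinear_scaleR]
    by (simp add: power2_eq_square)
  have "is_weak_grad D (\<lambda>x. M * inverse (a x)) (\<lambda>x. (M * inverse (a x))\<^sup>2 *\<^sub>R S x)"
    by (rule is_weak_grad_limit[OF D grf l1' l2 limf limF bf bF])
  \<comment> \<open>As \<open>S\<close> is \<open>- G / M\<close>, the limit gradient is
    \<open>- M G / a\<^sup>2\<close>; dividing by \<open>M\<close> gives that of
    \<open>1 / a\<close>.\<close>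
  from is_weak_grad_scale[OF D this, of "inverse M"] show ?thesis
    using M0 by (simp add: S_def power2_eq_square field_simps)
qed

subsection \<open>The spaces \<open>L\<^sup>2\<close> and \<open>V\<close>\<close>

lemma mem_Lp2_iff:
  "f \<in> Lp_space D 2 \<longleftrightarrow> f \<in> borel_measurable (lebesgue_on D) \<and> integrable (lebesgue_on D) (\<lambda>x. (norm (f x))\<^sup>2)"
  unfolding Lp_space_def by (simp add: powr_numeral)

lemma Lp2_norm_sqrt: "Lp_norm D 2 f = sqrt (LINT x|lebesgue_on D. (norm (f x))\<^sup>2)"
  unfolding Lp_norm_def by (simp add: powr_numeral powr_half_sqrt)

lemma Lp2_norm_nonneg: "Lp_norm D 2 f \<ge> 0" unfolding Lp2_norm_sqrt by simp

lemma Lp2_norm_power2: "(Lp_norm D 2 f)\<^sup>2 = (LINT x|lebesgue_on D. (norm (f x))\<^sup>2)"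
  unfolding Lp2_norm_sqrt by simp

text \<open>Evaluate at the minimiser \<open>- m / a\<close>. It yields the Cauchy-Schwarz
  inequality and, with \<open>b = 0\<close>, the vanishing of a first variation.\<close>

lemma quadratic_nonneg_discriminant:
  fixes a b m :: real
  assumes "\<And>t. a * t\<^sup>2 + 2 * m * t + b \<ge> 0" "a \<ge> 0"
  shows "m\<^sup>2 \<le> a * b"
proof (cases "a = 0")
  case True
  have "m = 0"
  proof (rule ccontr)
    assume "m \<noteq> 0"
    \<comment> \<open>At this point the affine function \<open>2 * m * t + b\<close> equals
      -1.\<close>
    then show False using assms(1)[of "- (b + 1) / (2 * m)"] True by simp
  qed
  then show ?thesis using True by simp
next
  case False
  then have "a > 0" using assms(2) by simp
  have "0 \<le> a * (- m / a)\<^sup>2 + 2 * m * (- m / a) + b" by (rule assms(1))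
  also have "\<dots> = b - m\<^sup>2 / a" using \<open>a > 0\<close> by (simp add: power2_eq_square field_simps)
  finally show ?thesis using \<open>a > 0\<close> by (simp add: field_simps)
qed

lemma Lp2_integrable_prod:
  fixes f :: "'a::euclidean_space \<Rightarrow> 'b::euclidean_space" and g :: "'a \<Rightarrow> 'c::euclidean_space"
  assumes "f \<in> Lp_space D 2" "g \<in> Lp_space D 2"
  shows "integrable (lebesgue_on D) (\<lambda>x. norm (f x) * norm (g x))"
proof (rule Bochner_Integration.integrable_bound[of _ "\<lambda>x. (norm (f x))\<^sup>2 + (norm (g x))\<^sup>2"])
  show "AE x in lebesgue_on D. norm (norm (f x) * norm (g x)) \<le> norm ((norm (f x))\<^sup>2 + (norm (g x))\<^sup>2)"
  proof (rule AE_I2)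
    fix x
    have "0 \<le> (norm (f x) - norm (g x))\<^sup>2" by simp
    then have "2 * (norm (f x) * norm (g x)) \<le> (norm (f x))\<^sup>2 + (norm (g x))\<^sup>2"
      by (simp add: power2_diff)
    then show "norm (norm (f x) * norm (g x)) \<le> norm ((norm (f x))\<^sup>2 + (norm (g x))\<^sup>2)"
    proof -
      assume "2 * (norm (f x) * norm (g x)) \<le> (norm (f x))\<^sup>2 + (norm (g x))\<^sup>2"
      moreover have "0 \<le> norm (f x) * norm (g x)" by simp
      ultimately have "norm (f x) * norm (g x) \<le> (norm (f x))\<^sup>2 + (norm (g x))\<^sup>2" by linarith
      then show ?thesis by simp
    qed
  qed
qed (use assms in \<open>auto simp: mem_Lp2_iff\<close>)

lemma Lp2_Cauchy_Schwarz:
  fixes f :: "'a::euclidean_space \<Rightarrow> 'b::euclidean_space" and g :: "'a \<Rightarrow> 'c::euclidean_space"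
  assumes f: "f \<in> Lp_space D 2" and g: "g \<in> Lp_space D 2"
  shows "(LINT x|lebesgue_on D. norm (f x) * norm (g x)) \<le> Lp_norm D 2 f * Lp_norm D 2 g"
proof -
  let ?m = "LINT x|lebesgue_on D. norm (f x) * norm (g x)"
  let ?a = "LINT x|lebesgue_on D. (norm (f x))\<^sup>2" and ?b = "LINT x|lebesgue_on D. (norm (g x))\<^sup>2"
  have "?m\<^sup>2 \<le> ?a * ?b"
  proof (rule quadratic_nonneg_discriminant)
    fix t
    have i: "integrable (lebesgue_on D) (\<lambda>x. (norm (f x))\<^sup>2)" "integrable (lebesgue_on D) (\<lambda>x. (norm (g x))\<^sup>2)"
      using f g by (auto simp: mem_Lp2_iff)
    have "0 \<le> (LINT x|lebesgue_on D. (t * norm (f x) + norm (g x))\<^sup>2)" by simp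
    also have "\<dots> = (LINT x|lebesgue_on D. t\<^sup>2 * (norm (f x))\<^sup>2 + 2 * t * (norm (f x) * norm (g x)) + (norm (g x))\<^sup>2)"
      by (intro Bochner_Integration.integral_cong refl) (simp add: power2_eq_square algebra_simps)
    also have "\<dots> = ?a * t\<^sup>2 + 2 * ?m * t + ?b"
      using i Lp2_integrable_prod[OF f g] by (simp add: mult_ac)
    finally show "0 \<le> ?a * t\<^sup>2 + 2 * ?m * t + ?b" .
  qed simp
  then have "?m \<le> sqrt (?a * ?b)" by (rule real_le_rsqrt)
  then show ?thesis by (simp add: Lp2_norm_sqrt real_sqrt_mult)
qed

lemma Lp2_add:
  fixes f g :: "'a::euclidean_space \<Rightarrow> 'b::euclidean_space"
  assumes f: "f \<in> Lp_space D 2" and g: "g \<in> Lp_space D 2"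
  shows "(\<lambda>x. f x + g x) \<in> Lp_space D 2"
    and "Lp_norm D 2 (\<lambda>x. f x + g x) \<le> Lp_norm D 2 f + Lp_norm D 2 g"
proof -
  have m: "f \<in> borel_measurable (lebesgue_on D)" "g \<in> borel_measurable (lebesgue_on D)"
    and i: "integrable (lebesgue_on D) (\<lambda>x. (norm (f x))\<^sup>2)" "integrable (lebesgue_on D) (\<lambda>x. (norm (g x))\<^sup>2)"
    using f g by (auto simp: mem_Lp2_iff)
  have pt: "(norm (f x + g x))\<^sup>2 \<le> (norm (f x))\<^sup>2 + 2 * (norm (f x) * norm (g x)) + (norm (g x))\<^sup>2" for x
    using power_mono[OF norm_triangle_ineq[of "f x" "g x"], of 2] by (simp add: power2_sum)
  have i': "integrable (lebesgue_on D) (\<lambda>x. (norm (f x))\<^sup>2 + 2 * (norm (f x) * norm (g x)) + (norm (g x))\<^sup>2)"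
    using i Lp2_integrable_prod[OF f g] by auto
  have iS: "integrable (lebesgue_on D) (\<lambda>x. (norm (f x + g x))\<^sup>2)"
  proof (rule Bochner_Integration.integrable_bound[OF i'])
    show "AE x in lebesgue_on D. norm ((norm (f x + g x))\<^sup>2)
      \<le> norm ((norm (f x))\<^sup>2 + 2 * (norm (f x) * norm (g x)) + (norm (g x))\<^sup>2)"
      using pt by (auto intro!: order.trans[OF _ abs_ge_self])
  qed (use m in measurable)
  then show "(\<lambda>x. f x + g x) \<in> Lp_space D 2" using m by (auto simp: mem_Lp2_iff)
  have "(LINT x|lebesgue_on D. (norm (f x + g x))\<^sup>2) \<le>
     (LINT x|lebesgue_on D. (norm (f x))\<^sup>2 + 2 * (norm (f x) * norm (g x)) + (norm (g x))\<^sup>2)"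
    by (rule integral_mono[OF iS i']) (rule pt)
  also have "\<dots> = (LINT x|lebesgue_on D. (norm (f x))\<^sup>2) + 2 * (LINT x|lebesgue_on D. norm (f x) * norm (g x)) + (LINT x|lebesgue_on D. (norm (g x))\<^sup>2)"
    using i Lp2_integrable_prod[OF f g] by simp
  also have "\<dots> \<le> (Lp_norm D 2 f)\<^sup>2 + 2 * (Lp_norm D 2 f * Lp_norm D 2 g) + (Lp_norm D 2 g)\<^sup>2"
    using Lp2_Cauchy_Schwarz[OF f g] by (simp add: Lp2_norm_power2)
  also have "\<dots> = (Lp_norm D 2 f + Lp_norm D 2 g)\<^sup>2" by (simp add: power2_sum)
  finally have "(Lp_norm D 2 (\<lambda>x. f x + g x))\<^sup>2 \<le> (Lp_norm D 2 f + Lp_norm D 2 g)\<^sup>2"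
    by (simp add: Lp2_norm_power2)
  then show "Lp_norm D 2 (\<lambda>x. f x + g x) \<le> Lp_norm D 2 f + Lp_norm D 2 g"
    by (rule power2_le_imp_le) (simp add: Lp2_norm_nonneg)
qed

lemma Lp2_scale:
  fixes f :: "'a::euclidean_space \<Rightarrow> 'b::euclidean_space"
  assumes f: "f \<in> Lp_space D 2"
  shows "(\<lambda>x. c *\<^sub>R f x) \<in> Lp_space D 2"
    and "Lp_norm D 2 (\<lambda>x. c *\<^sub>R f x) = \<bar>c\<bar> * Lp_norm D 2 f"
  using f by (auto simp: mem_Lp2_iff Lp2_norm_sqrt power_mult_distrib real_sqrt_mult)

lemma Lp2_diff:
  fixes f g :: "'a::euclidean_space \<Rightarrow> 'b::euclidean_space"
  assumes f: "f \<in> Lp_space D 2" and g: "g \<in> Lp_space D 2"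
  shows "(\<lambda>x. f x - g x) \<in> Lp_space D 2"
    and "Lp_norm D 2 (\<lambda>x. f x - g x) \<le> Lp_norm D 2 f + Lp_norm D 2 g"
  using Lp2_add[OF f Lp2_scale(1)[OF g, of "-1"]] Lp2_scale(2)[OF g, of "-1"] by auto

lemma Lp2_norm_cong_AE:
  fixes f g :: "'a::euclidean_space \<Rightarrow> 'b::euclidean_space"
  assumes "f \<in> borel_measurable (lebesgue_on D)" "g \<in> borel_measurable (lebesgue_on D)"
    and "AE x in lebesgue_on D. f x = g x"
  shows "Lp_norm D 2 f = Lp_norm D 2 g"
proof -
  have "(LINT x|lebesgue_on D. (norm (f x))\<^sup>2) = (LINT x|lebesgue_on D. (norm (g x))\<^sup>2)"
    by (rule integral_cong_AE) (use assms in \<open>auto elim: eventually_mono\<close>)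
  then show ?thesis by (simp add: Lp2_norm_sqrt)
qed

lemma Lp2_cong_AE:
  fixes f g :: "'a::euclidean_space \<Rightarrow> 'b::euclidean_space"
  assumes f: "f \<in> Lp_space D 2" and g: "g \<in> borel_measurable (lebesgue_on D)"
    and ae: "AE x in lebesgue_on D. f x = g x"
  shows "g \<in> Lp_space D 2"
proof -
  have "integrable (lebesgue_on D) (\<lambda>x. (norm (f x))\<^sup>2) \<longleftrightarrow> integrable (lebesgue_on D) (\<lambda>x. (norm (g x))\<^sup>2)"
    by (rule integrable_cong_AE) (use f g ae in \<open>auto simp: mem_Lp2_iff elim: eventually_mono\<close>)
  then show ?thesis using f g by (auto simp: mem_Lp2_iff)
qed

text \<open>Local integrability speaks only of compact subsets; along a compact exhaustion the
  restrictions converge pointwise on all of \<open>D\<close>.\<close>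

lemma loc_integrable_measurable:
  fixes f :: "'a::euclidean_space \<Rightarrow> 'b::euclidean_space"
  assumes D: "open D" and f: "loc_integrable D f"
  shows "f \<in> borel_measurable (lebesgue_on D)"
proof -
  obtain C :: "nat \<Rightarrow> 'a set" where C: "\<And>n. compact (C n)" "\<And>n. C n \<subseteq> D" "\<And>n. C n \<subseteq> interior (C (Suc n))" "\<Union>(range C) = D"
    by (rule open_Union_compact_subsets[OF D]) blast
  have mono: "C n \<subseteq> C m" if "n \<le> m" for n m
    by (rule lift_Suc_mono_le[of C, OF _ that]) (use C(3) interior_subset in blast)
  show ?thesis
  proof (rule borel_measurable_LIMSEQ_metric)
    show "(\<lambda>x. indicator (C n) x *\<^sub>R f x) \<in> borel_measurable (lebesgue_on D)" for n
      using measurable_restrict_space1[OF borel_measurable_integrable[OF loc_integrableD[OF f C(1,2)]]] .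
    fix x assume "x \<in> space (lebesgue_on D)"
    then have "x \<in> D" by simp
    then obtain n where n: "x \<in> C n" using C(4) by blast
    have "eventually (\<lambda>m. f x = indicator (C m) x *\<^sub>R f x) sequentially"
      using eventually_ge_at_top[of n] by eventually_elim (use n mono in \<open>auto simp: indicator_def\<close>)
    then show "(\<lambda>m. indicator (C m) x *\<^sub>R f x) \<longlonglongrightarrow> f x"
      by (rule Lim_transform_eventually[OF tendsto_const])
  qed
qed

section \<open>Completeness of L^2 over a bounded domain\<close>

locale bounded_open_domain =
  fixes D :: "'a::euclidean_space set"
  assumes open_D: "open D" and bounded_D: "bounded D"
begin

lemma finite_measure_D: "finite_measure (lebesgue_on D)"
proof
  show "emeasure (lebesgue_on D) (space (lebesgue_on D)) \<noteq> \<infinity>"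
    using fmeasurableD2[OF lmeasurable_open[OF bounded_D open_D]] open_in_lebesgue[OF open_D]
    by (subst emeasure_restrict_space) auto
qed

sublocale mD: finite_measure "lebesgue_on D" by (rule finite_measure_D)

lemma D_in_lebesgue [simp]: "D \<in> sets lebesgue" by (rule open_in_lebesgue[OF open_D])

lemma Lp2_integrable:
  fixes f :: "'a \<Rightarrow> 'b::euclidean_space"
  assumes "f \<in> Lp_space D 2"
  shows "integrable (lebesgue_on D) f" "(LINT x|lebesgue_on D. norm (f x)) \<le> Lp_norm D 2 f * sqrt (measure (lebesgue_on D) D)"
proof -
  have 1: "(\<lambda>x. 1::real) \<in> Lp_space D 2" by (simp add: mem_Lp2_iff)
  have m: "f \<in> borel_measurable (lebesgue_on D)" using assms by (simp add: mem_Lp2_iff)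
  show "integrable (lebesgue_on D) f"
    using Lp2_integrable_prod[OF assms 1] m by (simp add: integrable_norm_iff)
  show "(LINT x|lebesgue_on D. norm (f x)) \<le> Lp_norm D 2 f * sqrt (measure (lebesgue_on D) D)"
    using Lp2_Cauchy_Schwarz[OF assms 1] by (simp add: Lp2_norm_sqrt)
qed

lemma integrable_imp_loc_integrable:
  fixes f :: "'a \<Rightarrow> 'b::euclidean_space"
  assumes "integrable (lebesgue_on D) f" shows "loc_integrable D f"
  unfolding loc_integrable_def
proof (intro allI impI)
  fix K assume K: "compact K \<and> K \<subseteq> D"
  have Kl: "K \<in> sets lebesgue" using K compact_in_lebesgue by blast
  have "integrable lebesgue (\<lambda>x. indicator D x *\<^sub>R f x)" using assms by (simp add: integrable_restrict_space)
  then have "integrable lebesgue (\<lambda>x. indicator K x *\<^sub>R (indicator D x *\<^sub>R f x))"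
    by (rule integrable_mult_indicator[OF Kl])
  moreover have "(\<lambda>x. indicator K x *\<^sub>R (indicator D x *\<^sub>R f x)) = (\<lambda>x. indicator K x *\<^sub>R f x)"
    using K by (auto simp: indicator_def fun_eq_iff)
  ultimately show "integrable (lebesgue_on K) f" using Kl by (simp add: integrable_restrict_space)
qed

lemma Lp2_loc_integrable: "f \<in> Lp_space D 2 \<Longrightarrow> loc_integrable D (f :: 'a \<Rightarrow> 'b::euclidean_space)"
  by (intro integrable_imp_loc_integrable Lp2_integrable)

text \<open>Finite measure turns the L^2 bounds on the increments into L^1 bounds. Their sum is
  finite, so by monotone convergence the increments are absolutely summable at almost every
  point.\<close>

lemma Lp2_AE_limit:
  fixes f :: "nat \<Rightarrow> 'a \<Rightarrow> 'b::euclidean_space"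
  assumes f: "\<And>n. f n \<in> Lp_space D 2"
    and fast: "\<And>n. Lp_norm D 2 (\<lambda>x. f (Suc n) x - f n x) \<le> (1 / 2) ^ n"
  obtains g where "g \<in> borel_measurable (lebesgue_on D)" "AE x in lebesgue_on D. (\<lambda>n. f n x) \<longlonglongrightarrow> g x"
proof -
  have m: "f n \<in> borel_measurable (lebesgue_on D)" for n using f by (simp add: mem_Lp2_iff)
  define d where "d n x = norm (f (Suc n) x - f n x)" for n x
  have dm[measurable]: "d n \<in> borel_measurable (lebesgue_on D)" for n unfolding d_def[abs_def] using m by measurable
  let ?c = "sqrt (measure (lebesgue_on D) D)"
  have df: "(\<lambda>x. f (Suc n) x - f n x) \<in> Lp_space D 2" for n by (rule Lp2_diff[OF f f])
  have di: "integrable (lebesgue_on D) (d n)" for n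
    unfolding d_def[abs_def] by (intro integrable_norm Lp2_integrable df)
  have dle: "(LINT x|lebesgue_on D. d n x) \<le> (1/2) ^ n * ?c" for n
    unfolding d_def using Lp2_integrable(2)[OF df[of n]] mult_right_mono[OF fast[of n], of ?c] by simp
  have sm: "summable (\<lambda>n. (1/2) ^ n * ?c)" by (intro summable_mult2 summable_geometric) simp
  have "(\<integral>\<^sup>+ x. (\<Sum>n. ennreal (d n x)) \<partial>lebesgue_on D) = (\<Sum>n. \<integral>\<^sup>+ x. ennreal (d n x) \<partial>lebesgue_on D)"
    by (intro nn_integral_suminf) measurable
  also have "\<dots> \<le> (\<Sum>n. ennreal ((1/2) ^ n * ?c))"
  proof (intro suminf_le summableI)
    fix n
    have "(\<integral>\<^sup>+ x. ennreal (d n x) \<partial>lebesgue_on D) = ennreal (LINT x|lebesgue_on D. d n x)"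
      by (rule nn_integral_eq_integral[OF di]) (simp add: d_def)
    then show "(\<integral>\<^sup>+ x. ennreal (d n x) \<partial>lebesgue_on D) \<le> ennreal ((1/2) ^ n * ?c)"
      using dle[of n] by (simp add: ennreal_leI)
  qed
  also have "\<dots> = ennreal (\<Sum>n. (1/2) ^ n * ?c)" by (rule suminf_ennreal2[OF _ sm]) simp
  also have "\<dots> < \<infinity>" by simp
  finally have "(\<integral>\<^sup>+ x. (\<Sum>n. ennreal (d n x)) \<partial>lebesgue_on D) \<noteq> \<infinity>" by simp
  then have "AE x in lebesgue_on D. (\<Sum>n. ennreal (d n x)) \<noteq> \<infinity>"
    by (intro nn_integral_noteq_infinite) auto
  then have conv: "AE x in lebesgue_on D. convergent (\<lambda>n. f n x)"
  proof eventually_elim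
    case (elim x)
    then have "summable (\<lambda>n. d n x)"
      by (intro summable_suminf_not_top) (auto simp: d_def)
    then have "summable (\<lambda>n. f (Suc n) x - f n x)" unfolding d_def by (rule summable_norm_cancel)
    then have "convergent (\<lambda>n. \<Sum>k<n. f (Suc k) x - f k x)" by (simp add: summable_iff_convergent)
    then have "convergent (\<lambda>n. f n x - f 0 x)" by (simp add: sum_lessThan_telescope[of "\<lambda>k. f k x"])
    then have "convergent (\<lambda>n. (f n x - f 0 x) + f 0 x)" by (rule convergent_add[OF _ convergent_const])
    then show ?case by simp
  qed
  define g where "g x = lim (\<lambda>n. f n x)" for x
  have "g \<in> borel_measurable (lebesgue_on D)" unfolding g_def[abs_def] by (rule borel_measurable_lim_metric[OF m])
  moreover have "AE x in lebesgue_on D. (\<lambda>n. f n x) \<longlonglongrightarrow> g x"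
    using conv by eventually_elim (simp add: g_def convergent_LIMSEQ_iff)
  ultimately show thesis using that by blast
qed

text \<open>Fatou's lemma for the squares. The bound is required only from \<open>N\<close> on,
  which is the form in which a Cauchy condition supplies it.\<close>

lemma Lp2_Fatou:
  fixes f :: "nat \<Rightarrow> 'a \<Rightarrow> 'b::euclidean_space"
  assumes f: "\<And>n. f n \<in> Lp_space D 2" and g: "g \<in> borel_measurable (lebesgue_on D)"
    and lim: "AE x in lebesgue_on D. (\<lambda>n. f n x) \<longlonglongrightarrow> g x"
    and bd: "\<And>n. n \<ge> N \<Longrightarrow> Lp_norm D 2 (f n) \<le> e"
  shows "g \<in> Lp_space D 2" "Lp_norm D 2 g \<le> e"
proof -
  have e0: "e \<ge> 0" using bd[of N] Lp2_norm_nonneg[of D "f N"] by simp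
  have m: "f n \<in> borel_measurable (lebesgue_on D)" for n using f by (simp add: mem_Lp2_iff)
  have nn: "(\<integral>\<^sup>+ x. ennreal ((norm (f n x))\<^sup>2) \<partial>lebesgue_on D) = ennreal ((Lp_norm D 2 (f n))\<^sup>2)" for n
    unfolding Lp2_norm_power2 using f[of n] by (intro nn_integral_eq_integral) (auto simp: mem_Lp2_iff)
  have "(\<integral>\<^sup>+ x. ennreal ((norm (g x))\<^sup>2) \<partial>lebesgue_on D) = (\<integral>\<^sup>+ x. liminf (\<lambda>n. ennreal ((norm (f n x))\<^sup>2)) \<partial>lebesgue_on D)"
  proof (rule nn_integral_cong_AE)
    show "AE x in lebesgue_on D. ennreal ((norm (g x))\<^sup>2) = liminf (\<lambda>n. ennreal ((norm (f n x))\<^sup>2))"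
      using lim
    proof eventually_elim
      case (elim x)
      have "(\<lambda>n. ennreal ((norm (f n x))\<^sup>2)) \<longlonglongrightarrow> ennreal ((norm (g x))\<^sup>2)"
        by (intro tendsto_ennrealI tendsto_power tendsto_norm elim)
      then show ?case using lim_imp_Liminf[OF trivial_limit_sequentially] by metis
    qed
  qed
  also have "\<dots> \<le> liminf (\<lambda>n. \<integral>\<^sup>+ x. ennreal ((norm (f n x))\<^sup>2) \<partial>lebesgue_on D)"
    by (rule nn_integral_liminf) (use m in measurable)
  also have "\<dots> \<le> ennreal (e\<^sup>2)"
  proof (rule Liminf_le)
    have "eventually (\<lambda>n. n \<ge> N) sequentially" by (rule eventually_ge_at_top)
    then show "\<forall>\<^sub>F n in sequentially. (\<integral>\<^sup>+ x. ennreal ((norm (f n x))\<^sup>2) \<partial>lebesgue_on D) \<le> ennreal (e\<^sup>2)"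
      by eventually_elim (use bd nn Lp2_norm_nonneg in \<open>auto intro!: ennreal_leI power_mono\<close>)
  qed simp
  finally have le: "(\<integral>\<^sup>+ x. ennreal ((norm (g x))\<^sup>2) \<partial>lebesgue_on D) \<le> ennreal (e\<^sup>2)" .
  have i: "integrable (lebesgue_on D) (\<lambda>x. (norm (g x))\<^sup>2)"
    by (rule integrableI_bounded) (use g le in \<open>auto simp: top_unique less_top[symmetric]\<close>)
  then show "g \<in> Lp_space D 2" using g by (simp add: mem_Lp2_iff)
  have "ennreal ((Lp_norm D 2 g)\<^sup>2) \<le> ennreal (e\<^sup>2)"
    unfolding Lp2_norm_power2 using le nn_integral_eq_integral[OF i] by simp
  then have "(Lp_norm D 2 g)\<^sup>2 \<le> e\<^sup>2" by (simp add: ennreal_le_iff)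
  then show "Lp_norm D 2 g \<le> e" using e0 by (rule power2_le_imp_le)
qed

lemma Lp2_complete:
  fixes f :: "nat \<Rightarrow> 'a \<Rightarrow> 'b::euclidean_space"
  assumes f: "\<And>n. f n \<in> Lp_space D 2"
    and cauchy: "\<And>e. e > 0 \<Longrightarrow> \<exists>N. \<forall>m\<ge>N. \<forall>n\<ge>N. Lp_norm D 2 (\<lambda>x. f m x - f n x) < e"
  obtains g where "g \<in> Lp_space D 2" "(\<lambda>n. Lp_norm D 2 (\<lambda>x. f n x - g x)) \<longlonglongrightarrow> 0"
proof -
  have "\<forall>k. \<exists>N. \<forall>m\<ge>N. \<forall>n\<ge>N. Lp_norm D 2 (\<lambda>x. f m x - f n x) < (1/2) ^ k"
    using cauchy by simp
  from choice[OF this] obtain N where N: "\<And>k m n. m \<ge> N k \<Longrightarrow> n \<ge> N k \<Longrightarrow> Lp_norm D 2 (\<lambda>x. f m x - f n x) < (1/2) ^ k"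
    by auto
  \<comment> \<open>Summing the thresholds makes \<open>r k\<close> exceed all earlier ones without
    assuming \<open>N\<close> monotone; the added \<open>k\<close> drives \<open>r k\<close> to
    infinity.\<close>
  define r where "r k = (\<Sum>i\<le>k. N i) + k" for k
  have rN: "r k \<ge> N k" "r (Suc k) \<ge> N k" "r k \<ge> k" for k
  proof -
    have "N k \<le> (\<Sum>i\<le>k. N i)" by (rule member_le_sum) auto
    then show "r k \<ge> N k" "r (Suc k) \<ge> N k" "r k \<ge> k" by (auto simp: r_def)
  qed
  have fast: "Lp_norm D 2 (\<lambda>x. f (r (Suc k)) x - f (r k) x) \<le> (1/2) ^ k" for k
    using N[OF rN(2) rN(1), of k] by simp
  obtain g where g: "g \<in> borel_measurable (lebesgue_on D)" "AE x in lebesgue_on D. (\<lambda>k. f (r k) x) \<longlonglongrightarrow> g x"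
    using Lp2_AE_limit[of "\<lambda>k. f (r k)", OF f fast] by blast
  \<comment> \<open>Fatou is applied to the differences with the subsequence, for a fixed
    \<open>n\<close> of the original sequence; the whole sequence therefore converges, not only the
    subsequence.\<close>
  have key: "(\<lambda>x. f n x - g x) \<in> Lp_space D 2 \<and> Lp_norm D 2 (\<lambda>x. f n x - g x) \<le> (1/2) ^ k" if "n \<ge> N k" for n k
  proof -
    have l: "AE x in lebesgue_on D. (\<lambda>j. f n x - f (r j) x) \<longlonglongrightarrow> f n x - g x"
      using g(2) by eventually_elim (intro tendsto_intros)
    have m: "(\<lambda>x. f n x - g x) \<in> borel_measurable (lebesgue_on D)" using f[of n] g(1) by (auto simp: mem_Lp2_iff)
    have "Lp_norm D 2 (\<lambda>x. f n x - f (r j) x) \<le> (1/2) ^ k" if "j \<ge> N k" for j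
      using N[OF \<open>n \<ge> N k\<close>, of "r j"] rN(3)[of j] that by simp
    then show ?thesis using Lp2_Fatou[of "\<lambda>j x. f n x - f (r j) x", OF Lp2_diff(1)[OF f f] m l] by blast
  qed
  have "g \<in> Lp_space D 2"
    using Lp2_diff(1)[OF f conjunct1[OF key[of 0 "N 0"]], of "N 0"] by simp
  moreover have "(\<lambda>n. Lp_norm D 2 (\<lambda>x. f n x - g x)) \<longlonglongrightarrow> 0"
  proof (rule LIMSEQ_I)
    fix e :: real assume "e > 0"
    then obtain k where k: "(1/2) ^ k < e" using real_arch_pow_inv[of e "1/2"] by auto
    show "\<exists>no. \<forall>n\<ge>no. norm (Lp_norm D 2 (\<lambda>x. f n x - g x) - 0) < e"
    proof (intro exI[of _ "N k"] allI impI)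
      fix n assume "n \<ge> N k"
      then show "norm (Lp_norm D 2 (\<lambda>x. f n x - g x) - 0) < e"
        using key[of k n] k Lp2_norm_nonneg[of D "\<lambda>x. f n x - g x"] by simp
    qed
  qed
  ultimately show thesis using that by blast
qed

end

lemma LINT_norm_le:
  fixes f :: "'a \<Rightarrow> 'b::{banach, second_countable_topology}"
  assumes "integrable M f" "integrable M g" "\<And>x. norm (f x) \<le> g x"
  shows "norm (integral\<^sup>L M f) \<le> integral\<^sup>L M g"
  using order.trans[OF integral_norm_bound integral_mono[OF integrable_norm[OF assms(1)] assms(2,3)]] .

section \<open>The space V: density of test functions, Poincare inequality, completeness\<close>

context bounded_open_domain
begin

lemma H1_weak_grad:
  assumes "is_weak_grad D v G" "G \<in> Lp_space D 2"
  shows "is_weak_grad D v (weak_grad D v)" "weak_grad D v \<in> Lp_space D 2"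
    "AE x in lebesgue_on D. weak_grad D v x = G x" "Lp_norm D 2 (weak_grad D v) = Lp_norm D 2 G"
proof -
  show 1: "is_weak_grad D v (weak_grad D v)" by (rule weak_grad_is_weak_grad[OF assms(1)])
  show 2: "AE x in lebesgue_on D. weak_grad D v x = G x" by (rule weak_grad_AE_eq[OF open_D assms(1)])
  have m: "weak_grad D v \<in> borel_measurable (lebesgue_on D)" "G \<in> borel_measurable (lebesgue_on D)"
    using 1 assms loc_integrable_measurable[OF open_D] unfolding is_weak_grad_def by auto
  show "weak_grad D v \<in> Lp_space D 2"
    by (rule Lp2_cong_AE[OF assms(2) m(1)]) (use 2 in \<open>auto elim: eventually_mono\<close>)
  show "Lp_norm D 2 (weak_grad D v) = Lp_norm D 2 G" by (rule Lp2_norm_cong_AE[OF m 2])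
qed

lemma test_functions_Lp2:
  assumes "\<phi> \<in> test_functions D"
  shows "\<phi> \<in> Lp_space D 2" "grad \<phi> \<in> Lp_space D 2"
proof -
  obtain K where K: "compact K" "K \<subseteq> D" "\<And>x. x \<notin> K \<Longrightarrow> \<phi> x = 0"
    using test_functions_supp[OF assms] by blast
  note c = test_functionsD(4)[OF assms] test_functions_grad_continuous[OF assms]
  note gK = grad_outside[OF assms compact_imp_closed[OF K(1)] K(3)]
  have i1: "integrable lborel (\<lambda>x. (norm (\<phi> x))\<^sup>2)"
    by (rule continuous_compact_support_integrable[OF _ K(1)]) (use c K in \<open>auto intro!: continuous_intros\<close>)
  have i2: "integrable lborel (\<lambda>x. (norm (grad \<phi> x))\<^sup>2)"
    by (rule continuous_compact_support_integrable[OF _ K(1)]) (use c gK in \<open>auto intro!: continuous_intros\<close>)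
  have "integrable (lebesgue_on D) (\<lambda>x. (norm (\<phi> x))\<^sup>2)"
    using integral_lborel_eq_lebesgue_on(2)[OF open_D borel_measurable_integrable[OF i1, simplified]]
      i1 test_functions_outside[OF assms] by simp
  then show "\<phi> \<in> Lp_space D 2"
    using continuous_imp_borel_measurable_lebesgue_on[OF c(1)] by (simp add: mem_Lp2_iff)
  have "integrable (lebesgue_on D) (\<lambda>x. (norm (grad \<phi> x))\<^sup>2)"
    using integral_lborel_eq_lebesgue_on(2)[OF open_D borel_measurable_integrable[OF i2, simplified]]
      i2 test_functions_outside[OF assms] by simp
  then show "grad \<phi> \<in> Lp_space D 2"
    using continuous_imp_borel_measurable_lebesgue_on[OF c(2)] by (simp add: mem_Lp2_iff)
qed

lemma is_weak_grad_diff: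
  assumes "is_weak_grad D f F" "is_weak_grad D g G"
  shows "is_weak_grad D (\<lambda>x. f x - g x) (\<lambda>x. F x - G x)"
  using is_weak_grad_add[OF open_D assms(1) is_weak_grad_scale[OF open_D assms(2), of "-1"]] by simp

lemma H1_norm_diff_test:
  assumes "v \<in> Lp_space D 2" "is_weak_grad D v G" "G \<in> Lp_space D 2" "\<phi> \<in> test_functions D"
  shows "H1_norm D (\<lambda>x. v x - \<phi> x) =
    sqrt ((Lp_norm D 2 (\<lambda>x. v x - \<phi> x))\<^sup>2 + (Lp_norm D 2 (\<lambda>x. G x - grad \<phi> x))\<^sup>2)"
  unfolding H1_norm_def
  using H1_weak_grad(4)[OF is_weak_grad_diff[OF assms(2) test_functions_weak_grad[OF open_D assms(4)]]
    Lp2_diff(1)[OF assms(3) test_functions_Lp2(2)[OF assms(4)]]] by simp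

text \<open>Splits the H^1 distance into its two parts and lets any square-integrable weak gradient
  stand for the chosen one. With its converse \<open>V_spaceD\<close> it is the working form of
  membership in V.\<close>

lemma V_spaceI:
  assumes v: "v \<in> Lp_space D 2" "is_weak_grad D v G" "G \<in> Lp_space D 2"
    and ap: "\<And>e. e > 0 \<Longrightarrow> \<exists>\<phi>\<in>test_functions D. Lp_norm D 2 (\<lambda>x. v x - \<phi> x) < e \<and> Lp_norm D 2 (\<lambda>x. G x - grad \<phi> x) < e"
  shows "v \<in> V_space D"
  unfolding V_space_def H1_space_def
proof (intro CollectI conjI v(1) exI allI impI)
  show "is_weak_grad D v G" "G \<in> Lp_space D 2" by fact+
  fix e :: real assume "e > 0"
  then obtain \<phi> where \<phi>: "\<phi> \<in> test_functions D" "Lp_norm D 2 (\<lambda>x. v x - \<phi> x) < e/2" "Lp_norm D 2 (\<lambda>x. G x - grad \<phi> x) < e/2"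
    using ap[of "e/2"] by auto
  have "H1_norm D (\<lambda>x. v x - \<phi> x) \<le> Lp_norm D 2 (\<lambda>x. v x - \<phi> x) + Lp_norm D 2 (\<lambda>x. G x - grad \<phi> x)"
    unfolding H1_norm_diff_test[OF v \<phi>(1)] by (rule sqrt_sum_squares_le_sum) (simp_all add: Lp2_norm_nonneg)
  also have "\<dots> < e" using \<phi> by simp
  finally show "\<exists>\<phi>\<in>test_functions D. H1_norm D (\<lambda>x. v x - \<phi> x) < e" using \<phi>(1) by blast
qed

lemma V_spaceD:
  assumes "v \<in> V_space D"
  shows "v \<in> Lp_space D 2" "is_weak_grad D v (weak_grad D v)" "weak_grad D v \<in> Lp_space D 2"
    "\<And>e. e > 0 \<Longrightarrow> \<exists>\<phi>\<in>test_functions D. Lp_norm D 2 (\<lambda>x. v x - \<phi> x) < e \<and> Lp_norm D 2 (\<lambda>x. weak_grad D v x - grad \<phi> x) < e"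
proof -
  obtain G where G: "is_weak_grad D v G" "G \<in> Lp_space D 2" and v: "v \<in> Lp_space D 2"
    using assms unfolding V_space_def H1_space_def by blast
  note g = H1_weak_grad[OF G]
  show "v \<in> Lp_space D 2" "is_weak_grad D v (weak_grad D v)" "weak_grad D v \<in> Lp_space D 2" by fact+
  fix e :: real assume "e > 0"
  then obtain \<phi> where \<phi>: "\<phi> \<in> test_functions D" "H1_norm D (\<lambda>x. v x - \<phi> x) < e"
    using assms unfolding V_space_def by blast
  note h = H1_norm_diff_test[OF v g(1,2) \<phi>(1)]
  have "Lp_norm D 2 (\<lambda>x. v x - \<phi> x) \<le> H1_norm D (\<lambda>x. v x - \<phi> x)"
    "Lp_norm D 2 (\<lambda>x. weak_grad D v x - grad \<phi> x) \<le> H1_norm D (\<lambda>x. v x - \<phi> x)"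
    unfolding h by (auto intro: real_le_rsqrt)
  then show "\<exists>\<phi>\<in>test_functions D. Lp_norm D 2 (\<lambda>x. v x - \<phi> x) < e \<and> Lp_norm D 2 (\<lambda>x. weak_grad D v x - grad \<phi> x) < e"
    using \<phi> by (intro bexI[of _ \<phi>]) auto
qed

lemma test_functions_V: "\<phi> \<in> test_functions D \<Longrightarrow> \<phi> \<in> V_space D"
  by (rule V_spaceI[OF test_functions_Lp2(1) test_functions_weak_grad[OF open_D] test_functions_Lp2(2)])
     (auto intro!: bexI[of _ \<phi>] simp: Lp2_norm_sqrt)

lemma V_space_add:
  assumes v: "v \<in> V_space D" and w: "w \<in> V_space D"
  shows "(\<lambda>x. v x + w x) \<in> V_space D"
    and "AE x in lebesgue_on D. weak_grad D (\<lambda>x. v x + w x) x = weak_grad D v x + weak_grad D w x"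
proof -
  note V = V_spaceD[OF v] and W = V_spaceD[OF w]
  note g = is_weak_grad_add[OF open_D V(2) W(2)]
  show "AE x in lebesgue_on D. weak_grad D (\<lambda>x. v x + w x) x = weak_grad D v x + weak_grad D w x"
    by (rule weak_grad_AE_eq[OF open_D g])
  show "(\<lambda>x. v x + w x) \<in> V_space D"
  proof (rule V_spaceI[OF Lp2_add(1)[OF V(1) W(1)] g Lp2_add(1)[OF V(3) W(3)]])
    fix e :: real assume "e > 0"
    then obtain \<phi> \<psi> where \<phi>: "\<phi> \<in> test_functions D" "Lp_norm D 2 (\<lambda>x. v x - \<phi> x) < e/2" "Lp_norm D 2 (\<lambda>x. weak_grad D v x - grad \<phi> x) < e/2"
      and \<psi>: "\<psi> \<in> test_functions D" "Lp_norm D 2 (\<lambda>x. w x - \<psi> x) < e/2" "Lp_norm D 2 (\<lambda>x. weak_grad D w x - grad \<psi> x) < e/2"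
      using V(4)[of "e/2"] W(4)[of "e/2"] by auto
    have "Lp_norm D 2 (\<lambda>x. v x + w x - (\<phi> x + \<psi> x)) < e"
      using Lp2_add(2)[OF Lp2_diff(1)[OF V(1) test_functions_Lp2(1)[OF \<phi>(1)]] Lp2_diff(1)[OF W(1) test_functions_Lp2(1)[OF \<psi>(1)]]]
        \<phi>(2) \<psi>(2) by (simp add: algebra_simps)
    moreover have "Lp_norm D 2 (\<lambda>x. weak_grad D v x + weak_grad D w x - grad (\<lambda>x. \<phi> x + \<psi> x) x) < e"
      using Lp2_add(2)[OF Lp2_diff(1)[OF V(3) test_functions_Lp2(2)[OF \<phi>(1)]] Lp2_diff(1)[OF W(3) test_functions_Lp2(2)[OF \<psi>(1)]]]
        \<phi>(3) \<psi>(3) by (simp add: grad_add[OF \<phi>(1) \<psi>(1)] algebra_simps)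
    ultimately show "\<exists>\<phi>\<in>test_functions D. Lp_norm D 2 (\<lambda>x. v x + w x - \<phi> x) < e \<and>
        Lp_norm D 2 (\<lambda>x. weak_grad D v x + weak_grad D w x - grad \<phi> x) < e"
      using test_functions_add[OF \<phi>(1) \<psi>(1)] by (intro bexI[of _ "\<lambda>x. \<phi> x + \<psi> x"]) auto
  qed
qed

lemma V_space_scale:
  assumes v: "v \<in> V_space D"
  shows "(\<lambda>x. c * v x) \<in> V_space D"
    and "AE x in lebesgue_on D. weak_grad D (\<lambda>x. c * v x) x = c *\<^sub>R weak_grad D v x"
proof -
  note V = V_spaceD[OF v]
  note g = is_weak_grad_scale[OF open_D V(2), of c]
  show "AE x in lebesgue_on D. weak_grad D (\<lambda>x. c * v x) x = c *\<^sub>R weak_grad D v x"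
    by (rule weak_grad_AE_eq[OF open_D g])
  show "(\<lambda>x. c * v x) \<in> V_space D"
  proof (rule V_spaceI[OF _ g Lp2_scale(1)[OF V(3)]])
    show "(\<lambda>x. c * v x) \<in> Lp_space D 2" using Lp2_scale(1)[OF V(1), of c] by simp
    fix e :: real assume "e > 0"
    define d where "d = e / (\<bar>c\<bar> + 1)"
    have "d > 0" using \<open>e > 0\<close> by (simp add: d_def)
    then obtain \<phi> where \<phi>: "\<phi> \<in> test_functions D" "Lp_norm D 2 (\<lambda>x. v x - \<phi> x) < d" "Lp_norm D 2 (\<lambda>x. weak_grad D v x - grad \<phi> x) < d"
      using V(4)[of d] by auto
    have cd: "\<bar>c\<bar> * t < e" if "t < d" "t \<ge> 0" for t
    proof -
      have "\<bar>c\<bar> * t \<le> (\<bar>c\<bar> + 1) * t" using that by (intro mult_right_mono) auto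
      also have "\<dots> < (\<bar>c\<bar> + 1) * d" using that by (intro mult_strict_left_mono) auto
      also have "\<dots> = e" by (simp add: d_def)
      finally show ?thesis .
    qed
    have "Lp_norm D 2 (\<lambda>x. c * v x - c * \<phi> x) < e"
      using Lp2_scale(2)[OF Lp2_diff(1)[OF V(1) test_functions_Lp2(1)[OF \<phi>(1)]], of c] cd[OF \<phi>(2) Lp2_norm_nonneg]
      by (simp add: right_diff_distrib)
    moreover have "Lp_norm D 2 (\<lambda>x. c *\<^sub>R weak_grad D v x - grad (\<lambda>x. c * \<phi> x) x) < e"
      using Lp2_scale(2)[OF Lp2_diff(1)[OF V(3) test_functions_Lp2(2)[OF \<phi>(1)]], of c] cd[OF \<phi>(3) Lp2_norm_nonneg]
      by (simp add: scaleR_diff_right grad_scale[OF \<phi>(1)])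
    ultimately show "\<exists>\<phi>\<in>test_functions D. Lp_norm D 2 (\<lambda>x. c * v x - \<phi> x) < e \<and>
        Lp_norm D 2 (\<lambda>x. c *\<^sub>R weak_grad D v x - grad \<phi> x) < e"
      using test_functions_scale[OF \<phi>(1)] by (intro bexI[of _ "\<lambda>x. c * \<phi> x"]) auto
  qed
qed

lemma V_space_diff:
  assumes v: "v \<in> V_space D" and w: "w \<in> V_space D"
  shows "(\<lambda>x. v x - w x) \<in> V_space D"
    and "AE x in lebesgue_on D. weak_grad D (\<lambda>x. v x - w x) x = weak_grad D v x - weak_grad D w x"
proof -
  note s = V_space_scale[OF w, of "-1"]
  show "(\<lambda>x. v x - w x) \<in> V_space D" using V_space_add(1)[OF v s(1)] by simp
  show "AE x in lebesgue_on D. weak_grad D (\<lambda>x. v x - w x) x = weak_grad D v x - weak_grad D w x"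
    by (rule weak_grad_AE_eq[OF open_D is_weak_grad_diff[OF V_spaceD(2)[OF v] V_spaceD(2)[OF w]]])
qed

lemma V_space_zero: "(\<lambda>x. 0) \<in> V_space D"
proof (rule test_functions_V)
  show "(\<lambda>x. 0) \<in> test_functions D" by (rule test_functionsI[of _ "{}"]) (auto simp: C_k_const)
qed

lemma V_norm_nonneg: "V_norm D v \<ge> 0" unfolding V_norm_def by (rule Lp2_norm_nonneg)

lemma weak_grad_measurable: "v \<in> V_space D \<Longrightarrow> weak_grad D v \<in> borel_measurable (lebesgue_on D)"
  using V_spaceD(3) by (auto simp: mem_Lp2_iff)

lemma V_norm_diff_le:
  assumes "v \<in> V_space D" "w \<in> V_space D"
  shows "V_norm D (\<lambda>x. v x - w x) = Lp_norm D 2 (\<lambda>x. weak_grad D v x - weak_grad D w x)"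
    and "V_norm D (\<lambda>x. v x - w x) \<le> V_norm D v + V_norm D w"
proof -
  show 1: "V_norm D (\<lambda>x. v x - w x) = Lp_norm D 2 (\<lambda>x. weak_grad D v x - weak_grad D w x)"
    unfolding V_norm_def
    by (rule Lp2_norm_cong_AE[OF weak_grad_measurable[OF V_space_diff(1)[OF assms]] _ V_space_diff(2)[OF assms]])
       (use weak_grad_measurable assms in auto)
  show "V_norm D (\<lambda>x. v x - w x) \<le> V_norm D v + V_norm D w"
    unfolding 1 using Lp2_diff(2)[OF V_spaceD(3)[OF assms(1)] V_spaceD(3)[OF assms(2)]] by (simp add: V_norm_def)
qed

lemma V_norm_add_le:
  assumes "v \<in> V_space D" "w \<in> V_space D"
  shows "V_norm D (\<lambda>x. v x + w x) \<le> V_norm D v + V_norm D w"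
proof -
  have "V_norm D (\<lambda>x. v x + w x) = Lp_norm D 2 (\<lambda>x. weak_grad D v x + weak_grad D w x)"
    unfolding V_norm_def
    by (rule Lp2_norm_cong_AE[OF weak_grad_measurable[OF V_space_add(1)[OF assms]] _ V_space_add(2)[OF assms]])
       (use weak_grad_measurable assms in auto)
  then show ?thesis
    using Lp2_add(2)[OF V_spaceD(3)[OF assms(1)] V_spaceD(3)[OF assms(2)]] by (simp add: V_norm_def)
qed

lemma V_norm_scale:
  assumes "v \<in> V_space D"
  shows "V_norm D (\<lambda>x. c * v x) = \<bar>c\<bar> * V_norm D v"
proof -
  have "V_norm D (\<lambda>x. c * v x) = Lp_norm D 2 (\<lambda>x. c *\<^sub>R weak_grad D v x)"
    unfolding V_norm_def
    by (rule Lp2_norm_cong_AE[OF weak_grad_measurable[OF V_space_scale(1)[OF assms]] _ V_space_scale(2)[OF assms]])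
       (use weak_grad_measurable assms in auto)
  then show ?thesis using Lp2_scale(2)[OF V_spaceD(3)[OF assms]] by (simp add: V_norm_def)
qed

text \<open>Density extends the inequality from test functions to V. It is what makes the gradient
  seminorm alone control the functions, so that V can be complete in it.\<close>

lemma Poincare:
  obtains C where "C \<ge> 0" "\<And>v. v \<in> V_space D \<Longrightarrow> Lp_norm D 2 v \<le> C * V_norm D v"
proof -
  obtain R where R: "R > 0" "\<And>x. x \<in> D \<Longrightarrow> norm x \<le> R" using bounded_D by (auto simp: bounded_pos)
  have test: "Lp_norm D 2 \<phi> \<le> (2 * R) * Lp_norm D 2 (grad \<phi>)" if \<phi>: "\<phi> \<in> test_functions D" for \<phi>
  proof -
    note m = continuous_imp_borel_measurable_lebesgue_on
    have b: "\<phi> \<in> borel_measurable borel" "grad \<phi> \<in> borel_measurable borel"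
      using test_functions_integrable[OF \<phi>] test_functions_grad_integrable[OF \<phi>] by auto
    have e1: "(LINT x|lebesgue_on D. (norm (\<phi> x))\<^sup>2) = (LINT x|lborel. (\<phi> x)\<^sup>2)"
      using integral_lborel_eq_lebesgue_on(1)[OF open_D, of "\<lambda>x. (norm (\<phi> x))\<^sup>2"] b test_functions_outside[OF \<phi>] by simp
    have e2: "(LINT x|lebesgue_on D. (norm (grad \<phi> x))\<^sup>2) = (LINT x|lborel. (norm (grad \<phi> x))\<^sup>2)"
      using integral_lborel_eq_lebesgue_on(1)[OF open_D, of "\<lambda>x. (norm (grad \<phi> x))\<^sup>2"] b test_functions_outside[OF \<phi>] by simp
    have "(Lp_norm D 2 \<phi>)\<^sup>2 \<le> ((2 * R) * Lp_norm D 2 (grad \<phi>))\<^sup>2"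
      using Poincare_test_functions[OF \<phi> R(2)] unfolding power_mult_distrib Lp2_norm_power2 e1 e2 by simp
    then show ?thesis by (rule power2_le_imp_le) (use R in \<open>simp add: Lp2_norm_nonneg\<close>)
  qed
  have "Lp_norm D 2 v \<le> (2 * R) * V_norm D v" if v: "v \<in> V_space D" for v
  proof (rule field_le_epsilon)
    fix e :: real assume "e > 0"
    \<comment> \<open>Approximation costs \<open>d\<close> for the function and
      \<open>2 * R * d\<close> for the gradient; this choice makes the two add up to
      \<open>e\<close>.\<close>
    define d where "d = e / (1 + 2 * R)"
    have d: "d > 0" using \<open>e > 0\<close> R by (simp add: d_def)
    note V = V_spaceD[OF v]
    obtain \<phi> where \<phi>: "\<phi> \<in> test_functions D" "Lp_norm D 2 (\<lambda>x. v x - \<phi> x) < d" "Lp_norm D 2 (\<lambda>x. weak_grad D v x - grad \<phi> x) < d"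
      using V(4)[OF d] by blast
    note p = test_functions_Lp2[OF \<phi>(1)]
    have "Lp_norm D 2 v \<le> Lp_norm D 2 (\<lambda>x. v x - \<phi> x) + Lp_norm D 2 \<phi>"
      using Lp2_add(2)[OF Lp2_diff(1)[OF V(1) p(1)] p(1)] by simp
    also have "Lp_norm D 2 \<phi> \<le> (2 * R) * Lp_norm D 2 (grad \<phi>)" by (rule test[OF \<phi>(1)])
    also have "Lp_norm D 2 (grad \<phi>) \<le> Lp_norm D 2 (weak_grad D v) + Lp_norm D 2 (\<lambda>x. weak_grad D v x - grad \<phi> x)"
      using Lp2_diff(2)[OF V(3) Lp2_diff(1)[OF V(3) p(2)]] by simp
    also have "(2 * R) * (Lp_norm D 2 (weak_grad D v) + Lp_norm D 2 (\<lambda>x. weak_grad D v x - grad \<phi> x)) \<le> (2 * R) * (V_norm D v + d)"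
      using R \<phi>(3) by (intro mult_left_mono) (auto simp: V_norm_def)
    finally have "Lp_norm D 2 v \<le> d + (2 * R) * (V_norm D v + d)" using \<phi>(2) R by auto
    also have "\<dots> = 2 * R * V_norm D v + d * (1 + 2 * R)" by (simp add: algebra_simps)
    also have "d * (1 + 2 * R) = e" using R by (simp add: d_def)
    finally show "Lp_norm D 2 v \<le> 2 * R * V_norm D v + e" .
  qed
  then show thesis using that[of "2 * R"] R by auto
qed

text \<open>The gradients converge in L^2 by completeness, and by \<open>Poincare\<close> so do the
  functions. The weak gradient identity is continuous under both limits, and a test function close
  to some \<open>v n\<close> is close to the limit.\<close>

lemma V_complete:
  assumes v: "\<And>n. v n \<in> V_space D"
    and cauchy: "\<And>e. e > 0 \<Longrightarrow> \<exists>N. \<forall>m\<ge>N. \<forall>n\<ge>N. V_norm D (\<lambda>x. v m x - v n x) < e"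
  obtains w where "w \<in> V_space D" "(\<lambda>n. V_norm D (\<lambda>x. v n x - w x)) \<longlonglongrightarrow> 0"
proof -
  obtain C where C: "C \<ge> 0" "\<And>v. v \<in> V_space D \<Longrightarrow> Lp_norm D 2 v \<le> C * V_norm D v" using Poincare by blast
  note V = V_spaceD[OF v]
  obtain G where G: "G \<in> Lp_space D 2" "(\<lambda>n. Lp_norm D 2 (\<lambda>x. weak_grad D (v n) x - G x)) \<longlonglongrightarrow> 0"
    using Lp2_complete[of "\<lambda>n. weak_grad D (v n)", OF V(3)] cauchy unfolding V_norm_diff_le(1)[OF v v] by blast
  obtain w where w: "w \<in> Lp_space D 2" "(\<lambda>n. Lp_norm D 2 (\<lambda>x. v n x - w x)) \<longlonglongrightarrow> 0"
  proof (rule Lp2_complete[of v, OF V(1)])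
    fix e :: real assume "e > 0"
    then obtain N where N: "\<And>m n. m \<ge> N \<Longrightarrow> n \<ge> N \<Longrightarrow> V_norm D (\<lambda>x. v m x - v n x) < e / (C + 1)"
      using cauchy[of "e / (C + 1)"] C(1) by auto
    have "Lp_norm D 2 (\<lambda>x. v m x - v n x) < e" if "m \<ge> N" "n \<ge> N" for m n
    proof -
      have "Lp_norm D 2 (\<lambda>x. v m x - v n x) \<le> C * V_norm D (\<lambda>x. v m x - v n x)"
        by (rule C(2)[OF V_space_diff(1)[OF v v]])
      also have "\<dots> \<le> (C + 1) * V_norm D (\<lambda>x. v m x - v n x)"
        by (intro mult_right_mono V_norm_nonneg) simp
      also have "\<dots> < (C + 1) * (e / (C + 1))" using N[OF that] C(1) by (intro mult_strict_left_mono) auto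
      also have "\<dots> = e" using C(1) by simp
      finally show ?thesis .
    qed
    then show "\<exists>N. \<forall>m\<ge>N. \<forall>n\<ge>N. Lp_norm D 2 (\<lambda>x. v m x - v n x) < e" by blast
  qed
  have lw: "loc_integrable D w" and lG: "loc_integrable D G" using w(1) G(1) by (auto intro: Lp2_loc_integrable)
  have wg: "is_weak_grad D w G"
    unfolding is_weak_grad_def
  proof (intro conjI ballI lw lG)
    fix \<phi> assume \<phi>: "\<phi> \<in> test_functions D"
    obtain B1 where B1: "\<And>x. norm (\<phi> x) \<le> B1" "B1 \<ge> 0" using test_functions_bounded[OF \<phi>] by blast
    obtain B2 where B2: "\<And>x. norm (grad \<phi> x) \<le> B2" "B2 \<ge> 0" using test_functions_grad_bounded[OF \<phi>] by blast
    let ?s = "sqrt (measure (lebesgue_on D) D)"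
    have l: "loc_integrable D (v n)" "loc_integrable D (weak_grad D (v n))" for n
      using V(2) unfolding is_weak_grad_def by auto
    have "(\<lambda>n. (LINT x|lebesgue_on D. v n x *\<^sub>R grad \<phi> x) - (LINT x|lebesgue_on D. w x *\<^sub>R grad \<phi> x)) \<longlonglongrightarrow> 0"
    proof (rule Lim_null_comparison)
      show "(\<lambda>n. Lp_norm D 2 (\<lambda>x. v n x - w x) * ?s * B2) \<longlonglongrightarrow> 0"
        using w(2) by (auto intro!: tendsto_eq_intros)
      have "norm ((LINT x|lebesgue_on D. v n x *\<^sub>R grad \<phi> x) - (LINT x|lebesgue_on D. w x *\<^sub>R grad \<phi> x)) \<le>
          Lp_norm D 2 (\<lambda>x. v n x - w x) * ?s * B2" for n
      proof -
        note d = Lp2_diff(1)[OF V(1)[of n] w(1)]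
        have "(LINT x|lebesgue_on D. v n x *\<^sub>R grad \<phi> x) - (LINT x|lebesgue_on D. w x *\<^sub>R grad \<phi> x) =
          (LINT x|lebesgue_on D. (v n x - w x) *\<^sub>R grad \<phi> x)"
          using weak_integrable_grad_scaleR[OF l(1)[of n] open_D \<phi>] weak_integrable_grad_scaleR[OF lw open_D \<phi>]
          by (simp add: scaleR_diff_left)
        also have "norm \<dots> \<le> (LINT x|lebesgue_on D. norm (v n x - w x) * B2)"
          using Lp2_integrable(1)[OF d] weak_integrable_grad_scaleR[OF Lp2_loc_integrable[OF d] open_D \<phi>] B2
          by (intro LINT_norm_le) (auto intro!: mult_left_mono)
        also have "\<dots> \<le> Lp_norm D 2 (\<lambda>x. v n x - w x) * ?s * B2"
          using mult_right_mono[OF Lp2_integrable(2)[OF d] B2(2)] by simp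
        finally show ?thesis .
      qed
      then show "\<forall>\<^sub>F n in sequentially. norm ((LINT x|lebesgue_on D. v n x *\<^sub>R grad \<phi> x) - (LINT x|lebesgue_on D. w x *\<^sub>R grad \<phi> x)) \<le>
          Lp_norm D 2 (\<lambda>x. v n x - w x) * ?s * B2" by simp
    qed
    then have L1: "(\<lambda>n. (LINT x|lebesgue_on D. v n x *\<^sub>R grad \<phi> x)) \<longlonglongrightarrow> (LINT x|lebesgue_on D. w x *\<^sub>R grad \<phi> x)"
      by (simp add: LIM_zero_iff)
    have "(\<lambda>n. (LINT x|lebesgue_on D. \<phi> x *\<^sub>R weak_grad D (v n) x) - (LINT x|lebesgue_on D. \<phi> x *\<^sub>R G x)) \<longlonglongrightarrow> 0"
    proof (rule Lim_null_comparison)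
      show "(\<lambda>n. B1 * (Lp_norm D 2 (\<lambda>x. weak_grad D (v n) x - G x) * ?s)) \<longlonglongrightarrow> 0"
        using G(2) by (auto intro!: tendsto_eq_intros)
      have "norm ((LINT x|lebesgue_on D. \<phi> x *\<^sub>R weak_grad D (v n) x) - (LINT x|lebesgue_on D. \<phi> x *\<^sub>R G x)) \<le>
          B1 * (Lp_norm D 2 (\<lambda>x. weak_grad D (v n) x - G x) * ?s)" for n
      proof -
        note d = Lp2_diff(1)[OF V(3)[of n] G(1)]
        have "(LINT x|lebesgue_on D. \<phi> x *\<^sub>R weak_grad D (v n) x) - (LINT x|lebesgue_on D. \<phi> x *\<^sub>R G x) =
          (LINT x|lebesgue_on D. \<phi> x *\<^sub>R (weak_grad D (v n) x - G x))"
          using weak_integrable_test_scaleR[OF l(2)[of n] open_D \<phi>] weak_integrable_test_scaleR[OF lG open_D \<phi>]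
          by (simp add: scaleR_diff_right)
        also have "norm \<dots> \<le> (LINT x|lebesgue_on D. B1 * norm (weak_grad D (v n) x - G x))"
          using Lp2_integrable(1)[OF d] weak_integrable_test_scaleR[OF Lp2_loc_integrable[OF d] open_D \<phi>] B1
          by (intro LINT_norm_le) (auto intro!: mult_right_mono)
        also have "\<dots> \<le> B1 * (Lp_norm D 2 (\<lambda>x. weak_grad D (v n) x - G x) * ?s)"
          using mult_left_mono[OF Lp2_integrable(2)[OF d] B1(2)] by simp
        finally show ?thesis .
      qed
      then show "\<forall>\<^sub>F n in sequentially. norm ((LINT x|lebesgue_on D. \<phi> x *\<^sub>R weak_grad D (v n) x) - (LINT x|lebesgue_on D. \<phi> x *\<^sub>R G x)) \<le>
          B1 * (Lp_norm D 2 (\<lambda>x. weak_grad D (v n) x - G x) * ?s)" by simp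
    qed
    then have "(\<lambda>n. (LINT x|lebesgue_on D. \<phi> x *\<^sub>R weak_grad D (v n) x)) \<longlonglongrightarrow> (LINT x|lebesgue_on D. \<phi> x *\<^sub>R G x)"
      by (simp add: LIM_zero_iff)
    then have L2: "(\<lambda>n. - (LINT x|lebesgue_on D. \<phi> x *\<^sub>R weak_grad D (v n) x)) \<longlonglongrightarrow> - (LINT x|lebesgue_on D. \<phi> x *\<^sub>R G x)"
      by (rule tendsto_minus)
    have "(LINT x|lebesgue_on D. v n x *\<^sub>R grad \<phi> x) = - (LINT x|lebesgue_on D. \<phi> x *\<^sub>R weak_grad D (v n) x)" for n
      using V(2)[of n] \<phi> unfolding is_weak_grad_def by blast
    with L1 L2 show "(LINT x|lebesgue_on D. w x *\<^sub>R grad \<phi> x) = - (LINT x|lebesgue_on D. \<phi> x *\<^sub>R G x)"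
      by (simp add: LIMSEQ_unique)
  qed
  have wV: "w \<in> V_space D"
  proof (rule V_spaceI[OF w(1) wg G(1)])
    fix e :: real assume "e > 0"
    have "eventually (\<lambda>n. Lp_norm D 2 (\<lambda>x. v n x - w x) < e/2 \<and> Lp_norm D 2 (\<lambda>x. weak_grad D (v n) x - G x) < e/2) sequentially"
      using order_tendstoD(2)[OF w(2), of "e/2"] order_tendstoD(2)[OF G(2), of "e/2"] \<open>e > 0\<close> by (intro eventually_conj) auto
    then obtain n where n: "Lp_norm D 2 (\<lambda>x. v n x - w x) < e/2" "Lp_norm D 2 (\<lambda>x. weak_grad D (v n) x - G x) < e/2"
      by (auto simp: eventually_sequentially)
    obtain \<phi> where \<phi>: "\<phi> \<in> test_functions D" "Lp_norm D 2 (\<lambda>x. v n x - \<phi> x) < e/2" "Lp_norm D 2 (\<lambda>x. weak_grad D (v n) x - grad \<phi> x) < e/2"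
      using V(4)[of "e/2" n] \<open>e > 0\<close> by auto
    note p = test_functions_Lp2[OF \<phi>(1)]
    have "Lp_norm D 2 (\<lambda>x. w x - \<phi> x) < e"
      using Lp2_diff(2)[OF Lp2_diff(1)[OF V(1)[of n] p(1)] Lp2_diff(1)[OF V(1)[of n] w(1)]] n \<phi> by simp
    moreover have "Lp_norm D 2 (\<lambda>x. G x - grad \<phi> x) < e"
      using Lp2_diff(2)[OF Lp2_diff(1)[OF V(3)[of n] p(2)] Lp2_diff(1)[OF V(3)[of n] G(1)]] n \<phi> by simp
    ultimately show "\<exists>\<phi>\<in>test_functions D. Lp_norm D 2 (\<lambda>x. w x - \<phi> x) < e \<and> Lp_norm D 2 (\<lambda>x. G x - grad \<phi> x) < e"
      using \<phi>(1) by blast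
  qed
  have "V_norm D (\<lambda>x. v n x - w x) = Lp_norm D 2 (\<lambda>x. weak_grad D (v n) x - G x)" for n
    unfolding V_norm_def
    by (rule H1_weak_grad(4)[OF is_weak_grad_diff[OF V(2) wg] Lp2_diff(1)[OF V(3) G(1)]])
  then show thesis using that[OF wV] G(2) by simp
qed

end

subsection \<open>The energy forms\<close>

text \<open>The Dirichlet form weighted by a coefficient. The coefficient is a parameter because the
  recursion combines the forms of \<open>abar\<close> and of all \<open>\<psi> j\<close>, and the
  estimates use those of their absolute values.\<close>

definition energy :: "'a::euclidean_space set \<Rightarrow> ('a \<Rightarrow> real) \<Rightarrow> ('a \<Rightarrow> real) \<Rightarrow> ('a \<Rightarrow> real) \<Rightarrow> real" where
  "energy D \<eta> u v = (LINT x|lebesgue_on D. \<eta> x * (weak_grad D u x \<bullet> weak_grad D v x))"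

section \<open>Essentially bounded coefficients\<close>

lemma esssup_less_top_AE:
  fixes S :: "'a \<Rightarrow> ereal"
  assumes "esssup M (\<lambda>x. \<bar>S x\<bar>) < \<infinity>"
  obtains K where "AE x in M. \<bar>S x\<bar> \<le> ereal K"
proof -
  obtain K where K: "esssup M (\<lambda>x. \<bar>S x\<bar>) \<le> ereal K"
    using assms by (cases "esssup M (\<lambda>x. \<bar>S x\<bar>)") auto
  have "AE x in M. \<bar>S x\<bar> \<le> ereal K"
    using esssup_AE[of "\<lambda>x. \<bar>S x\<bar>" M] by eventually_elim (use K in auto)
  then show thesis using that by blast
qed

lemma Linf_spaceD:
  assumes "\<eta> \<in> Linf_space D"
  obtains K where "K \<ge> 0" "AE x in lebesgue_on D. norm (\<eta> x) \<le> K" "\<eta> \<in> borel_measurable (lebesgue_on D)"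
proof -
  have lt: "esssup (lebesgue_on D) (\<lambda>x. \<bar>ereal (norm (\<eta> x))\<bar>) < \<infinity>"
    and m: "\<eta> \<in> borel_measurable (lebesgue_on D)"
    using assms unfolding Linf_space_def Linf_norm_def by auto
  obtain K where "AE x in lebesgue_on D. \<bar>ereal (norm (\<eta> x))\<bar> \<le> ereal K"
    by (rule esssup_less_top_AE[OF lt])
  then have "AE x in lebesgue_on D. norm (\<eta> x) \<le> \<bar>K\<bar>"
    by eventually_elim simp
  then show thesis by (rule that[OF abs_ge_zero _ m])
qed

lemma Linf_spaceI:
  assumes "\<eta> \<in> borel_measurable (lebesgue_on D)" "AE x in lebesgue_on D. norm (\<eta> x) \<le> K"
  shows "\<eta> \<in> Linf_space D"
proof -
  have "esssup (lebesgue_on D) (\<lambda>x. \<bar>ereal (norm (\<eta> x))\<bar>) \<le> ereal K"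
  proof (rule esssup_I)
    show "(\<lambda>x. \<bar>ereal (norm (\<eta> x))\<bar>) \<in> borel_measurable (lebesgue_on D)" using assms(1) by measurable
    show "AE x in lebesgue_on D. \<bar>ereal (norm (\<eta> x))\<bar> \<le> ereal K" using assms(2) by eventually_elim simp
  qed
  then have "Linf_norm D (\<lambda>x. ereal (norm (\<eta> x))) < \<infinity>"
    unfolding Linf_norm_def using order.strict_trans1 by fastforce
  then show ?thesis using assms(1) unfolding Linf_space_def by simp
qed

lemma Linf_space_add:
  fixes \<eta> \<xi> :: "'a::euclidean_space \<Rightarrow> real"
  assumes \<eta>: "\<eta> \<in> Linf_space D" and \<xi>: "\<xi> \<in> Linf_space D"
  shows "(\<lambda>x. \<eta> x + \<xi> x) \<in> Linf_space D"
proof -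
  obtain K where K: "K \<ge> 0" "AE x in lebesgue_on D. norm (\<eta> x) \<le> K" "\<eta> \<in> borel_measurable (lebesgue_on D)"
    using Linf_spaceD[OF \<eta>] by blast
  obtain L where L: "L \<ge> 0" "AE x in lebesgue_on D. norm (\<xi> x) \<le> L" "\<xi> \<in> borel_measurable (lebesgue_on D)"
    using Linf_spaceD[OF \<xi>] by blast
  show ?thesis
  proof (rule Linf_spaceI[where K="K + L"])
    show "AE x in lebesgue_on D. norm (\<eta> x + \<xi> x) \<le> K + L"
      using K(2) L(2) by eventually_elim (rule norm_add_rule_thm)
  qed (use K L in measurable)
qed

lemma Linf_space_scale:
  fixes \<eta> :: "'a::euclidean_space \<Rightarrow> real"
  assumes \<eta>: "\<eta> \<in> Linf_space D"
  shows "(\<lambda>x. c * \<eta> x) \<in> Linf_space D"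
proof -
  obtain K where K: "K \<ge> 0" "AE x in lebesgue_on D. norm (\<eta> x) \<le> K" "\<eta> \<in> borel_measurable (lebesgue_on D)"
    using Linf_spaceD[OF \<eta>] by blast
  show ?thesis
  proof (rule Linf_spaceI[where K="\<bar>c\<bar> * K"])
    show "AE x in lebesgue_on D. norm (c * \<eta> x) \<le> \<bar>c\<bar> * K"
      using K(2) by eventually_elim (simp add: abs_mult mult_left_mono)
  qed (use K in measurable)
qed

context bounded_open_domain
begin

lemma energy_integrable:
  assumes \<eta>: "\<eta> \<in> Linf_space D" and u: "u \<in> V_space D" and v: "v \<in> V_space D"
  shows "integrable (lebesgue_on D) (\<lambda>x. \<eta> x * (weak_grad D u x \<bullet> weak_grad D v x))"
proof -
  obtain K where K: "K \<ge> 0" "AE x in lebesgue_on D. norm (\<eta> x) \<le> K" and m: "\<eta> \<in> borel_measurable (lebesgue_on D)"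
    using Linf_spaceD[OF \<eta>] by blast
  note [measurable] = m weak_grad_measurable[OF u] weak_grad_measurable[OF v]
  show ?thesis
  proof (rule Bochner_Integration.integrable_bound[OF integrable_mult_right[OF Lp2_integrable_prod[OF V_spaceD(3)[OF u] V_spaceD(3)[OF v]], of K]])
    show "AE x in lebesgue_on D. norm (\<eta> x * (weak_grad D u x \<bullet> weak_grad D v x)) \<le>
       norm (K * (norm (weak_grad D u x) * norm (weak_grad D v x)))"
      using K(2)
    proof eventually_elim
      case (elim x)
      have "\<bar>\<eta> x\<bar> * \<bar>weak_grad D u x \<bullet> weak_grad D v x\<bar> \<le> K * (norm (weak_grad D u x) * norm (weak_grad D v x))"
        using elim K(1) by (intro mult_mono Cauchy_Schwarz_ineq2) auto
      then show ?case using K(1) by (simp add: abs_mult)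
    qed
  qed measurable
qed

lemma energy_bound:
  assumes K: "AE x in lebesgue_on D. norm (\<eta> x) \<le> K" "K \<ge> 0" and \<eta>: "\<eta> \<in> Linf_space D"
    and u: "u \<in> V_space D" and v: "v \<in> V_space D"
  shows "\<bar>energy D \<eta> u v\<bar> \<le> K * V_norm D u * V_norm D v"
proof -
  note p = Lp2_integrable_prod[OF V_spaceD(3)[OF u] V_spaceD(3)[OF v]]
  note i = energy_integrable[OF \<eta> u v]
  have "\<bar>energy D \<eta> u v\<bar> \<le> (LINT x|lebesgue_on D. \<bar>\<eta> x * (weak_grad D u x \<bullet> weak_grad D v x)\<bar>)"
    unfolding energy_def by (rule integral_abs_bound)
  also have "\<dots> \<le> (LINT x|lebesgue_on D. K * (norm (weak_grad D u x) * norm (weak_grad D v x)))"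
  proof (rule integral_mono_AE)
    show "AE x in lebesgue_on D. \<bar>\<eta> x * (weak_grad D u x \<bullet> weak_grad D v x)\<bar> \<le> K * (norm (weak_grad D u x) * norm (weak_grad D v x))"
      using K(1)
    proof eventually_elim
      case (elim x)
      show ?case unfolding abs_mult using elim K(2) by (intro mult_mono Cauchy_Schwarz_ineq2) auto
    qed
  qed (use i p in auto)
  also have "\<dots> = K * (LINT x|lebesgue_on D. norm (weak_grad D u x) * norm (weak_grad D v x))" by simp
  also have "\<dots> \<le> K * (V_norm D u * V_norm D v)"
    unfolding V_norm_def using K(2) Lp2_Cauchy_Schwarz[OF V_spaceD(3)[OF u] V_spaceD(3)[OF v]] by (rule mult_left_mono[rotated])
  finally show ?thesis by (simp add: mult_ac)
qed

lemma energy_commute: "energy D \<eta> u v = energy D \<eta> v u"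
  unfolding energy_def by (simp add: inner_commute)

lemma energy_add_left:
  assumes \<eta>: "\<eta> \<in> Linf_space D" and u: "u \<in> V_space D" and w: "w \<in> V_space D" and v: "v \<in> V_space D"
  shows "energy D \<eta> (\<lambda>x. u x + w x) v = energy D \<eta> u v + energy D \<eta> w v"
proof -
  have "energy D \<eta> (\<lambda>x. u x + w x) v = (LINT x|lebesgue_on D. \<eta> x * (weak_grad D u x \<bullet> weak_grad D v x) + \<eta> x * (weak_grad D w x \<bullet> weak_grad D v x))"
    unfolding energy_def
  proof (rule integral_cong_AE)
    show "AE x in lebesgue_on D. \<eta> x * (weak_grad D (\<lambda>x. u x + w x) x \<bullet> weak_grad D v x) =
      \<eta> x * (weak_grad D u x \<bullet> weak_grad D v x) + \<eta> x * (weak_grad D w x \<bullet> weak_grad D v x)"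
      using V_space_add(2)[OF u w] by eventually_elim (simp add: inner_add_left distrib_left)
  qed (use energy_integrable[OF \<eta>] V_space_add(1)[OF u w] u v w in auto)
  then show ?thesis using energy_integrable[OF \<eta> u v] energy_integrable[OF \<eta> w v] by (simp add: energy_def)
qed

lemma energy_scale_left:
  assumes \<eta>: "\<eta> \<in> Linf_space D" and u: "u \<in> V_space D" and v: "v \<in> V_space D"
  shows "energy D \<eta> (\<lambda>x. c * u x) v = c * energy D \<eta> u v"
proof -
  have "energy D \<eta> (\<lambda>x. c * u x) v = (LINT x|lebesgue_on D. c * (\<eta> x * (weak_grad D u x \<bullet> weak_grad D v x)))"
    unfolding energy_def
  proof (rule integral_cong_AE)
    show "AE x in lebesgue_on D. \<eta> x * (weak_grad D (\<lambda>x. c * u x) x \<bullet> weak_grad D v x) =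
      c * (\<eta> x * (weak_grad D u x \<bullet> weak_grad D v x))"
      using V_space_scale(2)[OF u, of c] by eventually_elim simp
  qed (use energy_integrable[OF \<eta>] V_space_scale(1)[OF u] u v in auto)
  then show ?thesis by (simp add: energy_def)
qed

lemma energy_diff_left:
  assumes \<eta>: "\<eta> \<in> Linf_space D" and u: "u \<in> V_space D" and w: "w \<in> V_space D" and v: "v \<in> V_space D"
  shows "energy D \<eta> (\<lambda>x. u x - w x) v = energy D \<eta> u v - energy D \<eta> w v"
  using energy_add_left[OF \<eta> u V_space_scale(1)[OF w, of "-1"] v] energy_scale_left[OF \<eta> w v, of "-1"] by simp

lemma energy_add_coeff:
  assumes "\<eta> \<in> Linf_space D" "\<xi> \<in> Linf_space D" "u \<in> V_space D" "v \<in> V_space D"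
  shows "energy D (\<lambda>x. \<eta> x + c * \<xi> x) u v = energy D \<eta> u v + c * energy D \<xi> u v"
proof -
  have "energy D (\<lambda>x. \<eta> x + c * \<xi> x) u v =
    (LINT x|lebesgue_on D. \<eta> x * (weak_grad D u x \<bullet> weak_grad D v x) + c * (\<xi> x * (weak_grad D u x \<bullet> weak_grad D v x)))"
    unfolding energy_def by (simp add: algebra_simps)
  then show ?thesis using energy_integrable[OF assms(1,3,4)] energy_integrable[OF assms(2,3,4)] by (simp add: energy_def)
qed

lemma energy_coercive:
  assumes \<eta>: "\<eta> \<in> Linf_space D" and c: "AE x in lebesgue_on D. c \<le> \<eta> x" and u: "u \<in> V_space D"
  shows "c * (V_norm D u)\<^sup>2 \<le> energy D \<eta> u u"
proof -
  have i: "integrable (lebesgue_on D) (\<lambda>x. (norm (weak_grad D u x))\<^sup>2)" using V_spaceD(3)[OF u] by (simp add: mem_Lp2_iff)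
  have "c * (V_norm D u)\<^sup>2 = (LINT x|lebesgue_on D. c * (norm (weak_grad D u x))\<^sup>2)"
    by (simp add: V_norm_def Lp2_norm_power2)
  also have "\<dots> \<le> energy D \<eta> u u"
    unfolding energy_def
  proof (rule integral_mono_AE)
    show "AE x in lebesgue_on D. c * (norm (weak_grad D u x))\<^sup>2 \<le> \<eta> x * (weak_grad D u x \<bullet> weak_grad D u x)"
      using c by eventually_elim (simp add: power2_norm_eq_inner mult_right_mono)
  qed (use i energy_integrable[OF \<eta> u u] in auto)
  finally show ?thesis .
qed

text \<open>Test with \<open>u\<close> itself and divide by its seminorm. If the seminorm is 0 the
  hypothesis at \<open>u\<close> says nothing about the sign of \<open>K\<close>, hence the second
  alternative.\<close>

lemma energy_estimate:
  assumes \<eta>: "\<eta> \<in> Linf_space D" and c: "AE x in lebesgue_on D. c \<le> \<eta> x" and u: "u \<in> V_space D"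
    and K: "\<And>v. v \<in> V_space D \<Longrightarrow> \<bar>energy D \<eta> u v\<bar> \<le> K * V_norm D v"
  shows "c * V_norm D u \<le> K \<or> V_norm D u = 0"
proof (cases "V_norm D u = 0")
  case False
  then have p: "V_norm D u > 0" using V_norm_nonneg[of u] by simp
  have "c * (V_norm D u)\<^sup>2 \<le> K * V_norm D u"
    using energy_coercive[OF \<eta> c u] K[OF u] by linarith
  then have "(c * V_norm D u) * V_norm D u \<le> K * V_norm D u" by (simp add: power2_eq_square mult_ac)
  then show ?thesis using p mult_le_cancel_right_pos by blast
qed simp

text \<open>The reason why arbitrary choices of solutions and derivatives do no harm in the
  recursion.\<close>

lemma energy_cong:
  assumes \<eta>: "\<eta> \<in> Linf_space D" and u: "u \<in> V_space D" and w: "w \<in> V_space D" and v: "v \<in> V_space D"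
    and 0: "V_norm D (\<lambda>x. u x - w x) = 0"
  shows "energy D \<eta> u v = energy D \<eta> w v"
proof -
  obtain K where K: "K \<ge> 0" "AE x in lebesgue_on D. norm (\<eta> x) \<le> K" using Linf_spaceD[OF \<eta>] by blast
  have "\<bar>energy D \<eta> (\<lambda>x. u x - w x) v\<bar> \<le> 0"
    using energy_bound[OF K(2,1) \<eta> V_space_diff(1)[OF u w] v] 0 by simp
  then show ?thesis using energy_diff_left[OF \<eta> u w v] by simp
qed

text \<open>Riesz representation, by minimising \<open>energy v v - 2 F v\<close>.\<close>

lemma energy_Riesz:
  assumes \<eta>: "\<eta> \<in> Linf_space D" and c: "AE x in lebesgue_on D. c \<le> \<eta> x" "c > 0"
    and Fadd: "\<And>v w. v \<in> V_space D \<Longrightarrow> w \<in> V_space D \<Longrightarrow> F (\<lambda>x. v x + w x) = F v + F w"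
    and Fscale: "\<And>v r. v \<in> V_space D \<Longrightarrow> F (\<lambda>x. r * v x) = r * F v"
    and C: "\<And>v. v \<in> V_space D \<Longrightarrow> \<bar>F v\<bar> \<le> C * V_norm D v"
  obtains u where "u \<in> V_space D" "\<And>v. v \<in> V_space D \<Longrightarrow> energy D \<eta> u v = F v"
proof -
  define E where "E v = energy D \<eta> v v - 2 * F v" for v
  have exp: "E (\<lambda>x. v x + t * w x) = E v + 2 * t * (energy D \<eta> v w - F w) + t\<^sup>2 * energy D \<eta> w w"
    if v: "v \<in> V_space D" and w: "w \<in> V_space D" for v w t
  proof -
    note tw = V_space_scale(1)[OF w, of t]
    note s = V_space_add(1)[OF v tw]
    have "energy D \<eta> (\<lambda>x. v x + t * w x) (\<lambda>x. v x + t * w x) =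
        energy D \<eta> v (\<lambda>x. v x + t * w x) + t * energy D \<eta> w (\<lambda>x. v x + t * w x)"
      using energy_add_left[OF \<eta> v tw s] energy_scale_left[OF \<eta> w s] by simp
    also have "energy D \<eta> v (\<lambda>x. v x + t * w x) = energy D \<eta> v v + t * energy D \<eta> w v"
      using energy_add_left[OF \<eta> v tw v] energy_scale_left[OF \<eta> w v] energy_commute by metis
    also have "energy D \<eta> w (\<lambda>x. v x + t * w x) = energy D \<eta> v w + t * energy D \<eta> w w"
      using energy_add_left[OF \<eta> v tw w] energy_scale_left[OF \<eta> w w] energy_commute by metis
    finally show ?thesis
      unfolding E_def Fadd[OF v tw] Fscale[OF w] using energy_commute[of \<eta> w v]
      by (simp add: algebra_simps power2_eq_square)
  qed
  \<comment> \<open>Completing the square in the seminorm, by coercivity and the bound on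
    \<open>F\<close>.\<close>
  have lower: "E v \<ge> - (C\<^sup>2 / c)" if v: "v \<in> V_space D" for v
  proof -
    let ?t = "V_norm D v"
    have "0 \<le> c * (?t - C / c)\<^sup>2" using c(2) by simp
    also have "c * (?t - C / c)\<^sup>2 = c * ?t\<^sup>2 - 2 * C * ?t + C\<^sup>2 / c"
      using c(2) by (simp add: power2_eq_square field_simps)
    finally show ?thesis
      using energy_coercive[OF \<eta> c(1) v] C[OF v] unfolding E_def by linarith
  qed
  define m where "m = Inf (E ` V_space D)"
  have bdd: "bdd_below (E ` V_space D)" using lower by (auto intro!: bdd_belowI2)
  have mle: "m \<le> E v" if "v \<in> V_space D" for v
    unfolding m_def by (rule cInf_lower[OF imageI[OF that] bdd])
  have "\<exists>v. v \<in> V_space D \<and> E v < m + inverse (real (Suc n))" for n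
  proof -
    have "Inf (E ` V_space D) < m + inverse (real (Suc n))" by (simp add: m_def)
    then show ?thesis using cInf_lessD[of "E ` V_space D"] V_space_zero by blast
  qed
  then have "\<forall>n. \<exists>v. v \<in> V_space D \<and> E v < m + inverse (real (Suc n))" by blast
  from choice[OF this] obtain v where v: "\<And>n. v n \<in> V_space D" "\<And>n. E (v n) < m + inverse (real (Suc n))"
    by blast
  \<comment> \<open>The parallelogram argument: the value at the midpoint of \<open>v i\<close> and
    \<open>v j\<close> is at least \<open>m\<close>, so two nearly minimal elements must be
    close.\<close>
  have par: "c * (V_norm D (\<lambda>x. v i x - v j x))\<^sup>2 \<le> 2 * E (v i) + 2 * E (v j) - 4 * m" for i j
  proof -
    note d = V_space_diff(1)[OF v(1)[of i] v(1)[of j]]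
    have e1: "(\<lambda>x. v j x + 1 * (v i x - v j x)) = v i" by auto
    have "E (v i) = E (v j) + 2 * (energy D \<eta> (v j) (\<lambda>x. v i x - v j x) - F (\<lambda>x. v i x - v j x)) + energy D \<eta> (\<lambda>x. v i x - v j x) (\<lambda>x. v i x - v j x)"
      using exp[OF v(1)[of j] d, of 1] unfolding e1 by simp
    moreover have "m \<le> E (\<lambda>x. v j x + (1/2) * (v i x - v j x))"
      by (rule mle, rule V_space_add(1)[OF v(1) V_space_scale(1)[OF d]])
    ultimately show ?thesis
      using exp[OF v(1)[of j] d, of "1/2"] energy_coercive[OF \<eta> c(1) d] by (simp add: power2_eq_square)
  qed
  obtain u where u: "u \<in> V_space D" "(\<lambda>n. V_norm D (\<lambda>x. v n x - u x)) \<longlonglongrightarrow> 0"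
  proof (rule V_complete[of v, OF v(1)])
    fix e :: real assume "e > 0"
    then have "c * e\<^sup>2 / 4 > 0" using c by simp
    then obtain N where N: "inverse (real (Suc N)) < c * e\<^sup>2 / 4" using reals_Archimedean by blast
    have "V_norm D (\<lambda>x. v i x - v j x) < e" if "i \<ge> N" "j \<ge> N" for i j
    proof -
      have "inverse (real (Suc i)) \<le> inverse (real (Suc N))" "inverse (real (Suc j)) \<le> inverse (real (Suc N))"
        using that by (auto intro!: le_imp_inverse_le)
      then have "c * (V_norm D (\<lambda>x. v i x - v j x))\<^sup>2 < c * e\<^sup>2"
        using par[of i j] v(2)[of i] v(2)[of j] N by linarith
      then have "(V_norm D (\<lambda>x. v i x - v j x))\<^sup>2 < e\<^sup>2" using c(2) mult_less_cancel_left_pos by blast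
      then show ?thesis by (rule power2_less_imp_less) (use \<open>e > 0\<close> in simp)
    qed
    then show "\<exists>N. \<forall>m\<ge>N. \<forall>n\<ge>N. V_norm D (\<lambda>x. v m x - v n x) < e" by blast
  qed
  have "energy D \<eta> u w = F w" if w: "w \<in> V_space D" for w
  proof -
    obtain K where K: "K \<ge> 0" "AE x in lebesgue_on D. norm (\<eta> x) \<le> K" using Linf_spaceD[OF \<eta>] by blast
    have "(\<lambda>n. energy D \<eta> (v n) w - energy D \<eta> u w) \<longlonglongrightarrow> 0"
    proof (rule Lim_null_comparison)
      show "(\<lambda>n. K * V_norm D (\<lambda>x. v n x - u x) * V_norm D w) \<longlonglongrightarrow> 0"
        using u(2) by (auto intro!: tendsto_eq_intros)
      show "\<forall>\<^sub>F n in sequentially. norm (energy D \<eta> (v n) w - energy D \<eta> u w) \<le> K * V_norm D (\<lambda>x. v n x - u x) * V_norm D w"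
        using energy_bound[OF K(2,1) \<eta> V_space_diff(1)[OF v(1) u(1)] w]
        by (simp add: energy_diff_left[OF \<eta> v(1) u(1) w])
    qed
    then have lim: "(\<lambda>n. energy D \<eta> (v n) w) \<longlonglongrightarrow> energy D \<eta> u w" by (simp add: LIM_zero_iff)
    \<comment> \<open>Perturbing \<open>v n\<close> by \<open>t w\<close> cannot go below
      \<open>m\<close>, hence lowers the value by less than \<open>inverse (real (Suc n))\<close>.
      In the limit the quadratic in \<open>t\<close> has no constant term, and its linear
      coefficient must vanish.\<close>
    have "0 \<le> energy D \<eta> w w * t\<^sup>2 + 2 * (energy D \<eta> u w - F w) * t + 0" for t
    proof (rule LIMSEQ_le)
      show "(\<lambda>n. - inverse (real (Suc n))) \<longlonglongrightarrow> 0"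
        using tendsto_minus[OF LIMSEQ_inverse_real_of_nat] by simp
      show "(\<lambda>n. energy D \<eta> w w * t\<^sup>2 + 2 * (energy D \<eta> (v n) w - F w) * t + 0) \<longlonglongrightarrow>
          energy D \<eta> w w * t\<^sup>2 + 2 * (energy D \<eta> u w - F w) * t + 0"
        by (intro tendsto_intros lim)
      have "- inverse (real (Suc n)) \<le> energy D \<eta> w w * t\<^sup>2 + 2 * (energy D \<eta> (v n) w - F w) * t + 0" for n
      proof -
        have "m \<le> E (\<lambda>x. v n x + t * w x)"
          by (rule mle, rule V_space_add(1)[OF v(1) V_space_scale(1)[OF w]])
        then show ?thesis using exp[OF v(1)[of n] w, of t] v(2)[of n] by (simp add: mult_ac)
      qed
      then show "\<exists>N. \<forall>n\<ge>N. - inverse (real (Suc n)) \<le> energy D \<eta> w w * t\<^sup>2 + 2 * (energy D \<eta> (v n) w - F w) * t + 0"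
        by blast
    qed
    moreover have "energy D \<eta> w w \<ge> 0"
      by (rule order.trans[OF mult_nonneg_nonneg energy_coercive[OF \<eta> c(1) w]]) (use c(2) in auto)
    ultimately have "(energy D \<eta> u w - F w)\<^sup>2 \<le> energy D \<eta> w w * 0"
      by (rule quadratic_nonneg_discriminant)
    then show ?thesis by simp
  qed
  then show thesis using that u(1) by blast
qed

end

subsection \<open>Derivatives of the parametric solution\<close>

locale parametric_problem = bounded_open_domain D for D :: "'a::euclidean_space set" +
  fixes abar :: "'a \<Rightarrow> real" and \<psi> :: "nat \<Rightarrow> 'a \<Rightarrow> real" and F :: "('a \<Rightarrow> real) \<Rightarrow> real"
  assumes abar: "abar \<in> Linf_space D" and psi: "\<And>j. \<psi> j \<in> Linf_space D" and F: "F \<in> V_dual D"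
    and elliptic: "\<exists>c>0. AE x in lebesgue_on D. c \<le> abar x"
begin

abbreviation acoeff :: "(nat \<Rightarrow> real) \<Rightarrow> 'a \<Rightarrow> real" where
  "acoeff \<equiv> affine_coeff abar \<psi>"

text \<open>Finite support turns the coefficient into a finite sum, and small changes of a single
  coordinate preserve both conditions. Iterated partial derivatives at 0 involve no other
  parameters.\<close>

definition admissible :: "(nat \<Rightarrow> real) \<Rightarrow> bool" where
  "admissible y \<longleftrightarrow> finite {j. y j \<noteq> 0} \<and> (\<exists>c>0. AE x in lebesgue_on D. c \<le> acoeff y x)"

lemma acoeff_finite:
  assumes "finite S" "{j. y j \<noteq> 0} \<subseteq> S"
  shows "acoeff y x = abar x + (\<Sum>j\<in>S. y j * \<psi> j x)"
  unfolding affine_coeff_def using suminf_finite[OF assms(1), of "\<lambda>j. y j * \<psi> j x"] assms(2) by auto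

lemma acoeff_zero: "acoeff (\<lambda>_. 0) x = abar x"
  using acoeff_finite[of "{}" "\<lambda>_. 0"] by simp

lemma acoeff_upd:
  assumes "finite {j. y j \<noteq> 0}"
  shows "acoeff (y(j := y j + h)) x = acoeff y x + h * \<psi> j x"
proof -
  let ?S = "insert j {j. y j \<noteq> 0}"
  have f: "finite ?S" using assms by simp
  have "acoeff (y(j := y j + h)) x = abar x + (\<Sum>i\<in>?S. (y(j := y j + h)) i * \<psi> i x)"
    by (rule acoeff_finite[OF f]) auto
  also have "(\<Sum>i\<in>?S. (y(j := y j + h)) i * \<psi> i x) = (\<Sum>i\<in>?S. y i * \<psi> i x + (if i = j then h * \<psi> j x else 0))"
    by (intro sum.cong) (auto simp: algebra_simps)
  also have "\<dots> = (\<Sum>i\<in>?S. y i * \<psi> i x) + h * \<psi> j x"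
    using f by (simp add: sum.distrib)
  finally show ?thesis unfolding acoeff_finite[OF f subset_insertI, of x] by (simp only: add.assoc)
qed

lemma acoeff_upd_fun:
  "finite {j. y j \<noteq> 0} \<Longrightarrow> acoeff (y(j := y j + h)) = (\<lambda>x. acoeff y x + h * \<psi> j x)"
  using acoeff_upd by blast

lemma acoeff_Linf:
  assumes "finite {j. y j \<noteq> 0}" shows "acoeff y \<in> Linf_space D"
proof -
  have "(\<lambda>x. abar x + (\<Sum>j\<in>S. y j * \<psi> j x)) \<in> Linf_space D" if "finite S" for S
    using that
  proof (induction S)
    case (insert j S)
    have "(\<lambda>x. (abar x + (\<Sum>j\<in>S. y j * \<psi> j x)) + y j * \<psi> j x) \<in> Linf_space D"
      by (rule Linf_space_add[OF insert.IH Linf_space_scale[OF psi]])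
    then show ?case using insert.hyps by (simp add: algebra_simps)
  qed (simp add: abar)
  moreover have "acoeff y = (\<lambda>x. abar x + (\<Sum>j\<in>{j. y j \<noteq> 0}. y j * \<psi> j x))"
    using acoeff_finite[OF assms] by auto
  ultimately show ?thesis using assms by simp
qed

lemma admissible_zero: "admissible (\<lambda>_. 0)"
  unfolding admissible_def using elliptic by (simp add: acoeff_zero)

lemma admissible_upd:
  assumes "admissible y"
  obtains c \<delta> where "c > 0" "\<delta> > 0" "AE x in lebesgue_on D. c \<le> acoeff y x"
    "\<And>h. \<bar>h\<bar> < \<delta> \<Longrightarrow> admissible (y(j := y j + h)) \<and> (AE x in lebesgue_on D. c \<le> acoeff (y(j := y j + h)) x)"
proof -
  obtain c where c: "c > 0" "AE x in lebesgue_on D. c \<le> acoeff y x" and f: "finite {j. y j \<noteq> 0}"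
    using assms unfolding admissible_def by blast
  obtain K where K: "K \<ge> 0" "AE x in lebesgue_on D. norm (\<psi> j x) \<le> K" using Linf_spaceD[OF psi] by blast
  \<comment> \<open>Chosen so that the perturbation \<open>h * \<psi> j x\<close> stays below
    \<open>c / 2\<close>. The same lower bound \<open>c / 2\<close> then serves for all these
    \<open>h\<close>, as uniform coercivity requires.\<close>
  define \<delta> where "\<delta> = c / 2 / (K + 1)"
  have \<delta>: "\<delta> > 0" using c K by (simp add: \<delta>_def)
  have "admissible (y(j := y j + h)) \<and> (AE x in lebesgue_on D. c / 2 \<le> acoeff (y(j := y j + h)) x)"
    if h: "\<bar>h\<bar> < \<delta>" for h
  proof -
    have ae: "AE x in lebesgue_on D. c / 2 \<le> acoeff (y(j := y j + h)) x"
      using c(2) K(2)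
    proof eventually_elim
      case (elim x)
      have "\<bar>h * \<psi> j x\<bar> \<le> \<delta> * (K + 1)"
        unfolding abs_mult using h elim(2) K(1) by (intro mult_mono) auto
      also have "\<dots> = c / 2"
      proof -
        have k: "K + 1 \<noteq> 0" using K(1) by linarith
        show ?thesis using \<delta>_def nonzero_divide_eq_eq[OF k, of "c/2" \<delta>] by metis
      qed
      finally show ?case unfolding acoeff_upd[OF f] using elim(1) by linarith
    qed
    have "finite {i. (y(j := y j + h)) i \<noteq> 0}" by (rule finite_subset[of _ "insert j {j. y j \<noteq> 0}"]) (use f in auto)
    then show ?thesis unfolding admissible_def using ae c(1) by (auto intro!: exI[of _ "c/2"])
  qed
  moreover have "AE x in lebesgue_on D. c / 2 \<le> acoeff y x"
    using c(2) by eventually_elim (use c(1) in simp)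
  ultimately show thesis using that[of "c/2" \<delta>] c(1) \<delta> by simp
qed

section \<open>The formally differentiated problem and its identification with the
  derivatives\<close>

definition deg :: "(nat \<Rightarrow> nat) \<Rightarrow> nat" where "deg \<mu> = (\<Sum>j | \<mu> j \<noteq> 0. \<mu> j)"

lemma deg_eq: "finite S \<Longrightarrow> {j. \<mu> j \<noteq> 0} \<subseteq> S \<Longrightarrow> deg \<mu> = (\<Sum>j\<in>S. \<mu> j)"
  unfolding deg_def by (intro sum.mono_neutral_left) auto

lemma deg_dec:
  assumes "\<mu> \<in> multiindices" "\<mu> j \<noteq> 0"
  shows "deg (\<mu>(j := \<mu> j - 1)) = deg \<mu> - 1" "deg \<mu> > 0"
proof -
  have f: "finite {j. \<mu> j \<noteq> 0}" using assms by (simp add: multiindices_def)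
  have "deg (\<mu>(j := \<mu> j - 1)) = (\<Sum>i\<in>{j. \<mu> j \<noteq> 0}. (\<mu>(j := \<mu> j - 1)) i)"
    by (rule deg_eq[OF f]) (use assms in auto)
  also have "\<dots> = (\<mu> j - 1) + (\<Sum>i\<in>{j. \<mu> j \<noteq> 0} - {j}. \<mu> i)"
    using assms(2) f by (subst sum.remove[of _ j]) auto
  moreover have "deg \<mu> = \<mu> j + (\<Sum>i\<in>{j. \<mu> j \<noteq> 0} - {j}. \<mu> i)"
    unfolding deg_def using assms(2) f by (subst sum.remove[of _ j]) auto
  ultimately show "deg (\<mu>(j := \<mu> j - 1)) = deg \<mu> - 1" "deg \<mu> > 0" using assms(2) by auto
qed

lemma multiindices_upd: "\<mu> \<in> multiindices \<Longrightarrow> \<mu>(j := k) \<in> multiindices"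
proof -
  assume "\<mu> \<in> multiindices"
  then have "finite (insert j {j. \<mu> j \<noteq> 0})" unfolding multiindices_def by simp
  moreover have "{i. (\<mu>(j := k)) i \<noteq> 0} \<subseteq> insert j {j. \<mu> j \<noteq> 0}" by auto
  ultimately show ?thesis unfolding multiindices_def mem_Collect_eq by (rule rev_finite_subset)
qed

text \<open>The coefficient is affine in the parameters, so Leibniz' rule leaves only the terms with
  one derivative on it; that derivative is \<open>\<psi> j\<close>, and the term occurs
  \<open>\<mu> j\<close> times. The first argument is meant to be the total degree of
  \<open>\<mu>\<close>, which makes the recursion structural.\<close>

fun dsol :: "nat \<Rightarrow> (nat \<Rightarrow> nat) \<Rightarrow> (nat \<Rightarrow> real) \<Rightarrow> 'a \<Rightarrow> real" where
  "dsol 0 \<mu> y = param_solution D abar \<psi> F y"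
| "dsol (Suc n) \<mu> y = (SOME u. u \<in> V_space D \<and> (\<forall>v\<in>V_space D.
     energy D (acoeff y) u v = - (\<Sum>j | \<mu> j \<noteq> 0. real (\<mu> j) * energy D (\<psi> j) (dsol n (\<mu>(j := \<mu> j - 1)) y) v)))"

text \<open>\<open>dsolution \<mu>\<close> is \<open>\<partial>\<^sup>\<mu> u\<close>, defined by the formally differentiated equation.\<close>

definition dsolution :: "(nat \<Rightarrow> nat) \<Rightarrow> (nat \<Rightarrow> real) \<Rightarrow> 'a \<Rightarrow> real" where
  "dsolution \<mu> = dsol (deg \<mu>) \<mu>"

lemma F_add: "v \<in> V_space D \<Longrightarrow> w \<in> V_space D \<Longrightarrow> F (\<lambda>x. v x + w x) = F v + F w"
  and F_scale: "v \<in> V_space D \<Longrightarrow> F (\<lambda>x. r * v x) = r * F v"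
  using F unfolding V_dual_def by auto

lemma param_solution_eq:
  assumes "admissible y"
  shows "param_solution D abar \<psi> F y \<in> V_space D"
    "\<And>v. v \<in> V_space D \<Longrightarrow> energy D (acoeff y) (param_solution D abar \<psi> F y) v = F v"
proof -
  obtain c where c: "c > 0" "AE x in lebesgue_on D. c \<le> acoeff y x" and f: "finite {j. y j \<noteq> 0}"
    using assms unfolding admissible_def by blast
  obtain C where C: "\<And>v. v \<in> V_space D \<Longrightarrow> \<bar>F v\<bar> \<le> C * V_norm D v" using F unfolding V_dual_def by blast
  obtain u where "u \<in> V_space D" "\<And>v. v \<in> V_space D \<Longrightarrow> energy D (acoeff y) u v = F v"
    using energy_Riesz[OF acoeff_Linf[OF f] c(2,1) F_add F_scale C] by blast
  then have "is_weak_solution D (acoeff y) F u" unfolding is_weak_solution_def energy_def by blast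
  then have "is_weak_solution D (acoeff y) F (param_solution D abar \<psi> F y)"
    unfolding param_solution_def by (rule someI[of "is_weak_solution D (acoeff y) F"])
  then show "param_solution D abar \<psi> F y \<in> V_space D"
    "\<And>v. v \<in> V_space D \<Longrightarrow> energy D (acoeff y) (param_solution D abar \<psi> F y) v = F v"
    unfolding is_weak_solution_def energy_def by blast+
qed

lemma psi_bounds:
  obtains K where "\<And>j. K j \<ge> 0" "\<And>j. AE x in lebesgue_on D. norm (\<psi> j x) \<le> K j"
proof -
  have "\<forall>j. \<exists>K. K \<ge> 0 \<and> (AE x in lebesgue_on D. norm (\<psi> j x) \<le> K)" using Linf_spaceD[OF psi] by metis
  from choice[OF this] show thesis using that by blast
qed

text \<open>By induction on the degree, the right-hand side is a bounded linear functional on V, so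
  \<open>energy_Riesz\<close> provides a witness for the choice in \<open>dsol\<close>. Degree 0
  fits the same formula because the sum is then empty.\<close>

lemma dsolution_eq:
  assumes y: "admissible y" and "\<mu> \<in> multiindices"
  shows "dsolution \<mu> y \<in> V_space D \<and> (\<forall>v\<in>V_space D. energy D (acoeff y) (dsolution \<mu> y) v =
     (if deg \<mu> = 0 then F v else 0) - (\<Sum>j | \<mu> j \<noteq> 0. real (\<mu> j) * energy D (\<psi> j) (dsolution (\<mu>(j := \<mu> j - 1)) y) v))"
  using assms(2)
proof (induction "deg \<mu>" arbitrary: \<mu>)
  case 0
  have "finite {j. \<mu> j \<noteq> 0}" using 0 by (simp add: multiindices_def)
  then have e: "{j. \<mu> j \<noteq> 0} = {}" using 0(1) unfolding deg_def by auto
  have d: "dsolution \<mu> = param_solution D abar \<psi> F" unfolding dsolution_def 0(1)[symmetric] by (rule ext) simp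
  show ?case unfolding d e 0(1)[symmetric] using param_solution_eq[OF y] by simp
next
  case (Suc n)
  obtain c where c: "c > 0" "AE x in lebesgue_on D. c \<le> acoeff y x" and f: "finite {j. y j \<noteq> 0}"
    using y unfolding admissible_def by blast
  have fin: "finite {j. \<mu> j \<noteq> 0}" using Suc.prems by (simp add: multiindices_def)
  have e: "dsol n (\<mu>(j := \<mu> j - 1)) y = dsolution (\<mu>(j := \<mu> j - 1)) y" if "\<mu> j \<noteq> 0" for j
    unfolding dsolution_def using deg_dec[OF Suc.prems that] Suc(2)[symmetric] by simp
  have V: "dsolution (\<mu>(j := \<mu> j - 1)) y \<in> V_space D" if "\<mu> j \<noteq> 0" for j
    using Suc(1)[of "\<mu>(j := \<mu> j - 1)"] deg_dec[OF Suc.prems that] Suc(2) multiindices_upd[OF Suc.prems] by simp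
  define R where "R v = - (\<Sum>j | \<mu> j \<noteq> 0. real (\<mu> j) * energy D (\<psi> j) (dsolution (\<mu>(j := \<mu> j - 1)) y) v)" for v
  have Radd: "R (\<lambda>x. v x + w x) = R v + R w" if "v \<in> V_space D" "w \<in> V_space D" for v w
  proof -
    have "energy D (\<psi> j) (dsolution (\<mu>(j := \<mu> j - 1)) y) (\<lambda>x. v x + w x) =
      energy D (\<psi> j) (dsolution (\<mu>(j := \<mu> j - 1)) y) v + energy D (\<psi> j) (dsolution (\<mu>(j := \<mu> j - 1)) y) w"
      if j: "\<mu> j \<noteq> 0" for j
      using energy_add_left[OF psi \<open>v \<in> V_space D\<close> \<open>w \<in> V_space D\<close> V[OF j]] by (simp add: energy_commute)
    then show ?thesis unfolding R_def by (simp add: distrib_left sum.distrib)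
  qed
  have Rscale: "R (\<lambda>x. r * v x) = r * R v" if "v \<in> V_space D" for v r
  proof -
    have "energy D (\<psi> j) (dsolution (\<mu>(j := \<mu> j - 1)) y) (\<lambda>x. r * v x) =
      r * energy D (\<psi> j) (dsolution (\<mu>(j := \<mu> j - 1)) y) v"
      if j: "\<mu> j \<noteq> 0" for j
      using energy_scale_left[OF psi \<open>v \<in> V_space D\<close> V[OF j]] by (simp add: energy_commute)
    then show ?thesis unfolding R_def by (simp add: sum_distrib_left mult_ac)
  qed
  obtain K where K: "\<And>j. K j \<ge> 0" "\<And>j. AE x in lebesgue_on D. norm (\<psi> j x) \<le> K j" using psi_bounds by blast
  have Rbd: "\<bar>R v\<bar> \<le> (\<Sum>j | \<mu> j \<noteq> 0. real (\<mu> j) * (K j * V_norm D (dsolution (\<mu>(j := \<mu> j - 1)) y))) * V_norm D v"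
    if v: "v \<in> V_space D" for v
  proof -
    have "\<bar>R v\<bar> \<le> (\<Sum>j | \<mu> j \<noteq> 0. \<bar>real (\<mu> j) * energy D (\<psi> j) (dsolution (\<mu>(j := \<mu> j - 1)) y) v\<bar>)"
      unfolding R_def abs_minus_cancel by (rule sum_abs)
    also have "\<dots> \<le> (\<Sum>j | \<mu> j \<noteq> 0. real (\<mu> j) * (K j * V_norm D (dsolution (\<mu>(j := \<mu> j - 1)) y) * V_norm D v))"
      using energy_bound[OF K(2,1) psi V v] by (intro sum_mono) (auto simp: abs_mult mult.assoc intro!: mult_left_mono)
    finally show ?thesis by (simp only: sum_distrib_right mult.assoc)
  qed
  obtain u where u: "u \<in> V_space D" "\<And>v. v \<in> V_space D \<Longrightarrow> energy D (acoeff y) u v = R v"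
    using energy_Riesz[OF acoeff_Linf[OF f] c(2,1) Radd Rscale Rbd] by blast
  let ?P = "\<lambda>u. u \<in> V_space D \<and> (\<forall>v\<in>V_space D.
     energy D (acoeff y) u v = - (\<Sum>j | \<mu> j \<noteq> 0. real (\<mu> j) * energy D (\<psi> j) (dsol n (\<mu>(j := \<mu> j - 1)) y) v))"
  have "?P u" using u e unfolding R_def by simp
  then have "?P (dsolution \<mu> y)" unfolding dsolution_def Suc(2)[symmetric] dsol.simps by (rule someI[of ?P])
  then show ?case using e Suc(2) by simp
qed

lemmas dsolution_V = conjunct1[OF dsolution_eq]
lemmas dsolution_energy = bspec[OF conjunct2[OF dsolution_eq]]

text \<open>Equality in the quotient of V by functions of seminorm zero. Membership is part of it
  because the seminorm of a function without a weak gradient carries no information.\<close>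

definition V_eq :: "('a \<Rightarrow> real) \<Rightarrow> ('a \<Rightarrow> real) \<Rightarrow> bool" where
  "V_eq u w \<longleftrightarrow> u \<in> V_space D \<and> w \<in> V_space D \<and> V_norm D (\<lambda>x. u x - w x) = 0"

text \<open>The difference \<open>E \<mu> h\<close> solves the problem with the shifted coefficient,
  whose right-hand side consists of the differences of lower degree and of \<open>h\<close> times
  the form of \<open>\<psi> j\<close> at \<open>dsolution \<mu> y\<close>; the functional
  \<open>F\<close> cancels. \<open>B h\<close> bounds this right-hand side, and coercivity is
  uniform in small \<open>h\<close>.\<close>

lemma dsolution_continuous:
  assumes y: "admissible y" and "\<mu> \<in> multiindices"
  shows "((\<lambda>h. V_norm D (\<lambda>x. dsolution \<mu> (y(j := y j + h)) x - dsolution \<mu> y x)) \<longlongrightarrow> 0) (at 0)"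
  using assms(2)
proof (induction "deg \<mu>" arbitrary: \<mu> rule: less_induct)
  case less
  obtain c \<delta> where c: "c > 0" "\<delta> > 0" "AE x in lebesgue_on D. c \<le> acoeff y x"
    and adm: "\<And>h. \<bar>h\<bar> < \<delta> \<Longrightarrow> admissible (y(j := y j + h))"
    and ch: "\<And>h. \<bar>h\<bar> < \<delta> \<Longrightarrow> AE x in lebesgue_on D. c \<le> acoeff (y(j := y j + h)) x"
    using admissible_upd[OF y, of j] by metis
  have f: "finite {j. y j \<noteq> 0}" using y unfolding admissible_def by blast
  have fin: "finite {j. \<mu> j \<noteq> 0}" using less.prems by (simp add: multiindices_def)
  obtain K where K: "\<And>j. K j \<ge> 0" "\<And>j. AE x in lebesgue_on D. norm (\<psi> j x) \<le> K j" using psi_bounds by blast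
  define E where "E \<mu> h = (\<lambda>x. dsolution \<mu> (y(j := y j + h)) x - dsolution \<mu> y x)" for \<mu> h
  define B where "B h = (\<Sum>i | \<mu> i \<noteq> 0. real (\<mu> i) * (K i * V_norm D (E (\<mu>(i := \<mu> i - 1)) h))) + \<bar>h\<bar> * (K j * V_norm D (dsolution \<mu> y))" for h
  have lim: "(B \<longlongrightarrow> 0) (at 0)"
  proof -
    have "((\<lambda>h. V_norm D (E (\<mu>(i := \<mu> i - 1)) h)) \<longlongrightarrow> 0) (at 0)" if "\<mu> i \<noteq> 0" for i
      unfolding E_def using less.hyps[of "\<mu>(i := \<mu> i - 1)"] deg_dec[OF less.prems that] multiindices_upd[OF less.prems] by simp
    then have "(B \<longlongrightarrow> (\<Sum>i | \<mu> i \<noteq> 0. real (\<mu> i) * (K i * 0)) + \<bar>0\<bar> * (K j * V_norm D (dsolution \<mu> y))) (at 0)"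
      unfolding B_def[abs_def] by (intro tendsto_intros) auto
    then show ?thesis by simp
  qed
  have B0: "B h \<ge> 0" for h unfolding B_def
    by (intro add_nonneg_nonneg sum_nonneg mult_nonneg_nonneg K V_norm_nonneg) auto
  have est: "V_norm D (E \<mu> h) \<le> B h / c" if h: "\<bar>h\<bar> < \<delta>" for h
  proof -
    let ?yh = "y(j := y j + h)"
    note ah = adm[OF h]
    have fh: "finite {i. ?yh i \<noteq> 0}" using ah unfolding admissible_def by blast
    have EV: "E \<mu>' h \<in> V_space D" if "\<mu>' \<in> multiindices" for \<mu>'
      unfolding E_def by (rule V_space_diff(1)[OF dsolution_V[OF ah that] dsolution_V[OF y that]])
    have "\<bar>energy D (acoeff ?yh) (E \<mu> h) v\<bar> \<le> B h * V_norm D v" if v: "v \<in> V_space D" for v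
    proof -
      have "energy D (acoeff ?yh) (E \<mu> h) v = energy D (acoeff ?yh) (dsolution \<mu> ?yh) v - energy D (acoeff ?yh) (dsolution \<mu> y) v"
        unfolding E_def by (rule energy_diff_left[OF acoeff_Linf[OF fh] dsolution_V[OF ah less.prems] dsolution_V[OF y less.prems] v])
      also have "energy D (acoeff ?yh) (dsolution \<mu> y) v = energy D (acoeff y) (dsolution \<mu> y) v + h * energy D (\<psi> j) (dsolution \<mu> y) v"
        using energy_add_coeff[OF acoeff_Linf[OF f] psi dsolution_V[OF y less.prems] v, of h j] unfolding acoeff_upd_fun[OF f] .
      finally have "energy D (acoeff ?yh) (E \<mu> h) v =
         - (\<Sum>i | \<mu> i \<noteq> 0. real (\<mu> i) * energy D (\<psi> i) (E (\<mu>(i := \<mu> i - 1)) h) v) - h * energy D (\<psi> j) (dsolution \<mu> y) v"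
        unfolding dsolution_energy[OF ah less.prems v] dsolution_energy[OF y less.prems v] E_def
        using energy_diff_left[OF psi dsolution_V[OF ah multiindices_upd[OF less.prems]] dsolution_V[OF y multiindices_upd[OF less.prems]] v]
        by (simp add: right_diff_distrib sum_subtractf del: fun_upd_apply)
      then have "\<bar>energy D (acoeff ?yh) (E \<mu> h) v\<bar> \<le>
         (\<Sum>i | \<mu> i \<noteq> 0. \<bar>real (\<mu> i) * energy D (\<psi> i) (E (\<mu>(i := \<mu> i - 1)) h) v\<bar>) + \<bar>h * energy D (\<psi> j) (dsolution \<mu> y) v\<bar>"
        using sum_abs[of "\<lambda>i. real (\<mu> i) * energy D (\<psi> i) (E (\<mu>(i := \<mu> i - 1)) h) v" "{i. \<mu> i \<noteq> 0}"] by linarith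
      also have "\<dots> \<le> (\<Sum>i | \<mu> i \<noteq> 0. real (\<mu> i) * (K i * V_norm D (E (\<mu>(i := \<mu> i - 1)) h) * V_norm D v)) + \<bar>h\<bar> * (K j * V_norm D (dsolution \<mu> y) * V_norm D v)"
        using energy_bound[OF K(2,1) psi EV[OF multiindices_upd[OF less.prems]] v]
          energy_bound[OF K(2,1) psi dsolution_V[OF y less.prems] v]
        by (intro add_mono sum_mono) (auto simp: abs_mult mult.assoc intro!: mult_left_mono)
      also have "\<dots> = B h * V_norm D v"
        unfolding B_def by (simp only: distrib_right sum_distrib_right mult.assoc)
      finally show ?thesis .
    qed
    then have "c * V_norm D (E \<mu> h) \<le> B h \<or> V_norm D (E \<mu> h) = 0"
      by (rule energy_estimate[OF acoeff_Linf[OF fh] ch[OF h] EV[OF less.prems]])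
    then show ?thesis using c(1) B0[of h] by (auto simp: field_simps)
  qed
  have "((\<lambda>h. V_norm D (E \<mu> h)) \<longlongrightarrow> 0) (at 0)"
  proof (rule Lim_null_comparison)
    show "((\<lambda>h. B h / c) \<longlongrightarrow> 0) (at 0)" using tendsto_divide[OF lim tendsto_const, of c] c(1) by simp
    have "eventually (\<lambda>h::real. \<bar>h\<bar> < \<delta>) (at 0)"
      unfolding eventually_at using c(2) by (auto intro!: exI[of _ \<delta>])
    then show "\<forall>\<^sub>F h in at 0. norm (V_norm D (E \<mu> h)) \<le> B h / c"
      by eventually_elim (use est V_norm_nonneg in auto)
  qed
  then show ?case unfolding E_def .
qed

text \<open>The defect \<open>Q \<mu> h\<close> between difference quotient and candidate solves the
  unshifted problem, with the defects of lower degree and the form of \<open>\<psi> j\<close> at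
  \<open>E \<mu> h\<close> on the right. The former vanish by induction, the latter by
  \<open>dsolution_continuous\<close>.\<close>

lemma dsolution_derivative:
  assumes y: "admissible y" and "\<mu> \<in> multiindices"
  shows "((\<lambda>h. V_norm D (\<lambda>x. (dsolution \<mu> (y(j := y j + h)) x - dsolution \<mu> y x) / h - dsolution (\<mu>(j := Suc (\<mu> j))) y x)) \<longlongrightarrow> 0) (at 0)"
  using assms(2)
proof (induction "deg \<mu>" arbitrary: \<mu> rule: less_induct)
  case less
  obtain c \<delta> where c: "c > 0" "\<delta> > 0" "AE x in lebesgue_on D. c \<le> acoeff y x"
    and adm: "\<And>h. \<bar>h\<bar> < \<delta> \<Longrightarrow> admissible (y(j := y j + h))"
    using admissible_upd[OF y, of j] by metis
  have f: "finite {j. y j \<noteq> 0}" using y unfolding admissible_def by blast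
  have fin: "finite {j. \<mu> j \<noteq> 0}" using less.prems by (simp add: multiindices_def)
  obtain K where K: "\<And>j. K j \<ge> 0" "\<And>j. AE x in lebesgue_on D. norm (\<psi> j x) \<le> K j" using psi_bounds by blast
  define E where "E \<mu> h = (\<lambda>x. dsolution \<mu> (y(j := y j + h)) x - dsolution \<mu> y x)" for \<mu> h
  define Q where "Q \<mu> h = (\<lambda>x. inverse h * E \<mu> h x - dsolution (\<mu>(j := Suc (\<mu> j))) y x)" for \<mu> h
  define B where "B h = (\<Sum>i | \<mu> i \<noteq> 0. real (\<mu> i) * (K i * V_norm D (Q (\<mu>(i := \<mu> i - 1)) h))) + K j * V_norm D (E \<mu> h)" for h
  have lim: "(B \<longlongrightarrow> 0) (at 0)"
  proof -
    have "((\<lambda>h. V_norm D (Q (\<mu>(i := \<mu> i - 1)) h)) \<longlongrightarrow> 0) (at 0)" if "\<mu> i \<noteq> 0" for i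
      unfolding Q_def E_def using less.hyps[of "\<mu>(i := \<mu> i - 1)"] deg_dec[OF less.prems that] multiindices_upd[OF less.prems]
      by (simp add: divide_inverse mult.commute)
    moreover have "((\<lambda>h. V_norm D (E \<mu> h)) \<longlongrightarrow> 0) (at 0)"
      unfolding E_def by (rule dsolution_continuous[OF y less.prems])
    ultimately have "(B \<longlongrightarrow> (\<Sum>i | \<mu> i \<noteq> 0. real (\<mu> i) * (K i * 0)) + K j * 0) (at 0)"
      unfolding B_def[abs_def] by (intro tendsto_intros) auto
    then show ?thesis by simp
  qed
  have B0: "B h \<ge> 0" for h unfolding B_def
    by (intro add_nonneg_nonneg sum_nonneg mult_nonneg_nonneg K V_norm_nonneg) auto
  have est: "V_norm D (Q \<mu> h) \<le> B h / c" if h: "\<bar>h\<bar> < \<delta>" "h \<noteq> 0" for h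
  proof -
    let ?yh = "y(j := y j + h)"
    note ah = adm[OF h(1)]
    have fh: "finite {i. ?yh i \<noteq> 0}" using ah unfolding admissible_def by blast
    have EV: "E \<mu>' h \<in> V_space D" if "\<mu>' \<in> multiindices" for \<mu>'
      unfolding E_def by (rule V_space_diff(1)[OF dsolution_V[OF ah that] dsolution_V[OF y that]])
    have QV: "Q \<mu>' h \<in> V_space D" if "\<mu>' \<in> multiindices" for \<mu>'
      unfolding Q_def by (rule V_space_diff(1)[OF V_space_scale(1)[OF EV[OF that]] dsolution_V[OF y multiindices_upd[OF that]]])
    have Qen: "energy D \<eta> (Q \<mu>' h) v = inverse h * energy D \<eta> (E \<mu>' h) v - energy D \<eta> (dsolution (\<mu>'(j := Suc (\<mu>' j))) y) v"
      if "\<mu>' \<in> multiindices" "\<eta> \<in> Linf_space D" "v \<in> V_space D" for \<mu>' \<eta> v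
      unfolding Q_def
      using energy_diff_left[OF that(2) V_space_scale(1)[OF EV[OF that(1)]] dsolution_V[OF y multiindices_upd[OF that(1)]] that(3)]
        energy_scale_left[OF that(2) EV[OF that(1)] that(3)] by simp
    have "\<bar>energy D (acoeff y) (Q \<mu> h) v\<bar> \<le> B h * V_norm D v" if v: "v \<in> V_space D" for v
    proof -
      let ?en = "\<lambda>i w. energy D (\<psi> i) w v"
      have "energy D (acoeff y) (E \<mu> h) v = energy D (acoeff y) (dsolution \<mu> ?yh) v - energy D (acoeff y) (dsolution \<mu> y) v"
        unfolding E_def by (rule energy_diff_left[OF acoeff_Linf[OF f] dsolution_V[OF ah less.prems] dsolution_V[OF y less.prems] v])
      moreover have "energy D (acoeff ?yh) (dsolution \<mu> ?yh) v = energy D (acoeff y) (dsolution \<mu> ?yh) v + h * ?en j (dsolution \<mu> ?yh)"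
        using energy_add_coeff[OF acoeff_Linf[OF f] psi dsolution_V[OF ah less.prems] v, of h j] unfolding acoeff_upd_fun[OF f] .
      ultimately have e1: "energy D (acoeff y) (E \<mu> h) v =
         - (\<Sum>i | \<mu> i \<noteq> 0. real (\<mu> i) * ?en i (E (\<mu>(i := \<mu> i - 1)) h)) - h * ?en j (dsolution \<mu> ?yh)"
        unfolding dsolution_energy[OF ah less.prems v] dsolution_energy[OF y less.prems v] E_def
        using energy_diff_left[OF psi dsolution_V[OF ah multiindices_upd[OF less.prems]] dsolution_V[OF y multiindices_upd[OF less.prems]] v]
        by (simp add: right_diff_distrib sum_subtractf)
      let ?\<mu>j = "\<mu>(j := Suc (\<mu> j))"
      let ?S = "insert j {i. \<mu> i \<noteq> 0}"
      have "deg ?\<mu>j \<noteq> 0" using deg_dec(2)[OF multiindices_upd[OF less.prems], of j "Suc (\<mu> j)" j] by simp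
      then have "energy D (acoeff y) (dsolution ?\<mu>j y) v = - (\<Sum>i | ?\<mu>j i \<noteq> 0. real (?\<mu>j i) * ?en i (dsolution (?\<mu>j(i := ?\<mu>j i - 1)) y))"
        using dsolution_energy[OF y multiindices_upd[OF less.prems] v] by simp
      also have "{i. ?\<mu>j i \<noteq> 0} = ?S" by auto
      \<comment> \<open>For \<open>i = j\<close> the factor is \<open>\<mu> j + 1\<close>: the part
        \<open>\<mu> j\<close> matches the recursion for the defects, and the remaining 1 gives the
        extra term at \<open>dsolution \<mu> y\<close>.\<close>
      also have "(\<Sum>i\<in>?S. real (?\<mu>j i) * ?en i (dsolution (?\<mu>j(i := ?\<mu>j i - 1)) y)) =
        (\<Sum>i\<in>?S. real (\<mu> i) * ?en i (dsolution ((\<mu>(i := \<mu> i - 1))(j := Suc ((\<mu>(i := \<mu> i - 1)) j))) y) + (if i = j then ?en j (dsolution \<mu> y) else 0))"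
      proof (rule sum.cong[OF refl])
        fix i
        show "real (?\<mu>j i) * ?en i (dsolution (?\<mu>j(i := ?\<mu>j i - 1)) y) =
          real (\<mu> i) * ?en i (dsolution ((\<mu>(i := \<mu> i - 1))(j := Suc ((\<mu>(i := \<mu> i - 1)) j))) y) + (if i = j then ?en j (dsolution \<mu> y) else 0)"
        proof (cases "i = j")
          case True
          then show ?thesis by (cases "\<mu> j = 0") (auto simp: algebra_simps fun_upd_idem)
        next
          case False
          then show ?thesis by (simp add: fun_upd_twist)
        qed
      qed
      also have "\<dots> = (\<Sum>i\<in>?S. real (\<mu> i) * ?en i (dsolution ((\<mu>(i := \<mu> i - 1))(j := Suc ((\<mu>(i := \<mu> i - 1)) j))) y)) + ?en j (dsolution \<mu> y)"
        using fin by (simp add: sum.distrib)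
      also have "(\<Sum>i\<in>?S. real (\<mu> i) * ?en i (dsolution ((\<mu>(i := \<mu> i - 1))(j := Suc ((\<mu>(i := \<mu> i - 1)) j))) y)) =
         (\<Sum>i | \<mu> i \<noteq> 0. real (\<mu> i) * ?en i (dsolution ((\<mu>(i := \<mu> i - 1))(j := Suc ((\<mu>(i := \<mu> i - 1)) j))) y))"
        using fin by (intro sum.mono_neutral_right) auto
      finally have e2: "energy D (acoeff y) (dsolution ?\<mu>j y) v =
         - ((\<Sum>i | \<mu> i \<noteq> 0. real (\<mu> i) * ?en i (dsolution ((\<mu>(i := \<mu> i - 1))(j := Suc ((\<mu>(i := \<mu> i - 1)) j))) y)) + ?en j (dsolution \<mu> y))" .
      have e3: "?en j (E \<mu> h) = ?en j (dsolution \<mu> ?yh) - ?en j (dsolution \<mu> y)"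
        unfolding E_def by (rule energy_diff_left[OF psi dsolution_V[OF ah less.prems] dsolution_V[OF y less.prems] v])
      have "(\<Sum>i | \<mu> i \<noteq> 0. real (\<mu> i) * ?en i (Q (\<mu>(i := \<mu> i - 1)) h)) =
         inverse h * (\<Sum>i | \<mu> i \<noteq> 0. real (\<mu> i) * ?en i (E (\<mu>(i := \<mu> i - 1)) h)) -
         (\<Sum>i | \<mu> i \<noteq> 0. real (\<mu> i) * ?en i (dsolution ((\<mu>(i := \<mu> i - 1))(j := Suc ((\<mu>(i := \<mu> i - 1)) j))) y))"
        unfolding Qen[OF multiindices_upd[OF less.prems] psi v] sum_distrib_left sum_subtractf[symmetric]
        by (rule sum.cong[OF refl]) (simp add: right_diff_distrib mult_ac)
      moreover have "inverse h * energy D (acoeff y) (E \<mu> h) v =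
         - (inverse h * (\<Sum>i | \<mu> i \<noteq> 0. real (\<mu> i) * ?en i (E (\<mu>(i := \<mu> i - 1)) h))) - ?en j (dsolution \<mu> ?yh)"
        unfolding e1 using h(2) by (simp add: field_simps)
      ultimately have "energy D (acoeff y) (Q \<mu> h) v = - (\<Sum>i | \<mu> i \<noteq> 0. real (\<mu> i) * ?en i (Q (\<mu>(i := \<mu> i - 1)) h)) - ?en j (E \<mu> h)"
        unfolding Qen[OF less.prems acoeff_Linf[OF f] v] e2 e3 by linarith
      then have "\<bar>energy D (acoeff y) (Q \<mu> h) v\<bar> \<le>
         (\<Sum>i | \<mu> i \<noteq> 0. \<bar>real (\<mu> i) * ?en i (Q (\<mu>(i := \<mu> i - 1)) h)\<bar>) + \<bar>?en j (E \<mu> h)\<bar>"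
        using sum_abs[of "\<lambda>i. real (\<mu> i) * ?en i (Q (\<mu>(i := \<mu> i - 1)) h)" "{i. \<mu> i \<noteq> 0}"] by linarith
      also have "\<dots> \<le> (\<Sum>i | \<mu> i \<noteq> 0. real (\<mu> i) * (K i * V_norm D (Q (\<mu>(i := \<mu> i - 1)) h) * V_norm D v)) + K j * V_norm D (E \<mu> h) * V_norm D v"
        using energy_bound[OF K(2,1) psi QV[OF multiindices_upd[OF less.prems]] v]
          energy_bound[OF K(2,1) psi EV[OF less.prems] v]
        by (intro add_mono sum_mono) (auto simp: abs_mult mult.assoc intro!: mult_left_mono)
      also have "\<dots> = B h * V_norm D v"
        unfolding B_def by (simp only: distrib_right sum_distrib_right mult.assoc)
      finally show ?thesis .
    qed
    then have "c * V_norm D (Q \<mu> h) \<le> B h \<or> V_norm D (Q \<mu> h) = 0"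
      by (rule energy_estimate[OF acoeff_Linf[OF f] c(3) QV[OF less.prems]])
    then show ?thesis using c(1) B0[of h] by (auto simp: field_simps)
  qed
  have "((\<lambda>h. V_norm D (Q \<mu> h)) \<longlongrightarrow> 0) (at 0)"
  proof (rule Lim_null_comparison)
    show "((\<lambda>h. B h / c) \<longlongrightarrow> 0) (at 0)" using tendsto_divide[OF lim tendsto_const, of c] c(1) by simp
    have "eventually (\<lambda>h::real. \<bar>h\<bar> < \<delta> \<and> h \<noteq> 0) (at 0)"
      unfolding eventually_at using c(2) by (auto intro!: exI[of _ \<delta>])
    then show "\<forall>\<^sub>F h in at 0. norm (V_norm D (Q \<mu> h)) \<le> B h / c"
      by eventually_elim (use est V_norm_nonneg in auto)
  qed
  then show ?case unfolding Q_def E_def by (simp add: divide_inverse mult.commute)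
qed

text \<open>Replacing \<open>G\<close> by \<open>dsolution \<mu>\<close> changes difference
  quotients only by elements of seminorm zero, so a derivative exists. Any other choice is a limit
  of the same quotients and hence agrees with it in V. Assuming only \<open>V_eq\<close> for
  \<open>G\<close> is what allows the step to be iterated.\<close>

lemma V_partial_dsolution:
  assumes \<mu>: "\<mu> \<in> multiindices" and G: "\<And>y. admissible y \<Longrightarrow> V_eq (G y) (dsolution \<mu> y)" and y: "admissible y"
  shows "V_eq (V_partial D j G y) (dsolution (\<mu>(j := Suc (\<mu> j))) y)"
proof -
  define w where "w = dsolution (\<mu>(j := Suc (\<mu> j))) y"
  have wV: "w \<in> V_space D" unfolding w_def by (rule dsolution_V[OF y multiindices_upd[OF \<mu>]])
  obtain \<delta> where \<delta>: "\<delta> > 0" and adm: "\<And>h. \<bar>h\<bar> < \<delta> \<Longrightarrow> admissible (y(j := y j + h))"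
    using admissible_upd[OF y, of j] by metis
  have ev: "eventually (\<lambda>h::real. \<bar>h\<bar> < \<delta> \<and> h \<noteq> 0) (at 0)"
    unfolding eventually_at using \<delta> by (auto intro!: exI[of _ \<delta>])
  define q where "q h = (\<lambda>x. (G (y(j := y j + h)) x - G y x) / h)" for h
  have qV: "q h \<in> V_space D" if "\<bar>h\<bar> < \<delta>" for h
    using V_space_scale(1)[OF V_space_diff(1)[of "G (y(j := y j + h))" "G y"], of "inverse h"] G[OF adm[OF that]] G[OF y]
    unfolding V_eq_def q_def by (simp add: divide_inverse mult.commute)
  have "((\<lambda>h. V_norm D (\<lambda>x. q h x - w x)) \<longlongrightarrow> 0) (at 0)"
  proof (rule Lim_null_comparison)
    show "((\<lambda>h. V_norm D (\<lambda>x. (dsolution \<mu> (y(j := y j + h)) x - dsolution \<mu> y x) / h - w x)) \<longlongrightarrow> 0) (at 0)"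
      unfolding w_def by (rule dsolution_derivative[OF y \<mu>])
    show "\<forall>\<^sub>F h in at 0. norm (V_norm D (\<lambda>x. q h x - w x)) \<le>
        V_norm D (\<lambda>x. (dsolution \<mu> (y(j := y j + h)) x - dsolution \<mu> y x) / h - w x)"
      using ev
    proof eventually_elim
      case (elim h)
      define g where "g = G (y(j := y j + h))"
      define d where "d = dsolution \<mu> (y(j := y j + h))"
      define g0 where "g0 = G y"
      define d0 where "d0 = dsolution \<mu> y"
      have gd: "g \<in> V_space D" "d \<in> V_space D" "V_norm D (\<lambda>x. g x - d x) = 0"
        using G[OF adm, of h] elim unfolding V_eq_def g_def d_def by auto
      have gd0: "g0 \<in> V_space D" "d0 \<in> V_space D" "V_norm D (\<lambda>x. g0 x - d0 x) = 0"
        using G[OF y] unfolding V_eq_def g0_def d0_def by auto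
      note e1 = V_space_diff(1)[OF gd(1,2)] and e0 = V_space_diff(1)[OF gd0(1,2)]
      note e = V_space_diff(1)[OF e1 e0]
      have A: "(\<lambda>x. (d x - d0 x) / h - w x) \<in> V_space D"
        using V_space_diff(1)[OF V_space_scale(1)[OF V_space_diff(1)[OF gd(2) gd0(2)], of "inverse h"] wV]
        by (simp add: divide_inverse mult.commute)
      have "V_norm D (\<lambda>x. (g x - d x) - (g0 x - d0 x)) \<le> 0"
        using V_norm_diff_le(2)[OF e1 e0] gd(3) gd0(3) by simp
      then have z: "V_norm D (\<lambda>x. inverse h * ((g x - d x) - (g0 x - d0 x))) = 0"
        using V_norm_scale[OF e, of "inverse h"] V_norm_nonneg[of "\<lambda>x. (g x - d x) - (g0 x - d0 x)"] by simp
      have "(\<lambda>x. q h x - w x) = (\<lambda>x. ((d x - d0 x) / h - w x) + inverse h * ((g x - d x) - (g0 x - d0 x)))"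
        unfolding q_def g_def[symmetric] g0_def[symmetric] by (auto simp: divide_inverse algebra_simps)
      then have "V_norm D (\<lambda>x. q h x - w x) \<le> V_norm D (\<lambda>x. (d x - d0 x) / h - w x)"
        using V_norm_add_le[OF A V_space_scale(1)[OF e, of "inverse h"]] z by simp
      then show ?case unfolding d_def d0_def using V_norm_nonneg by simp
    qed
  qed
  then have has: "has_V_partial_derivative D j G y w" and lim: "((\<lambda>h. V_norm D (\<lambda>x. q h x - w x)) \<longlongrightarrow> 0) (at 0)"
    unfolding has_V_partial_derivative_def q_def using wV by auto
  define p where "p = V_partial D j G y"
  have hp: "has_V_partial_derivative D j G y p"
    unfolding p_def V_partial_def by (rule someI[of "has_V_partial_derivative D j G y", OF has])
  then have pV: "p \<in> V_space D" and limp: "((\<lambda>h. V_norm D (\<lambda>x. q h x - p x)) \<longlongrightarrow> 0) (at 0)"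
    unfolding has_V_partial_derivative_def q_def by auto
  have "V_norm D (\<lambda>x. p x - w x) \<le> 0"
  proof (rule tendsto_lowerbound)
    show "((\<lambda>h. V_norm D (\<lambda>x. q h x - w x) + V_norm D (\<lambda>x. q h x - p x)) \<longlongrightarrow> 0) (at 0)"
      using tendsto_add[OF lim limp] by simp
    show "\<forall>\<^sub>F h in at 0. V_norm D (\<lambda>x. p x - w x) \<le> V_norm D (\<lambda>x. q h x - w x) + V_norm D (\<lambda>x. q h x - p x)"
      using ev
    proof eventually_elim
      case (elim h)
      then have q: "q h \<in> V_space D" using qV by blast
      show ?case
        using V_norm_diff_le(2)[OF V_space_diff(1)[OF q wV] V_space_diff(1)[OF q pV]] by simp
    qed
  qed simp
  then show ?thesis using pV wV V_norm_nonneg[of "\<lambda>x. p x - w x"] unfolding V_eq_def p_def w_def by simp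
qed

lemma V_partial_iterate:
  assumes \<mu>: "\<mu> \<in> multiindices" and G: "\<And>y. admissible y \<Longrightarrow> V_eq (G y) (dsolution \<mu> y)" and y: "admissible y"
  shows "V_eq ((V_partial D j ^^ k) G y) (dsolution (\<mu>(j := \<mu> j + k)) y)"
  using y
proof (induction k arbitrary: y)
  case 0
  then show ?case using G by simp
next
  case (Suc k)
  have "V_eq (V_partial D j ((V_partial D j ^^ k) G) y) (dsolution ((\<mu>(j := \<mu> j + k))(j := Suc ((\<mu>(j := \<mu> j + k)) j))) y)"
    by (rule V_partial_dsolution[OF multiindices_upd[OF \<mu>] Suc.IH Suc.prems])
  then show ?case by (simp only: fun_upd_same fun_upd_upd funpow.simps o_apply add_Suc_right)
qed

text \<open>After the tail of the list has been processed, the multi-index reached is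
  \<open>\<nu>\<close> restricted to the tail; distinctness makes its entry at the head 0, so the
  head contributes exactly \<open>\<nu> j\<close> derivatives.\<close>

lemma V_mixed_partial_dsolution:
  assumes "distinct js" and y: "admissible y"
  shows "V_eq (foldr (\<lambda>j. V_partial D j ^^ \<nu> j) js (param_solution D abar \<psi> F) y)
    (dsolution (\<lambda>i. if i \<in> set js then \<nu> i else 0) y)"
  using assms
proof (induction js arbitrary: y)
  case Nil
  have "dsolution (\<lambda>i. 0) = param_solution D abar \<psi> F" by (auto simp: dsolution_def deg_def)
  then show ?case
    using param_solution_eq(1)[OF Nil(2)] V_norm_scale[OF V_space_zero, of 0] by (simp add: V_eq_def)
next
  case (Cons j js)
  let ?\<mu> = "\<lambda>i. if i \<in> set js then \<nu> i else 0"
  have \<mu>: "?\<mu> \<in> multiindices"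
    unfolding multiindices_def mem_Collect_eq by (rule finite_subset[of _ "set js"]) auto
  have "V_eq ((V_partial D j ^^ \<nu> j) (foldr (\<lambda>j. V_partial D j ^^ \<nu> j) js (param_solution D abar \<psi> F)) y)
     (dsolution (?\<mu>(j := ?\<mu> j + \<nu> j)) y)"
    by (rule V_partial_iterate[OF \<mu> Cons.IH Cons.prems(2)]) (use Cons.prems in auto)
  moreover have "?\<mu>(j := ?\<mu> j + \<nu> j) = (\<lambda>i. if i \<in> set (j # js) then \<nu> i else 0)"
    using Cons.prems by (auto simp: fun_eq_iff)
  ultimately show ?case by (simp only: foldr.simps o_apply)
qed

section \<open>From derivatives to Taylor coefficients\<close>

lemma multi_fact_eq: "finite S \<Longrightarrow> {j. \<nu> j \<noteq> 0} \<subseteq> S \<Longrightarrow> multi_fact \<nu> = (\<Prod>j\<in>S. fact (\<nu> j))"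
  unfolding multi_fact_def by (intro prod.mono_neutral_left) auto

lemma multi_fact_pos: "multi_fact \<nu> > 0"
  unfolding multi_fact_def by (intro prod_pos) simp

lemma multi_fact_dec:
  assumes "\<nu> \<in> multiindices" "\<nu> j \<noteq> 0"
  shows "multi_fact \<nu> = real (\<nu> j) * multi_fact (\<nu>(j := \<nu> j - 1))"
proof -
  let ?S = "{j. \<nu> j \<noteq> 0}"
  have f: "finite ?S" using assms by (simp add: multiindices_def)
  have "multi_fact (\<nu>(j := \<nu> j - 1)) = (\<Prod>i\<in>?S. fact ((\<nu>(j := \<nu> j - 1)) i))"
    by (rule multi_fact_eq[OF f]) (use assms in auto)
  also have "\<dots> = fact (\<nu> j - 1) * (\<Prod>i\<in>?S - {j}. fact (\<nu> i))"
    using assms(2) f by (subst prod.remove[of _ j]) auto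
  finally have "real (\<nu> j) * multi_fact (\<nu>(j := \<nu> j - 1)) = (real (\<nu> j) * fact (\<nu> j - 1)) * (\<Prod>i\<in>?S - {j}. fact (\<nu> i))"
    by simp
  also have "real (\<nu> j) * fact (\<nu> j - 1) = fact (\<nu> j)" using assms(2) by (simp add: fact_reduce)
  also have "fact (\<nu> j) * (\<Prod>i\<in>?S - {j}. fact (\<nu> i)) = multi_fact \<nu>"
    unfolding multi_fact_def using assms(2) f by (subst (2) prod.remove[of _ j]) auto
  finally show ?thesis by (rule sym)
qed

abbreviation taylor :: "(nat \<Rightarrow> nat) \<Rightarrow> 'a \<Rightarrow> real" where "taylor \<equiv> taylor_coeff D abar \<psi> F"

text \<open>The coefficient agrees with the solution of the differentiated problem only as an
  element of V, hence the identification through energy forms.\<close>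

lemma taylor_V_eq:
  assumes \<nu>: "\<nu> \<in> multiindices"
  shows "taylor \<nu> \<in> V_space D" "\<eta> \<in> Linf_space D \<Longrightarrow> v \<in> V_space D \<Longrightarrow>
    energy D \<eta> (taylor \<nu>) v = energy D \<eta> (dsolution \<nu> (\<lambda>_. 0)) v / multi_fact \<nu>"
proof -
  have f: "finite {j. \<nu> j \<noteq> 0}" using \<nu> by (simp add: multiindices_def)
  define w where "w = V_mixed_partial D \<nu> (param_solution D abar \<psi> F) (\<lambda>_. 0)"
  have "(\<lambda>i. if i \<in> set (sorted_list_of_set {j. \<nu> j \<noteq> 0}) then \<nu> i else 0) = \<nu>" using f by auto
  then have eq: "V_eq w (dsolution \<nu> (\<lambda>_. 0))"
    using V_mixed_partial_dsolution[of "sorted_list_of_set {j. \<nu> j \<noteq> 0}" "\<lambda>_. 0" \<nu>] admissible_zero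
    unfolding w_def V_mixed_partial_def by simp
  have t: "taylor \<nu> = (\<lambda>x. inverse (multi_fact \<nu>) * w x)"
    unfolding taylor_coeff_def w_def by (auto simp: divide_inverse)
  show "taylor \<nu> \<in> V_space D" unfolding t using eq V_space_scale(1) unfolding V_eq_def by blast
  assume \<eta>: "\<eta> \<in> Linf_space D" and v: "v \<in> V_space D"
  show "energy D \<eta> (taylor \<nu>) v = energy D \<eta> (dsolution \<nu> (\<lambda>_. 0)) v / multi_fact \<nu>"
    unfolding t using energy_scale_left[OF \<eta> _ v, of w] energy_cong[OF \<eta> _ _ v, of w "dsolution \<nu> (\<lambda>_. 0)"] eq
    unfolding V_eq_def by (simp add: divide_inverse_commute)
qed

text \<open>Dividing by the factorial cancels the Leibniz factor, because
  \<open>multi_fact \<nu>\<close> is \<open>\<nu> j\<close> times the factorial of the lowered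
  index.\<close>

lemma taylor_energy:
  assumes \<nu>: "\<nu> \<in> multiindices" and v: "v \<in> V_space D"
  shows "energy D abar (taylor \<nu>) v =
    (if \<nu> = (\<lambda>_. 0) then F v else 0) - (\<Sum>j | \<nu> j \<noteq> 0. energy D (\<psi> j) (taylor (\<nu>(j := \<nu> j - 1))) v)"
proof -
  have f: "finite {j. \<nu> j \<noteq> 0}" using \<nu> by (simp add: multiindices_def)
  have "acoeff (\<lambda>_. 0) = abar" using acoeff_zero by auto
  then have "energy D abar (dsolution \<nu> (\<lambda>_. 0)) v = (if deg \<nu> = 0 then F v else 0) -
      (\<Sum>j | \<nu> j \<noteq> 0. real (\<nu> j) * energy D (\<psi> j) (dsolution (\<nu>(j := \<nu> j - 1)) (\<lambda>_. 0)) v)"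
    using dsolution_energy[OF admissible_zero \<nu> v] by simp
  also have "(\<Sum>j | \<nu> j \<noteq> 0. real (\<nu> j) * energy D (\<psi> j) (dsolution (\<nu>(j := \<nu> j - 1)) (\<lambda>_. 0)) v) =
     (\<Sum>j | \<nu> j \<noteq> 0. multi_fact \<nu> * energy D (\<psi> j) (taylor (\<nu>(j := \<nu> j - 1))) v)"
  proof (rule sum.cong[OF refl])
    fix j assume "j \<in> {j. \<nu> j \<noteq> 0}"
    then have j: "\<nu> j \<noteq> 0" by simp
    have "multi_fact (\<nu>(j := \<nu> j - 1)) \<noteq> 0" using multi_fact_pos[of "\<nu>(j := \<nu> j - 1)"] by simp
    then show "real (\<nu> j) * energy D (\<psi> j) (dsolution (\<nu>(j := \<nu> j - 1)) (\<lambda>_. 0)) v =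
      multi_fact \<nu> * energy D (\<psi> j) (taylor (\<nu>(j := \<nu> j - 1))) v"
      unfolding taylor_V_eq(2)[OF multiindices_upd[OF \<nu>] psi v] multi_fact_dec[OF \<nu> j] by simp
  qed
  also have "(if deg \<nu> = 0 then F v else 0) = multi_fact \<nu> * (if \<nu> = (\<lambda>_. 0) then F v else 0)"
  proof (cases "\<nu> = (\<lambda>_. 0)")
    case True
    then show ?thesis by (simp add: deg_def multi_fact_def)
  next
    case False
    then obtain j where "\<nu> j \<noteq> 0" by auto
    then have "deg \<nu> > 0" by (rule deg_dec(2)[OF \<nu>])
    then show ?thesis using False by simp
  qed
  finally show ?thesis
    unfolding taylor_V_eq(2)[OF \<nu> abar v] using multi_fact_pos[of \<nu>]
    by (simp add: sum_distrib_left[symmetric] right_diff_distrib[symmetric] del: fun_upd_apply)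
qed

end

subsection \<open>Inequalities for powers\<close>

text \<open>Convexity: the left-hand side is the tangent
  \<open>z powr p + p * z powr (p - 1) * (x - z)\<close>. It is Young's inequality for the exponents
  \<open>p\<close> and \<open>p / (p - 1)\<close>.\<close>

lemma powr_tangent:
  fixes x z p :: real
  assumes p: "1 \<le> p" and x: "0 \<le> x" and z: "0 < z"
  shows "p * x * z powr (p - 1) - (p - 1) * z powr p \<le> x powr p"
proof (cases "p = 1")
  case True
  then show ?thesis using x z by simp
next
  case False
  then have p1: "p > 1" using p by simp
  define q where "q = p / (p - 1)"
  have q: "q > 1" "1 / p + 1 / q = 1" using p1 by (auto simp: q_def field_simps)
  have "x * z powr (p - 1) \<le> x powr p / p + (z powr (p - 1)) powr q / q"
    by (rule Youngs_inequality[OF p1 q x]) simp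
  also have "(z powr (p - 1)) powr q = z powr p"
    using p1 by (simp add: powr_powr q_def)
  finally have "p * (x * z powr (p - 1)) \<le> p * (x powr p / p + z powr p / q)"
    using p1 by (intro mult_left_mono) auto
  also have "\<dots> = x powr p + (p - 1) * z powr p"
    using p1 by (simp add: q_def field_simps)
  finally show ?thesis by (simp add: mult_ac)
qed

text \<open>The weights are completed to total mass 1 by giving the value \<open>r / (1 - V)\<close>
  the missing weight \<open>1 - V\<close>; then the tangent at the mean is used. Each power keeps
  its weight \<open>w i\<close> without a further constant, which is what makes the later absorption
  possible.\<close>

lemma powr_Jensen:
  fixes w a :: "'i \<Rightarrow> real" and r p \<theta> :: real
  assumes p: "1 \<le> p" and fin: "finite S" and w: "\<And>i. i \<in> S \<Longrightarrow> 0 \<le> w i" and a: "\<And>i. i \<in> S \<Longrightarrow> 0 \<le> a i"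
    and W: "(\<Sum>i\<in>S. w i) \<le> \<theta>" and \<theta>: "\<theta> < 1" and r: "0 \<le> r"
  shows "((\<Sum>i\<in>S. w i * a i) + r) powr p \<le> (\<Sum>i\<in>S. w i * a i powr p) + (r / (1 - \<theta>)) powr p"
proof -
  define z where "z = (\<Sum>i\<in>S. w i * a i) + r"
  define V where "V = (\<Sum>i\<in>S. w i)"
  have V: "V \<le> \<theta>" "0 \<le> V" using W w by (auto simp: V_def intro: sum_nonneg)
  have s0: "(\<Sum>i\<in>S. w i * a i) \<ge> 0" using w a by (intro sum_nonneg) auto
  show ?thesis
  proof (cases "z = 0")
    case True
    have "(\<Sum>i\<in>S. w i * a i powr p) \<ge> 0" using w by (intro sum_nonneg) auto
    then show ?thesis using True unfolding z_def by simp
  next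
    case False
    then have z: "z > 0" using s0 r unfolding z_def by linarith
    have "z powr p = p * z * z powr (p - 1) - (p - 1) * z powr p"
      using z by (simp add: powr_diff field_simps)
    also have "\<dots> = (\<Sum>i\<in>S. w i * (p * a i * z powr (p - 1) - (p - 1) * z powr p)) +
        (1 - V) * (p * (r / (1 - V)) * z powr (p - 1) - (p - 1) * z powr p)"
    proof -
      have "(\<Sum>i\<in>S. w i * (p * a i * z powr (p - 1) - (p - 1) * z powr p)) =
        (\<Sum>i\<in>S. w i * a i) * (p * z powr (p - 1)) - V * ((p - 1) * z powr p)"
        unfolding V_def sum_distrib_right sum_subtractf[symmetric] by (rule sum.cong) (auto simp: algebra_simps)
      moreover have "(1 - V) * (p * (r / (1 - V)) * z powr (p - 1) - (p - 1) * z powr p) =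
        r * (p * z powr (p - 1)) - (1 - V) * ((p - 1) * z powr p)"
        using V \<theta> by (simp add: field_simps)
      moreover have "p * z * z powr (p - 1) = (\<Sum>i\<in>S. w i * a i) * (p * z powr (p - 1)) + r * (p * z powr (p - 1))"
        unfolding z_def by (simp add: algebra_simps)
      ultimately show ?thesis by (simp add: algebra_simps)
    qed
    also have "\<dots> \<le> (\<Sum>i\<in>S. w i * a i powr p) + (1 - V) * (r / (1 - V)) powr p"
      using w a r V \<theta> z p by (intro add_mono sum_mono mult_left_mono powr_tangent) auto
    also have "(1 - V) * (r / (1 - V)) powr p \<le> 1 * (r / (1 - \<theta>)) powr p"
      using V \<theta> r p by (intro mult_mono powr_mono2 divide_left_mono) auto
    finally show ?thesis by (simp add: z_def)
  qed
qed

text \<open>Dividing by \<open>2 * M + 1\<close> brings the total weight below 1/2, where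
  \<open>powr_Jensen\<close> applies without remainder; the divisor is at least 1, so the weights
  may be restored afterwards.\<close>

lemma powr_weighted_sum:
  fixes m a :: "'i \<Rightarrow> real" and M p :: real
  assumes p: "1 \<le> p" and fin: "finite S" and m: "\<And>i. i \<in> S \<Longrightarrow> 0 \<le> m i" and a: "\<And>i. i \<in> S \<Longrightarrow> 0 \<le> a i"
    and M: "(\<Sum>i\<in>S. m i) \<le> M" "M \<ge> 0"
  shows "(\<Sum>i\<in>S. m i * a i) powr p \<le> (2 * M + 1) powr p * (\<Sum>i\<in>S. m i * a i powr p)"
proof -
  let ?k = "2 * M + 1"
  have k: "?k \<ge> 1" using M by simp
  have "(\<Sum>i\<in>S. m i / ?k) \<le> 1 / 2"
    using M by (simp add: sum_divide_distrib[symmetric] field_simps)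
  then have J: "((\<Sum>i\<in>S. m i / ?k * a i) + 0) powr p \<le> (\<Sum>i\<in>S. m i / ?k * a i powr p) + (0 / (1 - 1/2)) powr p"
    using m a k by (intro powr_Jensen[OF p fin]) auto
  have "(\<Sum>i\<in>S. m i * a i) = ?k * (\<Sum>i\<in>S. m i / ?k * a i)"
    using k by (simp add: sum_distrib_left)
  then have "(\<Sum>i\<in>S. m i * a i) powr p = ?k powr p * (\<Sum>i\<in>S. m i / ?k * a i) powr p"
    using k m a by (simp add: powr_mult sum_nonneg)
  also have "\<dots> \<le> ?k powr p * (\<Sum>i\<in>S. m i / ?k * a i powr p)"
    using J by (intro mult_left_mono) auto
  also have "\<dots> \<le> ?k powr p * (\<Sum>i\<in>S. m i * a i powr p)"
  proof (intro mult_left_mono sum_mono)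
    fix i assume i: "i \<in> S"
    have "m i / ?k \<le> m i" using m[OF i] k by (simp add: divide_le_eq mult_le_cancel_left1)
    then show "m i / ?k * a i powr p \<le> m i * a i powr p" by (intro mult_right_mono) auto
  qed simp
  finally show ?thesis .
qed

lemma powr_add_le:
  fixes a b p :: real
  assumes "0 \<le> p" "0 \<le> a" "0 \<le> b"
  shows "(a + b) powr p \<le> 2 powr p * (a powr p + b powr p)"
proof -
  have "(a + b) powr p \<le> (2 * max a b) powr p" using assms by (intro powr_mono2) auto
  also have "\<dots> = 2 powr p * (max a b) powr p" using assms by (simp add: powr_mult)
  also have "\<dots> \<le> 2 powr p * (a powr p + b powr p)" using assms by (intro mult_left_mono) (auto simp: max_def)
  finally show ?thesis .
qed

text \<open>Young's inequality with the exponents \<open>2/p\<close> and \<open>q/p\<close>, where \<open>1/2 + 1/q = 1/p\<close>.\<close>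

lemma powr_Young:
  fixes a s p q :: real
  assumes p: "1 \<le> p" "p < 2" and q: "1 / 2 + 1 / q = 1 / p" and a: "0 \<le> a" and s: "0 \<le> s"
  shows "(a * s) powr p \<le> a\<^sup>2 + s powr q"
proof -
  have q1: "1 / q = (2 - p) / (2 * p)" using q p by (simp add: field_simps)
  then have q0: "q > 0" using p by (metis divide_pos_pos less_diff_eq add_0 mult_pos_pos zero_less_divide_1_iff zero_less_numeral less_le_trans zero_less_one)
  have qe: "q = 2 * p / (2 - p)" using q1 q0 p by (simp add: field_simps)
  have pq: "q > p" unfolding qe using p by (simp add: field_simps)
  have "a powr p * s powr p \<le> (a powr p) powr (2 / p) / (2 / p) + (s powr p) powr (q / p) / (q / p)"
    by (rule Youngs_inequality) (use p pq q0 q in \<open>auto simp: field_simps\<close>)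
  also have "\<dots> = a\<^sup>2 * (p / 2) + s powr q * (p / q)"
    using p a by (simp add: powr_powr powr_numeral)
  also have "\<dots> \<le> a\<^sup>2 * 1 + s powr q * 1"
    using p pq q0 by (intro add_mono mult_left_mono) auto
  finally show ?thesis using a s by (simp add: powr_mult)
qed

subsection \<open>Multi-indices\<close>

definition index_box :: "nat \<Rightarrow> nat \<Rightarrow> (nat \<Rightarrow> nat) set" where
  "index_box N n = {\<nu>. (\<forall>j\<ge>N. \<nu> j = 0) \<and> (\<forall>j. \<nu> j \<le> n)}"

lemma index_box_supp: "\<nu> \<in> index_box N n \<Longrightarrow> {j. \<nu> j \<noteq> 0} \<subseteq> {..<N}"
  unfolding index_box_def by (auto simp: not_less[symmetric])

lemma index_box_multiindices: "index_box N n \<subseteq> multiindices"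
  using finite_subset[OF index_box_supp finite_lessThan] unfolding multiindices_def by auto

lemma finite_index_box: "finite (index_box N n)"
proof -
  have "finite {\<nu>. \<forall>j. (j \<in> {..<N} \<longrightarrow> \<nu> j \<in> {..n}) \<and> (j \<notin> {..<N} \<longrightarrow> \<nu> j = (0::nat))}"
    by (rule finite_set_of_finite_funs) auto
  then show ?thesis by (rule rev_finite_subset) (auto simp: index_box_def)
qed

lemma index_box_dec: "\<nu> \<in> index_box N n \<Longrightarrow> \<nu>(j := \<nu> j - 1) \<in> index_box N n"
  unfolding index_box_def by (auto intro: order.trans[OF diff_le_self])

lemma index_box_zero: "(\<lambda>_. 0) \<in> index_box N n"
  by (simp add: index_box_def)

lemma finite_subset_index_box:
  assumes "finite F" "F \<subseteq> multiindices"
  obtains N n where "F \<subseteq> index_box N n"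
proof -
  let ?S = "\<Union>\<nu>\<in>F. {j. \<nu> j \<noteq> 0}"
  have fS: "finite ?S" using assms by (auto simp: multiindices_def)
  let ?R = "\<Union>\<nu>\<in>F. \<nu> ` ?S"
  have fR: "finite ?R" using assms fS by auto
  obtain N where N: "\<And>j. j \<in> ?S \<Longrightarrow> j < N" using fS finite_nat_set_iff_bounded by meson
  obtain n where n: "\<And>k. k \<in> ?R \<Longrightarrow> k < n" using fR finite_nat_set_iff_bounded by meson
  have "F \<subseteq> index_box N n"
  proof
    fix \<nu> assume \<nu>: "\<nu> \<in> F"
    have "\<nu> j = 0" if "j \<ge> N" for j
    proof (rule ccontr)
      assume "\<nu> j \<noteq> 0"
      then have "j < N" using N \<nu> by blast
      then show False using that by simp
    qed
    moreover have "\<nu> j \<le> n" for j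
    proof (cases "\<nu> j = 0")
      case False
      then have "j \<in> ?S" using \<nu> by blast
      then have "\<nu> j \<in> ?R" using \<nu> by blast
      then show ?thesis using n less_imp_le by blast
    qed simp
    ultimately show "\<nu> \<in> index_box N n" by (simp add: index_box_def)
  qed
  then show thesis using that by blast
qed

text \<open>The map \<open>(\<nu>, j) \<mapsto> (\<nu> - e\<^sub>j, j)\<close> is injective.\<close>

lemma sum_index_box_dec:
  fixes h :: "nat \<Rightarrow> (nat \<Rightarrow> nat) \<Rightarrow> real"
  assumes h: "\<And>j \<mu>. 0 \<le> h j \<mu>"
  shows "(\<Sum>\<nu>\<in>index_box N n. \<Sum>j | \<nu> j \<noteq> 0. h j (\<nu>(j := \<nu> j - 1))) \<le> (\<Sum>\<mu>\<in>index_box N n. \<Sum>j<N. h j \<mu>)"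
proof -
  let ?\<Lambda> = "index_box N n"
  let ?A = "SIGMA \<nu>:?\<Lambda>. {j. \<nu> j \<noteq> 0}"
  let ?f = "\<lambda>(\<nu>::nat \<Rightarrow> nat, j). (\<nu>(j := \<nu> j - 1), j)"
  have fj: "finite {j. \<nu> j \<noteq> 0}" if "\<nu> \<in> ?\<Lambda>" for \<nu>
    using finite_subset[OF index_box_supp[OF that] finite_lessThan] .
  have inj: "inj_on ?f ?A"
  proof (rule inj_onI, clarsimp)
    fix \<nu> \<mu> :: "nat \<Rightarrow> nat" and j
    assume p: "0 < \<nu> j" "0 < \<mu> j" and e: "\<nu>(j := \<nu> j - Suc 0) = \<mu>(j := \<mu> j - Suc 0)"
    show "\<nu> = \<mu>"
    proof
      fix i
      show "\<nu> i = \<mu> i" using fun_cong[OF e, of i] p by (cases "i = j") auto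
    qed
  qed
  have "(\<Sum>\<nu>\<in>?\<Lambda>. \<Sum>j | \<nu> j \<noteq> 0. h j (\<nu>(j := \<nu> j - 1))) = (\<Sum>(\<nu>, j)\<in>?A. h j (\<nu>(j := \<nu> j - 1)))"
    by (rule sum.Sigma) (use finite_index_box fj in auto)
  also have "\<dots> = (\<Sum>(\<mu>, j)\<in>?f ` ?A. h j \<mu>)"
    by (subst sum.reindex[OF inj]) (auto intro!: sum.cong)
  also have "\<dots> \<le> (\<Sum>(\<mu>, j)\<in>?\<Lambda> \<times> {..<N}. h j \<mu>)"
  proof (rule sum_mono2)
    show "?f ` ?A \<subseteq> ?\<Lambda> \<times> {..<N}"
    proof clarify
      fix \<nu> j assume \<nu>: "\<nu> \<in> ?\<Lambda>" "0 < \<nu> j"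
      have "j \<in> {j. \<nu> j \<noteq> 0}" using \<nu>(2) by simp
      then have "j \<in> {..<N}" using index_box_supp[OF \<nu>(1)] by blast
      then show "\<nu>(j := \<nu> j - 1) \<in> ?\<Lambda> \<and> j \<in> {..<N}" using index_box_dec[OF \<nu>(1)] by blast
    qed
  qed (use finite_index_box h in auto)
  also have "\<dots> = (\<Sum>\<mu>\<in>?\<Lambda>. \<Sum>j<N. h j \<mu>)" by (simp add: sum.cartesian_product)
  finally show ?thesis .
qed

lemma multi_power_eq: "finite S \<Longrightarrow> {j. \<nu> j \<noteq> 0} \<subseteq> S \<Longrightarrow> multi_power r \<nu> = (\<Prod>j\<in>S. r j ^ \<nu> j)"
  unfolding multi_power_def by (intro prod.mono_neutral_left) auto

lemma multi_power_pos: "(\<And>j. r j > 0) \<Longrightarrow> multi_power r \<nu> > 0"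
  unfolding multi_power_def by (intro prod_pos) simp

lemma multi_power_zero: "multi_power r (\<lambda>_. 0) = 1"
  unfolding multi_power_def by simp

lemma multi_power_mult: "multi_power (\<lambda>j. a j * b j) \<nu> = multi_power a \<nu> * multi_power b \<nu>"
  unfolding multi_power_def by (simp add: power_mult_distrib prod.distrib)

lemma multi_power_dec:
  assumes "\<nu> \<in> multiindices" "\<nu> j \<noteq> 0"
  shows "multi_power r \<nu> = r j * multi_power r (\<nu>(j := \<nu> j - 1))"
proof -
  let ?S = "{j. \<nu> j \<noteq> 0}"
  have f: "finite ?S" using assms by (simp add: multiindices_def)
  have "multi_power r (\<nu>(j := \<nu> j - 1)) = (\<Prod>i\<in>?S. r i ^ (\<nu>(j := \<nu> j - 1)) i)"
    by (rule multi_power_eq[OF f]) (use assms in auto)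
  also have "\<dots> = r j ^ (\<nu> j - 1) * (\<Prod>i\<in>?S - {j}. r i ^ \<nu> i)"
    using assms(2) f by (subst prod.remove[of _ j]) auto
  finally have "r j * multi_power r (\<nu>(j := \<nu> j - 1)) = (r j * r j ^ (\<nu> j - 1)) * (\<Prod>i\<in>?S - {j}. r i ^ \<nu> i)"
    by simp
  also have "r j * r j ^ (\<nu> j - 1) = r j ^ \<nu> j" using assms(2) by (simp add: power_eq_if)
  also have "r j ^ \<nu> j * (\<Prod>i\<in>?S - {j}. r i ^ \<nu> i) = multi_power r \<nu>"
    unfolding multi_power_def using assms(2) f by (subst (2) prod.remove[of _ j]) auto
  finally show ?thesis by (rule sym)
qed

lemma multi_power_powr:
  assumes "\<And>j. r j > 0"
  shows "multi_power (\<lambda>j. r j powr p) \<nu> = multi_power r \<nu> powr p"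
proof -
  have "(r j powr p) ^ k = (r j ^ k) powr p" for j k
    using assms[of j] by (simp add: powr_power powr_realpow[symmetric] powr_powr mult.commute)
  then show ?thesis unfolding multi_power_def
    using assms by (subst prod_powr_distrib) (auto intro: less_imp_le)
qed

lemma multi_power_inverse: "multi_power (\<lambda>j. inverse (r j)) \<nu> = inverse (multi_power r \<nu>)"
  unfolding multi_power_def by (simp add: power_inverse prod_inversef[symmetric] o_def)

text \<open>The sum over a box factorises into finite geometric sums. Each is at most
  \<open>1 / (1 - s j) = 1 + s j / (1 - s j)\<close>, hence at most
  \<open>exp (s j / (1 - t))\<close> when \<open>t\<close> < 1 bounds all \<open>s j\<close>, and
  the exponents are summable.\<close>

lemma sum_multi_power_bounded:
  fixes s :: "nat \<Rightarrow> real"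
  assumes s: "\<And>j. 0 \<le> s j" "\<And>j. s j < 1" and sm: "summable s"
  obtains C where "\<And>N n. (\<Sum>\<nu>\<in>index_box N n. multi_power s \<nu>) \<le> C"
proof -
  have step: "(\<Sum>\<nu>\<in>index_box (Suc N) n. multi_power s \<nu>) = (\<Sum>k\<le>n. s N ^ k) * (\<Sum>\<nu>\<in>index_box N n. multi_power s \<nu>)" for N n
  proof -
    let ?f = "\<lambda>(k, \<nu>::nat \<Rightarrow> nat). \<nu>(N := k)"
    have inj: "inj_on ?f ({..n} \<times> index_box N n)"
    proof (rule inj_onI, clarsimp)
      fix k l \<nu> \<mu> assume \<nu>: "\<nu> \<in> index_box N n" "\<mu> \<in> index_box N n" and e: "\<nu>(N := k) = \<mu>(N := (l::nat))"
      have "k = l" using fun_cong[OF e, of N] by simp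
      moreover have "\<nu> = \<mu>"
      proof
        fix i
        show "\<nu> i = \<mu> i" using fun_cong[OF e, of i] \<nu> by (cases "i = N") (auto simp: index_box_def)
      qed
      ultimately show "k = l \<and> \<nu> = \<mu>" by simp
    qed
    have img: "?f ` ({..n} \<times> index_box N n) = index_box (Suc N) n"
    proof (intro equalityI subsetI)
      fix \<mu> assume \<mu>: "\<mu> \<in> index_box (Suc N) n"
      have "\<mu> = ?f (\<mu> N, \<mu>(N := 0))" by simp
      moreover have "\<mu>(N := 0) \<in> index_box N n"
      proof -
        have "(\<mu>(N := 0)) j = 0" if "N \<le> j" for j
        proof (cases "j = N")
          case False
          then have "Suc N \<le> j" using that by simp
          then show ?thesis using \<mu> by (simp add: index_box_def)
        qed simp
        then show ?thesis using \<mu> by (simp add: index_box_def)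
      qed
      moreover have "\<mu> N \<le> n" using \<mu> by (simp add: index_box_def)
      ultimately show "\<mu> \<in> ?f ` ({..n} \<times> index_box N n)" by (metis SigmaI atMost_iff image_eqI)
    qed (auto simp: index_box_def)
    have mp: "multi_power s (\<nu>(N := k)) = s N ^ k * multi_power s \<nu>" if \<nu>: "\<nu> \<in> index_box N n" for \<nu> k
    proof -
      have "\<nu> N = 0" using \<nu> by (simp add: index_box_def)
      have sub: "{j. \<nu> j \<noteq> 0} \<subseteq> {..<N}" by (rule index_box_supp[OF \<nu>])
      have "multi_power s (\<nu>(N := k)) = (\<Prod>j\<in>insert N {..<N}. s j ^ (\<nu>(N := k)) j)"
        by (rule multi_power_eq) (use sub in auto)
      also have "\<dots> = s N ^ k * (\<Prod>j<N. s j ^ (\<nu>(N := k)) j)" by simp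
      also have "(\<Prod>j<N. s j ^ (\<nu>(N := k)) j) = (\<Prod>j<N. s j ^ \<nu> j)" by (rule prod.cong) auto
      also have "\<dots> = multi_power s \<nu>" by (rule multi_power_eq[symmetric]) (use sub in auto)
      finally show ?thesis .
    qed
    have "(\<Sum>\<nu>\<in>index_box (Suc N) n. multi_power s \<nu>) = (\<Sum>(k, \<nu>)\<in>{..n} \<times> index_box N n. s N ^ k * multi_power s \<nu>)"
      unfolding img[symmetric] by (subst sum.reindex[OF inj]) (auto intro!: sum.cong simp: mp)
    then show ?thesis by (simp add: sum.cartesian_product[symmetric] sum_product)
  qed
  have "s \<longlonglongrightarrow> 0" by (rule summable_LIMSEQ_zero[OF sm])
  then have "eventually (\<lambda>j. s j < 1/2) sequentially" by (rule order_tendstoD) simp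
  then obtain J where J: "\<And>j. j \<ge> J \<Longrightarrow> s j < 1/2" by (auto simp: eventually_sequentially)
  \<comment> \<open>All but finitely many \<open>s j\<close> lie below 1/2, so a maximum over the
    others and 1/2 stays below 1.\<close>
  define t where "t = Max (insert (1/2) (s ` {..<J}))"
  have t1: "t < 1" unfolding t_def using s(2) by (subst Max_less_iff) auto
  have st: "s j \<le> t" for j
  proof (cases "j < J")
    case True
    then show ?thesis unfolding t_def by (intro Max_ge) auto
  next
    case False
    then have "s j < 1/2" using J by simp
    also have "1/2 \<le> t" unfolding t_def by (intro Max_ge) auto
    finally show ?thesis by simp
  qed
  have geo: "(\<Sum>k\<le>n. s j ^ k) \<le> exp (s j / (1 - t))" for j n
  proof -
    have "(\<Sum>k\<le>n. s j ^ k) \<le> (\<Sum>k. s j ^ k)"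
      using s by (intro sum_le_suminf summable_geometric) auto
    also have "\<dots> = 1 / (1 - s j)" using s by (intro suminf_geometric) auto
    also have "\<dots> = 1 + s j / (1 - s j)" using s(2)[of j] by (simp add: field_simps)
    also have "\<dots> \<le> 1 + s j / (1 - t)" using s[of j] st[of j] t1 by (intro add_left_mono divide_left_mono) auto
    also have "\<dots> \<le> exp (s j / (1 - t))" by (rule exp_ge_add_one_self)
    finally show ?thesis .
  qed
  have "(\<Sum>\<nu>\<in>index_box N n. multi_power s \<nu>) \<le> exp (\<Sum>j<N. s j / (1 - t))" for N n
  proof (induction N)
    case 0
    have "index_box 0 n = {\<lambda>_. 0}" by (auto simp: index_box_def)
    then show ?case by (simp add: multi_power_zero)
  next
    case (Suc N)
    have "(\<Sum>\<nu>\<in>index_box N n. multi_power s \<nu>) \<ge> 0"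
      unfolding multi_power_def using s by (intro sum_nonneg prod_nonneg) auto
    then have "(\<Sum>\<nu>\<in>index_box (Suc N) n. multi_power s \<nu>) \<le> exp (s N / (1 - t)) * exp (\<Sum>j<N. s j / (1 - t))"
      unfolding step by (intro mult_mono geo Suc) auto
    then show ?case by (simp add: exp_add mult.commute)
  qed
  note bd = this
  have "exp (\<Sum>j<N. s j / (1 - t)) \<le> exp (\<Sum>j. s j / (1 - t))" for N
    using s t1 sm by (intro iffD2[OF exp_le_cancel_iff] sum_le_suminf summable_divide) auto
  then show thesis by (rule that[OF order.trans[OF bd]])
qed

text \<open>The absorption argument at one point x, freed of measure theory. It will be used with
  \<open>G\<close> the weighted Laplacians, \<open>T\<close> the weighted gradients,
  \<open>w j\<close> = \<open>\<rho> j\<close> times the absolute value of \<open>\<psi> j\<close>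
  over \<open>abar\<close>, \<open>m j\<close> = \<open>\<rho> j\<close> times the norm of the
  gradient of \<open>\<psi> j\<close>, \<open>A\<close> a bound for the gradient of
  \<open>abar\<close>, \<open>B\<close> the size of the source and \<open>K\<close> = 1/c.\<close>

lemma box_estimate:
  fixes G T :: "(nat \<Rightarrow> nat) \<Rightarrow> real" and w m :: "nat \<Rightarrow> real"
  assumes p: "1 \<le> p" and G: "\<And>\<nu>. 0 \<le> G \<nu>" and T: "\<And>\<nu>. 0 \<le> T \<nu>"
    and w: "\<And>j. 0 \<le> w j" "(\<Sum>j<N. w j) \<le> \<theta>" "\<theta> < 1" and m: "\<And>j. 0 \<le> m j" "(\<Sum>j<N. m j) \<le> M"
    and A: "0 \<le> A" and B: "0 \<le> B" and K: "0 \<le> K"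
    and le: "\<And>\<nu>. \<nu> \<in> index_box N n \<Longrightarrow> G \<nu> \<le> (\<Sum>j | \<nu> j \<noteq> 0. w j * G (\<nu>(j := \<nu> j - 1))) +
       K * (A * T \<nu> + (\<Sum>j | \<nu> j \<noteq> 0. m j * T (\<nu>(j := \<nu> j - 1))) + (if \<nu> = (\<lambda>_. 0) then B else 0))"
  shows "(1 - \<theta>) * (\<Sum>\<nu>\<in>index_box N n. G \<nu> powr p) \<le>
    (K / (1 - \<theta>)) powr p * 4 powr p * (A powr p + (2 * M + 1) powr p * M + 1) * ((\<Sum>\<nu>\<in>index_box N n. T \<nu> powr p) + B powr p)"
proof -
  let ?\<Lambda> = "index_box N n"
  define C1 where "C1 = (K / (1 - \<theta>)) powr p * 4 powr p"
  have C1: "C1 \<ge> 0" by (simp add: C1_def)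
  have M0: "M \<ge> 0" using order.trans[OF sum_nonneg m(2)] m(1) by auto
  have fin: "finite {j. \<nu> j \<noteq> 0}" "{j. \<nu> j \<noteq> 0} \<subseteq> {..<N}" if "\<nu> \<in> ?\<Lambda>" for \<nu>
    using finite_subset[OF index_box_supp[OF that] finite_lessThan] index_box_supp[OF that] by auto
  define SG where "SG = (\<Sum>\<nu>\<in>?\<Lambda>. G \<nu> powr p)"
  define ST where "ST = (\<Sum>\<nu>\<in>?\<Lambda>. T \<nu> powr p)"
  have step: "G \<nu> powr p \<le> (\<Sum>j | \<nu> j \<noteq> 0. w j * G (\<nu>(j := \<nu> j - 1)) powr p) +
      C1 * (A powr p * T \<nu> powr p + (2 * M + 1) powr p * (\<Sum>j | \<nu> j \<noteq> 0. m j * T (\<nu>(j := \<nu> j - 1)) powr p) + (if \<nu> = (\<lambda>_. 0) then B powr p else 0))"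
    if \<nu>: "\<nu> \<in> ?\<Lambda>" for \<nu>
  proof -
    let ?S = "{j. \<nu> j \<noteq> 0}"
    define a1 where "a1 = A * T \<nu>"
    define a2 where "a2 = (\<Sum>j\<in>?S. m j * T (\<nu>(j := \<nu> j - 1)))"
    define a3 where "a3 = (if \<nu> = (\<lambda>_. 0) then B else 0)"
    have a: "a1 \<ge> 0" "a2 \<ge> 0" "a3 \<ge> 0"
      using A T m(1) B by (auto simp: a1_def a2_def a3_def intro!: sum_nonneg mult_nonneg_nonneg)
    have W: "(\<Sum>j\<in>?S. w j) \<le> \<theta>"
      using order.trans[OF sum_mono2[OF _ fin(2)[OF \<nu>], of w] w(2)] w(1) by auto
    have Mm: "(\<Sum>j\<in>?S. m j) \<le> M"
      using order.trans[OF sum_mono2[OF _ fin(2)[OF \<nu>], of m] m(2)] m(1) by auto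
    have "G \<nu> powr p \<le> ((\<Sum>j\<in>?S. w j * G (\<nu>(j := \<nu> j - 1))) + K * (a1 + a2 + a3)) powr p"
      using le[OF \<nu>] G p unfolding a1_def a2_def a3_def by (intro powr_mono2) auto
    also have "\<dots> \<le> (\<Sum>j\<in>?S. w j * G (\<nu>(j := \<nu> j - 1)) powr p) + (K * (a1 + a2 + a3) / (1 - \<theta>)) powr p"
      by (rule powr_Jensen[OF p fin(1)[OF \<nu>] w(1) G W w(3)]) (use K a in auto)
    also have "(K * (a1 + a2 + a3) / (1 - \<theta>)) powr p = (K / (1 - \<theta>)) powr p * (a1 + (a2 + a3)) powr p"
      using K a w(3) by (simp add: powr_mult[symmetric] add.assoc)
    \<comment> \<open>Two successive splittings, each with factor \<open>2 powr p\<close>.\<close>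
    also have "(a1 + (a2 + a3)) powr p \<le> 4 powr p * (a1 powr p + a2 powr p + a3 powr p)"
    proof -
      have "(a1 + (a2 + a3)) powr p \<le> 2 powr p * (a1 powr p + (a2 + a3) powr p)"
        using a p by (intro powr_add_le) auto
      also have "\<dots> \<le> 2 powr p * (2 powr p * a1 powr p + 2 powr p * (a2 powr p + a3 powr p))"
        using a p powr_add_le[of p a2 a3] ge_one_powr_ge_zero[of 2 p]
        by (intro mult_left_mono add_mono) (auto simp: mult_le_cancel_right1)
      also have "\<dots> = (2 * 2) powr p * (a1 powr p + a2 powr p + a3 powr p)"
        by (subst powr_mult) (auto simp: algebra_simps)
      finally show ?thesis by simp
    qed
    also have "a2 powr p \<le> (2 * M + 1) powr p * (\<Sum>j\<in>?S. m j * T (\<nu>(j := \<nu> j - 1)) powr p)"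
      unfolding a2_def by (rule powr_weighted_sum[OF p fin(1)[OF \<nu>] m(1) T Mm M0])
    also have "a1 powr p = A powr p * T \<nu> powr p" unfolding a1_def using A T by (simp add: powr_mult)
    also have "a3 powr p = (if \<nu> = (\<lambda>_. 0) then B powr p else 0)" unfolding a3_def by simp
    finally show ?thesis
      by (simp add: C1_def mult.assoc mult_left_mono del: fun_upd_apply split del: if_split)
  qed
  \<comment> \<open>After reindexing, a multi-index is met at most once for each
    \<open>j < N\<close>, so its total weight is at most \<open>\<theta>\<close>.\<close>
  have h1: "(\<Sum>\<nu>\<in>?\<Lambda>. \<Sum>j | \<nu> j \<noteq> 0. w j * G (\<nu>(j := \<nu> j - 1)) powr p) \<le> \<theta> * SG"
  proof -
    have "(\<Sum>\<nu>\<in>?\<Lambda>. \<Sum>j | \<nu> j \<noteq> 0. w j * G (\<nu>(j := \<nu> j - 1)) powr p) \<le> (\<Sum>\<nu>\<in>?\<Lambda>. \<Sum>j<N. w j * G \<nu> powr p)"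
      by (rule sum_index_box_dec) (use w in auto)
    also have "\<dots> \<le> (\<Sum>\<nu>\<in>?\<Lambda>. \<theta> * G \<nu> powr p)"
      unfolding sum_distrib_right[symmetric] by (intro sum_mono mult_right_mono w) auto
    finally show ?thesis by (simp add: SG_def sum_distrib_left)
  qed
  have h2: "(\<Sum>\<nu>\<in>?\<Lambda>. \<Sum>j | \<nu> j \<noteq> 0. m j * T (\<nu>(j := \<nu> j - 1)) powr p) \<le> M * ST"
  proof -
    have "(\<Sum>\<nu>\<in>?\<Lambda>. \<Sum>j | \<nu> j \<noteq> 0. m j * T (\<nu>(j := \<nu> j - 1)) powr p) \<le> (\<Sum>\<nu>\<in>?\<Lambda>. \<Sum>j<N. m j * T \<nu> powr p)"
      by (rule sum_index_box_dec) (use m in auto)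
    also have "\<dots> \<le> (\<Sum>\<nu>\<in>?\<Lambda>. M * T \<nu> powr p)"
      unfolding sum_distrib_right[symmetric] by (intro sum_mono mult_right_mono m) auto
    finally show ?thesis by (simp add: ST_def sum_distrib_left)
  qed
  have "SG \<le> (\<Sum>\<nu>\<in>?\<Lambda>. (\<Sum>j | \<nu> j \<noteq> 0. w j * G (\<nu>(j := \<nu> j - 1)) powr p) +
      C1 * (A powr p * T \<nu> powr p + (2 * M + 1) powr p * (\<Sum>j | \<nu> j \<noteq> 0. m j * T (\<nu>(j := \<nu> j - 1)) powr p) + (if \<nu> = (\<lambda>_. 0) then B powr p else 0)))"
    unfolding SG_def by (rule sum_mono) (rule step)
  also have "\<dots> = (\<Sum>\<nu>\<in>?\<Lambda>. \<Sum>j | \<nu> j \<noteq> 0. w j * G (\<nu>(j := \<nu> j - 1)) powr p) +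
      C1 * (A powr p * ST + (2 * M + 1) powr p * (\<Sum>\<nu>\<in>?\<Lambda>. \<Sum>j | \<nu> j \<noteq> 0. m j * T (\<nu>(j := \<nu> j - 1)) powr p) + B powr p)"
    using index_box_zero finite_index_box
    by (simp add: sum.distrib sum_distrib_left[symmetric] ST_def sum.delta' del: fun_upd_apply)
  also have "\<dots> \<le> \<theta> * SG + C1 * (A powr p * ST + (2 * M + 1) powr p * (M * ST) + B powr p)"
    using C1 by (intro add_mono mult_left_mono h1 h2 order.refl) auto
  finally have "(1 - \<theta>) * SG \<le> C1 * (A powr p * ST + (2 * M + 1) powr p * (M * ST) + B powr p)"
    by (simp add: algebra_simps)
  also have "\<dots> \<le> C1 * ((A powr p + (2 * M + 1) powr p * M + 1) * (ST + B powr p))"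
  proof (rule mult_left_mono[OF _ C1])
    have ST0: "ST \<ge> 0" unfolding ST_def by (intro sum_nonneg) simp
    \<comment> \<open>This is exactly the difference of the two sides below; the product form leaves
      a single constant.\<close>
    have "0 \<le> ST + (A powr p + (2 * M + 1) powr p * M) * B powr p" using ST0 M0 by simp
    then show "A powr p * ST + (2 * M + 1) powr p * (M * ST) + B powr p \<le> (A powr p + (2 * M + 1) powr p * M + 1) * (ST + B powr p)"
      by (simp add: algebra_simps)
  qed
  finally show ?thesis unfolding SG_def ST_def C1_def by (simp add: mult.assoc)
qed

context bounded_open_domain
begin

text \<open>Cauchy-Schwarz and the inequality of arithmetic and geometric means, under the integral.
  The factors \<open>\<alpha>\<close> and \<open>\<beta>\<close> let two elements of V with
  different multi-index weights be separated symmetrically.\<close>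

lemma energy_cross:
  assumes \<eta>: "\<eta> \<in> Linf_space D" and u: "u \<in> V_space D" and v: "v \<in> V_space D" and "\<alpha> \<ge> 0" "\<beta> \<ge> 0"
  shows "\<alpha> * \<beta> * \<bar>energy D \<eta> u v\<bar> \<le> (\<alpha>\<^sup>2 * energy D (\<lambda>x. \<bar>\<eta> x\<bar>) u u + \<beta>\<^sup>2 * energy D (\<lambda>x. \<bar>\<eta> x\<bar>) v v) / 2"
proof -
  obtain K where K: "K \<ge> 0" "AE x in lebesgue_on D. norm (\<eta> x) \<le> K" "\<eta> \<in> borel_measurable (lebesgue_on D)"
    using Linf_spaceD[OF \<eta>] by blast
  have abs: "(\<lambda>x. \<bar>\<eta> x\<bar>) \<in> Linf_space D" by (rule Linf_spaceI[where K=K]) (use K in auto)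
  note i = energy_integrable[OF \<eta> u v] energy_integrable[OF abs u u] energy_integrable[OF abs v v]
  have "\<alpha> * \<beta> * \<bar>energy D \<eta> u v\<bar> \<le> \<alpha> * \<beta> * (LINT x|lebesgue_on D. \<bar>\<eta> x * (weak_grad D u x \<bullet> weak_grad D v x)\<bar>)"
    unfolding energy_def using assms(4,5) by (intro mult_left_mono integral_abs_bound) auto
  also have "\<dots> = (LINT x|lebesgue_on D. \<alpha> * \<beta> * \<bar>\<eta> x * (weak_grad D u x \<bullet> weak_grad D v x)\<bar>)" by simp
  also have "\<dots> \<le> (LINT x|lebesgue_on D. (\<alpha>\<^sup>2 * (\<bar>\<eta> x\<bar> * (weak_grad D u x \<bullet> weak_grad D u x)) +
      \<beta>\<^sup>2 * (\<bar>\<eta> x\<bar> * (weak_grad D v x \<bullet> weak_grad D v x))) / 2)"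
  proof (rule integral_mono)
    fix x
    let ?a = "weak_grad D u x" and ?b = "weak_grad D v x"
    have "\<alpha> * \<beta> * \<bar>?a \<bullet> ?b\<bar> \<le> \<alpha> * \<beta> * (norm ?a * norm ?b)"
      using assms(4,5) by (intro mult_left_mono Cauchy_Schwarz_ineq2) auto
    also have "\<dots> = (\<alpha> * norm ?a) * (\<beta> * norm ?b)" by simp
    also have "\<dots> \<le> ((\<alpha> * norm ?a)\<^sup>2 + (\<beta> * norm ?b)\<^sup>2) / 2"
      using sum_squares_bound[of "\<alpha> * norm ?a" "\<beta> * norm ?b"] by simp
    also have "\<dots> = (\<alpha>\<^sup>2 * (?a \<bullet> ?a) + \<beta>\<^sup>2 * (?b \<bullet> ?b)) / 2" by (simp add: power_mult_distrib power2_norm_eq_inner)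
    finally have "\<bar>\<eta> x\<bar> * (\<alpha> * \<beta> * \<bar>?a \<bullet> ?b\<bar>) \<le> \<bar>\<eta> x\<bar> * ((\<alpha>\<^sup>2 * (?a \<bullet> ?a) + \<beta>\<^sup>2 * (?b \<bullet> ?b)) / 2)"
      by (rule mult_left_mono) simp
    then show "\<alpha> * \<beta> * \<bar>\<eta> x * (?a \<bullet> ?b)\<bar> \<le> (\<alpha>\<^sup>2 * (\<bar>\<eta> x\<bar> * (?a \<bullet> ?a)) + \<beta>\<^sup>2 * (\<bar>\<eta> x\<bar> * (?b \<bullet> ?b))) / 2"
      by (simp add: abs_mult algebra_simps)
  qed (use i in auto)
  also have "\<dots> = (\<alpha>\<^sup>2 * energy D (\<lambda>x. \<bar>\<eta> x\<bar>) u u + \<beta>\<^sup>2 * energy D (\<lambda>x. \<bar>\<eta> x\<bar>) v v) / 2"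
    unfolding energy_def using i by simp
  finally show ?thesis .
qed

subsection \<open>Functions in \<open>L\<^sup>p\<close>\<close>

lemma Lp_integrable:
  fixes f :: "'a \<Rightarrow> real"
  assumes p: "1 \<le> p" and f: "f \<in> Lp_space D p" shows "integrable (lebesgue_on D) f"
proof (rule Bochner_Integration.integrable_bound[of _ "\<lambda>x. 1 + norm (f x) powr p"])
  show "AE x in lebesgue_on D. norm (f x) \<le> norm (1 + norm (f x) powr p)"
  proof (rule AE_I2)
    fix x
    show "norm (f x) \<le> norm (1 + norm (f x) powr p)"
    proof (cases "norm (f x) \<le> 1")
      case True
      then show ?thesis by (simp add: add_increasing2)
    next
      case False
      then have "norm (f x) powr 1 \<le> norm (f x) powr p" using p by (intro powr_mono) auto
      then show ?thesis using False by simp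
    qed
  qed
qed (use f in \<open>auto simp: Lp_space_def\<close>)

lemma Lp_space_dominated:
  fixes f :: "'a \<Rightarrow> real" and g :: "'a \<Rightarrow> real"
  assumes "f \<in> borel_measurable (lebesgue_on D)" "integrable (lebesgue_on D) g" "AE x in lebesgue_on D. norm (f x) powr p \<le> g x"
  shows "f \<in> Lp_space D p"
  unfolding Lp_space_def
proof (intro CollectI conjI assms(1))
  show "integrable (lebesgue_on D) (\<lambda>x. norm (f x) powr p)"
  proof (rule Bochner_Integration.integrable_bound[OF assms(2)])
    show "AE x in lebesgue_on D. norm (norm (f x) powr p) \<le> norm (g x)"
      using assms(3) by eventually_elim auto
  qed (use assms(1) in measurable)
qed

lemma Lp_space_add:
  fixes f g :: "'a \<Rightarrow> real"
  assumes p: "1 \<le> p" and f: "f \<in> Lp_space D p" and g: "g \<in> Lp_space D p"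
  shows "(\<lambda>x. f x + g x) \<in> Lp_space D p"
proof (rule Lp_space_dominated[where g="\<lambda>x. 2 powr p * (norm (f x) powr p + norm (g x) powr p)"])
  show "AE x in lebesgue_on D. norm (f x + g x) powr p \<le> 2 powr p * (norm (f x) powr p + norm (g x) powr p)"
  proof (rule AE_I2)
    fix x
    have "norm (f x + g x) powr p \<le> (norm (f x) + norm (g x)) powr p"
      using p by (intro powr_mono2 norm_triangle_ineq) auto
    also have "\<dots> \<le> 2 powr p * (norm (f x) powr p + norm (g x) powr p)"
      using p by (intro powr_add_le) auto
    finally show "norm (f x + g x) powr p \<le> 2 powr p * (norm (f x) powr p + norm (g x) powr p)" .
  qed
qed (use f g in \<open>auto simp: Lp_space_def\<close>)

lemma Lp_space_mult_bounded:
  fixes f b :: "'a \<Rightarrow> real"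
  assumes p: "1 \<le> p" and f: "f \<in> Lp_space D p" and b: "b \<in> borel_measurable (lebesgue_on D)"
    and K: "AE x in lebesgue_on D. norm (b x) \<le> K"
  shows "(\<lambda>x. b x * f x) \<in> Lp_space D p"
proof (rule Lp_space_dominated[where g="\<lambda>x. \<bar>K\<bar> powr p * norm (f x) powr p"])
  show "AE x in lebesgue_on D. norm (b x * f x) powr p \<le> \<bar>K\<bar> powr p * norm (f x) powr p"
    using K
  proof eventually_elim
    case (elim x)
    have "norm (b x * f x) powr p = norm (b x) powr p * norm (f x) powr p" by (simp add: abs_mult powr_mult)
    also have "\<dots> \<le> \<bar>K\<bar> powr p * norm (f x) powr p"
      using elim p by (intro mult_right_mono powr_mono2) auto
    finally show ?case .
  qed
qed (use f b in \<open>auto simp: Lp_space_def\<close>)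

lemma powr_le_square:
  fixes a :: real
  assumes "0 \<le> a" "1 \<le> p" "p < 2" shows "a powr p \<le> a\<^sup>2 + 1"
proof (cases "a \<le> 1")
  case True
  have "a powr p \<le> 1 powr p" using assms True by (intro powr_mono2) auto
  then show ?thesis by (simp add: add_increasing)
next
  case False
  then have "a powr p \<le> a powr 2" using assms by (intro powr_mono) auto
  then show ?thesis using False by (simp add: powr_numeral)
qed

text \<open>Brings gradients from L^2 to L^p: the measure of \<open>D\<close> is finite and
  \<open>p\<close> < 2, so powers are dominated by squares plus 1.\<close>

lemma Lp_space_inner_bounded:
  fixes b g :: "'a \<Rightarrow> 'a"
  assumes p: "1 \<le> p" "p < 2" and g: "g \<in> Lp_space D 2" and b: "b \<in> borel_measurable (lebesgue_on D)"
    and K: "AE x in lebesgue_on D. norm (b x) \<le> K"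
  shows "(\<lambda>x. b x \<bullet> g x) \<in> Lp_space D p"
proof (rule Lp_space_dominated[where g="\<lambda>x. K\<^sup>2 * (norm (g x))\<^sup>2 + 1"])
  show "AE x in lebesgue_on D. norm (b x \<bullet> g x) powr p \<le> K\<^sup>2 * (norm (g x))\<^sup>2 + 1"
    using K
  proof eventually_elim
    case (elim x)
    have "norm (b x \<bullet> g x) powr p \<le> (norm (b x \<bullet> g x))\<^sup>2 + 1" using p by (intro powr_le_square) auto
    also have "(norm (b x \<bullet> g x))\<^sup>2 \<le> (K * norm (g x))\<^sup>2"
    proof (rule power_mono)
      have "norm (b x \<bullet> g x) \<le> norm (b x) * norm (g x)" by (simp add: Cauchy_Schwarz_ineq2)
      also have "\<dots> \<le> K * norm (g x)" using elim by (intro mult_right_mono) auto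
      finally show "norm (b x \<bullet> g x) \<le> K * norm (g x)" .
    qed simp
    finally show ?case by (simp add: power_mult_distrib)
  qed
  show "integrable (lebesgue_on D) (\<lambda>x. K\<^sup>2 * (norm (g x))\<^sup>2 + 1)" using g by (auto simp: mem_Lp2_iff)
qed (use g b in \<open>auto simp: mem_Lp2_iff\<close>)

subsection \<open>The weak Laplacian\<close>

lemma is_weak_div_cong_AE:
  assumes div: "is_weak_div D G g" and m: "loc_integrable D G'" and ae: "AE x in lebesgue_on D. G x = G' x"
  shows "is_weak_div D G' g"
  unfolding is_weak_div_def
proof (intro conjI ballI m)
  show "loc_integrable D g" using div unfolding is_weak_div_def by blast
  fix \<phi> assume \<phi>: "\<phi> \<in> test_functions D"
  have "(LINT x|lebesgue_on D. G' x \<bullet> grad \<phi> x) = (LINT x|lebesgue_on D. G x \<bullet> grad \<phi> x)"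
  proof (rule integral_cong_AE)
    show "(\<lambda>x. G' x \<bullet> grad \<phi> x) \<in> borel_measurable (lebesgue_on D)"
      by (rule borel_measurable_integrable[OF weak_integrable_grad_inner[OF m open_D \<phi>]])
    show "(\<lambda>x. G x \<bullet> grad \<phi> x) \<in> borel_measurable (lebesgue_on D)"
      by (rule borel_measurable_integrable[OF weak_integrable_grad_inner[OF _ open_D \<phi>]])
        (use div in \<open>auto simp: is_weak_div_def\<close>)
    show "AE x in lebesgue_on D. G' x \<bullet> grad \<phi> x = G x \<bullet> grad \<phi> x" using ae by eventually_elim simp
  qed
  then show "(LINT x|lebesgue_on D. G' x \<bullet> grad \<phi> x) = - (LINT x|lebesgue_on D. g x * \<phi> x)"
    using div \<phi> unfolding is_weak_div_def by simp
qed

text \<open>The existential over weak gradients collapses, because all of them agree almost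
  everywhere.\<close>

lemma is_weak_laplacian_iff:
  assumes v: "v \<in> V_space D"
  shows "is_weak_laplacian D v g \<longleftrightarrow> is_weak_div D (weak_grad D v) g"
proof
  assume "is_weak_laplacian D v g"
  then obtain G where G: "is_weak_grad D v G" "is_weak_div D G g" unfolding is_weak_laplacian_def by blast
  show "is_weak_div D (weak_grad D v) g"
    by (rule is_weak_div_cong_AE[OF G(2) Lp2_loc_integrable[OF V_spaceD(3)[OF v]]])
       (use weak_grad_AE_eq[OF open_D G(1)] in \<open>auto elim: eventually_mono\<close>)
qed (use V_spaceD(2)[OF v] in \<open>auto simp: is_weak_laplacian_def\<close>)

lemma weak_laplacian_props:
  assumes v: "v \<in> V_space D" and g: "is_weak_div D (weak_grad D v) g" "g \<in> Lp_space D p"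
  shows "is_weak_div D (weak_grad D v) (weak_laplacian D v)" "weak_laplacian D v \<in> Lp_space D p"
proof -
  show 1: "is_weak_div D (weak_grad D v) (weak_laplacian D v)"
    using g(1) unfolding is_weak_laplacian_iff[OF v, symmetric] weak_laplacian_def
    by (rule someI[of "is_weak_laplacian D v"])
  have ae: "AE x in lebesgue_on D. weak_laplacian D v x = g x"
    by (rule is_weak_div_unique[OF open_D 1 g(1)]) simp
  have m: "weak_laplacian D v \<in> borel_measurable (lebesgue_on D)"
    using 1 loc_integrable_measurable[OF open_D] unfolding is_weak_div_def by blast
  show "weak_laplacian D v \<in> Lp_space D p"
    by (rule Lp_space_dominated[OF m, where g="\<lambda>x. norm (g x) powr p"])
       (use g(2) ae in \<open>auto simp: Lp_space_def elim: eventually_mono\<close>)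
qed

lemma W1inf_weak_grad:
  assumes "f \<in> W1inf_space D"
  obtains K where "K \<ge> 0" "is_weak_grad D f (weak_grad D f)" "AE x in lebesgue_on D. norm (weak_grad D f x) \<le> K"
    "weak_grad D f \<in> borel_measurable (lebesgue_on D)"
proof -
  obtain G where G: "is_weak_grad D f G" "G \<in> Linf_space D" using assms unfolding W1inf_space_def by blast
  obtain K where K: "K \<ge> 0" "AE x in lebesgue_on D. norm (G x) \<le> K" using Linf_spaceD[OF G(2)] by blast
  have 1: "is_weak_grad D f (weak_grad D f)" by (rule weak_grad_is_weak_grad[OF G(1)])
  have "AE x in lebesgue_on D. norm (weak_grad D f x) \<le> K"
    using weak_grad_AE_eq[OF open_D G(1)] K(2) by eventually_elim simp
  moreover have "weak_grad D f \<in> borel_measurable (lebesgue_on D)"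
    using 1 loc_integrable_measurable[OF open_D] unfolding is_weak_grad_def by blast
  ultimately show thesis using that K(1) 1 by blast
qed

end

subsection \<open>Summability of the Taylor coefficients\<close>

text \<open>The two series conditions are kept as bounds on all finite partial sums off one null
  set; only finite sums enter the estimates.\<close>

locale weighted_problem = parametric_problem D abar \<psi> F
  for D :: "'a::euclidean_space set" and abar :: "'a \<Rightarrow> real" and \<psi> :: "nat \<Rightarrow> 'a \<Rightarrow> real"
    and F :: "('a \<Rightarrow> real) \<Rightarrow> real" +
  fixes \<rho> \<rho>bar :: "nat \<Rightarrow> real" and \<tau> q \<theta> :: real
  assumes tau: "1 \<le> \<tau>" "\<tau> < 2" and rho: "\<And>j. \<rho> j > 0" "\<And>j. \<rho>bar j > 1"
    and theta: "\<theta> < 1" and q: "1 / 2 + 1 / q = 1 / \<tau>"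
    and psi_sum: "AE x in lebesgue_on D. \<forall>N. (\<Sum>j<N. \<rho>bar j * \<rho> j * \<bar>\<psi> j x\<bar>) \<le> \<theta> * abar x"
    and summable_inverse: "summable (\<lambda>j. inverse (\<rho>bar j) powr q)"
    and F_Lp: "functional_in_Lp D \<tau> F"
    and abar_W1inf: "abar \<in> W1inf_space D" and psi_W1inf: "\<And>j. \<psi> j \<in> W1inf_space D"
    and grad_psi_sum: "\<exists>M. AE x in lebesgue_on D. \<forall>N. (\<Sum>j<N. \<rho> j * norm (weak_grad D (\<psi> j) x)) \<le> M"
begin

section \<open>Square summability of the weighted gradients\<close>

abbreviation weight :: "(nat \<Rightarrow> nat) \<Rightarrow> real" where
  "weight \<equiv> multi_power (\<lambda>j. \<rho>bar j * \<rho> j)"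

lemma weight_pos: "weight \<nu> > 0"
  using rho by (intro multi_power_pos) (meson less_trans mult_pos_pos zero_less_one)

lemma multi_power_rho_pos: "multi_power \<rho> \<nu> > 0"
  by (rule multi_power_pos[OF rho(1)])

lemma abs_psi_Linf: "(\<lambda>x. \<bar>\<psi> j x\<bar>) \<in> Linf_space D"
proof -
  obtain K where "K \<ge> 0" "AE x in lebesgue_on D. norm (\<psi> j x) \<le> K" "\<psi> j \<in> borel_measurable (lebesgue_on D)"
    using Linf_spaceD[OF psi] by blast
  then show ?thesis by (intro Linf_spaceI[where K=K]) auto
qed

lemma energy_psi_sum:
  assumes u: "u \<in> V_space D"
  shows "(\<Sum>j<N. \<rho>bar j * \<rho> j * energy D (\<lambda>x. \<bar>\<psi> j x\<bar>) u u) \<le> \<theta> * energy D abar u u"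
proof -
  note i = energy_integrable[OF abs_psi_Linf u u]
  have "(\<Sum>j<N. \<rho>bar j * \<rho> j * energy D (\<lambda>x. \<bar>\<psi> j x\<bar>) u u) =
    (LINT x|lebesgue_on D. (\<Sum>j<N. \<rho>bar j * \<rho> j * (\<bar>\<psi> j x\<bar> * (weak_grad D u x \<bullet> weak_grad D u x))))"
    unfolding energy_def using i by (subst Bochner_Integration.integral_sum) auto
  also have "\<dots> \<le> (LINT x|lebesgue_on D. \<theta> * (abar x * (weak_grad D u x \<bullet> weak_grad D u x)))"
  proof (rule integral_mono_AE)
    show "AE x in lebesgue_on D. (\<Sum>j<N. \<rho>bar j * \<rho> j * (\<bar>\<psi> j x\<bar> * (weak_grad D u x \<bullet> weak_grad D u x))) \<le>
      \<theta> * (abar x * (weak_grad D u x \<bullet> weak_grad D u x))"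
      using psi_sum
    proof eventually_elim
      case (elim x)
      have "(\<Sum>j<N. \<rho>bar j * \<rho> j * \<bar>\<psi> j x\<bar>) * (weak_grad D u x \<bullet> weak_grad D u x) \<le> \<theta> * abar x * (weak_grad D u x \<bullet> weak_grad D u x)"
        using elim by (intro mult_right_mono) auto
      then show ?case by (simp add: sum_distrib_right mult.assoc)
    qed
  qed (use i energy_integrable[OF abar u u] in auto)
  finally show ?thesis by (simp add: energy_def)
qed

text \<open>After \<open>energy_cross\<close>, the half carrying \<open>\<nu>\<close> is absorbed
  termwise at cost \<open>\<theta> / 2\<close>; the half carrying the lowered index is absorbed only
  after summation over the box, at another \<open>\<theta> / 2\<close>. What remains is the term at
  0.\<close>

lemma sum_energy_bounded:
  obtains C where "\<And>N n. (\<Sum>\<nu>\<in>index_box N n. (weight \<nu>)\<^sup>2 * energy D abar (taylor \<nu>) (taylor \<nu>)) \<le> C"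
proof -
  define d where "d \<nu> = (weight \<nu>)\<^sup>2 * energy D abar (taylor \<nu>) (taylor \<nu>)" for \<nu>
  \<comment> \<open>Set to 0 off the multi-indices, where \<open>taylor \<mu>\<close> need not be in
    V: the reindexing lemma requires nonnegativity for every \<open>\<mu>\<close>.\<close>
  define b where "b j \<mu> = (if \<mu> \<in> multiindices then \<rho>bar j * \<rho> j * (weight \<mu>)\<^sup>2 * energy D (\<lambda>x. \<bar>\<psi> j x\<bar>) (taylor \<mu>) (taylor \<mu>) else 0)" for j \<mu>
  have rr: "\<rho>bar j * \<rho> j > 0" for j using rho(1)[of j] rho(2)[of j] by simp
  have en0: "energy D (\<lambda>x. \<bar>\<psi> j x\<bar>) u u \<ge> 0" if "u \<in> V_space D" for j u
    using energy_coercive[OF abs_psi_Linf _ that, of 0 j] by simp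
  have b0: "b j \<mu> \<ge> 0" for j \<mu>
    unfolding b_def using rr[of j] en0[OF taylor_V_eq(1)] by (auto intro!: mult_nonneg_nonneg)
  let ?z = "\<lambda>_::nat. 0::nat"
  \<comment> \<open>The first term is chosen to make the inequality an equality at
    \<open>\<nu>\<close> = 0, where the recursion has the source \<open>F\<close> instead; one
    formula can then be summed over the whole box.\<close>
  have step: "d \<nu> \<le> (if \<nu> = ?z then (1 - \<theta> / 2) * d ?z else 0) + (\<Sum>j | \<nu> j \<noteq> 0. b j (\<nu>(j := \<nu> j - 1))) / 2 + \<theta> / 2 * d \<nu>"
    if \<nu>: "\<nu> \<in> index_box N n" for \<nu> N n
  proof (cases "\<nu> = ?z")
    case True
    then show ?thesis by (simp add: algebra_simps)
  next
    case False
    have \<nu>m: "\<nu> \<in> multiindices" using \<nu> index_box_multiindices by blast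
    note tV = taylor_V_eq(1)[OF \<nu>m]
    let ?S = "{j. \<nu> j \<noteq> 0}"
    let ?e = "\<lambda>j u. energy D (\<lambda>x. \<bar>\<psi> j x\<bar>) u u"
    have tm: "- ((weight \<nu>)\<^sup>2 * energy D (\<psi> j) (taylor (\<nu>(j := \<nu> j - 1))) (taylor \<nu>)) \<le>
        b j (\<nu>(j := \<nu> j - 1)) / 2 + (weight \<nu>)\<^sup>2 * (\<rho>bar j * \<rho> j * ?e j (taylor \<nu>)) / 2" if j: "j \<in> ?S" for j
    proof -
      let ?\<mu> = "\<nu>(j := \<nu> j - 1)"
      have \<mu>m: "?\<mu> \<in> multiindices" by (rule multiindices_upd[OF \<nu>m])
      \<comment> \<open>One of the two factors \<open>weight \<nu>\<close> is rewritten by this,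
        which supplies the coefficient \<open>\<rho>bar j * \<rho> j\<close> needed for
        \<open>energy_psi_sum\<close> and leaves the mixed product of weights for
        \<open>energy_cross\<close>.\<close>
      have wj: "weight \<nu> = \<rho>bar j * \<rho> j * weight ?\<mu>" using multi_power_dec[OF \<nu>m] j by simp
      have "- ((weight \<nu>)\<^sup>2 * energy D (\<psi> j) (taylor ?\<mu>) (taylor \<nu>)) \<le> (weight \<nu>)\<^sup>2 * \<bar>energy D (\<psi> j) (taylor ?\<mu>) (taylor \<nu>)\<bar>"
        unfolding minus_mult_right by (intro mult_left_mono) auto
      also have "\<dots> = \<rho>bar j * \<rho> j * (weight ?\<mu> * weight \<nu> * \<bar>energy D (\<psi> j) (taylor ?\<mu>) (taylor \<nu>)\<bar>)"
        unfolding power2_eq_square by (subst (1) wj) (simp only: mult.assoc)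
      also have "\<dots> \<le> \<rho>bar j * \<rho> j * (((weight ?\<mu>)\<^sup>2 * ?e j (taylor ?\<mu>) + (weight \<nu>)\<^sup>2 * ?e j (taylor \<nu>)) / 2)"
        using rr[of j] weight_pos by (intro mult_left_mono energy_cross[OF psi taylor_V_eq(1)[OF \<mu>m] tV]) (auto intro: less_imp_le)
      also have "\<dots> = b j ?\<mu> / 2 + (weight \<nu>)\<^sup>2 * (\<rho>bar j * \<rho> j * ?e j (taylor \<nu>)) / 2"
        using \<mu>m unfolding b_def by (simp add: algebra_simps add_divide_distrib)
      finally show ?thesis .
    qed
    have "energy D abar (taylor \<nu>) (taylor \<nu>) = - (\<Sum>j\<in>?S. energy D (\<psi> j) (taylor (\<nu>(j := \<nu> j - 1))) (taylor \<nu>))"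
      using taylor_energy[OF \<nu>m tV] False by simp
    then have "d \<nu> = (\<Sum>j\<in>?S. - ((weight \<nu>)\<^sup>2 * energy D (\<psi> j) (taylor (\<nu>(j := \<nu> j - 1))) (taylor \<nu>)))"
      unfolding d_def by (simp add: sum_distrib_left sum_negf del: fun_upd_apply)
    also have "\<dots> \<le> (\<Sum>j\<in>?S. b j (\<nu>(j := \<nu> j - 1)) / 2 + (weight \<nu>)\<^sup>2 * (\<rho>bar j * \<rho> j * ?e j (taylor \<nu>)) / 2)"
      by (rule sum_mono) (rule tm)
    also have "\<dots> = (\<Sum>j\<in>?S. b j (\<nu>(j := \<nu> j - 1))) / 2 + (weight \<nu>)\<^sup>2 / 2 * (\<Sum>j\<in>?S. \<rho>bar j * \<rho> j * ?e j (taylor \<nu>))"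
      by (simp add: sum.distrib sum_divide_distrib sum_distrib_left del: fun_upd_apply)
    also have "(\<Sum>j\<in>?S. \<rho>bar j * \<rho> j * ?e j (taylor \<nu>)) \<le> (\<Sum>j<N. \<rho>bar j * \<rho> j * ?e j (taylor \<nu>))"
      using index_box_supp[OF \<nu>] mult_nonneg_nonneg[OF less_imp_le[OF rr] en0[OF tV]] by (intro sum_mono2) auto
    also have "\<dots> \<le> \<theta> * energy D abar (taylor \<nu>) (taylor \<nu>)" by (rule energy_psi_sum[OF tV])
    finally have "d \<nu> \<le> (\<Sum>j\<in>?S. b j (\<nu>(j := \<nu> j - 1))) / 2 + (weight \<nu>)\<^sup>2 / 2 * (\<theta> * energy D abar (taylor \<nu>) (taylor \<nu>))"
      by (simp add: mult_left_mono del: fun_upd_apply)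
    then show ?thesis using False by (simp add: d_def mult_ac del: fun_upd_apply)
  qed
  have "(\<Sum>\<nu>\<in>index_box N n. d \<nu>) \<le> (1 - \<theta> / 2) * d ?z / (1 - \<theta>)" for N n
  proof -
    let ?\<Lambda> = "index_box N n"
    have h: "(\<Sum>\<nu>\<in>?\<Lambda>. \<Sum>j | \<nu> j \<noteq> 0. b j (\<nu>(j := \<nu> j - 1))) \<le> \<theta> * (\<Sum>\<nu>\<in>?\<Lambda>. d \<nu>)"
    proof -
      have "(\<Sum>\<nu>\<in>?\<Lambda>. \<Sum>j | \<nu> j \<noteq> 0. b j (\<nu>(j := \<nu> j - 1))) \<le> (\<Sum>\<nu>\<in>?\<Lambda>. \<Sum>j<N. b j \<nu>)"
        by (rule sum_index_box_dec[OF b0])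
      also have "\<dots> \<le> (\<Sum>\<nu>\<in>?\<Lambda>. \<theta> * d \<nu>)"
      proof (rule sum_mono)
        fix \<nu> assume "\<nu> \<in> ?\<Lambda>"
        then have \<nu>m: "\<nu> \<in> multiindices" using index_box_multiindices by blast
        have "(\<Sum>j<N. b j \<nu>) = (weight \<nu>)\<^sup>2 * (\<Sum>j<N. \<rho>bar j * \<rho> j * energy D (\<lambda>x. \<bar>\<psi> j x\<bar>) (taylor \<nu>) (taylor \<nu>))"
          unfolding b_def using \<nu>m by (simp add: sum_distrib_left mult_ac)
        also have "\<dots> \<le> (weight \<nu>)\<^sup>2 * (\<theta> * energy D abar (taylor \<nu>) (taylor \<nu>))"
          by (intro mult_left_mono energy_psi_sum taylor_V_eq(1) \<nu>m) simp
        finally show "(\<Sum>j<N. b j \<nu>) \<le> \<theta> * d \<nu>" by (simp add: d_def mult_ac)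
      qed
      finally show ?thesis by (simp add: sum_distrib_left)
    qed
    have "(\<Sum>\<nu>\<in>?\<Lambda>. d \<nu>) \<le> (\<Sum>\<nu>\<in>?\<Lambda>. (if \<nu> = ?z then (1 - \<theta> / 2) * d ?z else 0) + (\<Sum>j | \<nu> j \<noteq> 0. b j (\<nu>(j := \<nu> j - 1))) / 2 + \<theta> / 2 * d \<nu>)"
      by (rule sum_mono) (rule step)
    also have "\<dots> = (1 - \<theta> / 2) * d ?z + (\<Sum>\<nu>\<in>?\<Lambda>. \<Sum>j | \<nu> j \<noteq> 0. b j (\<nu>(j := \<nu> j - 1))) / 2 + \<theta> / 2 * (\<Sum>\<nu>\<in>?\<Lambda>. d \<nu>)"
      using finite_index_box index_box_zero
      by (simp add: sum.distrib sum_divide_distrib[symmetric] sum_distrib_left[symmetric] sum.delta del: fun_upd_apply)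
    finally have "(1 - \<theta>) * (\<Sum>\<nu>\<in>?\<Lambda>. d \<nu>) \<le> (1 - \<theta> / 2) * d ?z" using h by (simp add: algebra_simps)
    then show ?thesis using theta by (simp add: field_simps)
  qed
  then show thesis using that unfolding d_def by blast
qed

lemma sum_V_norm_bounded:
  obtains C where "\<And>N n. (\<Sum>\<nu>\<in>index_box N n. (weight \<nu> * V_norm D (taylor \<nu>))\<^sup>2) \<le> C"
proof -
  obtain c where c: "c > 0" "AE x in lebesgue_on D. c \<le> abar x" using elliptic by blast
  obtain C where C: "\<And>N n. (\<Sum>\<nu>\<in>index_box N n. (weight \<nu>)\<^sup>2 * energy D abar (taylor \<nu>) (taylor \<nu>)) \<le> C"
    using sum_energy_bounded by blast
  have "(\<Sum>\<nu>\<in>index_box N n. (weight \<nu> * V_norm D (taylor \<nu>))\<^sup>2) \<le> C / c" for N n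
  proof -
    have "c * (\<Sum>\<nu>\<in>index_box N n. (weight \<nu> * V_norm D (taylor \<nu>))\<^sup>2) =
      (\<Sum>\<nu>\<in>index_box N n. (weight \<nu>)\<^sup>2 * (c * (V_norm D (taylor \<nu>))\<^sup>2))"
      by (simp add: sum_distrib_left power_mult_distrib mult_ac)
    also have "\<dots> \<le> (\<Sum>\<nu>\<in>index_box N n. (weight \<nu>)\<^sup>2 * energy D abar (taylor \<nu>) (taylor \<nu>))"
    proof (intro sum_mono mult_left_mono)
      fix \<nu> assume "\<nu> \<in> index_box N n"
      then have "\<nu> \<in> multiindices" using index_box_multiindices by blast
      then show "c * (V_norm D (taylor \<nu>))\<^sup>2 \<le> energy D abar (taylor \<nu>) (taylor \<nu>)"
        by (intro energy_coercive[OF abar c(2)] taylor_V_eq(1))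
    qed simp
    also have "\<dots> \<le> C" by (rule C)
    finally show ?thesis using c(1) by (simp add: field_simps)
  qed
  then show thesis using that by blast
qed

section \<open>Passage from l^2 to l^\<tau>, and the Laplacians\<close>

abbreviation tail_weight :: "(nat \<Rightarrow> nat) \<Rightarrow> real" where
  "tail_weight \<equiv> multi_power (\<lambda>j. inverse (\<rho>bar j) powr q)"

lemma q_pos: "q > 0"
proof -
  have "1 / 2 < 1 / \<tau>" using tau by (intro divide_strict_left_mono) auto
  then have "1 / q > 0" using q by linarith
  then show ?thesis by simp
qed

text \<open>Write \<open>multi_power \<rho> \<nu> * a\<close> as \<open>weight \<nu> * a\<close>
  times the inverse power of \<open>\<rho>bar\<close>. The first summand is controlled by the
  energies and the second does not depend on \<open>a\<close>; the bound is used for the norms and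
  pointwise for the gradients.\<close>

lemma weighted_Young:
  assumes a: "0 \<le> a"
  shows "(multi_power \<rho> \<nu> * a) powr \<tau> \<le> (weight \<nu> * a)\<^sup>2 + tail_weight \<nu>"
proof -
  have ri: "inverse (\<rho>bar j) > 0" for j using rho(2)[of j] by simp
  have rp: "multi_power \<rho>bar \<nu> > 0" using rho(2) by (intro multi_power_pos) (meson less_trans zero_less_one)
  have "multi_power \<rho> \<nu> * a = (weight \<nu> * a) * multi_power (\<lambda>j. inverse (\<rho>bar j)) \<nu>"
    unfolding multi_power_mult multi_power_inverse using rp by (simp add: field_simps)
  also have "\<dots> powr \<tau> \<le> (weight \<nu> * a)\<^sup>2 + multi_power (\<lambda>j. inverse (\<rho>bar j)) \<nu> powr q"
    using a less_imp_le[OF weight_pos] less_imp_le[OF multi_power_pos[OF ri]] by (intro powr_Young[OF tau q]) auto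
  finally show ?thesis unfolding multi_power_powr[OF ri] .
qed

lemma sum_tail_weight_bounded:
  obtains C where "\<And>N n. (\<Sum>\<nu>\<in>index_box N n. tail_weight \<nu>) \<le> C"
proof (rule sum_multi_power_bounded[OF _ _ summable_inverse])
  fix j
  have "inverse (\<rho>bar j) powr q < 1 powr q"
    using rho(2)[of j] q_pos by (intro powr_less_mono2) (auto simp: inverse_less_1_iff intro: less_imp_le less_trans[OF zero_less_one])
  then show "inverse (\<rho>bar j) powr q < 1" by simp
qed (use that in auto)

text \<open>The recursion tested with smooth functions, each term on the right rewritten by the
  product rule. The divergences \<open>g j\<close> are arbitrary, not the chosen Laplacians, so that
  the lemma can be used inside the induction which establishes these.\<close>

lemma taylor_div:
  assumes \<nu>: "\<nu> \<in> multiindices"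
    and g: "\<And>j. \<nu> j \<noteq> 0 \<Longrightarrow> is_weak_div D (weak_grad D (taylor (\<nu>(j := \<nu> j - 1)))) (g j)"
    and f: "loc_integrable D f" "\<And>\<phi>. \<phi> \<in> test_functions D \<Longrightarrow> F \<phi> = (LINT x|lebesgue_on D. f x * \<phi> x)"
  shows "is_weak_div D (\<lambda>x. abar x *\<^sub>R weak_grad D (taylor \<nu>) x)
    (\<lambda>x. - ((if \<nu> = (\<lambda>_. 0) then f x else 0) +
       (\<Sum>j | \<nu> j \<noteq> 0. \<psi> j x * g j x + weak_grad D (\<psi> j) x \<bullet> weak_grad D (taylor (\<nu>(j := \<nu> j - 1))) x)))"
proof -
  let ?S = "{j. \<nu> j \<noteq> 0}"
  have fS: "finite ?S" using \<nu> by (simp add: multiindices_def)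
  define t where "t j = weak_grad D (taylor (\<nu>(j := \<nu> j - 1)))" for j
  define h where "h j x = \<psi> j x * g j x + weak_grad D (\<psi> j) x \<bullet> t j x" for j x
  have sc: "is_weak_div D (\<lambda>x. \<psi> j x *\<^sub>R t j x) (h j)" if j: "\<nu> j \<noteq> 0" for j
  proof -
    obtain K where K: "AE x in lebesgue_on D. norm (\<psi> j x) \<le> K" using Linf_spaceD[OF psi] by metis
    obtain L where L: "is_weak_grad D (\<psi> j) (weak_grad D (\<psi> j))" "AE x in lebesgue_on D. norm (weak_grad D (\<psi> j) x) \<le> L"
      using W1inf_weak_grad[OF psi_W1inf] by metis
    show ?thesis unfolding h_def[abs_def]
      by (rule is_weak_div_scale[OF open_D g[OF j, folded t_def] L(1) K L(2)])
  qed
  have lh: "loc_integrable D (h j)" if "\<nu> j \<noteq> 0" for j using sc[OF that] unfolding is_weak_div_def by blast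
  have lsum: "loc_integrable D (\<lambda>x. \<Sum>j\<in>?S. h j x)"
    unfolding loc_integrable_def using lh unfolding loc_integrable_def by auto
  have lif: "loc_integrable D (\<lambda>x. if \<nu> = (\<lambda>_. 0) then f x else 0)"
    using f(1) unfolding loc_integrable_def by (cases "\<nu> = (\<lambda>_. 0)") auto
  have lH: "loc_integrable D (\<lambda>x. - ((if \<nu> = (\<lambda>_. 0) then f x else 0) + (\<Sum>j\<in>?S. h j x)))"
    using loc_integrable_scaleR[OF loc_integrable_add[OF lif lsum], of "-1"] by simp
  obtain Ka where Ka: "AE x in lebesgue_on D. norm (abar x) \<le> Ka" "abar \<in> borel_measurable (lebesgue_on D)"
    using Linf_spaceD[OF abar] by metis
  note tV = taylor_V_eq(1)[OF \<nu>]
  have la: "loc_integrable D (\<lambda>x. abar x *\<^sub>R weak_grad D (taylor \<nu>) x)"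
  proof (rule loc_integrable_bounded_bilinear[OF _ Lp2_loc_integrable[OF V_spaceD(3)[OF tV]] open_D Ka(1) bounded_bilinear_scaleR])
    show "loc_integrable D abar"
      using W1inf_weak_grad[OF abar_W1inf] unfolding is_weak_grad_def by metis
  qed
  have "is_weak_div D (\<lambda>x. abar x *\<^sub>R weak_grad D (taylor \<nu>) x)
    (\<lambda>x. - ((if \<nu> = (\<lambda>_. 0) then f x else 0) + (\<Sum>j\<in>?S. h j x)))"
    unfolding is_weak_div_def
  proof (intro conjI ballI la lH)
    fix \<phi> assume \<phi>: "\<phi> \<in> test_functions D"
    note \<phi>V = test_functions_V[OF \<phi>]
    have en: "energy D \<eta> u \<phi> = (LINT x|lebesgue_on D. (\<eta> x *\<^sub>R weak_grad D u x) \<bullet> grad \<phi> x)"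
      if \<eta>: "\<eta> \<in> Linf_space D" and u: "u \<in> V_space D" for \<eta> u
      unfolding energy_def
    proof (rule integral_cong_AE)
      have m: "\<eta> \<in> borel_measurable (lebesgue_on D)" using Linf_spaceD[OF \<eta>] by metis
      show "AE x in lebesgue_on D. \<eta> x * (weak_grad D u x \<bullet> weak_grad D \<phi> x) = (\<eta> x *\<^sub>R weak_grad D u x) \<bullet> grad \<phi> x"
        using weak_grad_AE_eq[OF open_D test_functions_weak_grad[OF open_D \<phi>]] by eventually_elim simp
      show "(\<lambda>x. (\<eta> x *\<^sub>R weak_grad D u x) \<bullet> grad \<phi> x) \<in> borel_measurable (lebesgue_on D)"
        using m weak_grad_measurable[OF u] continuous_imp_borel_measurable_lebesgue_on[OF test_functions_grad_continuous[OF \<phi>]] by measurable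
    qed (rule borel_measurable_integrable[OF energy_integrable[OF \<eta> u \<phi>V]])
    have "energy D (\<psi> j) (taylor (\<nu>(j := \<nu> j - 1))) \<phi> = - (LINT x|lebesgue_on D. h j x * \<phi> x)" if j: "\<nu> j \<noteq> 0" for j
      unfolding en[OF psi taylor_V_eq(1)[OF multiindices_upd[OF \<nu>]]] t_def[symmetric]
      using sc[OF j] \<phi> unfolding is_weak_div_def by blast
    then have e: "energy D abar (taylor \<nu>) \<phi> = (if \<nu> = (\<lambda>_. 0) then F \<phi> else 0) + (\<Sum>j\<in>?S. LINT x|lebesgue_on D. h j x * \<phi> x)"
      unfolding taylor_energy[OF \<nu> \<phi>V] by (simp add: sum_negf del: fun_upd_apply)
    have i1: "integrable (lebesgue_on D) (\<lambda>x. h j x * \<phi> x)" if "j \<in> ?S" for j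
      using weak_integrable_test_mult[OF lh open_D \<phi>] that by simp
    have i2: "integrable (lebesgue_on D) (\<lambda>x. (if \<nu> = (\<lambda>_. 0) then f x else 0) * \<phi> x)"
      by (rule weak_integrable_test_mult[OF lif open_D \<phi>])
    have "(LINT x|lebesgue_on D. - ((if \<nu> = (\<lambda>_. 0) then f x else 0) + (\<Sum>j\<in>?S. h j x)) * \<phi> x) =
       (LINT x|lebesgue_on D. - ((if \<nu> = (\<lambda>_. 0) then f x else 0) * \<phi> x + (\<Sum>j\<in>?S. h j x * \<phi> x)))"
      by (intro Bochner_Integration.integral_cong refl) (simp add: sum_distrib_right distrib_right)
    also have "\<dots> = - ((LINT x|lebesgue_on D. (if \<nu> = (\<lambda>_. 0) then f x else 0) * \<phi> x) + (\<Sum>j\<in>?S. LINT x|lebesgue_on D. h j x * \<phi> x))"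
      using i1 i2 by (simp only: integral_minus Bochner_Integration.integral_add Bochner_Integration.integrable_sum Bochner_Integration.integral_sum)
    also have "(LINT x|lebesgue_on D. (if \<nu> = (\<lambda>_. 0) then f x else 0) * \<phi> x) = (if \<nu> = (\<lambda>_. 0) then F \<phi> else 0)"
      using f(2)[OF \<phi>] by simp
    finally show "(LINT x|lebesgue_on D. (abar x *\<^sub>R weak_grad D (taylor \<nu>) x) \<bullet> grad \<phi> x) =
      - (LINT x|lebesgue_on D. - ((if \<nu> = (\<lambda>_. 0) then f x else 0) + (\<Sum>j\<in>?S. h j x)) * \<phi> x)"
      using e unfolding en[OF abar tV] by simp
  qed
  then show ?thesis unfolding h_def t_def .
qed

lemma Lp_space_sum:
  assumes "finite S" "\<And>j. j \<in> S \<Longrightarrow> h j \<in> Lp_space D \<tau>"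
  shows "(\<lambda>x. \<Sum>j\<in>S. h j x :: real) \<in> Lp_space D \<tau>"
  using assms
proof (induction S)
  case empty
  then show ?case by (simp add: Lp_space_def)
next
  case (insert j S)
  then show ?case using Lp_space_add[OF tau(1), of "h j" "\<lambda>x. \<Sum>j\<in>S. h j x"] by simp
qed

text \<open>The gradient of the coefficient is 1/abar times the flux, and \<open>taylor_div\<close>
  gives the divergence of the flux from the Laplacians of lower degree. The product rule with the
  multiplier 1/abar then exhibits a Laplacian in L^\<tau>.\<close>

lemma taylor_laplacian:
  assumes "\<nu> \<in> multiindices"
  shows "is_weak_div D (weak_grad D (taylor \<nu>)) (weak_laplacian D (taylor \<nu>)) \<and> weak_laplacian D (taylor \<nu>) \<in> Lp_space D \<tau>"
  using assms
proof (induction "deg \<nu>" arbitrary: \<nu> rule: less_induct)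
  case less
  note \<nu> = less.prems
  let ?S = "{j. \<nu> j \<noteq> 0}"
  have fS: "finite ?S" using \<nu> by (simp add: multiindices_def)
  note tV = taylor_V_eq(1)[OF \<nu>]
  obtain f where f: "f \<in> Lp_space D \<tau>" "\<And>\<phi>. \<phi> \<in> test_functions D \<Longrightarrow> F \<phi> = (LINT x|lebesgue_on D. f x * \<phi> x)"
    using F_Lp unfolding functional_in_Lp_def by blast
  define g where "g j = weak_laplacian D (taylor (\<nu>(j := \<nu> j - 1)))" for j
  have IH: "is_weak_div D (weak_grad D (taylor (\<nu>(j := \<nu> j - 1)))) (g j)" "g j \<in> Lp_space D \<tau>" if j: "\<nu> j \<noteq> 0" for j
    unfolding g_def using less.hyps[OF _ multiindices_upd[OF \<nu>], of j "\<nu> j - 1"] deg_dec[OF \<nu> j] by auto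
  define H where "H x = - ((if \<nu> = (\<lambda>_. 0) then f x else 0) +
       (\<Sum>j\<in>?S. \<psi> j x * g j x + weak_grad D (\<psi> j) x \<bullet> weak_grad D (taylor (\<nu>(j := \<nu> j - 1))) x))" for x
  have div: "is_weak_div D (\<lambda>x. abar x *\<^sub>R weak_grad D (taylor \<nu>) x) H"
    unfolding H_def[abs_def]
    by (rule taylor_div[OF \<nu> IH(1) integrable_imp_loc_integrable[OF Lp_integrable[OF tau(1) f(1)]] f(2)])
  have HL: "H \<in> Lp_space D \<tau>"
  proof -
    have "(\<lambda>x. \<psi> j x * g j x + weak_grad D (\<psi> j) x \<bullet> weak_grad D (taylor (\<nu>(j := \<nu> j - 1))) x) \<in> Lp_space D \<tau>"
      if j: "j \<in> ?S" for j
    proof (rule Lp_space_add[OF tau(1)])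
      obtain K where K: "AE x in lebesgue_on D. norm (\<psi> j x) \<le> K" "\<psi> j \<in> borel_measurable (lebesgue_on D)" using Linf_spaceD[OF psi] by metis
      show "(\<lambda>x. \<psi> j x * g j x) \<in> Lp_space D \<tau>" by (rule Lp_space_mult_bounded[OF tau(1) IH(2) K(2,1)]) (use j in simp)
      obtain L where L: "AE x in lebesgue_on D. norm (weak_grad D (\<psi> j) x) \<le> L" "weak_grad D (\<psi> j) \<in> borel_measurable (lebesgue_on D)"
        using W1inf_weak_grad[OF psi_W1inf] by metis
      show "(\<lambda>x. weak_grad D (\<psi> j) x \<bullet> weak_grad D (taylor (\<nu>(j := \<nu> j - 1))) x) \<in> Lp_space D \<tau>"
        by (rule Lp_space_inner_bounded[OF tau V_spaceD(3)[OF taylor_V_eq(1)[OF multiindices_upd[OF \<nu>]]] L(2,1)])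
    qed
    note s = Lp_space_sum[OF fS this]
    have "(\<lambda>x. if \<nu> = (\<lambda>_. 0) then f x else 0) \<in> Lp_space D \<tau>"
      using f(1) by (cases "\<nu> = (\<lambda>_. 0)") (auto simp: Lp_space_def)
    note a = Lp_space_add[OF tau(1) this s]
    then have "(\<lambda>x. (-1) * ((if \<nu> = (\<lambda>_. 0) then f x else 0) +
       (\<Sum>j\<in>?S. \<psi> j x * g j x + weak_grad D (\<psi> j) x \<bullet> weak_grad D (taylor (\<nu>(j := \<nu> j - 1))) x))) \<in> Lp_space D \<tau>"
      by (rule Lp_space_mult_bounded[OF tau(1), where K=1]) auto
    then show ?thesis unfolding H_def[abs_def] by simp
  qed
  obtain c where c: "c > 0" "AE x in lebesgue_on D. c \<le> abar x" using elliptic by blast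
  obtain K where K: "K \<ge> 0" "AE x in lebesgue_on D. norm (abar x) \<le> K" "abar \<in> borel_measurable (lebesgue_on D)"
    using Linf_spaceD[OF abar] by blast
  obtain L where L: "L \<ge> 0" "is_weak_grad D abar (weak_grad D abar)" "AE x in lebesgue_on D. norm (weak_grad D abar x) \<le> L"
    "weak_grad D abar \<in> borel_measurable (lebesgue_on D)"
    using W1inf_weak_grad[OF abar_W1inf] by blast
  \<comment> \<open>Adding \<open>c\<close> ensures that the upper bound is at least
    \<open>c\<close>, as the lemma on inverses requires.\<close>
  have KM: "AE x in lebesgue_on D. abar x \<le> K + c" using K(2) by eventually_elim (use c in auto)
  have inv: "is_weak_grad D (\<lambda>x. inverse (abar x)) (\<lambda>x. - ((inverse (abar x))\<^sup>2 *\<^sub>R weak_grad D abar x))"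
    by (rule is_weak_grad_inverse[OF open_D L(2) c KM _ L(3)]) (use K in simp)
  have i1: "AE x in lebesgue_on D. norm (inverse (abar x)) \<le> inverse c"
    using c(2) by eventually_elim (use c(1) in \<open>auto intro: le_imp_inverse_le\<close>)
  have i2: "AE x in lebesgue_on D. norm (- ((inverse (abar x))\<^sup>2 *\<^sub>R weak_grad D abar x)) \<le> (inverse c)\<^sup>2 * L"
    using i1 L(3)
  proof eventually_elim
    case (elim x)
    have "(norm (inverse (abar x)))\<^sup>2 \<le> (inverse c)\<^sup>2" using elim by (intro power_mono) auto
    then have "(norm (inverse (abar x)))\<^sup>2 * norm (weak_grad D abar x) \<le> (inverse c)\<^sup>2 * L"
      using elim by (intro mult_mono) auto
    then show ?case by (simp add: power_inverse)
  qed
  have "is_weak_div D (\<lambda>x. inverse (abar x) *\<^sub>R (abar x *\<^sub>R weak_grad D (taylor \<nu>) x))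
     (\<lambda>x. inverse (abar x) * H x + (- ((inverse (abar x))\<^sup>2 *\<^sub>R weak_grad D abar x)) \<bullet> (abar x *\<^sub>R weak_grad D (taylor \<nu>) x))"
    by (rule is_weak_div_scale[OF open_D div inv i1 i2])
  then have d2: "is_weak_div D (weak_grad D (taylor \<nu>))
     (\<lambda>x. inverse (abar x) * H x + (- ((inverse (abar x))\<^sup>2 *\<^sub>R weak_grad D abar x)) \<bullet> (abar x *\<^sub>R weak_grad D (taylor \<nu>) x))"
  proof (rule is_weak_div_cong_AE[OF _ Lp2_loc_integrable[OF V_spaceD(3)[OF tV]]])
    show "AE x in lebesgue_on D. inverse (abar x) *\<^sub>R (abar x *\<^sub>R weak_grad D (taylor \<nu>) x) = weak_grad D (taylor \<nu>) x"
      using c(2) by eventually_elim (use c(1) in auto)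
  qed
  have gL: "(\<lambda>x. inverse (abar x) * H x + (- ((inverse (abar x))\<^sup>2 *\<^sub>R weak_grad D abar x)) \<bullet> (abar x *\<^sub>R weak_grad D (taylor \<nu>) x)) \<in> Lp_space D \<tau>"
  proof (rule Lp_space_add[OF tau(1)])
    show "(\<lambda>x. inverse (abar x) * H x) \<in> Lp_space D \<tau>"
      by (rule Lp_space_mult_bounded[OF tau(1) HL _ i1]) (use K(3) in measurable)
    have "(\<lambda>x. (abar x *\<^sub>R (- ((inverse (abar x))\<^sup>2 *\<^sub>R weak_grad D abar x))) \<bullet> weak_grad D (taylor \<nu>) x) \<in> Lp_space D \<tau>"
    proof (rule Lp_space_inner_bounded[OF tau V_spaceD(3)[OF tV]])
      show "AE x in lebesgue_on D. norm (abar x *\<^sub>R (- ((inverse (abar x))\<^sup>2 *\<^sub>R weak_grad D abar x))) \<le> K * ((inverse c)\<^sup>2 * L)"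
        using K(2) i2
      proof eventually_elim
        case (elim x)
        show ?case unfolding norm_scaleR[of "abar x"] using elim K(1) by (intro mult_mono) auto
      qed
    qed (use K(3) L(4) in measurable)
    then show "(\<lambda>x. (- ((inverse (abar x))\<^sup>2 *\<^sub>R weak_grad D abar x)) \<bullet> (abar x *\<^sub>R weak_grad D (taylor \<nu>) x)) \<in> Lp_space D \<tau>"
      by (simp add: mult_ac)
  qed
  show ?case using weak_laplacian_props[OF tV d2 gL] by blast
qed

text \<open>Two expressions for the weak divergence of one field, the flux: the product rule with
  multiplier \<open>abar\<close>, and the recursion. Uniqueness makes them equal almost
  everywhere.\<close>

lemma taylor_laplacian_identity:
  assumes \<nu>: "\<nu> \<in> multiindices"
    and f: "f \<in> Lp_space D \<tau>" "\<And>\<phi>. \<phi> \<in> test_functions D \<Longrightarrow> F \<phi> = (LINT x|lebesgue_on D. f x * \<phi> x)"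
  shows "AE x in lebesgue_on D. abar x * weak_laplacian D (taylor \<nu>) x + weak_grad D abar x \<bullet> weak_grad D (taylor \<nu>) x =
    - ((if \<nu> = (\<lambda>_. 0) then f x else 0) + (\<Sum>j | \<nu> j \<noteq> 0. \<psi> j x * weak_laplacian D (taylor (\<nu>(j := \<nu> j - 1))) x +
        weak_grad D (\<psi> j) x \<bullet> weak_grad D (taylor (\<nu>(j := \<nu> j - 1))) x))"
proof -
  obtain K where K: "AE x in lebesgue_on D. norm (abar x) \<le> K" using Linf_spaceD[OF abar] by metis
  obtain L where L: "is_weak_grad D abar (weak_grad D abar)" "AE x in lebesgue_on D. norm (weak_grad D abar x) \<le> L"
    using W1inf_weak_grad[OF abar_W1inf] by metis
  have d1: "is_weak_div D (\<lambda>x. abar x *\<^sub>R weak_grad D (taylor \<nu>) x)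
    (\<lambda>x. abar x * weak_laplacian D (taylor \<nu>) x + weak_grad D abar x \<bullet> weak_grad D (taylor \<nu>) x)"
    by (rule is_weak_div_scale[OF open_D conjunct1[OF taylor_laplacian[OF \<nu>]] L(1) K L(2)])
  show ?thesis
    by (rule is_weak_div_unique[OF open_D d1 taylor_div[OF \<nu> conjunct1[OF taylor_laplacian[OF multiindices_upd[OF \<nu>]]]
        integrable_imp_loc_integrable[OF Lp_integrable[OF tau(1) f(1)]] f(2)]]) simp_all
qed

text \<open>The absorption is carried out at almost every point before integrating, because the
  Jensen weights depend on x and their sum is bounded by \<open>\<theta>\<close> pointwise.\<close>

lemma sum_laplacian_bounded:
  obtains C where "\<And>N n. (\<Sum>\<nu>\<in>index_box N n. LINT x|lebesgue_on D. (multi_power \<rho> \<nu> * \<bar>weak_laplacian D (taylor \<nu>) x\<bar>) powr \<tau>) \<le> C"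
proof -
  obtain f where f: "f \<in> Lp_space D \<tau>" "\<And>\<phi>. \<phi> \<in> test_functions D \<Longrightarrow> F \<phi> = (LINT x|lebesgue_on D. f x * \<phi> x)"
    using F_Lp unfolding functional_in_Lp_def by blast
  obtain c where c: "c > 0" "AE x in lebesgue_on D. c \<le> abar x" using elliptic by blast
  obtain L where L: "L \<ge> 0" "AE x in lebesgue_on D. norm (weak_grad D abar x) \<le> L"
    using W1inf_weak_grad[OF abar_W1inf] by blast
  obtain M' where M': "AE x in lebesgue_on D. \<forall>N. (\<Sum>j<N. \<rho> j * norm (weak_grad D (\<psi> j) x)) \<le> M'"
    using grad_psi_sum by blast
  define M where "M = \<bar>M'\<bar>"
  have M: "AE x in lebesgue_on D. \<forall>N. (\<Sum>j<N. \<rho> j * norm (weak_grad D (\<psi> j) x)) \<le> M" "M \<ge> 0"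
    using M' by (auto simp: M_def elim!: eventually_mono intro: order.trans[OF _ abs_ge_self])
  obtain CV where CV: "\<And>N n. (\<Sum>\<nu>\<in>index_box N n. (weight \<nu> * V_norm D (taylor \<nu>))\<^sup>2) \<le> CV" using sum_V_norm_bounded by blast
  obtain Cs where Cs: "\<And>N n. (\<Sum>\<nu>\<in>index_box N n. tail_weight \<nu>) \<le> Cs" using sum_tail_weight_bounded by blast
  \<comment> \<open>The constant of \<open>box_estimate\<close> for \<open>K = inverse c\<close> and
    \<open>A = L\<close>, divided by the factor \<open>1 - \<theta>\<close> left over after
    absorption.\<close>
  define Cb where "Cb = (inverse c / (1 - \<theta>)) powr \<tau> * 4 powr \<tau> * (L powr \<tau> + (2 * M + 1) powr \<tau> * M + 1) / (1 - \<theta>)"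
  define g where "g \<nu> = weak_laplacian D (taylor \<nu>)" for \<nu>
  define t where "t \<nu> = weak_grad D (taylor \<nu>)" for \<nu>
  let ?r = "multi_power \<rho>"
  let ?\<mu>D = "measure (lebesgue_on D) D"
  have pt: "AE x in lebesgue_on D. (\<Sum>\<nu>\<in>index_box N n. (?r \<nu> * \<bar>g \<nu> x\<bar>) powr \<tau>) \<le>
      Cb * ((\<Sum>\<nu>\<in>index_box N n. (weight \<nu> * norm (t \<nu> x))\<^sup>2 + tail_weight \<nu>) + \<bar>f x\<bar> powr \<tau>)" for N n
  proof -
    \<comment> \<open>Finitely many identities share one null set; fixing x outside it makes the
      recursion a statement about real numbers.\<close>
    have "AE x in lebesgue_on D. \<forall>\<nu>\<in>index_box N n. abar x * g \<nu> x + weak_grad D abar x \<bullet> t \<nu> x =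
      - ((if \<nu> = (\<lambda>_. 0) then f x else 0) + (\<Sum>j | \<nu> j \<noteq> 0. \<psi> j x * g (\<nu>(j := \<nu> j - 1)) x + weak_grad D (\<psi> j) x \<bullet> t (\<nu>(j := \<nu> j - 1)) x))"
      unfolding g_def t_def
      by (rule AE_finite_allI[OF finite_index_box], rule taylor_laplacian_identity[OF _ f]) (use index_box_multiindices in auto)
    with c(2) L(2) M(1) psi_sum show ?thesis
    proof eventually_elim
      case (elim x)
      have ab: "abar x > 0" using elim(1) c(1) by simp
      define T where "T \<nu> = ?r \<nu> * norm (t \<nu> x)" for \<nu>
      define G where "G \<nu> = ?r \<nu> * \<bar>g \<nu> x\<bar>" for \<nu>
      define w where "w j = \<rho> j * \<bar>\<psi> j x\<bar> / abar x" for j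
      define m where "m j = \<rho> j * norm (weak_grad D (\<psi> j) x)" for j
      have r0: "?r \<nu> \<ge> 0" for \<nu> using multi_power_rho_pos[of \<nu>] by simp
      have G0: "0 \<le> G \<nu>" and T0: "0 \<le> T \<nu>" for \<nu> using r0 by (auto simp: G_def T_def)
      have w0: "0 \<le> w j" and m0: "0 \<le> m j" for j using rho(1)[of j] ab by (auto simp: w_def m_def)
      have wsum: "(\<Sum>j<N. w j) \<le> \<theta>"
      proof -
        have "(\<Sum>j<N. \<rho> j * \<bar>\<psi> j x\<bar>) \<le> (\<Sum>j<N. \<rho>bar j * \<rho> j * \<bar>\<psi> j x\<bar>)"
        proof (intro sum_mono mult_right_mono)
          fix j show "\<rho> j \<le> \<rho>bar j * \<rho> j" using rho[of j] by (simp add: mult_le_cancel_right1)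
        qed simp
        also have "\<dots> \<le> \<theta> * abar x" using elim(4) by blast
        finally show ?thesis using ab unfolding w_def sum_divide_distrib[symmetric] by (simp add: field_simps)
      qed
      have msum: "(\<Sum>j<N. m j) \<le> M" unfolding m_def using elim(3) by blast
      have le: "G \<nu> \<le> (\<Sum>j | \<nu> j \<noteq> 0. w j * G (\<nu>(j := \<nu> j - 1))) +
          inverse c * (L * T \<nu> + (\<Sum>j | \<nu> j \<noteq> 0. m j * T (\<nu>(j := \<nu> j - 1))) + (if \<nu> = (\<lambda>_. 0) then \<bar>f x\<bar> else 0))"
        if \<nu>: "\<nu> \<in> index_box N n" for \<nu>
      proof -
        have \<nu>m: "\<nu> \<in> multiindices" using \<nu> index_box_multiindices by blast
        let ?S = "{j. \<nu> j \<noteq> 0}"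
        let ?d = "\<lambda>j. \<nu>(j := \<nu> j - 1)"
        let ?f = "if \<nu> = (\<lambda>_. 0) then \<bar>f x\<bar> else 0"
        have "abar x * g \<nu> x = - (weak_grad D abar x \<bullet> t \<nu> x) - (if \<nu> = (\<lambda>_. 0) then f x else 0)
            - (\<Sum>j\<in>?S. \<psi> j x * g (?d j) x + weak_grad D (\<psi> j) x \<bullet> t (?d j) x)"
          using bspec[OF elim(5) \<nu>] by linarith
        then have "\<bar>abar x * g \<nu> x\<bar> \<le> \<bar>weak_grad D abar x \<bullet> t \<nu> x\<bar> + ?f
            + \<bar>\<Sum>j\<in>?S. \<psi> j x * g (?d j) x + weak_grad D (\<psi> j) x \<bullet> t (?d j) x\<bar>"
          by (cases "\<nu> = (\<lambda>_. 0)") auto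
        also have "\<bar>weak_grad D abar x \<bullet> t \<nu> x\<bar> \<le> L * norm (t \<nu> x)"
          using order.trans[OF Cauchy_Schwarz_ineq2 mult_right_mono[OF elim(2)]] by simp
        also have "\<bar>\<Sum>j\<in>?S. \<psi> j x * g (?d j) x + weak_grad D (\<psi> j) x \<bullet> t (?d j) x\<bar> \<le>
            (\<Sum>j\<in>?S. \<bar>\<psi> j x\<bar> * \<bar>g (?d j) x\<bar> + norm (weak_grad D (\<psi> j) x) * norm (t (?d j) x))"
        proof (rule order.trans[OF sum_abs sum_mono])
          fix j
          show "\<bar>\<psi> j x * g (?d j) x + weak_grad D (\<psi> j) x \<bullet> t (?d j) x\<bar> \<le>
            \<bar>\<psi> j x\<bar> * \<bar>g (?d j) x\<bar> + norm (weak_grad D (\<psi> j) x) * norm (t (?d j) x)"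
            using abs_triangle_ineq[of "\<psi> j x * g (?d j) x" "weak_grad D (\<psi> j) x \<bullet> t (?d j) x"]
              Cauchy_Schwarz_ineq2[of "weak_grad D (\<psi> j) x" "t (?d j) x"] by (simp only: abs_mult)
        qed
        finally have "?r \<nu> * \<bar>abar x * g \<nu> x\<bar> \<le> ?r \<nu> * (L * norm (t \<nu> x) + ?f +
            (\<Sum>j\<in>?S. \<bar>\<psi> j x\<bar> * \<bar>g (?d j) x\<bar> + norm (weak_grad D (\<psi> j) x) * norm (t (?d j) x)))"
          using r0[of \<nu>] by (intro mult_left_mono) auto
        also have "?r \<nu> * \<bar>abar x * g \<nu> x\<bar> = abar x * G \<nu>"
          using ab by (simp add: G_def abs_mult)
        also have "?r \<nu> * (L * norm (t \<nu> x) + ?f +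
            (\<Sum>j\<in>?S. \<bar>\<psi> j x\<bar> * \<bar>g (?d j) x\<bar> + norm (weak_grad D (\<psi> j) x) * norm (t (?d j) x))) =
            L * T \<nu> + ?f + (\<Sum>j\<in>?S. ?r \<nu> * (\<bar>\<psi> j x\<bar> * \<bar>g (?d j) x\<bar> + norm (weak_grad D (\<psi> j) x) * norm (t (?d j) x)))"
          by (cases "\<nu> = (\<lambda>_. 0)") (simp_all add: T_def multi_power_zero distrib_left sum_distrib_left mult_ac del: fun_upd_apply)
        also have "(\<Sum>j\<in>?S. ?r \<nu> * (\<bar>\<psi> j x\<bar> * \<bar>g (?d j) x\<bar> + norm (weak_grad D (\<psi> j) x) * norm (t (?d j) x))) =
            (\<Sum>j\<in>?S. abar x * (w j * G (?d j)) + m j * T (?d j))"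
        proof (rule sum.cong[OF refl])
          fix j assume "j \<in> ?S"
          then have r: "?r \<nu> = \<rho> j * ?r (?d j)" using multi_power_dec[OF \<nu>m] by simp
          show "?r \<nu> * (\<bar>\<psi> j x\<bar> * \<bar>g (?d j) x\<bar> + norm (weak_grad D (\<psi> j) x) * norm (t (?d j) x)) =
            abar x * (w j * G (?d j)) + m j * T (?d j)"
            unfolding r w_def m_def G_def T_def using ab by (simp add: distrib_left mult_ac del: fun_upd_apply)
        qed
        also have "\<dots> = abar x * (\<Sum>j\<in>?S. w j * G (?d j)) + (\<Sum>j\<in>?S. m j * T (?d j))"
          by (simp add: sum.distrib sum_distrib_left del: fun_upd_apply)
        finally have e: "abar x * G \<nu> \<le> abar x * (\<Sum>j\<in>?S. w j * G (?d j)) + (L * T \<nu> + (\<Sum>j\<in>?S. m j * T (?d j)) + ?f)" by simp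
        define R where "R = L * T \<nu> + (\<Sum>j\<in>?S. m j * T (?d j)) + ?f"
        have R0: "R \<ge> 0" unfolding R_def using L(1) T0 m0 by (intro add_nonneg_nonneg sum_nonneg mult_nonneg_nonneg) auto
        have "G \<nu> \<le> (\<Sum>j\<in>?S. w j * G (?d j)) + R / abar x"
          using e ab unfolding R_def[symmetric] by (simp add: field_simps del: fun_upd_apply)
        also have "R / abar x \<le> inverse c * R"
          unfolding divide_inverse using R0 elim(1) c(1) by (simp add: mult.commute mult_left_mono le_imp_inverse_le)
        finally show ?thesis unfolding R_def by (simp del: fun_upd_apply split del: if_split)
      qed
      have ST: "(\<Sum>\<nu>\<in>index_box N n. T \<nu> powr \<tau>) \<le> (\<Sum>\<nu>\<in>index_box N n. (weight \<nu> * norm (t \<nu> x))\<^sup>2 + tail_weight \<nu>)"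
        unfolding T_def by (intro sum_mono weighted_Young) simp
      have k0: "(inverse c / (1 - \<theta>)) powr \<tau> * 4 powr \<tau> * (L powr \<tau> + (2 * M + 1) powr \<tau> * M + 1) \<ge> 0"
        using M(2) by (intro mult_nonneg_nonneg add_nonneg_nonneg) auto
      have "(1 - \<theta>) * (\<Sum>\<nu>\<in>index_box N n. G \<nu> powr \<tau>) \<le>
        (inverse c / (1 - \<theta>)) powr \<tau> * 4 powr \<tau> * (L powr \<tau> + (2 * M + 1) powr \<tau> * M + 1) * ((\<Sum>\<nu>\<in>index_box N n. T \<nu> powr \<tau>) + \<bar>f x\<bar> powr \<tau>)"
        by (rule box_estimate[OF tau(1) G0 T0 w0 wsum theta m0 msum L(1) _ _ le]) (use c(1) in auto)
      also have "\<dots> \<le> (inverse c / (1 - \<theta>)) powr \<tau> * 4 powr \<tau> * (L powr \<tau> + (2 * M + 1) powr \<tau> * M + 1) *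
          ((\<Sum>\<nu>\<in>index_box N n. (weight \<nu> * norm (t \<nu> x))\<^sup>2 + tail_weight \<nu>) + \<bar>f x\<bar> powr \<tau>)"
        by (intro mult_left_mono add_right_mono ST k0)
      finally show ?case using theta unfolding Cb_def G_def by (simp add: field_simps)
    qed
  qed
  have Cb0: "Cb \<ge> 0"
    unfolding Cb_def using theta M(2) by (auto intro!: divide_nonneg_nonneg mult_nonneg_nonneg add_nonneg_nonneg)
  have gi: "integrable (lebesgue_on D) (\<lambda>x. (?r \<nu> * \<bar>g \<nu> x\<bar>) powr \<tau>)" if "\<nu> \<in> multiindices" for \<nu>
  proof -
    have "integrable (lebesgue_on D) (\<lambda>x. norm (g \<nu> x) powr \<tau>)"
      using taylor_laplacian[OF that] unfolding g_def Lp_space_def by blast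
    then show ?thesis using multi_power_rho_pos[of \<nu>] by (simp add: powr_mult)
  qed
  have ti: "integrable (lebesgue_on D) (\<lambda>x. (weight \<nu> * norm (t \<nu> x))\<^sup>2)"
    "(LINT x|lebesgue_on D. (weight \<nu> * norm (t \<nu> x))\<^sup>2) = (weight \<nu> * V_norm D (taylor \<nu>))\<^sup>2" if "\<nu> \<in> multiindices" for \<nu>
    using V_spaceD(3)[OF taylor_V_eq(1)[OF that]] unfolding t_def V_norm_def power_mult_distrib Lp2_norm_power2
    by (auto simp: mem_Lp2_iff)
  have fi: "integrable (lebesgue_on D) (\<lambda>x. \<bar>f x\<bar> powr \<tau>)" using f(1) unfolding Lp_space_def by simp
  have "(\<Sum>\<nu>\<in>index_box N n. LINT x|lebesgue_on D. (?r \<nu> * \<bar>g \<nu> x\<bar>) powr \<tau>) \<le>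
      Cb * (CV + Cs * ?\<mu>D + (LINT x|lebesgue_on D. \<bar>f x\<bar> powr \<tau>))" for N n
  proof -
    let ?\<Lambda> = "index_box N n"
    have mi: "\<nu> \<in> multiindices" if "\<nu> \<in> ?\<Lambda>" for \<nu> using that index_box_multiindices by blast
    have i1: "integrable (lebesgue_on D) (\<lambda>x. \<Sum>\<nu>\<in>?\<Lambda>. (weight \<nu> * norm (t \<nu> x))\<^sup>2 + tail_weight \<nu>)"
      by (intro Bochner_Integration.integrable_sum Bochner_Integration.integrable_add ti(1) mi) auto
    have "(\<Sum>\<nu>\<in>?\<Lambda>. LINT x|lebesgue_on D. (?r \<nu> * \<bar>g \<nu> x\<bar>) powr \<tau>) = (LINT x|lebesgue_on D. (\<Sum>\<nu>\<in>?\<Lambda>. (?r \<nu> * \<bar>g \<nu> x\<bar>) powr \<tau>))"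
      by (rule Bochner_Integration.integral_sum[symmetric]) (use gi mi in auto)
    also have "\<dots> \<le> (LINT x|lebesgue_on D. Cb * ((\<Sum>\<nu>\<in>?\<Lambda>. (weight \<nu> * norm (t \<nu> x))\<^sup>2 + tail_weight \<nu>) + \<bar>f x\<bar> powr \<tau>))"
    proof (rule integral_mono_AE[OF _ _ pt])
      show "integrable (lebesgue_on D) (\<lambda>x. \<Sum>\<nu>\<in>?\<Lambda>. (?r \<nu> * \<bar>g \<nu> x\<bar>) powr \<tau>)"
        by (intro Bochner_Integration.integrable_sum gi mi)
      show "integrable (lebesgue_on D) (\<lambda>x. Cb * ((\<Sum>\<nu>\<in>?\<Lambda>. (weight \<nu> * norm (t \<nu> x))\<^sup>2 + tail_weight \<nu>) + \<bar>f x\<bar> powr \<tau>))"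
        by (intro integrable_mult_right Bochner_Integration.integrable_add i1 fi)
    qed
    also have "\<dots> = Cb * ((LINT x|lebesgue_on D. (\<Sum>\<nu>\<in>?\<Lambda>. (weight \<nu> * norm (t \<nu> x))\<^sup>2 + tail_weight \<nu>)) + (LINT x|lebesgue_on D. \<bar>f x\<bar> powr \<tau>))"
      using i1 fi by simp
    also have "(LINT x|lebesgue_on D. (\<Sum>\<nu>\<in>?\<Lambda>. (weight \<nu> * norm (t \<nu> x))\<^sup>2 + tail_weight \<nu>)) =
       (\<Sum>\<nu>\<in>?\<Lambda>. LINT x|lebesgue_on D. (weight \<nu> * norm (t \<nu> x))\<^sup>2 + tail_weight \<nu>)"
      by (rule Bochner_Integration.integral_sum) (intro Bochner_Integration.integrable_add ti(1) mi, auto)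
    \<comment> \<open>The pointwise gradient squares integrate to the V norms; the tail weights are
      constant in x and pick up the measure of \<open>D\<close>, which is finite.\<close>
    also have "\<dots> = (\<Sum>\<nu>\<in>?\<Lambda>. (weight \<nu> * V_norm D (taylor \<nu>))\<^sup>2 + tail_weight \<nu> * ?\<mu>D)"
    proof (rule sum.cong[OF refl])
      fix \<nu> assume "\<nu> \<in> ?\<Lambda>"
      note m = mi[OF this]
      have "(LINT x|lebesgue_on D. (weight \<nu> * norm (t \<nu> x))\<^sup>2 + tail_weight \<nu>) =
        (LINT x|lebesgue_on D. (weight \<nu> * norm (t \<nu> x))\<^sup>2) + (LINT x|lebesgue_on D. tail_weight \<nu>)"
        by (rule Bochner_Integration.integral_add[OF ti(1)[OF m]]) simp
      then show "(LINT x|lebesgue_on D. (weight \<nu> * norm (t \<nu> x))\<^sup>2 + tail_weight \<nu>) = (weight \<nu> * V_norm D (taylor \<nu>))\<^sup>2 + tail_weight \<nu> * ?\<mu>D"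
        unfolding ti(2)[OF m] by (simp add: mult.commute)
    qed
    also have "\<dots> = (\<Sum>\<nu>\<in>?\<Lambda>. (weight \<nu> * V_norm D (taylor \<nu>))\<^sup>2) + (\<Sum>\<nu>\<in>?\<Lambda>. tail_weight \<nu>) * ?\<mu>D"
      by (simp add: sum.distrib sum_distrib_right)
    also have "Cb * ((\<Sum>\<nu>\<in>?\<Lambda>. (weight \<nu> * V_norm D (taylor \<nu>))\<^sup>2) + (\<Sum>\<nu>\<in>?\<Lambda>. tail_weight \<nu>) * ?\<mu>D + (LINT x|lebesgue_on D. \<bar>f x\<bar> powr \<tau>)) \<le>
      Cb * (CV + Cs * ?\<mu>D + (LINT x|lebesgue_on D. \<bar>f x\<bar> powr \<tau>))"
      using Cb0 by (intro mult_left_mono add_right_mono add_mono CV mult_right_mono Cs) auto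
    finally show ?thesis .
  qed
  then show thesis using that unfolding g_def by blast
qed

text \<open>For nonnegative terms a common bound on finite partial sums suffices, and every finite
  set of multi-indices lies in a box. Membership in \<open>B_space\<close> is asserted as well,
  since \<open>B_norm\<close> is built on a chosen Laplacian and is meaningful only there.\<close>

lemma taylor_summable:
  "(\<forall>\<nu>\<in>multiindices. taylor \<nu> \<in> B_space D \<tau>) \<and>
   (\<lambda>\<nu>. (multi_power \<rho> \<nu> * B_norm D \<tau> (taylor \<nu>)) powr \<tau>) summable_on multiindices"
proof
  show "\<forall>\<nu>\<in>multiindices. taylor \<nu> \<in> B_space D \<tau>"
    unfolding B_space_def using taylor_V_eq(1) taylor_laplacian is_weak_laplacian_iff by blast
  obtain CV where CV: "\<And>N n. (\<Sum>\<nu>\<in>index_box N n. (weight \<nu> * V_norm D (taylor \<nu>))\<^sup>2) \<le> CV" using sum_V_norm_bounded by blast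
  obtain Cs where Cs: "\<And>N n. (\<Sum>\<nu>\<in>index_box N n. tail_weight \<nu>) \<le> Cs" using sum_tail_weight_bounded by blast
  obtain Cl where Cl: "\<And>N n. (\<Sum>\<nu>\<in>index_box N n. LINT x|lebesgue_on D. (multi_power \<rho> \<nu> * \<bar>weak_laplacian D (taylor \<nu>) x\<bar>) powr \<tau>) \<le> Cl"
    using sum_laplacian_bounded by blast
  let ?b = "\<lambda>\<nu>. (multi_power \<rho> \<nu> * B_norm D \<tau> (taylor \<nu>)) powr \<tau>"
  have term_le: "?b \<nu> \<le> 2 powr \<tau> * (((weight \<nu> * V_norm D (taylor \<nu>))\<^sup>2 + tail_weight \<nu>) +
     (LINT x|lebesgue_on D. (multi_power \<rho> \<nu> * \<bar>weak_laplacian D (taylor \<nu>) x\<bar>) powr \<tau>))" for \<nu>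
  proof -
    let ?r = "multi_power \<rho> \<nu>" and ?g = "weak_laplacian D (taylor \<nu>)"
    let ?I = "LINT x|lebesgue_on D. \<bar>?g x\<bar> powr \<tau>"
    have r: "?r \<ge> 0" using multi_power_rho_pos[of \<nu>] by simp
    have L0: "Lp_norm D \<tau> ?g \<ge> 0" by (simp add: Lp_norm_def)
    have "?b \<nu> = (?r * V_norm D (taylor \<nu>) + ?r * Lp_norm D \<tau> ?g) powr \<tau>"
      by (simp add: B_norm_def distrib_left)
    also have "\<dots> \<le> 2 powr \<tau> * ((?r * V_norm D (taylor \<nu>)) powr \<tau> + (?r * Lp_norm D \<tau> ?g) powr \<tau>)"
      using r tau L0 V_norm_nonneg by (intro powr_add_le) auto
    also have "(?r * Lp_norm D \<tau> ?g) powr \<tau> = (LINT x|lebesgue_on D. (?r * \<bar>?g x\<bar>) powr \<tau>)"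
    proof -
      have "(?r * Lp_norm D \<tau> ?g) powr \<tau> = ?r powr \<tau> * (?I powr (1 / \<tau>)) powr \<tau>"
        using r by (simp add: Lp_norm_def powr_mult)
      also have "(?I powr (1 / \<tau>)) powr \<tau> = ?I" using tau by (simp add: powr_powr)
      finally show ?thesis using r by (simp add: powr_mult)
    qed
    also have "(?r * V_norm D (taylor \<nu>)) powr \<tau> \<le> (weight \<nu> * V_norm D (taylor \<nu>))\<^sup>2 + tail_weight \<nu>"
      by (rule weighted_Young[OF V_norm_nonneg])
    finally show ?thesis by simp
  qed
  show "?b summable_on multiindices"
  proof (rule nonneg_bdd_above_summable_on)
    show "bdd_above (sum ?b ` {S. S \<subseteq> multiindices \<and> finite S})"
    proof (rule bdd_aboveI2)
      fix S assume "S \<in> {S. S \<subseteq> multiindices \<and> finite S}"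
      then obtain N n where S: "S \<subseteq> index_box N n" using finite_subset_index_box by blast
      have "sum ?b S \<le> sum ?b (index_box N n)"
        by (rule sum_mono2[OF finite_index_box S]) simp
      also have "\<dots> \<le> (\<Sum>\<nu>\<in>index_box N n. 2 powr \<tau> * (((weight \<nu> * V_norm D (taylor \<nu>))\<^sup>2 + tail_weight \<nu>) +
          (LINT x|lebesgue_on D. (multi_power \<rho> \<nu> * \<bar>weak_laplacian D (taylor \<nu>) x\<bar>) powr \<tau>)))"
        by (rule sum_mono) (rule term_le)
      also have "\<dots> = 2 powr \<tau> * (((\<Sum>\<nu>\<in>index_box N n. (weight \<nu> * V_norm D (taylor \<nu>))\<^sup>2) + (\<Sum>\<nu>\<in>index_box N n. tail_weight \<nu>)) +
          (\<Sum>\<nu>\<in>index_box N n. LINT x|lebesgue_on D. (multi_power \<rho> \<nu> * \<bar>weak_laplacian D (taylor \<nu>) x\<bar>) powr \<tau>))"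
        by (simp only: sum_distrib_left[symmetric] sum.distrib)
      also have "\<dots> \<le> 2 powr \<tau> * ((CV + Cs) + Cl)"
        by (intro mult_left_mono add_mono CV Cs Cl) auto
      finally show "sum ?b S \<le> 2 powr \<tau> * ((CV + Cs) + Cl)" .
    qed
  qed simp
qed

end

section \<open>Unpacking the extended-real hypotheses\<close>

lemma ereal_partial_sum_le:
  assumes "\<And>j. 0 \<le> t j"
  shows "ereal (\<Sum>j<N. t j) \<le> (\<Sum>j. ereal (t j))"
proof -
  have "(\<Sum>j<N. ereal (t j)) \<le> (\<Sum>j. ereal (t j))"
    by (rule sum_le_suminf[OF summable_ereal_pos]) (use assms in auto)
  then show ?thesis by simp
qed

theorem theorem7p1:
  fixes D :: "(real ^ 'm) set"
    and abar :: "real ^ 'm \<Rightarrow> real"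
    and \<psi> :: "nat \<Rightarrow> real ^ 'm \<Rightarrow> real"
    and f :: "(real ^ 'm \<Rightarrow> real) \<Rightarrow> real"
    and \<rho> \<rho>bar :: "nat \<Rightarrow> real"
    and \<tau> qbar \<theta> :: real
  assumes "bounded_Lipschitz_domain D"
    and "1 \<le> \<tau>" and "\<tau> < 2"
    and "abar \<in> Linf_space D" and "\<And>j. \<psi> j \<in> Linf_space D"
    and "ess_inf D abar > 0"
    and "\<And>j. \<rho> j > 0" and "\<And>j. \<rho>bar j > 1"
    and "Linf_norm D (\<lambda>x. (\<Sum>j. ereal (\<rho>bar j * \<rho> j * \<bar>\<psi> j x\<bar>)) / ereal (abar x)) = ereal \<theta>"
    and "\<theta> < 1"
    and "1 / 2 + 1 / qbar = 1 / \<tau>"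
    and "summable (\<lambda>j. inverse (\<rho>bar j) powr qbar)"
    and "f \<in> V_dual D" and "functional_in_Lp D \<tau> f"
    and "abar \<in> W1inf_space D" and "\<And>j. \<psi> j \<in> W1inf_space D"
    and "Linf_norm D (\<lambda>x. \<Sum>j. ereal (\<rho> j * norm (weak_grad D (\<psi> j) x))) < \<infinity>"
  shows "(\<forall>\<nu>\<in>multiindices. taylor_coeff D abar \<psi> f \<nu> \<in> B_space D \<tau>) \<and>
         (\<lambda>\<nu>. (multi_power \<rho> \<nu> * B_norm D \<tau> (taylor_coeff D abar \<psi> f \<nu>)) powr \<tau>)
           summable_on multiindices"
proof -
  have D: "open D" "bounded D" using assms(1) unfolding bounded_Lipschitz_domain_def by auto
  have elliptic: "\<exists>c>0. AE x in lebesgue_on D. c \<le> abar x"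
  proof -
    let ?e = "esssup (lebesgue_on D) (\<lambda>x. ereal (- abar x))"
    have "?e < 0" using assms(6) unfolding ess_inf_def by (cases ?e) auto
    then obtain c where c: "c > 0" "?e \<le> ereal (- c)"
    proof (cases ?e)
      case (real s)
      then show ?thesis using that[of "- s"] \<open>?e < 0\<close> by simp
    next
      \<comment> \<open>Here any positive \<open>c\<close> satisfies the bound; 1 is a mere
        choice.\<close>
      case MInf
      then show ?thesis using that[of 1] by simp
    qed auto
    have "AE x in lebesgue_on D. c \<le> abar x"
      using esssup_AE[of "\<lambda>x. ereal (- abar x)" "lebesgue_on D"]
    proof eventually_elim
      case (elim x)
      then have "ereal (- abar x) \<le> ereal (- c)" using c(2) by (rule order.trans)
      then show ?case by simp
    qed
    then show ?thesis using c(1) by blast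
  qed
  \<comment> \<open>The essential bound concerns the full series, whose partial sums lie below it as
    the terms are nonnegative. One null set therefore serves all \<open>N\<close>.\<close>
  have psi_sum: "AE x in lebesgue_on D. \<forall>N. (\<Sum>j<N. \<rho>bar j * \<rho> j * \<bar>\<psi> j x\<bar>) \<le> \<theta> * abar x"
  proof -
    obtain c where c: "c > 0" "AE x in lebesgue_on D. c \<le> abar x" using elliptic by blast
    let ?S = "\<lambda>x. (\<Sum>j. ereal (\<rho>bar j * \<rho> j * \<bar>\<psi> j x\<bar>)) / ereal (abar x)"
    show ?thesis
      using c(2) esssup_AE[of "\<lambda>x. \<bar>?S x\<bar>" "lebesgue_on D", folded Linf_norm_def]
    proof eventually_elim
      case (elim x)
      show ?case
      proof
        fix N
        have ab: "abar x > 0" using elim(1) c(1) by simp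
        have t: "0 \<le> \<rho>bar j * \<rho> j * \<bar>\<psi> j x\<bar>" for j using assms(7)[of j] assms(8)[of j] by simp
        have "ereal (\<Sum>j<N. \<rho>bar j * \<rho> j * \<bar>\<psi> j x\<bar>) / ereal (abar x) \<le> ?S x"
          by (rule ereal_divide_right_mono[OF ereal_partial_sum_le[OF t]]) (use ab in simp)
        also have "\<dots> \<le> \<bar>?S x\<bar>" by (cases "?S x") auto
        also have "\<dots> \<le> ereal \<theta>" using elim(2) assms(9) by simp
        finally have "(\<Sum>j<N. \<rho>bar j * \<rho> j * \<bar>\<psi> j x\<bar>) / abar x \<le> \<theta>" using ab by simp
        then show "(\<Sum>j<N. \<rho>bar j * \<rho> j * \<bar>\<psi> j x\<bar>) \<le> \<theta> * abar x" using ab by (simp add: field_simps)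
      qed
    qed
  qed
  have grad_sum: "\<exists>M. AE x in lebesgue_on D. \<forall>N. (\<Sum>j<N. \<rho> j * norm (weak_grad D (\<psi> j) x)) \<le> M"
  proof -
    obtain M where M: "AE x in lebesgue_on D. \<bar>\<Sum>j. ereal (\<rho> j * norm (weak_grad D (\<psi> j) x))\<bar> \<le> ereal M"
      by (rule esssup_less_top_AE[OF assms(17)[unfolded Linf_norm_def]])
    have "AE x in lebesgue_on D. \<forall>N. (\<Sum>j<N. \<rho> j * norm (weak_grad D (\<psi> j) x)) \<le> M"
      using M
    proof eventually_elim
      case (elim x)
      show ?case
      proof
        fix N
        have t: "0 \<le> \<rho> j * norm (weak_grad D (\<psi> j) x)" for j using assms(7)[of j] by simp
        have "ereal (\<Sum>j<N. \<rho> j * norm (weak_grad D (\<psi> j) x)) \<le> (\<Sum>j. ereal (\<rho> j * norm (weak_grad D (\<psi> j) x)))"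
          by (rule ereal_partial_sum_le[OF t])
        also have "\<dots> \<le> \<bar>\<Sum>j. ereal (\<rho> j * norm (weak_grad D (\<psi> j) x))\<bar>"
          by (cases "\<Sum>j. ereal (\<rho> j * norm (weak_grad D (\<psi> j) x))") auto
        also have "\<dots> \<le> ereal M" by (rule elim)
        finally show "(\<Sum>j<N. \<rho> j * norm (weak_grad D (\<psi> j) x)) \<le> M" by simp
      qed
    qed
    then show ?thesis by blast
  qed
  interpret weighted_problem D abar \<psi> f \<rho> \<rho>bar \<tau> qbar \<theta>
    by unfold_locales (use D assms elliptic psi_sum grad_sum in auto)
  show ?thesis by (rule taylor_summable)
qed

end
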